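(* Let $\hat{\mathbb Z}=\mathbb Z\cup\{u,v\}$. For $\hat\alpha\in\hat{\mathbb Z}$ and $p\ge 0$ let $Q_{\hat\alpha,p}$ be the functions of $\lambda,\bar\lambda$ $$Q_{\alpha,p}=-\frac{(\lambda+\bar\lambda)^{\alpha+1}(\bar\lambda-\lambda)^p}{(\alpha+1)(2p)!!}\qquad(\alpha\in\mathbb Z,\ \alpha\neq -1),$$ $$Q_{-1,p}=-\frac{(-\lambda)^p}{p!}\Big(\log\big(1+\tfrac{\bar\lambda}{\lambda}\big)+c_p-1\Big)-\frac{(\bar\lambda-\lambda)^p}{(2p)!!},$$ $$Q_{v,p}=-\frac{(-\lambda)^p}{p!}\Big(\log\big(1+\tfrac{\bar\lambda}{\lambda}\big)+c_p-1\Big)+\frac{\bar\lambda^p}{p!}\Big(\log\big(\bar\lambda(\lambda+\bar\lambda)\big)-c_p-1\Big),$$ $$Q_{u,p}=\frac{\bar\lambda^{p+1}}{(p+1)!},$$ where $c_p=1+\frac12+\cdots+\frac1p$ are the harmonic numbers ($c_0=0$). (1) The Lax equations $$\frac{\partial\lambda}{\partial t^{\hat\alpha,p}}=\{-(Q_{\hat\alpha,p})_-,\lambda\},\qquad \frac{\partial\bar\lambda}{\partial t^{\hat\alpha,p}}=\{(Q_{\hat\alpha,p})_+,\bar\lambda\}\qquad(\hat\alpha\in\hat{\mathbb Z},\ p\ge0)$$ define a tau-symmetric hierarchy of commuting flows on the loop space $\mathcal L M_1=C^\infty(S^1,M_1)$. (2) These flows admit a bi-Hamiltonian formulation with respect to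 the dispersionless 2D Toda Poisson brackets $\{\,,\}_1$ and $\{\,,\}_2$: $$\frac{\partial}{\partial t^{\hat\alpha,p}}\,\cdot=\{\,\cdot\,,H_{\hat\alpha,p}\}_1,$$ with recursion relations, for $p\ge -1$ and $\alpha\in\mathbb Z$, $$\{\cdot,H_{\alpha,p}\}_2=(\alpha+p+2)\{\cdot,H_{\alpha,p+1}\}_1,$$ $$\{\cdot,H_{v,p}\}_2=(p+1)\{\cdot,H_{v,p+1}\}_1+2\{\cdot,H_{u,p}\}_1,$$ $$\{\cdot,H_{u,p}\}_2=(p+2)\{\cdot,H_{u,p+1}\}_1,$$ and Hamiltonians $$H_{\hat\alpha,p}=\oint_{S^1}\frac1{2\pi i}\oint_{|z|=1}Q_{\hat\alpha,p+1}(\lambda(z),\bar\lambda(z))\,\frac{dz}{z}\,dx .$$ (3) The dispersionless 2D Toda flows are finite (linear) combinations of the flows $\frac{\partial}{\partial t^{\hat\alpha,p}}$, $\hat\alpha\in\hat{\mathbb Z}$, $p\ge0$, on $\mathcal L M_1$ given by $\frac{\partial\lambda}{\partial t^{\hat\alpha,p}}=\{-(Q_{\hat\alpha,p})_-,\lambda\}$, $\frac{\partial\bar\lambda}{\partial t^{\hat\alpha,p}}=\{(Q_{\hat\alpha,p})_+,\bar\lambda\}$.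
   Context: **Spaces.** $D_0$ is the closed unit disc in $\mathbb C\cup\{\infty\}$, $D_\infty$ the closure of its complement, $\mathbb S^1=D_0\cap D_\infty$. For a compact $K\subset\mathbb C\cup\{\infty\}$, $\mathcal H(K)$ is the space of functions holomorphic on a neighbourhood of $K$. For $f=\sum_k f_kz^k\in\mathcal H(\mathbb S^1)$: $(f)_+=\sum_{k\ge0}f_kz^k$, $(f)_-=\sum_{k<0}f_kz^k$, and similarly $(f)_{\le 0},(f)_{>0}$, etc. $M$ is the affine space of pairs $(\lambda,\bar\lambda)\in z\mathcal H(D_\infty)\oplus\frac1z\mathcal H(D_0)$ with $\lambda(z)=z+O(1)$ as $z\to\infty$. $M_1\subset M$ is the open subset of pairs such that $w=\lambda+\bar\lambda$, $\lambda$, $\bar\lambda$ restricted to $\mathbb S^1$ define analytic curves in $\mathbb C^\times$ with winding numbers around $0$ equal to $1$, $1$, $-1$ respectively. $S^1=\mathbb R/2\pi\mathbb Z$ has coordinate $x$; a point of $\mathcal LM_1$ is a pair $(\lambda(z,x),\bar\lambda(z,x))$. $\bar\lambda$ is not the complex conjugate of $\lambda$. **Bracket in the Lax equations.** $\{f,g\}=z f_z g_x-z g_z f_x$ for functions of $(z,x)$; projections are in $z$. **Logarithms.** $\log(1+\bar\lambda/\lambda):=\log\frac{\lambda+\bar\lambda}{z}-\log\frac{\lambda}{z}$ and $\log(\bar\lambda(\lambda+\bar\lambda)):=\log(z\bar\lambda)+\log\frac{\lambda+\bar\lambda}{z}$. By the winding conditions these are single-valued holomorphic functions near $\mathbb S^1$;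 $\log\frac\lambda z$ is the branch in $\frac1z\mathcal H(D_\infty)$, and the other branches are chosen to depend continuously on the point $(\lambda,\bar\lambda)$ (smoothly on $x$). $(2p)!!=2^pp!$, $0!!=1$. **Poisson brackets.** Tangent vectors to $\mathcal LM$ are pairs $X=(X(z,x),\bar X(z,x))$ with values in $\mathcal H(D_\infty)\oplus\frac1z\mathcal H(D_0)$; $1$-forms are pairs $\hat\omega=(\omega,\bar\omega)$ with values in $\mathcal H(D_0)\oplus z\mathcal H(D_\infty)$; the pairing is $\langle\hat\omega,X\rangle=\frac1{2\pi i}\oint_{S^1}\oint_{|z|=1}(\omega X+\bar\omega\bar X)\frac{dz}z\,dx$. For $i=1,2$, $\{F,G\}_i=\langle dF,P_i(dG)\rangle$, and $\{\cdot,H\}_i$ denotes the vector field $P_i(dH)$, where, with $S:=\{\lambda,\omega\}+\{\bar\lambda,\bar\omega\}$, $\phi_x=\frac1{2\pi i}\oint_{|z|=1}S\frac{dz}z$ and $'=\partial_z$, $$P_1(\hat\omega)=\big(-\{\lambda,(\omega-\bar\omega)_-\}+S_{\le0},\ \{\bar\lambda,(\omega-\bar\omega)_+\}+S_{>0}\big),$$ $$P_2(\hat\omega)=\big(\{\lambda,(\lambda\omega+\bar\lambda\bar\omega)_-\}-\lambda S_{\le0}+z\lambda'\phi_x,\ -\{\bar\lambda,(\lambda\omega+\bar\lambda\bar\omega)_+\}+\bar\lambda S_{>0}+z\bar\lambda'\phi_x\big).$$ **Tau-symmetry.** The hierarchy is tau-symmetric if the densities $h_{\hat\alpha,p}=\frac1{2\pi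 i}\oint_{|z|=1}Q_{\hat\alpha,p+1}(\lambda(z),\bar\lambda(z))\frac{dz}z$ ($p\ge-1$) satisfy $\frac{\partial h_{\hat\alpha,p-1}}{\partial t^{\hat\beta,q}}=\frac{\partial h_{\hat\beta,q-1}}{\partial t^{\hat\alpha,p}}$ for all $\hat\alpha,\hat\beta\in\hat{\mathbb Z}$, $p,q\ge0$. **Dispersionless 2D Toda flows** ($n\ge0$): $\partial_{t_n}\lambda=\{(\lambda^n)_+,\lambda\}$, $\partial_{t_n}\bar\lambda=\{(\lambda^n)_+,\bar\lambda\}$, $\partial_{\bar t_n}\lambda=\{(\bar\lambda^n)_-,\lambda\}$, $\partial_{\bar t_n}\bar\lambda=\{(\bar\lambda^n)_-,\bar\lambda\}$.
   Formalization: For the indices −1 and v, the Hamiltonian statements and the periodicity in x of the Lax fields are claimed only for loops on which the logarithms in Q have single-valued branches in x on the circle; on other loops (e.g. λ=z, λ̄=ce^{ix}/z) these Hamiltonians are undefined. *)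

theory Defs
  imports
    "HOL-Complex_Analysis.Complex_Analysis"
    "HOL-Library.Landau_Symbols"
begin

section \<open>Germs near the closed discs and the circle\<close>

text \<open>The point at infinity is never a value of \<open>z\<close>: functions on a neighbourhood of
  \<open>D\<^sub>\<infinity>\<close> are functions on a neighbourhood of its finite part \<open>Dinf\<close> which are
  regular in the coordinate \<open>1/z\<close> up to \<open>1/z = 0\<close>. Functions with a possible pole at
  \<open>z = 0\<close> live near \<open>D0p\<close>. Values of a function outside the relevant neighbourhood carry
  no meaning.\<close>

abbreviation D0 :: "complex set" where "D0 \<equiv> cball 0 1"
abbreviation D0p :: "complex set" where "D0p \<equiv> cball 0 1 - {0}"
abbreviation Dinf :: "complex set" where "Dinf \<equiv> {z. 1 \<le> norm z}"
abbreviation circ :: "complex set" where "circ \<equiv> sphere 0 1"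

definition eq_near :: "complex set \<Rightarrow> (complex \<Rightarrow> 'b) \<Rightarrow> (complex \<Rightarrow> 'b) \<Rightarrow> bool" where
  "eq_near K f g \<longleftrightarrow> (\<exists>U. open U \<and> K \<subseteq> U \<and> (\<forall>z\<in>U. f z = g z))"

section \<open>The manifolds \<open>M\<close> and \<open>M\<^sub>1\<close>\<close>

definition M :: "((complex \<Rightarrow> complex) \<times> (complex \<Rightarrow> complex)) set" where
  "M = {(l, lb).
     (\<exists>g. g analytic_on D0 \<and> eq_near Dinf l (\<lambda>z. z * g (inverse z))) \<and>
     (\<lambda>z. l z - z) \<in> O[at_infinity](\<lambda>_. 1) \<and>
     (\<exists>g. g analytic_on D0 \<and> eq_near D0p lb (\<lambda>z. g z / z))}"

definition winds :: "(complex \<Rightarrow> complex) \<Rightarrow> int \<Rightarrow> bool" where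
  "winds f n \<longleftrightarrow> (\<forall>z\<in>circ. f z \<noteq> 0) \<and> winding_number (f \<circ> circlepath 0 1) 0 = of_int n"

definition M1 :: "((complex \<Rightarrow> complex) \<times> (complex \<Rightarrow> complex)) set" where
  "M1 = {(l, lb) \<in> M. winds (\<lambda>z. l z + lb z) 1 \<and> winds l 1 \<and> winds lb (-1)}"

section \<open>Functions of \<open>(z, x)\<close>\<close>

type_synonym fld = "complex \<Rightarrow> real \<Rightarrow> complex"
type_synonym fpair = "fld \<times> fld"

definition dx :: "fld \<Rightarrow> fld" where
  "dx f = (\<lambda>z x. vector_derivative (f z) (at x))"

definition dz :: "fld \<Rightarrow> fld" where
  "dz f = (\<lambda>z x. deriv (\<lambda>z. f z x) z)"

text \<open>Smooth maps from the line to \<open>\<H>(K)\<close>. A smooth curve in the inductive limit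
  \<open>\<H>(K)\<close> locally takes values in the functions on one fixed neighbourhood; the
  neighbourhood is uniform in \<open>x\<close> because all objects come from a compact circle.\<close>

definition smooth_fam :: "complex set \<Rightarrow> fld \<Rightarrow> bool" where
  "smooth_fam K f \<longleftrightarrow> (\<exists>U. open U \<and> K \<subseteq> U \<and> (\<forall>k.
     (\<forall>z\<in>U. \<forall>x. ((dx ^^ k) f z) differentiable (at x)) \<and>
     continuous_on (U \<times> UNIV) (\<lambda>(z, x). (dx ^^ k) f z x) \<and>
     (\<forall>x. (\<lambda>z. (dx ^^ k) f z x) holomorphic_on U)))"

definition periodic_near :: "complex set \<Rightarrow> fld \<Rightarrow> bool" where
  "periodic_near K f \<longleftrightarrow> eq_near K (\<lambda>z x. f z (x + 2 * pi)) f"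

text \<open>Smooth families with values in \<open>\<H>(D\<^sub>\<infinity>) \<oplus> z\<^sup>-\<^sup>1 \<H>(D\<^sub>0)\<close>; adding periodicity gives the
  tangent vectors to the loop space.\<close>

definition smooth_Dinf :: "fld \<Rightarrow> bool" where
  "smooth_Dinf f \<longleftrightarrow> (\<exists>g. smooth_fam D0 g \<and> eq_near Dinf f (\<lambda>z. g (inverse z)))"

definition smooth_zinvD0 :: "fld \<Rightarrow> bool" where
  "smooth_zinvD0 f \<longleftrightarrow> (\<exists>g. smooth_fam D0 g \<and> eq_near D0p f (\<lambda>z x. g z x / z))"

definition smooth_zDinf :: "fld \<Rightarrow> bool" where
  "smooth_zDinf f \<longleftrightarrow>
     (\<exists>g. smooth_fam D0 g \<and> eq_near Dinf f (\<lambda>z x. z * g (inverse z) x))"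

definition smooth_zinvDinf :: "fld \<Rightarrow> bool" where
  "smooth_zinvDinf f \<longleftrightarrow>
     (\<exists>g. smooth_fam D0 g \<and> eq_near Dinf f (\<lambda>z x. g (inverse z) x / z))"

definition smooth_vectors :: "fpair set" where
  "smooth_vectors = {(X, Y). smooth_Dinf X \<and> smooth_zinvD0 Y}"

definition periodic_vectors :: "fpair set" where
  "periodic_vectors = {(X, Y). periodic_near Dinf X \<and> periodic_near D0p Y}"

definition TLM :: "fpair set" where
  "TLM = smooth_vectors \<inter> periodic_vectors"

definition one_forms :: "fpair set" where
  "one_forms = {(\<omega>, \<omega>b). smooth_fam D0 \<omega> \<and> smooth_zDinf \<omega>b \<and>
     periodic_near D0 \<omega> \<and> periodic_near Dinf \<omega>b}"

definition eq_vec :: "fpair \<Rightarrow> fpair \<Rightarrow> bool" where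
  "eq_vec X Y \<longleftrightarrow> eq_near Dinf (fst X) (fst Y) \<and> eq_near D0p (snd X) (snd Y)"

definition LM1 :: "fpair set" where
  "LM1 = {(l, lb). (\<lambda>z x. l z x - z, lb) \<in> TLM \<and>
     (\<forall>x. (\<lambda>z. l z x, \<lambda>z. lb z x) \<in> M1)}"

section \<open>Projections, bracket, pairing\<close>

definition coeff :: "(complex \<Rightarrow> complex) \<Rightarrow> int \<Rightarrow> complex" where
  "coeff f k = contour_integral (circlepath 0 1) (\<lambda>z. f z * z powi (-k - 1)) / (2 * pi * \<i>)"

definition proj :: "int set \<Rightarrow> fld \<Rightarrow> fld" where
  "proj A f = (\<lambda>z x. \<Sum>\<^sub>\<infinity>k\<in>A. coeff (\<lambda>z. f z x) k * z powi k)"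

definition res0 :: "fld \<Rightarrow> real \<Rightarrow> complex" where
  "res0 f x = contour_integral (circlepath 0 1) (\<lambda>z. f z x / z) / (2 * pi * \<i>)"

definition bracket :: "fld \<Rightarrow> fld \<Rightarrow> fld" where
  "bracket f g = (\<lambda>z x. z * dz f z x * dx g z x - z * dz g z x * dx f z x)"

definition pairing :: "fpair \<Rightarrow> fpair \<Rightarrow> complex" where
  "pairing W X = integral {0..2 * pi}
     (res0 (\<lambda>z x. fst W z x * fst X z x + snd W z x * snd X z x))"

section \<open>Branches of the logarithms\<close>

text \<open>\<open>(l0, l1, l2)\<close> are branches of \<open>log (\<lambda>/z)\<close>, \<open>log ((\<lambda> + \<lambda>b)/z)\<close>, \<open>log (z \<lambda>b)\<close>. They are
  smooth in \<open>x\<close> on the line: along a loop in \<open>M\<^sub>1\<close> on which \<open>(\<lambda> + \<lambda>b)/z\<close> or \<open>z \<lambda>b\<close>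
  winds around \<open>0\<close> as \<open>x\<close> runs through the circle, a branch of \<open>l1\<close> or \<open>l2\<close> returns with a
  multiple of \<open>2\<pi>i\<close> added.\<close>

type_synonym branches = "fld \<times> fld \<times> fld"
type_synonym state = "fpair \<times> branches"

fun log_branch :: "fpair \<Rightarrow> branches \<Rightarrow> bool" where
  "log_branch (l, lb) (l0, l1, l2) \<longleftrightarrow>
     smooth_zinvDinf l0 \<and> eq_near Dinf (\<lambda>z x. exp (l0 z x)) (\<lambda>z x. l z x / z) \<and>
     smooth_fam circ l1 \<and> eq_near circ (\<lambda>z x. exp (l1 z x)) (\<lambda>z x. (l z x + lb z x) / z) \<and>
     smooth_fam circ l2 \<and> eq_near circ (\<lambda>z x. exp (l2 z x)) (\<lambda>z x. z * lb z x)"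

definition states :: "state set" where
  "states = {(L, B). L \<in> LM1 \<and> log_branch L B}"

section \<open>The functions \<open>Q\<close>, the flows and the densities\<close>

datatype hidx = Zidx int | Vidx | Uidx

text \<open>The last two arguments are the values of \<open>log (1 + \<lambda>b/\<lambda>)\<close> and
  \<open>log (\<lambda>b (\<lambda> + \<lambda>b))\<close>; \<open>(2p)!! = 2\<^sup>p p!\<close>.\<close>

fun Q :: "hidx \<Rightarrow> nat \<Rightarrow> complex \<Rightarrow> complex \<Rightarrow> complex \<Rightarrow> complex \<Rightarrow> complex" where
  "Q (Zidx \<alpha>) p l lb lg1 lg2 =
     (if \<alpha> = -1
      then - ((-l) ^ p / fact p) * (lg1 + harm p - 1) - (lb - l) ^ p / (2 ^ p * fact p)
      else - ((l + lb) powi (\<alpha> + 1) * (lb - l) ^ p) / (of_int (\<alpha> + 1) * (2 ^ p * fact p)))"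
| "Q Vidx p l lb lg1 lg2 =
     - ((-l) ^ p / fact p) * (lg1 + harm p - 1) + lb ^ p / fact p * (lg2 - harm p - 1)"
| "Q Uidx p l lb lg1 lg2 = lb ^ (p + 1) / fact (p + 1)"

fun Qfld :: "hidx \<Rightarrow> nat \<Rightarrow> state \<Rightarrow> fld" where
  "Qfld a p ((l, lb), (l0, l1, l2)) =
     (\<lambda>z x. Q a p (l z x) (lb z x) (l1 z x - l0 z x) (l2 z x + l1 z x))"

definition lax :: "hidx \<Rightarrow> nat \<Rightarrow> state \<Rightarrow> fpair" where
  "lax a p St =
     (bracket (\<lambda>z x. - proj {..<0} (Qfld a p St) z x) (fst (fst St)),
      bracket (proj {0..} (Qfld a p St)) (snd (fst St)))"

text \<open>\<open>hdens a p\<close> and \<open>H a p\<close> are meant for \<open>p \<ge> -1\<close>.\<close>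

definition hdens :: "hidx \<Rightarrow> int \<Rightarrow> state \<Rightarrow> real \<Rightarrow> complex" where
  "hdens a p St = res0 (Qfld a (nat (p + 1)) St)"

definition H :: "hidx \<Rightarrow> int \<Rightarrow> state \<Rightarrow> complex" where
  "H a p St = integral {0..2 * pi} (hdens a p St)"

text \<open>The logarithms occurring in \<open>Q\<^bsub>a,p\<^esub>\<close> are single-valued functions of \<open>x\<close> on the circle
  (\<open>l0\<close> always is, by its normalisation at infinity).\<close>

fun single_valued_at :: "hidx \<Rightarrow> state \<Rightarrow> bool" where
  "single_valued_at (Zidx \<alpha>) (L, (l0, l1, l2)) \<longleftrightarrow> (\<alpha> = -1 \<longrightarrow> periodic_near circ l1)"
| "single_valued_at Vidx (L, (l0, l1, l2)) \<longleftrightarrow> periodic_near circ l1 \<and> periodic_near circ l2"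
| "single_valued_at Uidx (L, (l0, l1, l2)) \<longleftrightarrow> True"

section \<open>Derivatives along vector fields\<close>

text \<open>The straight line through a state in the direction \<open>X\<close>. On the circle, and for small
  \<open>s\<close>, the principal logarithm of a quantity near \<open>1\<close> is the continuous continuation of the
  given branches from \<open>s = 0\<close>.\<close>

fun shift :: "real \<Rightarrow> fpair \<Rightarrow> state \<Rightarrow> state" where
  "shift s (X, Y) ((l, lb), (l0, l1, l2)) =
     ((\<lambda>z x. l z x + s * X z x, \<lambda>z x. lb z x + s * Y z x),
      (\<lambda>z x. l0 z x + Ln (1 + s * X z x / l z x),
       \<lambda>z x. l1 z x + Ln (1 + s * (X z x + Y z x) / (l z x + lb z x)),
       \<lambda>z x. l2 z x + Ln (1 + s * Y z x / lb z x)))"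

definition has_deriv_along :: "(state \<Rightarrow> complex) \<Rightarrow> state \<Rightarrow> fpair \<Rightarrow> complex \<Rightarrow> bool" where
  "has_deriv_along F St X D \<longleftrightarrow> ((\<lambda>s. F (shift s X St)) has_vector_derivative D) (at 0)"

text \<open>Vanishing of the commutator of the vector fields \<open>X\<close>, \<open>Y\<close>: the derivative of \<open>X\<close> along
  \<open>Y\<close> equals the derivative of \<open>Y\<close> along \<open>X\<close>.\<close>

definition commuting :: "(state \<Rightarrow> fpair) \<Rightarrow> (state \<Rightarrow> fpair) \<Rightarrow> bool" where
  "commuting X Y \<longleftrightarrow> (\<forall>St\<in>states.
     (\<exists>U. open U \<and> Dinf \<subseteq> U \<and> (\<forall>z\<in>U. \<forall>x. \<exists>D.
        has_deriv_along (\<lambda>T. fst (X T) z x) St (Y St) D \<and>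
        has_deriv_along (\<lambda>T. fst (Y T) z x) St (X St) D)) \<and>
     (\<exists>U. open U \<and> D0p \<subseteq> U \<and> (\<forall>z\<in>U. \<forall>x. \<exists>D.
        has_deriv_along (\<lambda>T. snd (X T) z x) St (Y St) D \<and>
        has_deriv_along (\<lambda>T. snd (Y T) z x) St (X St) D)))"

definition tau_symmetric :: bool where
  "tau_symmetric \<longleftrightarrow> (\<forall>a b p q. \<forall>St\<in>states. \<forall>x. \<exists>D.
     has_deriv_along (\<lambda>T. hdens a (int p - 1) T x) St (lax b q St) D \<and>
     has_deriv_along (\<lambda>T. hdens b (int q - 1) T x) St (lax a p St) D)"

section \<open>Poisson structures and Hamiltonian vector fields\<close>

fun Ssum :: "fpair \<Rightarrow> fpair \<Rightarrow> fld" where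
  "Ssum (l, lb) (\<omega>, \<omega>b) = (\<lambda>z x. bracket l \<omega> z x + bracket lb \<omega>b z x)"

fun P1 :: "fpair \<Rightarrow> fpair \<Rightarrow> fpair" where
  "P1 (l, lb) (\<omega>, \<omega>b) =
     (let S = Ssum (l, lb) (\<omega>, \<omega>b);
          d = (\<lambda>z x. \<omega> z x - \<omega>b z x)
      in (\<lambda>z x. - bracket l (proj {..<0} d) z x + proj {..0} S z x,
          \<lambda>z x. bracket lb (proj {0..} d) z x + proj {0<..} S z x))"

fun P2 :: "fpair \<Rightarrow> fpair \<Rightarrow> fpair" where
  "P2 (l, lb) (\<omega>, \<omega>b) =
     (let S = Ssum (l, lb) (\<omega>, \<omega>b);
          e = (\<lambda>z x. l z x * \<omega> z x + lb z x * \<omega>b z x);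
          phix = res0 S
      in (\<lambda>z x. bracket l (proj {..<0} e) z x - l z x * proj {..0} S z x + z * dz l z x * phix x,
          \<lambda>z x. - bracket lb (proj {0..} e) z x + lb z x * proj {0<..} S z x
                 + z * dz lb z x * phix x))"

definition differential :: "(state \<Rightarrow> complex) \<Rightarrow> state \<Rightarrow> fpair \<Rightarrow> bool" where
  "differential F St W \<longleftrightarrow> W \<in> one_forms \<and>
     (\<forall>X\<in>TLM. has_deriv_along F St X (pairing W X))"

text \<open>At \<open>St\<close> the functional \<open>F\<close> has a differential and the Hamiltonian vector field
  \<open>P(dF) = {\<cdot>, F}\<close> is \<open>X\<close>.\<close>

definition ham_field ::
    "(fpair \<Rightarrow> fpair \<Rightarrow> fpair) \<Rightarrow> (state \<Rightarrow> complex) \<Rightarrow> state \<Rightarrow> fpair \<Rightarrow> bool" where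
  "ham_field P F St X \<longleftrightarrow> (\<exists>W. differential F St W) \<and>
     (\<forall>W. differential F St W \<longrightarrow> eq_vec (P (fst St) W) X)"

section \<open>Linear combinations and the dispersionless 2D Toda flows\<close>

definition lincomb :: "'i set \<Rightarrow> ('i \<Rightarrow> complex) \<Rightarrow> ('i \<Rightarrow> fpair) \<Rightarrow> fpair" where
  "lincomb I c X = (\<lambda>z x. \<Sum>i\<in>I. c i * fst (X i) z x, \<lambda>z x. \<Sum>i\<in>I. c i * snd (X i) z x)"

definition vscale :: "complex \<Rightarrow> fpair \<Rightarrow> fpair" where
  "vscale c X = (\<lambda>z x. c * fst X z x, \<lambda>z x. c * snd X z x)"

definition vadd :: "fpair \<Rightarrow> fpair \<Rightarrow> fpair" where
  "vadd X Y = (\<lambda>z x. fst X z x + fst Y z x, \<lambda>z x. snd X z x + snd Y z x)"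

fun toda :: "nat \<Rightarrow> fpair \<Rightarrow> fpair" where
  "toda n (l, lb) =
     (let A = proj {0..} (\<lambda>z x. l z x ^ n) in (bracket A l, bracket A lb))"

fun toda_bar :: "nat \<Rightarrow> fpair \<Rightarrow> fpair" where
  "toda_bar n (l, lb) =
     (let A = proj {..<0} (\<lambda>z x. lb z x ^ n) in (bracket A l, bracket A lb))"

end

theory Submission
  imports Defs
begin

text \<open>Let \<open>Q\<close> be any function of \<open>\<lambda>\<close>, \<open>\<lambda>b\<close> and the two logarithms, with the flow
  \<open>\<lambda> \<mapsto> {-Q\<^sub>-, \<lambda>}\<close>, \<open>\<lambda>b \<mapsto> {Q\<^sub>+, \<lambda>b}\<close>. As \<open>Q = Q\<^sub>+ + Q\<^sub>-\<close> depends on \<open>(z, x)\<close> only through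
  \<open>\<lambda>\<close> and \<open>\<lambda>b\<close>, the derivative of \<open>R\<close> along the flow of \<open>Q\<close> minus that of \<open>Q\<close> along the flow
  of \<open>R\<close> equals \<open>{Q\<^sub>+, R\<^sub>+} - {Q\<^sub>-, R\<^sub>-}\<close>. Its projections and the Jacobi identity
  make any two such flows commute, and its vanishing residue is the symmetry of the densities.
  The differential of \<open>\<integral> res Q\<close> consists of projections of \<open>\<partial>Q/\<partial>\<lambda>\<close> and \<open>\<partial>Q/\<partial>\<lambda>b\<close>; since
  \<open>{\<lambda>, \<partial>Q/\<partial>\<lambda>} + {\<lambda>b, \<partial>Q/\<partial>\<lambda>b} = 0\<close>, the two Poisson structures send it to the flows of
  \<open>\<partial>Q/\<partial>\<lambda>b - \<partial>Q/\<partial>\<lambda>\<close> and of \<open>\<lambda> \<partial>Q/\<partial>\<lambda> + \<lambda>b \<partial>Q/\<partial>\<lambda>b\<close>. The recursion thus reduces to the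
  identity \<open>(\<partial>/\<partial>\<lambda>b - \<partial>/\<partial>\<lambda>) Q\<^bsub>a,p+1\<^esub> = Q\<^bsub>a,p\<^esub>\<close> and to the (quasi-)homogeneity of \<open>Q\<^bsub>a,p\<^esub>\<close>.\<close>

section \<open>Smooth families of holomorphic functions\<close>

text \<open>Three obstacles shape the development. Germs: neighbourhoods of \<open>D0\<close>,
  \<open>Dinf\<close> and the circle are not fixed, so conditions are restated as holding for all
  radii close to 1, and one radius then serves them all; a projection, defined as an infinite sum,
  is handled through Cauchy integrals, which carry smoothness in \<open>x\<close>. Logarithms: they
  need not be periodic in \<open>x\<close>. Commutativity and tau-symmetry are therefore proved over
  the whole line, and periodicity of the logarithms enters only for membership in \<open>TLM\<close>
  and \<open>one_forms\<close>; expressions are syntax trees, in which the logarithms can be traced.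
  Lines: \<open>has_deriv_along\<close> varies a state along a straight line, so derivatives in
  \<open>x\<close> and in the line parameter mix; for fixed \<open>x\<close> the line is itself a
  smooth family, and the calculus for \<open>x\<close> is reused. The truncation of a gradient to
  exponents \<open>{0..}\<close> and \<open>{..1}\<close> is forced by duality with
  \<open>TLM\<close>; the discarded tails reappear in the Poisson tensors, where they cancel or
  supply the missing terms. As \<open>ham_field\<close> speaks of every differential, uniqueness of
  the differential is needed too.\<close>

text \<open>The parameter \<open>x\<close> ranges over an open set \<open>J\<close> rather than the whole line so that the same
  notion also covers the parameter \<open>s\<close> of \<open>shift s X St\<close>, which has to stay small.\<close>

definition sm0 :: "complex set \<Rightarrow> real set \<Rightarrow> fld \<Rightarrow> bool" where
  "sm0 U J f \<longleftrightarrow> (\<forall>z\<in>U. \<forall>x\<in>J. f z differentiable (at x)) \<and>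
     continuous_on (U \<times> J) (\<lambda>(z, x). f z x) \<and> (\<forall>x\<in>J. (\<lambda>z. f z x) holomorphic_on U)"

text \<open>The recursion peels off one \<open>dx\<close> at a time, so that rules such as Leibniz,
  which express the derivative through the original family at lower order, close by induction on the
  order.\<close>

primrec smn :: "nat \<Rightarrow> complex set \<Rightarrow> real set \<Rightarrow> fld \<Rightarrow> bool" where
  "smn 0 U J f = sm0 U J f"
| "smn (Suc n) U J f = (sm0 U J f \<and> smn n U J (dx f))"

definition sm :: "complex set \<Rightarrow> real set \<Rightarrow> fld \<Rightarrow> bool" where
  "sm U J f \<longleftrightarrow> (\<forall>n. smn n U J f)"

lemma smn_iff: "smn n U J f \<longleftrightarrow> (\<forall>k\<le>n. sm0 U J ((dx ^^ k) f))"
proof (induction n arbitrary: f)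
  case (Suc n)
  have "(\<forall>k\<le>Suc n. sm0 U J ((dx ^^ k) f)) \<longleftrightarrow>
      sm0 U J f \<and> (\<forall>k\<le>n. sm0 U J ((dx ^^ Suc k) f))"
    by (metis Suc_le_mono funpow_0 less_eq_nat.simps(1) not0_implies_Suc)
  then show ?case using Suc by (simp add: funpow_swap1)
qed simp

lemma sm_iff: "sm U J f \<longleftrightarrow> (\<forall>k. sm0 U J ((dx ^^ k) f))"
  unfolding sm_def smn_iff by auto

lemma smooth_fam_iff: "smooth_fam K f \<longleftrightarrow> (\<exists>U. open U \<and> K \<subseteq> U \<and> sm U UNIV f)"
  unfolding smooth_fam_def sm_iff sm0_def by simp

lemma sm_sm0: "sm U J f \<Longrightarrow> sm0 U J f"
  unfolding sm_def by (metis smn.simps(1))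

lemma sm_dx: "sm U J f \<Longrightarrow> sm U J (dx f)"
  unfolding sm_def by (metis smn.simps(2))

lemma sm0_subset: "sm0 U J f \<Longrightarrow> V \<subseteq> U \<Longrightarrow> I \<subseteq> J \<Longrightarrow> sm0 V I f"
  unfolding sm0_def
  by (meson Sigma_mono continuous_on_subset holomorphic_on_subset subset_iff)

lemma sm_subset: "sm U J f \<Longrightarrow> V \<subseteq> U \<Longrightarrow> I \<subseteq> J \<Longrightarrow> sm V I f"
  by (meson sm0_subset sm_def smn_iff)

lemma sm0_dx: "sm0 U J f \<Longrightarrow> z \<in> U \<Longrightarrow> x \<in> J \<Longrightarrow> (f z has_vector_derivative dx f z x) (at x)"
  unfolding sm0_def dx_def using vector_derivative_works by blast

lemma sm0_cont: "sm0 U J f \<Longrightarrow> continuous_on (U \<times> J) (\<lambda>p. f (fst p) (snd p))"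
  unfolding sm0_def by (simp add: case_prod_beta')

lemma continuous_on_pair:
  assumes "continuous_on (U \<times> J) (\<lambda>p. f (fst p) (snd p))"
    and "continuous_on S a" "continuous_on S b" "\<And>s. s \<in> S \<Longrightarrow> a s \<in> U \<and> b s \<in> J"
  shows "continuous_on S (\<lambda>s. f (a s) (b s))"
proof -
  have "continuous_on S (\<lambda>s. (a s, b s))" "(\<lambda>s. (a s, b s)) ` S \<subseteq> U \<times> J"
    using assms by (auto intro: continuous_on_Pair)
  from continuous_on_compose2[OF assms(1) this] show ?thesis by simp
qed

lemma sm0_hol: "sm0 U J f \<Longrightarrow> x \<in> J \<Longrightarrow> (\<lambda>z. f z x) holomorphic_on U"
  unfolding sm0_def by blast

lemmas sm_has_dx = sm0_dx[OF sm_sm0] and sm_cont = sm0_cont[OF sm_sm0]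
  and sm_hol = sm0_hol[OF sm_sm0]

lemma sm_has_dz:
  "sm U J f \<Longrightarrow> open U \<Longrightarrow> z \<in> U \<Longrightarrow> x \<in> J \<Longrightarrow> ((\<lambda>z. f z x) has_field_derivative dz f z x) (at z)"
  unfolding dz_def by (rule holomorphic_derivI[OF sm_hol])

lemma sm0I:
  assumes "\<And>z x. z \<in> U \<Longrightarrow> x \<in> J \<Longrightarrow> (f z has_vector_derivative g z x) (at x)"
    and "continuous_on (U \<times> J) (\<lambda>p. f (fst p) (snd p))"
    and "\<And>x. x \<in> J \<Longrightarrow> (\<lambda>z. f z x) holomorphic_on U"
  shows "sm0 U J f"
  unfolding sm0_def using assms by (auto intro: differentiableI_vector simp: case_prod_beta')

lemma dx_eqI: "(f z has_vector_derivative D) (at x) \<Longrightarrow> dx f z x = D"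
  unfolding dx_def by (rule vector_derivative_at)

lemma dz_eqI: "((\<lambda>z. f z x) has_field_derivative D) (at z) \<Longrightarrow> dz f z x = D"
  unfolding dz_def by (rule DERIV_imp_deriv)

lemma dx_cong:
  "open J \<Longrightarrow> x \<in> J \<Longrightarrow> (\<And>y. y \<in> J \<Longrightarrow> f z y = g z y) \<Longrightarrow> dx f z x = dx g z x"
  unfolding dx_def
  by (intro vector_derivative_cong_eq) (auto simp: eventually_nhds)

lemma dz_cong:
  "open U \<Longrightarrow> z \<in> U \<Longrightarrow> (\<And>w. w \<in> U \<Longrightarrow> f w x = g w x) \<Longrightarrow> dz f z x = dz g z x"
  unfolding dz_def
  by (intro deriv_cong_ev) (auto simp: eventually_nhds)

text \<open>Agreement on \<open>U\<close> times \<open>J\<close> suffices: \<open>dx\<close> moves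
  only the second argument, so openness of \<open>J\<close> protects it, and holomorphy on
  \<open>U\<close> reads only values in \<open>U\<close>.\<close>

lemma sm0_cong:
  assumes J: "open J" and e: "\<And>z x. z \<in> U \<Longrightarrow> x \<in> J \<Longrightarrow> f z x = g z x" and f: "sm0 U J f"
  shows "sm0 U J g"
proof (rule sm0I)
  show "(g z has_vector_derivative dx f z x) (at x)" if "z \<in> U" "x \<in> J" for z x
    by (rule has_vector_derivative_transform_within_open[OF sm0_dx[OF f that] J]) (use that e in auto)
  show "continuous_on (U \<times> J) (\<lambda>p. g (fst p) (snd p))"
    by (rule continuous_on_eq[OF sm0_cont[OF f]]) (use e in auto)
  show "(\<lambda>z. g z x) holomorphic_on U" if "x \<in> J" for x
    by (rule holomorphic_transform[OF sm0_hol[OF f that]]) (use e that in auto)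
qed

lemma smn_cong:
  assumes J: "open J" and e: "\<And>z x. z \<in> U \<Longrightarrow> x \<in> J \<Longrightarrow> f z x = g z x" and f: "smn n U J f"
  shows "smn n U J g"
  using e f
proof (induction n arbitrary: f g)
  case 0
  then show ?case using sm0_cong[OF J] by simp blast
next
  case (Suc n)
  have "smn n U J (dx g)"
  proof (rule Suc.IH)
    show "dx f z x = dx g z x" if "z \<in> U" "x \<in> J" for z x
      using Suc.prems(1) that by (intro dx_cong[OF J]) auto
    show "smn n U J (dx f)" using Suc.prems(2) by simp
  qed
  moreover have "sm0 U J g"
    by (rule sm0_cong[OF J, of U f]) (use Suc.prems in auto)
  ultimately show ?case by simp
qed

lemma sm_cong:
  "open J \<Longrightarrow> (\<And>z x. z \<in> U \<Longrightarrow> x \<in> J \<Longrightarrow> f z x = g z x) \<Longrightarrow> sm U J f \<Longrightarrow> sm U J g"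
  unfolding sm_def using smn_cong by metis

lemma smn_SucI:
  assumes J: "open J" and f: "sm0 U J f" and g: "smn n U J g"
    and d: "\<And>z x. z \<in> U \<Longrightarrow> x \<in> J \<Longrightarrow> (f z has_vector_derivative g z x) (at x)"
  shows "smn (Suc n) U J f"
proof -
  have "smn n U J (dx f)"
    by (rule smn_cong[OF J _ g]) (metis d dx_eqI)
  then show ?thesis using f by simp
qed

lemma smn_Suc_le: "smn (Suc n) U J f \<Longrightarrow> smn n U J f"
  unfolding smn_iff by auto

lemma sm_SucI:
  assumes J: "open J" and f: "sm0 U J f" and g: "sm U J g"
    and d: "\<And>z x. z \<in> U \<Longrightarrow> x \<in> J \<Longrightarrow> (f z has_vector_derivative g z x) (at x)"
  shows "sm U J f"
  unfolding sm_def
proof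
  fix n
  have "smn (Suc n) U J f"
    by (rule smn_SucI[OF J f _ d]) (use g in \<open>auto simp: sm_def\<close>)
  then show "smn n U J f" by (rule smn_Suc_le)
qed

text \<open>Smoothness as a greatest fixed point: a class closed under differentiation reaches every
  order by induction. It suits classes such as compositions with a fixed map, conjugates and
  parameter integrals, whose derivatives have the same shape as their members.\<close>

lemma sm_coinduct:
  assumes J: "open J" and f: "P f"
    and step: "\<And>f. P f \<Longrightarrow> sm0 U J f \<and>
      (\<exists>g. P g \<and> (\<forall>z\<in>U. \<forall>x\<in>J. (f z has_vector_derivative g z x) (at x)))"
  shows "sm U J f"
proof -
  have "smn n U J f" if "P f" for n f
    using that
  proof (induction n arbitrary: f)
    case 0
    then show ?case using step by auto
  next
    case (Suc n)
    then obtain g where "P g" "\<forall>z\<in>U. \<forall>x\<in>J. (f z has_vector_derivative g z x) (at x)"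
      using step by blast
    then show ?case
      using Suc.IH[of g] step[OF Suc.prems] by (intro smn_SucI[OF J, of U f n g]) auto
  qed
  with f show ?thesis unfolding sm_def by blast
qed

text \<open>Cauchy kernels yield smoothness only on a disc around each point. All orders of
  \<open>dx\<close> keep \<open>z\<close> fixed, so the discs glue while \<open>J\<close> stays the
  same.\<close>

lemma sm_local:
  assumes U: "open U" and J: "open J" and l: "\<And>z. z \<in> U \<Longrightarrow> \<exists>V. open V \<and> z \<in> V \<and> sm V J f"
  shows "sm U J f"
proof (rule sm_coinduct[OF J, where P = "\<lambda>f. \<forall>z\<in>U. \<exists>V. open V \<and> z \<in> V \<and> sm V J f"])
  fix f assume l: "\<forall>z\<in>U. \<exists>V. open V \<and> z \<in> V \<and> sm V J f"
  have d: "(f z has_vector_derivative dx f z x) (at x)" if "z \<in> U" "x \<in> J" for z x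
    using l sm_has_dx that by blast
  have "sm0 U J f"
  proof (rule sm0I[OF d])
    show "continuous_on (U \<times> J) (\<lambda>p. f (fst p) (snd p))"
      unfolding continuous_on_eq_continuous_at[OF open_Times[OF U J]]
    proof
      fix p assume "p \<in> U \<times> J"
      then obtain V where V: "open V" "fst p \<in> V" "sm V J f" "snd p \<in> J" using l by (cases p) auto
      then have "continuous_on (V \<times> J) (\<lambda>p. f (fst p) (snd p))" using sm_cont by blast
      then show "isCont (\<lambda>p. f (fst p) (snd p)) p"
        using V J continuous_on_eq_continuous_at[OF open_Times, of V J] by (cases p) auto
    qed
    show "(\<lambda>z. f z x) holomorphic_on U" if "x \<in> J" for x
    proof -
      have "(\<lambda>z. f z x) field_differentiable at z" if "z \<in> U" for z
        using l sm_hol \<open>x \<in> J\<close> that holomorphic_on_imp_differentiable_at by blast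
      then show ?thesis using holomorphic_on_open[OF U] field_differentiable_def by blast
    qed
  qed auto
  moreover have "\<forall>z\<in>U. \<exists>V. open V \<and> z \<in> V \<and> sm V J (dx f)" using l sm_dx by blast
  ultimately show "sm0 U J f \<and> (\<exists>g. (\<forall>z\<in>U. \<exists>V. open V \<and> z \<in> V \<and> sm V J g) \<and>
      (\<forall>z\<in>U. \<forall>x\<in>J. (f z has_vector_derivative g z x) (at x)))"
    using d by blast
qed (use l in blast)

section \<open>Closure of smooth families under algebra, composition and logarithms\<close>

lemma sm_hol_const:
  assumes "open J" "g holomorphic_on U"
  shows "sm U J (\<lambda>z x. g z)"
proof -
  have c: "continuous_on (U \<times> J) (\<lambda>p. h (fst p))" if "h holomorphic_on U" for h :: "complex \<Rightarrow> complex"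
    by (rule continuous_on_compose2[OF holomorphic_on_imp_continuous_on[OF that]])
      (auto intro!: continuous_on_fst continuous_on_id)
  have d: "((\<lambda>x. h z) has_vector_derivative 0) (at x)" for h :: "complex \<Rightarrow> complex" and z x
    by (rule has_vector_derivative_const)
  have 0: "sm0 U J (\<lambda>z x. h z)" if "h holomorphic_on U" for h :: "complex \<Rightarrow> complex"
    by (rule sm0I[where g = "\<lambda>z x. 0"]) (simp_all add: d c that)
  have "smn n U J (\<lambda>z x. 0)" for n
  proof (induction n)
    case (Suc n)
    show ?case
      by (rule smn_SucI[where g = "\<lambda>z x. 0", OF assms(1) _ Suc]) (simp_all add: d 0)
  qed (simp add: 0)
  then have 1: "sm U J (\<lambda>z x. 0)" unfolding sm_def by blast
  show ?thesis
    by (rule sm_SucI[where g = "\<lambda>z x. 0", OF assms(1) _ 1]) (simp_all add: d 0 assms)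
qed

lemma sm_const: "open J \<Longrightarrow> sm U J (\<lambda>z x. c)"
  by (rule sm_hol_const) auto

lemma sm_z: "open J \<Longrightarrow> sm U J (\<lambda>z x. z)"
  by (rule sm_hol_const) auto

lemma sm_param: assumes "open J" shows "sm U J (\<lambda>z x. complex_of_real x)"
proof -
  have d: "(complex_of_real has_vector_derivative 1) (at x)" for x
    using has_vector_derivative_of_real[OF DERIV_ident] by simp
  have "sm0 U J (\<lambda>z x. complex_of_real x)"
    by (rule sm0I[where g = "\<lambda>z x. 1"])
      (simp_all add: d continuous_on_of_real continuous_on_snd)
  then show ?thesis
    by (rule sm_SucI[OF assms _ sm_const[OF assms, of U 1]]) (rule d)
qed

lemma sm0_add: assumes "sm0 U J f" "sm0 U J g" shows "sm0 U J (\<lambda>z x. f z x + g z x)"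
  by (rule sm0I[where g = "\<lambda>z x. dx f z x + dx g z x"])
    (intro has_vector_derivative_add continuous_on_add holomorphic_on_add
      sm0_dx[OF assms(1)] sm0_dx[OF assms(2)] sm0_cont[OF assms(1)] sm0_cont[OF assms(2)]
      sm0_hol[OF assms(1)] sm0_hol[OF assms(2)]; assumption)+

lemma sm0_mult: assumes "sm0 U J f" "sm0 U J g" shows "sm0 U J (\<lambda>z x. f z x * g z x)"
  by (rule sm0I[where g = "\<lambda>z x. f z x * dx g z x + dx f z x * g z x"])
    (intro has_vector_derivative_mult continuous_on_mult holomorphic_on_mult
      sm0_dx[OF assms(1)] sm0_dx[OF assms(2)] sm0_cont[OF assms(1)] sm0_cont[OF assms(2)]
      sm0_hol[OF assms(1)] sm0_hol[OF assms(2)]; assumption)+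

lemma smn_add: "open J \<Longrightarrow> smn n U J f \<Longrightarrow> smn n U J g \<Longrightarrow> smn n U J (\<lambda>z x. f z x + g z x)"
proof (induction n arbitrary: f g)
  case (Suc n)
  then show ?case
    by (intro smn_SucI[where g = "\<lambda>z x. dx f z x + dx g z x"])
      (auto intro!: sm0_add has_vector_derivative_add sm0_dx)
qed (simp add: sm0_add)

lemma smn_mult: "open J \<Longrightarrow> smn n U J f \<Longrightarrow> smn n U J g \<Longrightarrow> smn n U J (\<lambda>z x. f z x * g z x)"
proof (induction n arbitrary: f g)
  case (Suc n)
  then have "smn n U J (\<lambda>z x. f z x * dx g z x + dx f z x * g z x)"
    using smn_Suc_le[OF Suc.prems(2)] smn_Suc_le[OF Suc.prems(3)] by (intro smn_add) auto
  with Suc.prems show ?case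
    by (intro smn_SucI[where g = "\<lambda>z x. f z x * dx g z x + dx f z x * g z x"])
      (auto intro!: sm0_mult has_vector_derivative_mult sm0_dx)
qed (simp add: sm0_mult)

lemma sm_add: "open J \<Longrightarrow> sm U J f \<Longrightarrow> sm U J g \<Longrightarrow> sm U J (\<lambda>z x. f z x + g z x)"
  unfolding sm_def by (simp add: smn_add)

lemma sm_mult: "open J \<Longrightarrow> sm U J f \<Longrightarrow> sm U J g \<Longrightarrow> sm U J (\<lambda>z x. f z x * g z x)"
  unfolding sm_def by (simp add: smn_mult)

lemma sm_uminus: "open J \<Longrightarrow> sm U J f \<Longrightarrow> sm U J (\<lambda>z x. - f z x)"
  using sm_mult[OF _ sm_const[of J U "-1"], of f] by simp

lemma sm_diff: "open J \<Longrightarrow> sm U J f \<Longrightarrow> sm U J g \<Longrightarrow> sm U J (\<lambda>z x. f z x - g z x)"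
  using sm_add[OF _ _ sm_uminus, of J U f g] by simp

lemma sm_power: "open J \<Longrightarrow> sm U J f \<Longrightarrow> sm U J (\<lambda>z x. f z x ^ n)"
  by (induction n) (simp_all add: sm_const sm_mult)

lemma sm_inverse:
  assumes J: "open J" and f: "sm U J f" and nz: "\<And>z x. z \<in> U \<Longrightarrow> x \<in> J \<Longrightarrow> f z x \<noteq> 0"
  shows "sm U J (\<lambda>z x. inverse (f z x))"
proof -
  have d: "((\<lambda>x. inverse (f z x)) has_vector_derivative
      - (dx f z x * (inverse (f z x) * inverse (f z x)))) (at x)" if "z \<in> U" "x \<in> J" for z x
  proof -
    have "(f z has_derivative (\<lambda>h. h *\<^sub>R dx f z x)) (at x)"
      using sm_has_dx[OF f that] unfolding has_vector_derivative_def .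
    from Deriv.has_derivative_inverse[OF _ this] nz[OF that] show ?thesis
      unfolding has_vector_derivative_def by (simp add: mult_ac)
  qed
  have 0: "sm0 U J (\<lambda>z x. inverse (f z x))"
    by (rule sm0I[OF d]) (use nz in \<open>auto intro!: continuous_on_inverse sm_cont[OF f] holomorphic_on_inverse sm_hol[OF f]\<close>)
  have n: "smn n U J (\<lambda>z x. inverse (f z x))" for n
  proof (induction n)
    case (Suc n)
    \<comment> \<open>The derivative contains the inverse itself, whose smoothness to order
      \<open>n\<close> is the induction hypothesis.\<close>
    have "smn n U J (\<lambda>z x. (-1) * (dx f z x * (inverse (f z x) * inverse (f z x))))"
      using sm_dx[OF f] sm_const[OF J, of U "-1"] by (intro smn_mult J Suc) (auto simp: sm_def)
    then show ?case
      by (intro smn_SucI[OF J 0 _ d]) auto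
  qed (simp add: 0)
  then show ?thesis unfolding sm_def by blast
qed

lemma sm_divide:
  "open J \<Longrightarrow> sm U J f \<Longrightarrow> sm U J g \<Longrightarrow> (\<And>z x. z \<in> U \<Longrightarrow> x \<in> J \<Longrightarrow> g z x \<noteq> 0) \<Longrightarrow>
    sm U J (\<lambda>z x. f z x / g z x)"
  unfolding divide_inverse by (intro sm_mult sm_inverse) auto

lemma sm_powi:
  assumes "open J" "sm U J f" "\<And>z x. z \<in> U \<Longrightarrow> x \<in> J \<Longrightarrow> f z x \<noteq> 0"
  shows "sm U J (\<lambda>z x. f z x powi k)"
  using assms by (cases "k \<ge> 0") (simp_all add: power_int_def sm_power sm_inverse)

lemma sm_compose_z:
  assumes J: "open J" and f: "sm V J f" and h: "h holomorphic_on U" "h ` U \<subseteq> V"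
  shows "sm U J (\<lambda>z x. f (h z) x)"
proof (rule sm_coinduct[OF J, where P = "\<lambda>F. \<exists>f. sm V J f \<and> F = (\<lambda>z x. f (h z) x)"])
  fix F assume "\<exists>f. sm V J f \<and> F = (\<lambda>z x. f (h z) x)"
  then obtain f where f: "sm V J f" and F: "F = (\<lambda>z x. f (h z) x)" by blast
  have d: "(F z has_vector_derivative dx f (h z) x) (at x)" if "z \<in> U" "x \<in> J" for z x
    unfolding F using sm_has_dx[OF f] h that by auto
  have "sm0 U J F"
  proof (rule sm0I[OF d])
    show "continuous_on (U \<times> J) (\<lambda>p. F (fst p) (snd p))"
      unfolding F
    proof (rule continuous_on_pair[OF sm_cont[OF f]])
      show "continuous_on (U \<times> J) (\<lambda>p. h (fst p))"
        by (rule continuous_on_compose2[OF holomorphic_on_imp_continuous_on[OF h(1)]])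
          (auto intro!: continuous_on_fst continuous_on_id)
    qed (use h(2) in \<open>auto intro!: continuous_on_snd continuous_on_id\<close>)
    show "(\<lambda>z. F z x) holomorphic_on U" if "x \<in> J" for x
      using holomorphic_on_compose_gen[OF h(1) sm_hol[OF f that] h(2)] unfolding F by (simp add: o_def)
  qed
  then show "sm0 U J F \<and> (\<exists>g. (\<exists>f. sm V J f \<and> g = (\<lambda>z x. f (h z) x)) \<and>
     (\<forall>z\<in>U. \<forall>x\<in>J. (F z has_vector_derivative g z x) (at x)))"
    using d sm_dx[OF f] by blast
qed (use f in blast)

text \<open>Conjugation destroys holomorphy in \<open>z\<close>, hence \<open>z\<close> is frozen at
  \<open>a\<close> and only the dependence on \<open>x\<close> survives. Conjugated coefficients
  serve as test vectors in the uniqueness of differentials.\<close>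

lemma sm_cnj:
  assumes J: "open J" and f: "sm V J f" and a: "a \<in> V"
  shows "sm U J (\<lambda>z x. cnj (f a x))"
proof (rule sm_coinduct[OF J, where P = "\<lambda>F. \<exists>f. sm V J f \<and> F = (\<lambda>z x. cnj (f a x))"])
  fix F :: fld assume "\<exists>f. sm V J f \<and> F = (\<lambda>z x. cnj (f a x))"
  then obtain f where f: "sm V J f" and F: "F = (\<lambda>z x. cnj (f a x))" by blast
  have d: "(F z has_vector_derivative cnj (dx f a x)) (at x)" if "z \<in> U" "x \<in> J" for z x
    unfolding F using has_vector_derivative_cnj[OF sm_has_dx[OF f a that(2)]] by simp
  have "sm0 U J F"
  proof (rule sm0I[OF d])
    have "continuous_on (U \<times> J) (\<lambda>p. f a (snd p))"
      by (rule continuous_on_pair[OF sm_cont[OF f]]) (use a in \<open>auto intro!: continuous_on_snd continuous_on_id\<close>)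
    then show "continuous_on (U \<times> J) (\<lambda>p. F (fst p) (snd p))"
      unfolding F by (intro continuous_intros)
  qed (auto simp: F)
  then show "sm0 U J F \<and> (\<exists>g. (\<exists>f. sm V J f \<and> g = (\<lambda>z x. cnj (f a x))) \<and>
     (\<forall>z\<in>U. \<forall>x\<in>J. (F z has_vector_derivative g z x) (at x)))"
    using d sm_dx[OF f] by blast
qed (use f in blast)

lemma sm_slice:
  assumes J: "open J" and f: "sm V J f" and a: "a \<in> V"
  shows "sm U J (\<lambda>z x. f a x)"
  using sm_compose_z[OF J f, of "\<lambda>_. a" U] a by auto

text \<open>A continuous logarithm is as smooth as its exponential: near each point it is a constant
  plus the principal logarithm of a quotient close to 1, so its derivative is the logarithmic
  derivative of \<open>f\<close>, which is smooth.\<close>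

lemma sm_log:
  assumes U: "open U" and J: "open J" and f: "sm U J f"
    and c: "continuous_on (U \<times> J) (\<lambda>p. g (fst p) (snd p))"
    and e: "\<And>z x. z \<in> U \<Longrightarrow> x \<in> J \<Longrightarrow> exp (g z x) = f z x"
  shows "sm U J g"
    and "\<And>z x. z \<in> U \<Longrightarrow> x \<in> J \<Longrightarrow> (g z has_vector_derivative dx f z x / f z x) (at x)"
proof -
  \<comment> \<open>By continuity the increment of \<open>h\<close> has imaginary part below pi in
    absolute value near \<open>b\<close>, and on that strip \<open>Ln\<close> inverts
    \<open>exp\<close>.\<close>
  have near: "\<forall>\<^sub>F y in nhds b. h y = h b + Ln (F y / F b)"
    if h: "isCont h b" and F: "isCont F b" and hF: "\<forall>\<^sub>F y in nhds b. exp (h y) = F y" and nz: "F b \<noteq> 0"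
    for h F :: "'a :: t2_space \<Rightarrow> complex" and b
  proof -
    have b: "exp (h b) = F b" using hF eventually_nhds_x_imp_x by blast
    have "((\<lambda>y. Im (h y - h b)) \<longlongrightarrow> Im (h b - h b)) (nhds b)"
      using h unfolding isCont_def tendsto_at_iff_tendsto_nhds by (intro tendsto_intros)
    then have "\<forall>\<^sub>F y in nhds b. \<bar>Im (h y - h b)\<bar> < pi"
      using order_tendstoD(2)[OF tendsto_rabs, of "\<lambda>y. Im (h y - h b)" 0 "nhds b" pi] by simp
    with hF show ?thesis
    proof eventually_elim
      case (elim y)
      then have "F y / F b = exp (h y - h b)" using b by (simp add: exp_diff)
      then show ?case using elim Ln_exp[of "h y - h b"] by auto
    qed
  qed
  have nz: "f z x \<noteq> 0" if "z \<in> U" "x \<in> J" for z x using e[OF that] by (metis exp_not_eq_zero)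
  have gx: "isCont (g z) x" and gz: "isCont (\<lambda>z. g z x) z" if "z \<in> U" "x \<in> J" for z x
  proof -
    have "continuous_on J (\<lambda>y. g z y)"
      by (rule continuous_on_pair[OF c]) (use that in \<open>auto intro!: continuous_intros\<close>)
    then show "isCont (g z) x" using J that continuous_on_eq_continuous_at by blast
    have "continuous_on U (\<lambda>w. g w x)"
      by (rule continuous_on_pair[OF c]) (use that in \<open>auto intro!: continuous_intros\<close>)
    then show "isCont (\<lambda>z. g z x) z" using U that continuous_on_eq_continuous_at by blast
  qed
  show d: "(g z has_vector_derivative dx f z x / f z x) (at x)" if zx: "z \<in> U" "x \<in> J" for z x
  proof -
    have fd: "(f z has_vector_derivative dx f z x) (at x)" by (rule sm_has_dx[OF f zx])
    have "\<forall>\<^sub>F y in nhds x. g z y = g z x + Ln (f z y / f z x)"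
      using near[OF gx[OF zx] has_vector_derivative_continuous[OF fd, folded isCont_def] _ nz[OF zx]]
        e zx J eventually_nhds by blast
    moreover have "((\<lambda>y. g z x + Ln (f z y / f z x)) has_vector_derivative 0 + dx f z x / f z x) (at x)"
    proof (rule has_vector_derivative_add[OF has_vector_derivative_const])
      have q: "((\<lambda>y. f z y / f z x) has_vector_derivative dx f z x / f z x) (at x)"
        using has_vector_derivative_mult_left[OF fd, of "inverse (f z x)"] by (simp add: divide_inverse)
      show "((\<lambda>y. Ln (f z y / f z x)) has_vector_derivative dx f z x / f z x) (at x)"
        using field_vector_diff_chain_at[OF q, of Ln 1] has_field_derivative_Ln[of 1] nz[OF zx]
        by (simp add: o_def)
    qed
    moreover have "g z x = g z x + Ln (f z x / f z x)"
      using calculation(1) eventually_nhds_x_imp_x by blast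
    ultimately show ?thesis
      using has_vector_derivative_cong_ev[where x = x and S = UNIV and f = "g z"
          and g = "\<lambda>y. g z x + Ln (f z y / f z x)"] by simp
  qed
  have 0: "sm0 U J g"
  proof (rule sm0I[OF d c])
    fix x assume x: "x \<in> J"
    have "(\<lambda>z. g z x) field_differentiable at z" if z: "z \<in> U" for z
    proof -
      have fd: "((\<lambda>z. f z x) has_field_derivative dz f z x) (at z)" by (rule sm_has_dz[OF f U z x])
      have "\<forall>\<^sub>F y in nhds z. g y x = g z x + Ln (f y x / f z x)"
        using near[OF gz[OF z x] DERIV_isCont[OF fd] _ nz[OF z x]]
          e x z U eventually_nhds by blast
      moreover have "((\<lambda>y. g z x + Ln (f y x / f z x)) has_field_derivative (1 * (dz f z x / f z x))) (at z)"
        using nz[OF z x] by (auto intro!: derivative_eq_intros fd)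
      ultimately show ?thesis unfolding field_differentiable_def
        using DERIV_cong_ev[where x = z and y = z and f = "\<lambda>z. g z x"
            and g = "\<lambda>y. g z x + Ln (f y x / f z x)"] by blast
    qed
    then show "(\<lambda>z. g z x) holomorphic_on U"
      using holomorphic_on_open[OF U] field_differentiable_def by blast
  qed
  have "sm U J (\<lambda>z x. dx f z x / f z x)" by (intro sm_divide J sm_dx f nz)
  then show "sm U J g" using sm_SucI[OF J 0 _ d] by blast
qed

section \<open>The bracket\<close>

text \<open>The variable \<open>x\<close> enters only through \<open>f\<close> and \<open>z\<close>
  only through the kernel. Hence \<open>dx\<close> of the integral is the same integral with
  \<open>dx f\<close>, which is the situation of \<open>sm_coinduct\<close>, while holomorphy in
  \<open>z\<close> comes from the kernel. Cauchy's derivative formula and the Laurent splitting are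
  both of this form.\<close>

lemma sm_param_integral:
  fixes \<gamma> :: "real \<Rightarrow> complex" and k k' :: "real \<Rightarrow> complex \<Rightarrow> complex"
  assumes V: "open V" and J: "open J" and f: "sm U J f"
    and \<gamma>: "continuous_on {0..1} \<gamma>" "\<gamma> ` {0..1} \<subseteq> U"
    and k: "continuous_on ({0..1} \<times> V) (\<lambda>p. k (fst p) (snd p))"
    and k': "continuous_on ({0..1} \<times> V) (\<lambda>p. k' (fst p) (snd p))"
    and kd: "\<And>t z. t \<in> {0..1} \<Longrightarrow> z \<in> V \<Longrightarrow> (k t has_field_derivative k' t z) (at z)"
  shows "sm V J (\<lambda>z x. integral {0..1} (\<lambda>t. f (\<gamma> t) x * k t z))"
    and "\<And>z x. z \<in> V \<Longrightarrow> x \<in> J \<Longrightarrow>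
      dx (\<lambda>z x. integral {0..1} (\<lambda>t. f (\<gamma> t) x * k t z)) z x = integral {0..1} (\<lambda>t. dx f (\<gamma> t) x * k t z)"
proof -
  define I where "I f = (\<lambda>z x. integral {0..1} (\<lambda>t. f (\<gamma> t) x * k t z))" for f :: fld
  have cf: "continuous_on S (\<lambda>s. f (\<gamma> (a s)) (b s))"
    if "sm U J f" "continuous_on S a" "continuous_on S b" "\<And>s. s \<in> S \<Longrightarrow> a s \<in> {0..1} \<and> b s \<in> J"
    for f and a b :: "'b :: topological_space \<Rightarrow> real" and S
    by (rule continuous_on_pair[OF sm_cont[OF that(1)]])
      (use that \<gamma> in \<open>auto intro!: continuous_on_compose2[OF \<gamma>(1)]\<close>)
  have ck: "continuous_on S (\<lambda>s. k (a s) (b s))" "continuous_on S (\<lambda>s. k' (a s) (b s))"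
    if "continuous_on S a" "continuous_on S b" "\<And>s. s \<in> S \<Longrightarrow> a s \<in> {0..1} \<and> b s \<in> V"
    for a and b :: "'b :: topological_space \<Rightarrow> complex" and S
    using continuous_on_pair[OF k, of S a b] continuous_on_pair[OF k', of S a b] that by auto
  have hvd: "(I f z has_vector_derivative I (dx f) z x) (at x)" if f: "sm U J f" and z: "z \<in> V" and x: "x \<in> J" for f z x
  proof -
    obtain e where e: "e > 0" "ball x e \<subseteq> J" using J x openE by blast
    have "((\<lambda>x. integral (cbox 0 1) (\<lambda>t. f (\<gamma> t) x * k t z)) has_vector_derivative
        integral (cbox 0 1) (\<lambda>t. dx f (\<gamma> t) x * k t z)) (at x within ball x e)"
    proof (rule leibniz_rule_vector_derivative)
      show "((\<lambda>x. f (\<gamma> t) x * k t z) has_vector_derivative dx f (\<gamma> t) y * k t z) (at y within ball x e)"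
        if "y \<in> ball x e" "t \<in> cbox 0 1" for y t
      proof -
        have "(f (\<gamma> t) has_vector_derivative dx f (\<gamma> t) y) (at y)"
          using that e \<gamma> by (intro sm_has_dx[OF f]) auto
        then show ?thesis
          by (rule has_vector_derivative_at_within[OF has_vector_derivative_mult_left])
      qed
      show "(\<lambda>t. f (\<gamma> t) y * k t z) integrable_on cbox 0 1" if "y \<in> ball x e" for y
        unfolding cbox_interval using that e z
        by (intro integrable_continuous_interval continuous_on_mult cf[OF f] ck) (auto intro!: continuous_intros)
      show "continuous_on (ball x e \<times> cbox 0 1) (\<lambda>(y, t). dx f (\<gamma> t) y * k t z)"
        unfolding case_prod_beta' using e z
        by (intro continuous_on_mult cf[OF sm_dx[OF f]] ck) (auto intro!: continuous_intros)
    qed (use e in auto)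
    then show ?thesis
      using e unfolding I_def by (simp add: at_within_open[OF _ open_ball])
  qed
  have s0: "sm0 V J (I f)" if f: "sm U J f" for f
  proof (rule sm0I[OF hvd[OF f]])
    have "continuous_on (V \<times> J) (\<lambda>p. integral (cbox 0 1) (\<lambda>t. f (\<gamma> t) (snd p) * k t (fst p)))"
      unfolding case_prod_beta'
      by (rule integral_continuous_on_param, unfold case_prod_beta', intro continuous_on_mult cf[OF f] ck)
        (auto intro!: continuous_intros)
    then show "continuous_on (V \<times> J) (\<lambda>p. I f (fst p) (snd p))" unfolding I_def by simp
    fix x assume x: "x \<in> J"
    have "(\<lambda>z. I f z x) field_differentiable at z" if z: "z \<in> V" for z
    proof -
      obtain e where e: "e > 0" "ball z e \<subseteq> V" using V z openE by blast
      have "(\<lambda>z. integral (cbox 0 1) (\<lambda>t. f (\<gamma> t) x * k t z)) field_differentiable at z within ball z e"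
      proof (rule leibniz_rule_field_differentiable)
        show "((\<lambda>z. f (\<gamma> t) x * k t z) has_field_derivative f (\<gamma> t) x * k' t y) (at y within ball z e)"
          if "y \<in> ball z e" "t \<in> cbox 0 1" for y t
        proof -
          have "(k t has_field_derivative k' t y) (at y)" using that e by (intro kd) auto
          then show ?thesis by (rule DERIV_cmult[OF has_field_derivative_at_within])
        qed
        show "(\<lambda>t. f (\<gamma> t) x * k t y) integrable_on cbox 0 1" if "y \<in> ball z e" for y
          unfolding cbox_interval using that e x
          by (intro integrable_continuous_interval continuous_on_mult cf[OF f] ck) (auto intro!: continuous_intros)
        show "continuous_on (ball z e \<times> cbox 0 1) (\<lambda>(y, t). f (\<gamma> t) x * k' t y)"
          unfolding case_prod_beta' using e x
          by (intro continuous_on_mult cf[OF f] ck) (auto intro!: continuous_intros)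
      qed (use e in auto)
      then show ?thesis
        using e unfolding I_def by (simp add: at_within_open[OF _ open_ball])
    qed
    then show "(\<lambda>z. I f z x) holomorphic_on V"
      using holomorphic_on_open[OF V] field_differentiable_def by blast
  qed auto
  have "sm V J (I f)"
  proof (rule sm_coinduct[OF J, where P = "\<lambda>F. \<exists>f. sm U J f \<and> F = I f"])
    show "\<exists>f'. sm U J f' \<and> I f = I f'" using f by blast
    show "sm0 V J F \<and> (\<exists>g. (\<exists>f. sm U J f \<and> g = I f) \<and>
        (\<forall>z\<in>V. \<forall>x\<in>J. (F z has_vector_derivative g z x) (at x)))"
      if "\<exists>f. sm U J f \<and> F = I f" for F
      using that s0 hvd sm_dx by metis
  qed
  then show "sm V J (\<lambda>z x. integral {0..1} (\<lambda>t. f (\<gamma> t) x * k t z))" unfolding I_def .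
  show "dx (\<lambda>z x. integral {0..1} (\<lambda>t. f (\<gamma> t) x * k t z)) z x = integral {0..1} (\<lambda>t. dx f (\<gamma> t) x * k t z)"
    if "z \<in> V" "x \<in> J" for z x
    using dx_eqI[where f = "I f", OF hvd[OF f that]] unfolding I_def .
qed

text \<open>Cauchy's formula writes \<open>dz f\<close> near a point as an integral of
  \<open>f\<close> over a fixed circle. Differentiating under that integral gives at once the
  smoothness of \<open>dz f\<close> and the interchange of \<open>dx\<close> and \<open>dz\<close>,
  without any two-variable calculus.\<close>

lemma sm_dz:
  assumes U: "open U" and J: "open J" and f: "sm U J f"
  shows "sm U J (dz f)" and "\<And>z x. z \<in> U \<Longrightarrow> x \<in> J \<Longrightarrow> dx (dz f) z x = dz (dx f) z x"
proof -
  have "\<exists>V. open V \<and> a \<in> V \<and> sm V J (dz f) \<and> (\<forall>z\<in>V. \<forall>x\<in>J. dx (dz f) z x = dz (dx f) z x)" if "a \<in> U" for a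
  proof -
    obtain \<rho> where \<rho>: "\<rho> > 0" "cball a \<rho> \<subseteq> U" using U \<open>a \<in> U\<close> open_contains_cball by blast
    define \<gamma> where "\<gamma> = circlepath a \<rho>"
    \<comment> \<open>The velocity of the circle divided by 2 pi i, which absorbs the constant in
      Cauchy's formula.\<close>
    define C where "C t = \<rho> * exp (2 * of_real pi * \<i> * of_real t)" for t
    define k where "k t w = C t * inverse ((\<gamma> t - w)\<^sup>2)" for t w
    define k' where "k' t w = C t * (inverse ((\<gamma> t - w)\<^sup>2) * (2 * (\<gamma> t - w)) * inverse ((\<gamma> t - w)\<^sup>2))" for t w
    define V where "V = ball a \<rho>"
    have im: "\<gamma> ` {0..1} = sphere a \<rho>"
      using \<rho> path_image_circlepath[of a \<rho>] unfolding \<gamma>_def path_image_def by simp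
    then have ne: "\<gamma> t \<noteq> w" if "t \<in> {0..1}" "w \<in> V" for t w
      using that unfolding V_def by (force simp: sphere_def)
    have \<gamma>c: "continuous_on {0..1} \<gamma>" unfolding \<gamma>_def circlepath by (intro continuous_intros)
    have vd: "vector_derivative \<gamma> (at t) = 2 * pi * \<i> * \<rho> * exp (2 * of_real pi * \<i> * of_real t)" for t
      unfolding \<gamma>_def vector_derivative_circlepath by simp
    have eq: "dz g w x = integral {0..1} (\<lambda>t. g (\<gamma> t) x * k t w)"
      if g: "sm U J g" and w: "w \<in> V" and x: "x \<in> J" for g w x
    proof -
      have h: "(\<lambda>z. g z x) holomorphic_on cball a \<rho>"
        using sm_hol[OF g x] \<rho> holomorphic_on_subset by blast
      then have "((\<lambda>z. g z x) has_field_derivative (1 / (2 * of_real pi * \<i>) *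
          contour_integral (circlepath a \<rho>) (\<lambda>u. g u x / (u - w)^2))) (at w)"
        using w unfolding V_def
        by (intro Cauchy_derivative_integral_circlepath holomorphic_on_imp_continuous_on)
          (auto intro: holomorphic_on_subset)
      from dz_eqI[where f = g, OF this] show ?thesis
        unfolding contour_integral_integral vector_derivative_circlepath \<gamma>_def[symmetric]
        by (simp add: vd k_def C_def integral_mult_right[symmetric] field_simps del: integral_mult_right)
    qed
    have ck: "continuous_on ({0..1} \<times> V) (\<lambda>p. k (fst p) (snd p))"
      "continuous_on ({0..1} \<times> V) (\<lambda>p. k' (fst p) (snd p))"
      unfolding k_def k'_def C_def using ne
      by (auto intro!: continuous_intros continuous_on_compose2[OF \<gamma>c])
    have kd: "(k t has_field_derivative k' t z) (at z)" if "t \<in> {0..1}" "z \<in> V" for t z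
    proof -
      have nz: "\<gamma> t - z \<noteq> 0" using ne[OF that] by simp
      have "((\<lambda>w. inverse ((\<gamma> t - w)\<^sup>2)) has_field_derivative
          - (inverse ((\<gamma> t - z)\<^sup>2) * (2 * (\<gamma> t - z) * (0 - 1)) * inverse ((\<gamma> t - z)\<^sup>2))) (at z)"
        using nz by (auto intro!: derivative_eq_intros)
      from DERIV_cmult[OF this, of "C t"] show ?thesis
        unfolding k_def k'_def by (simp add: algebra_simps)
    qed
    have V: "open V" "a \<in> V" unfolding V_def using \<rho> by auto
    have \<gamma>U: "\<gamma> ` {0..1} \<subseteq> U" using \<rho> unfolding im by (auto simp: sphere_def)
    note I = sm_param_integral[where \<gamma> = \<gamma> and k = k and k' = k', OF V(1) J _ \<gamma>c \<gamma>U ck]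
    have "sm V J (dz f)"
      by (rule sm_cong[where f = "\<lambda>z x. integral {0..1} (\<lambda>t. f (\<gamma> t) x * k t z)", OF J])
        (simp add: eq[OF f], rule I(1)[OF f kd])
    moreover have "dx (dz f) z x = dz (dx f) z x" if "z \<in> V" "x \<in> J" for z x
    proof -
      have "dx (dz f) z x = dx (\<lambda>z x. integral {0..1} (\<lambda>t. f (\<gamma> t) x * k t z)) z x"
        by (rule dx_cong[OF J that(2)]) (rule eq[OF f that(1)])
      also have "\<dots> = dz (dx f) z x"
        using I(2)[OF f kd that] eq[OF sm_dx[OF f] that] by simp
      finally show ?thesis .
    qed
    ultimately show ?thesis using V by blast
  qed
  note l = this
  show "sm U J (dz f)"
    by (rule sm_local[OF U J]) (use l in blast)
  show "dx (dz f) z x = dz (dx f) z x" if "z \<in> U" "x \<in> J" for z x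
    using l that by blast
qed

text \<open>The derivative with respect to log z. In terms of it \<open>bracket\<close> is the
  canonical Poisson bracket without explicit factors of \<open>z\<close>, and unlike
  \<open>dz\<close> it preserves orders at 0 and infinity.\<close>

definition th :: "fld \<Rightarrow> fld" where
  "th f = (\<lambda>z x. z * dz f z x)"

lemma bracket_th: "bracket f g z x = th f z x * dx g z x - th g z x * dx f z x"
  unfolding bracket_def th_def ..

lemma th_cong:
  "open U \<Longrightarrow> z \<in> U \<Longrightarrow> (\<And>w. w \<in> U \<Longrightarrow> f w x = g w x) \<Longrightarrow> th f z x = th g z x"
  unfolding th_def by (metis dz_cong)

lemma bracket_cong:
  assumes "open U" "open J" "z \<in> U" "x \<in> J"
    and f: "\<And>w y. w \<in> U \<Longrightarrow> y \<in> J \<Longrightarrow> f w y = f' w y" and g: "\<And>w y. w \<in> U \<Longrightarrow> y \<in> J \<Longrightarrow> g w y = g' w y"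
  shows "bracket f g z x = bracket f' g' z x"
proof -
  have "dx f z x = dx f' z x" "dx g z x = dx g' z x"
    using assms by (auto intro!: dx_cong[OF assms(2,4)])
  moreover have "th f z x = th f' z x" "th g z x = th g' z x"
    using assms by (auto intro!: th_cong[OF assms(1,3)])
  ultimately show ?thesis unfolding bracket_th by simp
qed

text \<open>The suffixes t and x stand for \<open>th\<close> and \<open>dx\<close>. One variable per
  mixed derivative is enough because the two derivations commute; the Jacobi identity then becomes a
  polynomial identity between second-order jets.\<close>

lemma jacobi_jets:
  fixes f g h ft gt ht fx gx hx ftt gtt htt ftx gtx htx fxx gxx hxx :: "'a :: comm_ring"
  shows "(ft * (gtx * hx + gt * hxx - htx * gx - ht * gxx) - (gtt * hx + gt * htx - htt * gx - ht * gtx) * fx)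
    - (gt * (ftx * hx + ft * hxx - htx * fx - ht * fxx) - (ftt * hx + ft * htx - htt * fx - ht * ftx) * gx)
    = (ftt * gx + ft * gtx - gtt * fx - gt * ftx) * hx - ht * (ftx * gx + ft * gxx - gtx * fx - gt * fxx)"
  by (simp only: algebra_simps)

section \<open>Leibniz rules and the Jacobi identity\<close>

locale domain_pair =
  fixes U :: "complex set" and J :: "real set"
  assumes oU: "open U" and oJ: "open J"
begin

lemma dx_rules:
  assumes z: "z \<in> U" and x: "x \<in> J" and f: "sm U J f" and g: "sm U J g"
  shows dx_add: "dx (\<lambda>z x. f z x + g z x) z x = dx f z x + dx g z x"
    and dx_diff: "dx (\<lambda>z x. f z x - g z x) z x = dx f z x - dx g z x"
    and dx_mult: "dx (\<lambda>z x. f z x * g z x) z x = dx f z x * g z x + f z x * dx g z x"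
    and dx_uminus: "dx (\<lambda>z x. - f z x) z x = - dx f z x"
    and dx_cmult: "dx (\<lambda>z x. c * f z x) z x = c * dx f z x"
proof -
  note f = sm_has_dx[OF f z x] and g = sm_has_dx[OF g z x]
  show "dx (\<lambda>z x. f z x + g z x) z x = dx f z x + dx g z x"
    by (rule dx_eqI[where f = "\<lambda>z x. f z x + g z x"]) (rule has_vector_derivative_add[OF f g])
  show "dx (\<lambda>z x. f z x - g z x) z x = dx f z x - dx g z x"
    by (rule dx_eqI[where f = "\<lambda>z x. f z x - g z x"]) (rule has_vector_derivative_diff[OF f g])
  show "dx (\<lambda>z x. f z x * g z x) z x = dx f z x * g z x + f z x * dx g z x"
    using dx_eqI[where f = "\<lambda>z x. f z x * g z x", OF has_vector_derivative_mult[OF f g]] by simp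
  show "dx (\<lambda>z x. - f z x) z x = - dx f z x"
    by (rule dx_eqI[where f = "\<lambda>z x. - f z x"]) (rule has_vector_derivative_minus[OF f])
  show "dx (\<lambda>z x. c * f z x) z x = c * dx f z x"
    by (rule dx_eqI[where f = "\<lambda>z x. c * f z x"]) (rule has_vector_derivative_mult_right[OF f])
qed

lemma th_rules:
  assumes z: "z \<in> U" and x: "x \<in> J" and f: "sm U J f" and g: "sm U J g"
  shows th_add: "th (\<lambda>z x. f z x + g z x) z x = th f z x + th g z x"
    and th_diff: "th (\<lambda>z x. f z x - g z x) z x = th f z x - th g z x"
    and th_mult: "th (\<lambda>z x. f z x * g z x) z x = th f z x * g z x + f z x * th g z x"
    and th_uminus: "th (\<lambda>z x. - f z x) z x = - th f z x"
    and th_cmult: "th (\<lambda>z x. c * f z x) z x = c * th f z x"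
proof -
  note f = sm_has_dz[OF f oU z x] and g = sm_has_dz[OF g oU z x]
  show "th (\<lambda>z x. f z x + g z x) z x = th f z x + th g z x"
    unfolding th_def dz_eqI[where f = "\<lambda>z x. f z x + g z x", OF DERIV_add[OF f g]] by (simp add: algebra_simps)
  show "th (\<lambda>z x. f z x - g z x) z x = th f z x - th g z x"
    unfolding th_def dz_eqI[where f = "\<lambda>z x. f z x - g z x", OF DERIV_diff[OF f g]] by (simp add: algebra_simps)
  show "th (\<lambda>z x. f z x * g z x) z x = th f z x * g z x + f z x * th g z x"
    unfolding th_def dz_eqI[where f = "\<lambda>z x. f z x * g z x", OF DERIV_mult[OF f g]] by (simp add: algebra_simps)
  show "th (\<lambda>z x. - f z x) z x = - th f z x"
    unfolding th_def dz_eqI[where f = "\<lambda>z x. - f z x", OF DERIV_minus[OF f]] by (simp add: algebra_simps)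
  show "th (\<lambda>z x. c * f z x) z x = c * th f z x"
    unfolding th_def dz_eqI[where f = "\<lambda>z x. c * f z x", OF DERIV_cmult[OF f]] by (simp add: algebra_simps)
qed

lemma sm_th: "sm U J f \<Longrightarrow> sm U J (th f)"
  unfolding th_def by (intro sm_mult oJ sm_z sm_dz oU)

lemma dx_th:
  assumes z: "z \<in> U" and x: "x \<in> J" and f: "sm U J f"
  shows "dx (th f) z x = th (dx f) z x"
proof -
  have "dx (th f) z x = z * dx (dz f) z x"
    unfolding th_def
    by (rule dx_eqI[where f = "\<lambda>z x. z * dz f z x"])
      (rule has_vector_derivative_mult_right[OF sm_has_dx[OF sm_dz(1)[OF oU oJ f] z x]])
  then show ?thesis using sm_dz(2)[OF oU oJ f z x] unfolding th_def by simp
qed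

lemma sm_bracket: "sm U J f \<Longrightarrow> sm U J g \<Longrightarrow> sm U J (bracket f g)"
  unfolding bracket_th[abs_def] by (intro sm_diff sm_mult oJ sm_th sm_dx)

lemma bracket_rules:
  assumes z: "z \<in> U" and x: "x \<in> J" and f: "sm U J f" and g: "sm U J g" and h: "sm U J h"
  shows bracket_add: "bracket (\<lambda>z x. f z x + g z x) h z x = bracket f h z x + bracket g h z x"
    and bracket_diff: "bracket (\<lambda>z x. f z x - g z x) h z x = bracket f h z x - bracket g h z x"
    and bracket_uminus: "bracket (\<lambda>z x. - f z x) h z x = - bracket f h z x"
    and bracket_cmult: "bracket (\<lambda>z x. c * f z x) h z x = c * bracket f h z x"
    and bracket_mult: "bracket (\<lambda>z x. f z x * g z x) h z x = bracket f h z x * g z x + f z x * bracket g h z x"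
  unfolding bracket_th dx_rules[OF z x f g] th_rules[OF z x f g] by (simp_all add: algebra_simps)

lemma bracket_commute: "bracket f g z x = - bracket g f z x"
  unfolding bracket_th by simp

lemma jacobi:
  assumes z: "z \<in> U" and x: "x \<in> J" and f: "sm U J f" and g: "sm U J g" and h: "sm U J h"
  shows "bracket f (bracket g h) z x - bracket g (bracket f h) z x = bracket (bracket f g) h z x"
proof -
  have dxb: "dx (bracket a b) z x = th (dx a) z x * dx b z x + th a z x * dx (dx b) z x
      - th (dx b) z x * dx a z x - th b z x * dx (dx a) z x" if a: "sm U J a" and b: "sm U J b" for a b
  proof -
    have "dx (bracket a b) z x = dx (\<lambda>z x. th a z x * dx b z x) z x - dx (\<lambda>z x. th b z x * dx a z x) z x"
      unfolding bracket_th[abs_def] by (rule dx_diff[OF z x]) (intro sm_mult oJ sm_th sm_dx a b)+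
    then show ?thesis
      unfolding dx_mult[OF z x sm_th[OF a] sm_dx[OF b]] dx_mult[OF z x sm_th[OF b] sm_dx[OF a]]
        dx_th[OF z x a] dx_th[OF z x b] by simp
  qed
  have thb: "th (bracket a b) z x = th (th a) z x * dx b z x + th a z x * th (dx b) z x
      - th (th b) z x * dx a z x - th b z x * th (dx a) z x" if a: "sm U J a" and b: "sm U J b" for a b
  proof -
    have "th (bracket a b) z x = th (\<lambda>z x. th a z x * dx b z x) z x - th (\<lambda>z x. th b z x * dx a z x) z x"
      unfolding bracket_th[abs_def] by (rule th_diff[OF z x]) (intro sm_mult oJ sm_th sm_dx a b)+
    then show ?thesis
      unfolding th_mult[OF z x sm_th[OF a] sm_dx[OF b]] th_mult[OF z x sm_th[OF b] sm_dx[OF a]] by simp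
  qed
  show ?thesis
    unfolding bracket_th[of _ _ z x] dxb[OF f g] dxb[OF g h] dxb[OF f h] thb[OF f g] thb[OF g h] thb[OF f h]
    by (rule jacobi_jets)
qed

end

section \<open>Laurent coefficients\<close>

definition annulus :: "real \<Rightarrow> complex set" where
  "annulus r = {z. inverse r < norm z \<and> norm z < r}"

definition exterior :: "real \<Rightarrow> complex set" where
  "exterior r = {z. inverse r < norm z}"

abbreviation pball :: "real \<Rightarrow> complex set" where
  "pball r \<equiv> ball (0 :: complex) r - {0}"

lemma open_annulus: "open (annulus r)"
  unfolding annulus_def by (intro open_Collect_conj open_Collect_less continuous_intros)

lemma open_exterior: "open (exterior r)"
  unfolding exterior_def by (intro open_Collect_less continuous_intros)

lemma open_pball: "open (pball r)"
  by (simp add: open_Diff)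

lemma annulus_eq: "r > 0 \<Longrightarrow> annulus r = exterior r \<inter> pball r"
  unfolding annulus_def exterior_def by (auto intro: le_less_trans less_trans[of 0 "inverse r"])

lemma circ_subset_annulus: "r > 1 \<Longrightarrow> circ \<subseteq> annulus r"
  unfolding annulus_def by (auto simp: inverse_less_1_iff)

lemma annulus_nz: "r > 0 \<Longrightarrow> z \<in> annulus r \<Longrightarrow> z \<noteq> 0"
  unfolding annulus_def by auto

lemma inverse_annulus: "r > 0 \<Longrightarrow> z \<in> annulus r \<Longrightarrow> inverse z \<in> annulus r"
  unfolding annulus_def
  by (auto simp: norm_inverse intro: inverse_less_imp_less)
    (metis inverse_inverse_eq inverse_less_iff_less inverse_positive_iff_positive less_trans)+

lemma inverse_exterior_iff: "r > 0 \<Longrightarrow> inverse z \<in> exterior r \<longleftrightarrow> z \<in> pball r"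
  using inverse_less_iff_less[of "norm z" r] unfolding exterior_def
  by (cases "z = 0") (auto simp: norm_inverse)

lemma inverse_pball_iff: "r > 0 \<Longrightarrow> inverse z \<in> pball r \<longleftrightarrow> z \<in> exterior r"
  using inverse_exterior_iff[of r "inverse z"] by simp

lemma annulus_mono: "0 < r \<Longrightarrow> r \<le> s \<Longrightarrow> annulus r \<subseteq> annulus s"
  unfolding annulus_def by (auto intro: le_less_trans less_le_trans le_imp_inverse_le)

lemma exterior_mono: "0 < r \<Longrightarrow> r \<le> s \<Longrightarrow> exterior r \<subseteq> exterior s"
  unfolding exterior_def by (auto intro: le_less_trans le_imp_inverse_le)

text \<open>The extra factor 1/z in \<open>coeff\<close> cancels against dz = 2 pi i z dt, leaving a
  Fourier coefficient. Linearity, shifts and inversion are then read off on the unit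
  interval.\<close>

lemma coeff_integral:
  "coeff F k = integral {0..1} (\<lambda>t. F (cis (2 * pi * t)) * cis (2 * pi * t) powi (- k))"
proof -
  have "contour_integral (circlepath 0 1) (\<lambda>z. F z * z powi (- k - 1)) =
      integral {0..1} (\<lambda>t. (2 * pi * \<i>) * (F (cis (2 * pi * t)) * cis (2 * pi * t) powi (- k)))"
    unfolding contour_integral_integral
  proof (rule integral_cong)
    fix t :: real
    have c: "circlepath 0 1 t = cis (2 * pi * t)"
      unfolding circlepath by (simp add: cis_conv_exp mult_ac)
    have "cis (2 * pi * t) powi (- k - 1) * cis (2 * pi * t) = cis (2 * pi * t) powi (- k)"
      by (simp add: power_int_diff)
    moreover have "vector_derivative (circlepath 0 1) (at t) = 2 * pi * \<i> * cis (2 * pi * t)"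
      unfolding vector_derivative_circlepath by (simp add: cis_conv_exp mult_ac)
    ultimately show "F (circlepath 0 1 t) * circlepath 0 1 t powi (- k - 1) * vector_derivative (circlepath 0 1) (at t) =
        (2 * pi * \<i>) * (F (cis (2 * pi * t)) * cis (2 * pi * t) powi (- k))"
      unfolding c by (simp add: mult_ac)
  qed
  then show ?thesis unfolding coeff_def by simp
qed

lemma coeff_cong: "(\<And>z. z \<in> circ \<Longrightarrow> F z = G z) \<Longrightarrow> coeff F k = coeff G k"
  unfolding coeff_integral by (rule integral_cong) simp

lemma proj_cong: "(\<And>z. z \<in> circ \<Longrightarrow> f z x = g z x) \<Longrightarrow> proj A f w x = proj A g w x"
  unfolding proj_def using coeff_cong[of "\<lambda>z. f z x" "\<lambda>z. g z x"] by simp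

lemma coeff_cmult: "coeff (\<lambda>z. c * F z) k = c * coeff F k"
  unfolding coeff_integral by (simp add: mult.assoc)

lemma coeff_add:
  assumes "continuous_on circ F" "continuous_on circ G"
  shows "coeff (\<lambda>z. F z + G z) k = coeff F k + coeff G k"
proof -
  have "(\<lambda>t. H (cis (2 * pi * t)) * cis (2 * pi * t) powi (- k)) integrable_on {0..1}"
    if "continuous_on circ H" for H :: "complex \<Rightarrow> complex"
    by (intro integrable_continuous_interval continuous_intros continuous_on_compose2[OF that]) auto
  from integral_add[OF this[OF assms(1)] this[OF assms(2)]] show ?thesis
    unfolding coeff_integral by (simp add: distrib_right)
qed

lemma coeff_shift: "coeff (\<lambda>z. z powi m * F z) k = coeff F (k - m)"
proof -
  have "cis t powi m * cis t powi (- k) = cis t powi (- (k - m))" for t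
    using power_int_add[of "cis t" m "- k"] by (simp add: algebra_simps)
  then show ?thesis
    unfolding coeff_integral by (intro integral_cong) (simp add: mult_ac)
qed

text \<open>On the circle inversion replaces the angle parameter \<open>t\<close> by
  \<open>1 - t\<close>, so the claim is a reflection of the interval of integration.\<close>

lemma coeff_inverse: "coeff (\<lambda>z. F (inverse z)) k = coeff F (- k)"
proof -
  define h where "h t = F (cis (2 * pi * t)) * cis (2 * pi * t) powi k" for t
  have "F (inverse (cis (2 * pi * t))) * cis (2 * pi * t) powi (- k) = h (1 - t)" for t
  proof -
    have "cis (2 * pi * (1 - t)) = inverse (cis (2 * pi * t))"
      by (simp add: complex_eq_iff right_diff_distrib cos_diff sin_diff)
    then show ?thesis unfolding h_def by (simp add: power_int_minus power_int_inverse del: cis_inverse)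
  qed
  then have "coeff (\<lambda>z. F (inverse z)) k = integral {0..1} (\<lambda>t. h (1 - t))"
    unfolding coeff_integral by simp
  also have "\<dots> = integral {-1..0} (\<lambda>t. h (t + 1))"
    using Henstock_Kurzweil_Integration.integral_reflect_real[where a = "-1" and b = 0 and f = "\<lambda>t. h (t + 1)"] by (simp add: add.commute)
  also have "\<dots> = integral {0..1} h"
    using integral_shift_Icc_real[of "-1" 0 h 1] by (simp add: o_def add.commute)
  finally show ?thesis unfolding coeff_integral h_def by simp
qed

lemma coeff_holomorphic:
  assumes F: "F holomorphic_on ball 0 r" and r: "r > 1"
  shows "coeff F k = (if k \<ge> 0 then (deriv ^^ nat k) F 0 / fact (nat k) else 0)"
proof (cases "k \<ge> 0")
  case True
  have F1: "F holomorphic_on cball 0 1" using F by (rule holomorphic_on_subset) (use r in auto)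
  have c: "((\<lambda>u. F u / (u - 0) ^ Suc (nat k)) has_contour_integral
      (2 * pi * \<i>) / fact (nat k) * (deriv ^^ nat k) F 0) (circlepath 0 1)"
    using F1 by (intro Cauchy_has_contour_integral_higher_derivative_circlepath
        holomorphic_on_imp_continuous_on) (auto intro: holomorphic_on_subset)
  have h: "u powi (- k - 1) = inverse (u ^ Suc (nat k))" if "u \<noteq> 0" for u :: complex
  proof -
    have "u powi (- k - 1) = inverse (u powi (k + 1))"
      by (simp add: power_int_minus[symmetric])
    also have "u powi (k + 1) = u ^ nat (k + 1)" using True by (simp add: power_int_def)
    also have "nat (k + 1) = Suc (nat k)" using True by simp
    finally show ?thesis .
  qed
  have "contour_integral (circlepath 0 1) (\<lambda>z. F z * z powi (- k - 1)) =
      contour_integral (circlepath 0 1) (\<lambda>u. F u / (u - 0) ^ Suc (nat k))"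
  proof (rule contour_integral_cong[OF refl])
    fix z assume "z \<in> path_image (circlepath 0 1)"
    then have "z \<noteq> 0" by auto
    from h[OF this] show "F z * z powi (- k - 1) = F z / (z - 0) ^ Suc (nat k)"
      by (simp only: divide_inverse diff_zero)
  qed
  then have "contour_integral (circlepath 0 1) (\<lambda>z. F z * z powi (- k - 1)) =
      (2 * pi * \<i>) / fact (nat k) * (deriv ^^ nat k) F 0"
    by (simp only: contour_integral_unique[OF c])
  then show ?thesis using True unfolding coeff_def by simp
next
  case False
  have "(\<lambda>z. F z * z powi (- k - 1)) holomorphic_on ball 0 r"
    using False F by (auto intro!: holomorphic_intros simp: power_int_def)
  then have "((\<lambda>z. F z * z powi (- k - 1)) has_contour_integral 0) (circlepath 0 1)"
    by (rule Cauchy_theorem_disc_simple) (use r in auto)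
  then show ?thesis using False unfolding coeff_def by (simp add: contour_integral_unique)
qed

lemma has_sum_holomorphic:
  assumes F: "F holomorphic_on ball 0 r" and r: "r > 1" and z: "z \<in> ball 0 r"
  shows "((\<lambda>k. coeff F k * z powi k) has_sum F z) {0..}"
proof -
  define a where "a n = (deriv ^^ n) F 0 / fact n" for n
  have s: "(\<lambda>n. a n * w ^ n) sums F w" if "w \<in> ball 0 r" for w
    using holomorphic_power_series[OF F that] unfolding a_def by simp
  \<comment> \<open>Convergence at a radius beyond the modulus of \<open>z\<close> makes the power
    series absolutely convergent at \<open>z\<close>, as \<open>has_sum\<close> requires.\<close>
  obtain \<rho> where \<rho>: "norm z < \<rho>" "\<rho> < r" using z dense by auto
  have "summable (\<lambda>n. a n * of_real \<rho> ^ n)"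
    by (rule sums_summable[OF s]) (use \<rho> le_less_trans[OF norm_ge_zero \<rho>(1)] in auto)
  then have "summable (\<lambda>n. norm (a n * z ^ n))"
    by (rule powser_insidea) (use \<rho> in auto)
  then have "((\<lambda>n. a n * z ^ n) has_sum F z) UNIV"
    by (rule norm_summable_imp_has_sum[OF _ s[OF z]])
  moreover have "bij_betw int UNIV {0..}"
    by (rule bij_betwI[where g = nat]) auto
  ultimately show ?thesis
    using has_sum_reindex_bij_betw[of int UNIV "{0..}" "\<lambda>k. coeff F k * z powi k" "F z"]
    by (simp add: coeff_holomorphic[OF F r] a_def)
qed

text \<open>The second summand of \<open>F\<close> has only negative exponents, so the coefficients
  of \<open>F\<close> with exponent at least 0 are the Taylor coefficients of
  \<open>C\<close>.\<close>

lemma laurent_has_sum: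
  assumes C: "C holomorphic_on ball 0 r" and N: "N holomorphic_on ball 0 r" and r: "r > 1"
    and F: "\<And>z. z \<in> circ \<Longrightarrow> F z = C z + inverse z * N (inverse z)" and z: "z \<in> ball 0 r"
  shows "((\<lambda>k. coeff F k * z powi k) has_sum C z) {0..}"
proof -
  have "coeff F k = coeff C k" if "k \<ge> 0" for k
  proof -
    define G where "G u = u * N u" for u
    have G: "G holomorphic_on ball 0 r" unfolding G_def by (intro holomorphic_intros N)
    have "coeff (\<lambda>z. G (inverse z)) k = 0"
      unfolding coeff_inverse coeff_holomorphic[OF G r] using that by (auto simp: G_def)
    moreover have "coeff F k = coeff (\<lambda>z. C z + G (inverse z)) k"
      by (rule coeff_cong) (simp add: F G_def)
    moreover have "coeff (\<lambda>z. C z + G (inverse z)) k = coeff C k + coeff (\<lambda>z. G (inverse z)) k"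
    proof (rule coeff_add)
      show "continuous_on circ C"
        using C r by (intro continuous_on_subset[OF holomorphic_on_imp_continuous_on]) auto
      show "continuous_on circ (\<lambda>z. G (inverse z))"
        by (rule continuous_on_compose2[OF holomorphic_on_imp_continuous_on[OF G]])
          (use r in \<open>auto intro!: continuous_intros simp: norm_inverse\<close>)
    qed
    ultimately show ?thesis by simp
  qed
  then show ?thesis
    using has_sum_holomorphic[OF C r z]
    by (subst has_sum_cong[where g = "\<lambda>k. coeff C k * z powi k"]) auto
qed

lemma homotopic_loops_circlepath:
  assumes "0 < s" "0 < t" "\<And>w. min s t \<le> norm w \<Longrightarrow> norm w \<le> max s t \<Longrightarrow> w \<in> A"
  shows "homotopic_loops A (circlepath 0 s) (circlepath 0 t)"
proof (rule homotopic_loops_linear)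
  fix u :: real assume "u \<in> {0..1}"
  define e where "e = exp (2 * of_real pi * \<i> * of_real u)"
  have e: "norm e = 1" unfolding e_def by (simp add: norm_exp)
  have c: "circlepath 0 q u = of_real q * e" for q
    unfolding circlepath e_def by simp
  show "closed_segment (circlepath 0 s u) (circlepath 0 t u) \<subseteq> A"
  proof
    fix w assume "w \<in> closed_segment (circlepath 0 s u) (circlepath 0 t u)"
    then obtain v where v: "0 \<le> v" "v \<le> 1" "w = (1 - v) *\<^sub>R (of_real s * e) + v *\<^sub>R (of_real t * e)"
      unfolding c closed_segment_def by blast
    then have "w = of_real ((1 - v) * s + v * t) * e"
      by (simp add: scaleR_conv_of_real algebra_simps)
    then have "norm w = (1 - v) * s + v * t"
      using v assms by (simp add: norm_mult e abs_of_nonneg del: of_real_add of_real_mult of_real_diff)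
    moreover have "min s t \<le> (1 - v) * s + v * t"
    proof -
      have "(1 - v) * min s t + v * min s t \<le> (1 - v) * s + v * t"
        using v by (intro add_mono mult_left_mono) auto
      then show ?thesis by (simp add: algebra_simps)
    qed
    moreover have "(1 - v) * s + v * t \<le> max s t"
      using convex_bound_le[of s "max s t" t "1 - v" v] v by simp
    ultimately show "w \<in> A" by (intro assms) auto
  qed
qed auto

text \<open>The difference quotient of \<open>F\<close> at \<open>z\<close> has a removable
  singularity, so its integrals over the outer and the inner circle agree. The pole 1/(w - z)
  integrates to 2 pi i over the outer circle and to 0 over the inner one.\<close>

lemma laurent_split:
  assumes F: "F holomorphic_on annulus r" and \<rho>: "1 < \<rho>" "\<rho> < r" and z: "z \<in> annulus \<rho>"
  shows "2 * pi * \<i> * F z = contour_integral (circlepath 0 \<rho>) (\<lambda>w. F w / (w - z)) +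
    inverse z * contour_integral (circlepath 0 (inverse \<rho>)) (\<lambda>w. F w / (1 - inverse z * w))"
proof -
  define g where "g w = (if w = z then deriv F z else (F w - F z) / (w - z))" for w
  have zr: "z \<in> annulus r" using z annulus_mono[of \<rho> r] \<rho> by auto
  have z0: "z \<noteq> 0" using annulus_nz[OF _ zr] \<rho> by simp
  have g: "g holomorphic_on annulus r"
    unfolding g_def by (rule pole_lemma[OF F]) (simp add: interior_open open_annulus zr)
  have i\<rho>: "0 < inverse \<rho>" "inverse \<rho> < 1" "inverse r < inverse \<rho>" "inverse r < \<rho>"
    using \<rho> less_trans[of "inverse r" 1 \<rho>] by (auto simp: inverse_less_1_iff)
  have S: "sphere 0 \<rho> \<subseteq> annulus r" "sphere 0 (inverse \<rho>) \<subseteq> annulus r"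
    unfolding annulus_def using \<rho> i\<rho> by auto
  have ne: "w \<noteq> z" if "norm w = \<rho> \<or> norm w = inverse \<rho>" for w
    using that z unfolding annulus_def by auto
  have eq: "contour_integral (circlepath 0 \<rho>) g = contour_integral (circlepath 0 (inverse \<rho>)) g"
    by (rule Cauchy_theorem_homotopic_loops[OF homotopic_loops_circlepath open_annulus g])
      (use \<rho> i\<rho>(1,2) less_le_trans[OF i\<rho>(3)] in \<open>auto simp: annulus_def\<close>)
  have int: "(\<lambda>w. h w / (w - z)) contour_integrable_on circlepath 0 q"
    if "q = \<rho> \<or> q = inverse \<rho>" "continuous_on (sphere 0 q) h" for q and h :: "complex \<Rightarrow> complex"
    using that \<rho> i\<rho> ne
    by (intro contour_integrable_continuous_circlepath) (auto intro!: continuous_intros)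
  have split: "contour_integral (circlepath 0 q) g = contour_integral (circlepath 0 q) (\<lambda>w. F w / (w - z))
      - F z * contour_integral (circlepath 0 q) (\<lambda>w. 1 / (w - z))" if q: "q = \<rho> \<or> q = inverse \<rho>" for q
  proof -
    have q0: "q > 0" using q \<rho> i\<rho> by auto
    have cF: "continuous_on (sphere 0 q) F"
      using S q by (intro continuous_on_subset[OF holomorphic_on_imp_continuous_on[OF F]]) auto
    have "contour_integral (circlepath 0 q) g =
        contour_integral (circlepath 0 q) (\<lambda>w. F w / (w - z) - F z * (1 / (w - z)))"
      by (rule contour_integral_cong) (use q q0 ne in \<open>auto simp: g_def diff_divide_distrib\<close>)
    also have "\<dots> = contour_integral (circlepath 0 q) (\<lambda>w. F w / (w - z))
      - contour_integral (circlepath 0 q) (\<lambda>w. F z * (1 / (w - z)))"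
      by (rule contour_integral_diff[OF int[OF q cF] contour_integrable_lmul[OF int[OF q]]]) auto
    also have "contour_integral (circlepath 0 q) (\<lambda>w. F z * (1 / (w - z))) =
        F z * contour_integral (circlepath 0 q) (\<lambda>w. 1 / (w - z))"
      by (rule contour_integral_lmul[OF int[OF q]]) auto
    finally show ?thesis .
  qed
  have 1: "contour_integral (circlepath 0 \<rho>) (\<lambda>w. 1 / (w - z)) = 2 * pi * \<i>"
    using Cauchy_integral_circlepath_simple[of "\<lambda>_. 1" 0 \<rho> z] z unfolding annulus_def
    by (auto intro!: contour_integral_unique)
  have 2: "contour_integral (circlepath 0 (inverse \<rho>)) (\<lambda>w. 1 / (w - z)) = 0"
  proof (rule contour_integral_unique, rule Cauchy_theorem_disc_simple)
    show "(\<lambda>w. 1 / (w - z)) holomorphic_on ball 0 (norm z)" by (auto intro!: holomorphic_intros)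
  qed (use z i\<rho> in \<open>auto simp: annulus_def\<close>)
  \<comment> \<open>Pulling out -1/z turns the inner Cauchy kernel into one that is regular in
    \<open>inverse z\<close>, so that this term visibly vanishes at infinity.\<close>
  have 3: "contour_integral (circlepath 0 (inverse \<rho>)) (\<lambda>w. F w / (w - z)) =
      - inverse z * contour_integral (circlepath 0 (inverse \<rho>)) (\<lambda>w. F w / (1 - inverse z * w))"
  proof -
    have h: "F w / (w - z) = (- inverse z) * (F w / (1 - inverse z * w))" if "norm w = inverse \<rho>" for w
      using z0 ne[of w] that by (simp add: field_simps)
    have "contour_integral (circlepath 0 (inverse \<rho>)) (\<lambda>w. F w / (w - z)) =
      contour_integral (circlepath 0 (inverse \<rho>)) (\<lambda>w. (- inverse z) * (F w / (1 - inverse z * w)))"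
      by (rule contour_integral_cong) (use h i\<rho> in auto)
    also have "\<dots> = - inverse z * contour_integral (circlepath 0 (inverse \<rho>)) (\<lambda>w. F w / (1 - inverse z * w))"
    proof (rule contour_integral_lmul, rule contour_integrable_continuous_circlepath)
      have "1 - inverse z * w \<noteq> 0" if "norm w = inverse \<rho>" for w
        using z0 ne[of w] that by (simp add: field_simps)
      then show "continuous_on (path_image (circlepath 0 (inverse \<rho>))) (\<lambda>w. F w / (1 - inverse z * w))"
        using S(2) i\<rho>
        by (intro continuous_intros continuous_on_subset[OF holomorphic_on_imp_continuous_on[OF F]]) auto
    qed
    finally show ?thesis .
  qed
  show ?thesis using split[of \<rho>] split[of "inverse \<rho>"] eq 1 2 3 by (simp add: algebra_simps)
qed

section \<open>Projections\<close>

lemma proj_eqI: "((\<lambda>k. coeff (\<lambda>z. f z x) k * z powi k) has_sum s) A \<Longrightarrow> proj A f z x = s"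
  unfolding proj_def by (rule infsumI)

text \<open>\<open>C\<close> is a Cauchy integral over the circle of radius \<rho> and
  \<open>N\<close> one over the circle of radius 1/\<rho>, taken in the variable
  \<open>inverse z\<close>. The contours do not move with \<open>z\<close> or \<open>x\<close>, so
  both are smooth families, and uniqueness of power series identifies them with the sums that define
  \<open>proj\<close>. The last fact makes the negative part accessible after a reflection.\<close>

lemma proj_cauchy:
  assumes J: "open J" and f: "sm (annulus r) J f" and \<rho>: "1 < \<rho>" "\<rho> < r"
  obtains C N where "sm (ball 0 \<rho>) J C" "sm (ball 0 \<rho>) J N"
    "\<And>z x. z \<in> ball 0 \<rho> \<Longrightarrow> x \<in> J \<Longrightarrow>
      ((\<lambda>k. coeff (\<lambda>z. f z x) k * z powi k) has_sum C z x) {0..}"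
    "\<And>z x. z \<in> ball 0 \<rho> \<Longrightarrow> x \<in> J \<Longrightarrow>
      ((\<lambda>k. coeff (\<lambda>z. dx f z x) k * z powi k) has_sum dx C z x) {0..}"
    "\<And>z x. z \<in> annulus \<rho> \<Longrightarrow> x \<in> J \<Longrightarrow> f z x = C z x + inverse z * N (inverse z) x"
    "\<And>z x. z \<in> ball 0 \<rho> \<Longrightarrow> x \<in> J \<Longrightarrow>
      ((\<lambda>k. coeff (\<lambda>z. inverse z * f (inverse z) x) k * z powi k) has_sum N z x) {0..}"
proof -
  have i\<rho>: "0 < inverse \<rho>" "inverse \<rho> < 1" "inverse r < inverse \<rho>" "inverse r < \<rho>"
    using \<rho> less_trans[of "inverse r" 1 \<rho>] by (auto simp: inverse_less_1_iff)
  define \<gamma> where "\<gamma> q = circlepath 0 q" for q :: real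
  define c where "c q t = complex_of_real q * exp (2 * of_real pi * \<i> * of_real t)" for q t :: real
  have vd: "vector_derivative (\<gamma> q) (at t) = 2 * pi * \<i> * c q t" for q t
    unfolding \<gamma>_def c_def vector_derivative_circlepath by simp
  have \<gamma>c: "continuous_on {0..1} (\<gamma> q)" for q unfolding \<gamma>_def circlepath by (intro continuous_intros)
  have cc: "continuous_on S (\<lambda>p. c q (h p))" if "continuous_on S h" for q S and h :: "'b :: topological_space \<Rightarrow> real"
    unfolding c_def by (intro continuous_intros that)
  have im: "\<gamma> q ` {0..1} = sphere 0 \<bar>q\<bar>" for q
    using path_image_circlepath[of 0 q] unfolding \<gamma>_def path_image_def by simp
  have n\<gamma>: "norm (\<gamma> q t) = \<bar>q\<bar>" for q t
    unfolding \<gamma>_def circlepath by (simp add: norm_mult norm_exp)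
  \<comment> \<open>As \<open>c q t\<close> is the velocity of the circle divided by 2 pi i,
    \<open>k\<close> and \<open>l\<close> are the outer and the inner Cauchy kernel including that
    constant, and \<open>k'\<close> and \<open>l'\<close> are their derivatives in
    \<open>z\<close>.\<close>
  define k where "k t z = c \<rho> t / (\<gamma> \<rho> t - z)" for t z
  define k' where "k' t z = c \<rho> t / (\<gamma> \<rho> t - z)\<^sup>2" for t z
  define l where "l t z = c (inverse \<rho>) t / (1 - z * \<gamma> (inverse \<rho>) t)" for t z
  define l' where "l' t z = c (inverse \<rho>) t * \<gamma> (inverse \<rho>) t / (1 - z * \<gamma> (inverse \<rho>) t)\<^sup>2" for t z
  have nek: "\<gamma> \<rho> t - z \<noteq> 0" if "t \<in> {0..1}" "z \<in> ball 0 \<rho>" for t z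
    using n\<gamma>[of \<rho> t] that \<rho> by auto
  have nel: "1 - z * \<gamma> (inverse \<rho>) t \<noteq> 0" if "t \<in> {0..1}" "z \<in> ball 0 \<rho>" for t z
  proof
    assume "1 - z * \<gamma> (inverse \<rho>) t = 0"
    then have "norm z * norm (\<gamma> (inverse \<rho>) t) = 1" by (metis eq_iff_diff_eq_0 norm_mult norm_one)
    moreover have "norm (\<gamma> (inverse \<rho>) t) = inverse \<rho>" using n\<gamma> i\<rho> by simp
    ultimately have "norm z * inverse \<rho> = 1" by simp
    then show False using that \<rho> by (simp add: field_simps)
  qed
  have ck: "continuous_on ({0..1} \<times> ball 0 \<rho>) (\<lambda>p. k (fst p) (snd p))"
      "continuous_on ({0..1} \<times> ball 0 \<rho>) (\<lambda>p. k' (fst p) (snd p))"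
    unfolding k_def k'_def using nek
    by (auto intro!: continuous_intros continuous_on_compose2[OF \<gamma>c] cc)
  have cl: "continuous_on ({0..1} \<times> ball 0 \<rho>) (\<lambda>p. l (fst p) (snd p))"
      "continuous_on ({0..1} \<times> ball 0 \<rho>) (\<lambda>p. l' (fst p) (snd p))"
    unfolding l_def l'_def using nel
    by (auto intro!: continuous_intros continuous_on_compose2[OF \<gamma>c] cc)
  have kd: "(k t has_field_derivative k' t z) (at z)" if "t \<in> {0..1}" "z \<in> ball 0 \<rho>" for t z
    unfolding k_def k'_def using nek[OF that]
    by (auto intro!: derivative_eq_intros simp: power2_eq_square)
  have ld: "(l t has_field_derivative l' t z) (at z)" if "t \<in> {0..1}" "z \<in> ball 0 \<rho>" for t z
    unfolding l_def l'_def using nel[OF that]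
    by (auto intro!: derivative_eq_intros simp: power2_eq_square)
  have im1: "\<gamma> \<rho> ` {0..1} \<subseteq> annulus r" "\<gamma> (inverse \<rho>) ` {0..1} \<subseteq> annulus r"
    unfolding im annulus_def using \<rho> i\<rho> by auto
  define C where "C f = (\<lambda>z x. integral {0..1} (\<lambda>t. f (\<gamma> \<rho> t) x * k t z))" for f :: fld
  define N where "N f = (\<lambda>z x. integral {0..1} (\<lambda>t. f (\<gamma> (inverse \<rho>) t) x * l t z))" for f :: fld
  have Cs: "sm (ball 0 \<rho>) J (C f)" "\<And>z x. z \<in> ball 0 \<rho> \<Longrightarrow> x \<in> J \<Longrightarrow> dx (C f) z x = C (dx f) z x"
    if f: "sm (annulus r) J f" for f
    unfolding C_def
    using sm_param_integral[where \<gamma> = "\<gamma> \<rho>" and k = k and k' = k', OF open_ball J f \<gamma>c im1(1) ck kd] by auto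
  have Ns: "sm (ball 0 \<rho>) J (N f)" if f: "sm (annulus r) J f" for f
    unfolding N_def
    by (rule sm_param_integral[where \<gamma> = "\<gamma> (inverse \<rho>)" and k = l and k' = l', OF open_ball J f \<gamma>c im1(2) cl ld])
  have split: "f z x = C f z x + inverse z * N f (inverse z) x"
    if f: "sm (annulus r) J f" and z: "z \<in> annulus \<rho>" and x: "x \<in> J" for f z x
  proof -
    have "contour_integral (circlepath 0 \<rho>) (\<lambda>w. f w x / (w - z)) = 2 * pi * \<i> * C f z x"
      unfolding contour_integral_integral C_def k_def \<gamma>_def[symmetric]
      by (simp add: vd integral_mult_right[symmetric] mult_ac del: integral_mult_right)
    moreover have "contour_integral (circlepath 0 (inverse \<rho>)) (\<lambda>w. f w x / (1 - inverse z * w)) =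
        2 * pi * \<i> * N f (inverse z) x"
      unfolding contour_integral_integral N_def l_def \<gamma>_def[symmetric]
      by (simp add: vd integral_mult_right[symmetric] mult_ac del: integral_mult_right)
    ultimately have "2 * pi * \<i> * f z x = 2 * pi * \<i> * (C f z x + inverse z * N f (inverse z) x)"
      using laurent_split[OF sm_hol[OF f x] \<rho> z] by (simp add: algebra_simps)
    then show ?thesis by simp
  qed
  have hs: "((\<lambda>k. coeff (\<lambda>z. f z x) k * z powi k) has_sum C f z x) {0..}"
    if f: "sm (annulus r) J f" and z: "z \<in> ball 0 \<rho>" and x: "x \<in> J" for f z x
    using sm_hol[OF Cs(1)[OF f] x] sm_hol[OF Ns[OF f] x] \<rho>(1) _ z
  proof (rule laurent_has_sum)
    show "f z x = C f z x + inverse z * N f (inverse z) x" if "z \<in> circ" for z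
      by (rule split[OF f _ x]) (use that circ_subset_annulus[OF \<rho>(1)] in blast)
  qed
  have hs': "((\<lambda>k. coeff (\<lambda>z. inverse z * f (inverse z) x) k * z powi k) has_sum N f z x) {0..}"
    if z: "z \<in> ball 0 \<rho>" and x: "x \<in> J" for z x
    using sm_hol[OF Ns[OF f] x] sm_hol[OF Cs(1)[OF f] x] \<rho>(1) _ z
  proof (rule laurent_has_sum)
    fix w assume w: "w \<in> circ"
    then have "inverse w \<in> annulus \<rho>" "w \<noteq> 0"
      using circ_subset_annulus[OF \<rho>(1)] by (auto simp: norm_inverse)
    then show "inverse w * f (inverse w) x = N f w x + inverse w * C f (inverse w) x"
      using split[OF f _ x, of "inverse w"] by (simp add: algebra_simps)
  qed
  show ?thesis
  proof (rule that[of "C f" "N f"])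
    show "((\<lambda>k. coeff (\<lambda>z. dx f z x) k * z powi k) has_sum dx (C f) z x) {0..}"
      if "z \<in> ball 0 \<rho>" "x \<in> J" for z x
      using hs[OF sm_dx[OF f] that] Cs(2)[OF f that] by simp
  qed (use Cs(1)[OF f] Ns[OF f] hs[OF f] split[OF f] hs' in auto)
qed

context
  fixes r :: real and J :: "real set"
  assumes r: "r > 1" and J: "open J"
begin

interpretation B: domain_pair "ball 0 r" J by unfold_locales (use J in auto)
interpretation PB: domain_pair "pball r" J by unfold_locales (use J open_pball in auto)

text \<open>A point of the ball lies in a ball of some radius \<rho> between 1 and \<open>r\<close>,
  where the Cauchy integral of \<open>proj_cauchy\<close> represents the projection; the radii
  exhaust the ball and \<open>sm_local\<close> glues.\<close>

lemma proj_nonneg: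
  assumes f: "sm (annulus r) J f"
  shows "sm (ball 0 r) J (proj {0..} f)"
    and "\<And>z x. z \<in> ball 0 r \<Longrightarrow> x \<in> J \<Longrightarrow> dx (proj {0..} f) z x = proj {0..} (dx f) z x"
    and "\<And>z x. z \<in> ball 0 r \<Longrightarrow> x \<in> J \<Longrightarrow>
      ((\<lambda>k. coeff (\<lambda>z. f z x) k * z powi k) has_sum proj {0..} f z x) {0..}"
proof -
  have l: "\<exists>V. open V \<and> a \<in> V \<and> sm V J (proj {0..} f) \<and> (\<forall>z\<in>V. \<forall>x\<in>J.
      dx (proj {0..} f) z x = proj {0..} (dx f) z x \<and>
      ((\<lambda>k. coeff (\<lambda>z. f z x) k * z powi k) has_sum proj {0..} f z x) {0..})" if "a \<in> ball 0 r" for a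
  proof -
    have "max 1 (norm a) < r" using that r by simp
    then obtain \<rho> where \<rho>: "max 1 (norm a) < \<rho>" "\<rho> < r" using dense by blast
    have \<rho>1: "1 < \<rho>" using \<rho> by simp
    obtain C N where C: "sm (ball 0 \<rho>) J C"
      "\<And>z x. z \<in> ball 0 \<rho> \<Longrightarrow> x \<in> J \<Longrightarrow>
        ((\<lambda>k. coeff (\<lambda>z. f z x) k * z powi k) has_sum C z x) {0..}"
      "\<And>z x. z \<in> ball 0 \<rho> \<Longrightarrow> x \<in> J \<Longrightarrow>
        ((\<lambda>k. coeff (\<lambda>z. dx f z x) k * z powi k) has_sum dx C z x) {0..}"
      by (rule proj_cauchy[OF J f \<rho>1 \<rho>(2)], rule that; blast)
    have e: "C z x = proj {0..} f z x" if "z \<in> ball 0 \<rho>" "x \<in> J" for z x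
      using proj_eqI[where f = f, OF C(2)[OF that]] by simp
    have "sm (ball 0 \<rho>) J (proj {0..} f)"
      by (rule sm_cong[OF J e C(1)])
    moreover have "dx (proj {0..} f) z x = proj {0..} (dx f) z x" if "z \<in> ball 0 \<rho>" "x \<in> J" for z x
    proof -
      have "dx (proj {0..} f) z x = dx C z x"
        by (rule dx_cong[OF J that(2)]) (rule e[OF that(1), symmetric])
      then show ?thesis using proj_eqI[where f = "dx f", OF C(3)[OF that]] by simp
    qed
    ultimately show ?thesis
      using C(2) e \<rho> by (intro exI[of _ "ball 0 \<rho>"]) auto
  qed
  show "sm (ball 0 r) J (proj {0..} f)"
    by (rule sm_local[OF open_ball J]) (use l in blast)
  show "dx (proj {0..} f) z x = proj {0..} (dx f) z x" if "z \<in> ball 0 r" "x \<in> J" for z x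
    using l that by blast
  show "((\<lambda>k. coeff (\<lambda>z. f z x) k * z powi k) has_sum proj {0..} f z x) {0..}"
    if "z \<in> ball 0 r" "x \<in> J" for z x
    using l that by blast
qed

text \<open>Since \<open>0 powi 0 = 1\<close> and the positive powers of 0 vanish, only the constant
  term survives. Thus residues are values of a smooth family and can be differentiated in
  \<open>x\<close>.\<close>

lemma proj_at_0: "proj {0..} f 0 x = coeff (\<lambda>z. f z x) 0"
proof (rule proj_eqI)
  have "((\<lambda>k. coeff (\<lambda>z. f z x) k * 0 powi k) has_sum coeff (\<lambda>z. f z x) 0) {0}"
    using has_sum_finite[of "{0 :: int}" "\<lambda>k. coeff (\<lambda>z. f z x) k * 0 powi k"] by simp
  then show "((\<lambda>k. coeff (\<lambda>z. f z x) k * 0 powi k) has_sum coeff (\<lambda>z. f z x) 0) {0..}"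
    by (rule has_sum_cong_neutral[THEN iffD1, rotated -1]) auto
qed

text \<open>Multiplication by a power of \<open>z\<close> translates exponents. Together with the
  reflection of \<open>z\<close> to its inverse this reduces every half line of exponents to
  \<open>{0..}\<close>.\<close>

lemma proj_shift:
  assumes "z \<noteq> 0"
  shows "proj ((\<lambda>k. k + m) ` A) f z x = z powi m * proj A (\<lambda>z x. z powi (- m) * f z x) z x"
proof -
  have "proj ((\<lambda>k. k + m) ` A) f z x = infsum (\<lambda>k. z powi m * (coeff (\<lambda>z. z powi (- m) * f z x) k * z powi k)) A"
    unfolding proj_def coeff_shift
    by (subst infsum_reindex) (use assms in \<open>auto simp: inj_on_def o_def power_int_add mult_ac\<close>)
  then show ?thesis unfolding proj_def by (simp add: infsum_cmult_right')
qed

lemma proj_shift_ge: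
  assumes "z \<noteq> 0"
  shows "proj {m..} f z x = z powi m * proj {0..} (\<lambda>z x. z powi (- m) * f z x) z x"
proof -
  have "(\<lambda>k. k + m) ` {0..} = {m..}"
    by (force intro: rev_image_eqI[of "_ - m"])
  then show ?thesis using proj_shift[OF assms, of m "{0..}"] by simp
qed

lemma proj_reflect:
  "proj {..m} f z x = proj {- m..} (\<lambda>z x. f (inverse z) x) (inverse z) x"
  unfolding proj_def coeff_inverse[of "\<lambda>w. f w x"]
  by (rule infsum_reindex_bij_witness[where i = uminus and j = uminus])
    (auto simp: power_int_inverse power_int_minus)

text \<open>For \<open>m = 0\<close> this is the splitting of \<open>proj_cauchy\<close>, with the
  negative part identified by reflection; a shift of exponents gives the other cuts.\<close>

lemma laurent:
  assumes f: "sm (annulus r) J f" and z: "z \<in> annulus r" and x: "x \<in> J"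
  shows "proj {m..} f z x + proj {..<m} f z x = f z x"
proof -
  have 0: "proj {0..} f z x + proj {..<0} f z x = f z x" if f: "sm (annulus r) J f" for f
  proof -
    have "max (norm z) (inverse (norm z)) < r"
      using z annulus_nz[OF _ z] r inverse_less_iff_less[of "norm z" "inverse r"] unfolding annulus_def
      by auto
    then have "max 1 (max (norm z) (inverse (norm z))) < r" using r by simp
    then obtain \<rho> where \<rho>: "max 1 (max (norm z) (inverse (norm z))) < \<rho>" "\<rho> < r"
      using dense by blast
    have z0: "z \<noteq> 0" using annulus_nz[OF _ z] r by simp
    have zi: "z \<in> annulus \<rho>" "inverse z \<in> ball 0 \<rho>" "z \<in> ball 0 \<rho>"
      using \<rho> z0 less_imp_inverse_less[of "inverse (norm z)" \<rho>]
      unfolding annulus_def by (auto simp: norm_inverse)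
    have \<rho>1: "1 < \<rho>" using \<rho> by simp
    obtain C N where C:
      "\<And>z x. z \<in> ball 0 \<rho> \<Longrightarrow> x \<in> J \<Longrightarrow>
        ((\<lambda>k. coeff (\<lambda>z. f z x) k * z powi k) has_sum C z x) {0..}"
      "\<And>z x. z \<in> annulus \<rho> \<Longrightarrow> x \<in> J \<Longrightarrow> f z x = C z x + inverse z * N (inverse z) x"
      "\<And>z x. z \<in> ball 0 \<rho> \<Longrightarrow> x \<in> J \<Longrightarrow>
        ((\<lambda>k. coeff (\<lambda>z. inverse z * f (inverse z) x) k * z powi k) has_sum N z x) {0..}"
      by (rule proj_cauchy[OF J f \<rho>1 \<rho>(2)], rule that; blast)
    have "{..<0} = {..(-1 :: int)}" by auto
    then have "proj {..<0} f z x = proj {1..} (\<lambda>z x. f (inverse z) x) (inverse z) x"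
      using proj_reflect[of "-1" f z x] by simp
    also have "\<dots> = inverse z * proj {0..} (\<lambda>z x. inverse z * f (inverse z) x) (inverse z) x"
      using proj_shift_ge[of "inverse z" 1] z0 by (simp add: power_int_minus)
    also have "\<dots> = inverse z * N (inverse z) x"
      using proj_eqI[where f = "\<lambda>z x. inverse z * f (inverse z) x", OF C(3)[OF zi(2) x]] by simp
    finally show ?thesis
      using C(2)[OF zi(1) x] proj_eqI[where f = f, OF C(1)[OF zi(3) x]] by simp
  qed
  have z0: "z \<noteq> 0" using annulus_nz[OF _ z] r by simp
  have "sm (annulus r) J (\<lambda>z x. z powi (- m) * f z x)"
    using annulus_nz[of r] r by (intro sm_mult J f sm_powi sm_z) auto
  from 0[OF this] have "z powi m * (z powi (- m) * f z x) =
      z powi m * proj {0..} (\<lambda>z x. z powi (- m) * f z x) z x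
      + z powi m * proj {..<0} (\<lambda>z x. z powi (- m) * f z x) z x"
    by (simp flip: distrib_left)
  also have "z powi m * proj {..<0} (\<lambda>z x. z powi (- m) * f z x) z x = proj {..<m} f z x"
  proof -
    have "(\<lambda>k. k + m) ` {..<0} = {..<m}"
      by (force intro: rev_image_eqI[of "_ - m"])
    then show ?thesis using proj_shift[OF z0, of m "{..<0}"] by simp
  qed
  also have "z powi m * (z powi (- m) * f z x) = f z x"
    using z0 by (simp add: power_int_minus)
  finally show ?thesis
    by (simp add: proj_shift_ge[OF z0, of m f])
qed

section \<open>Orders at 0 and at infinity\<close>

definition pol :: "int \<Rightarrow> fld \<Rightarrow> bool" where
  "pol m f \<longleftrightarrow> (\<exists>g. sm (ball 0 r) J g \<and> (\<forall>z\<in>pball r. \<forall>x\<in>J. f z x = z powi m * g z x))"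

text \<open>\<open>z\<^bsup>-m\<^esup> f\<close> is regular at \<open>z = 0\<close> for \<open>pol m f\<close> and at \<open>z = \<infinity>\<close> for \<open>mil m f\<close>.\<close>

definition mil :: "int \<Rightarrow> fld \<Rightarrow> bool" where
  "mil m f \<longleftrightarrow> pol (- m) (\<lambda>z x. f (inverse z) x)"

lemma polI: "sm (ball 0 r) J g \<Longrightarrow> (\<And>z x. z \<in> pball r \<Longrightarrow> x \<in> J \<Longrightarrow> f z x = z powi m * g z x) \<Longrightarrow> pol m f"
  unfolding pol_def by blast

lemma pol_cong: "pol m f \<Longrightarrow> (\<And>z x. z \<in> pball r \<Longrightarrow> x \<in> J \<Longrightarrow> f z x = g z x) \<Longrightarrow> pol m g"
  unfolding pol_def by (metis (no_types, lifting))

lemma pol_sm: assumes "pol m f" shows "sm (pball r) J f"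
proof -
  from assms obtain g where g: "sm (ball 0 r) J g"
    "\<And>z x. z \<in> pball r \<Longrightarrow> x \<in> J \<Longrightarrow> f z x = z powi m * g z x"
    unfolding pol_def by blast
  have "sm (pball r) J (\<lambda>z x. z powi m * g z x)"
    by (intro sm_mult J sm_powi sm_z sm_subset[OF g(1)]) auto
  then show ?thesis by (rule sm_cong[OF J, rotated]) (use g(2) in auto)
qed

lemma pol_ball: "sm (ball 0 r) J f \<Longrightarrow> pol 0 f"
  by (rule polI[where g = f]) auto

lemma pol_mult: assumes "pol m f" "pol n g" shows "pol (m + n) (\<lambda>z x. f z x * g z x)"
proof -
  from assms(1) obtain f' where f: "sm (ball 0 r) J f'"
    "\<And>z x. z \<in> pball r \<Longrightarrow> x \<in> J \<Longrightarrow> f z x = z powi m * f' z x"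
    unfolding pol_def by blast
  from assms(2) obtain g' where g: "sm (ball 0 r) J g'"
    "\<And>z x. z \<in> pball r \<Longrightarrow> x \<in> J \<Longrightarrow> g z x = z powi n * g' z x"
    unfolding pol_def by blast
  show ?thesis
    by (rule polI[OF sm_mult[OF J f(1) g(1)]]) (auto simp: f(2) g(2) power_int_add)
qed

lemma pol_add: assumes "pol m f" "pol m g" shows "pol m (\<lambda>z x. f z x + g z x)"
proof -
  from assms(1) obtain f' where f: "sm (ball 0 r) J f'"
    "\<And>z x. z \<in> pball r \<Longrightarrow> x \<in> J \<Longrightarrow> f z x = z powi m * f' z x"
    unfolding pol_def by blast
  from assms(2) obtain g' where g: "sm (ball 0 r) J g'"
    "\<And>z x. z \<in> pball r \<Longrightarrow> x \<in> J \<Longrightarrow> g z x = z powi m * g' z x"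
    unfolding pol_def by blast
  show ?thesis
    by (rule polI[OF sm_add[OF J f(1) g(1)]]) (auto simp: f(2) g(2) algebra_simps)
qed

lemma pol_powi: "pol m (\<lambda>z x. z powi m)"
  by (rule polI[OF sm_const[OF J, of _ 1]]) auto

lemma pol_cmult: "pol m f \<Longrightarrow> pol m (\<lambda>z x. c * f z x)"
  using pol_mult[OF pol_ball[OF sm_const[OF J]], of m f c] by simp

lemma pol_uminus: "pol m f \<Longrightarrow> pol m (\<lambda>z x. - f z x)"
  using pol_cmult[of m f "-1"] by simp

lemma pol_diff: "pol m f \<Longrightarrow> pol m g \<Longrightarrow> pol m (\<lambda>z x. f z x - g z x)"
  using pol_add[OF _ pol_uminus, of m f g] by simp

lemma pol_mono: assumes "pol m f" "n \<le> m" shows "pol n f"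
proof -
  have "sm (ball 0 r) J (\<lambda>z x. z ^ nat (m - n))"
    by (intro sm_power sm_z J)
  from pol_mult[OF pol_mult[OF pol_powi[of "n - m"] pol_ball[OF this]] assms(1)]
  have "pol n (\<lambda>z x. z powi (n - m) * z ^ nat (m - n) * f z x)" by simp
  then show ?thesis
  proof (rule pol_cong)
    fix z :: complex and x assume "z \<in> pball r"
    then have "z powi (n - m) * z powi (m - n) = 1" by (simp flip: power_int_add)
    moreover have "z powi (m - n) = z ^ nat (m - n)" using assms(2) by (simp add: power_int_def)
    ultimately show "z powi (n - m) * z ^ nat (m - n) * f z x = f z x" by simp
  qed
qed

lemma pol_dx: assumes "pol m f" shows "pol m (dx f)"
proof -
  from assms obtain g where g: "sm (ball 0 r) J g"
    "\<And>z x. z \<in> pball r \<Longrightarrow> x \<in> J \<Longrightarrow> f z x = z powi m * g z x"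
    unfolding pol_def by blast
  show ?thesis
  proof (rule polI[OF sm_dx[OF g(1)]])
    fix z x assume zx: "z \<in> pball r" "x \<in> J"
    have "dx f z x = dx (\<lambda>z x. z powi m * g z x) z x"
      by (rule dx_cong[OF J zx(2)]) (use g(2) zx in auto)
    also have "\<dots> = z powi m * dx g z x"
      by (rule dx_eqI[where f = "\<lambda>z x. z powi m * g z x"])
        (rule has_vector_derivative_mult_right, rule sm_has_dx[OF g(1)], use zx in auto)
    finally show "dx f z x = z powi m * dx g z x" .
  qed
qed

lemma pol_th: assumes "pol m f" shows "pol m (th f)"
proof -
  from assms obtain g where g: "sm (ball 0 r) J g"
    "\<And>z x. z \<in> pball r \<Longrightarrow> x \<in> J \<Longrightarrow> f z x = z powi m * g z x"
    unfolding pol_def by blast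
  have "sm (ball 0 r) J (\<lambda>z x. of_int m * g z x + th g z x)"
    by (intro sm_add J sm_mult sm_const B.sm_th g)
  then show ?thesis
  proof (rule polI)
    fix z x assume zx: "z \<in> pball r" "x \<in> J"
    have "th f z x = th (\<lambda>z x. z powi m * g z x) z x"
      by (rule th_cong[OF open_pball zx(1)]) (use g(2) zx in auto)
    also have "((\<lambda>z. z powi m * g z x) has_field_derivative
        of_int m * z powi (m - 1) * 1 * g z x + dz g z x * z powi m) (at z)"
      by (rule DERIV_mult[OF DERIV_power_int[OF DERIV_ident] sm_has_dz[OF g(1) open_ball]])
        (use zx in auto)
    then have "th (\<lambda>z x. z powi m * g z x) z x = z * (of_int m * z powi (m - 1) * 1 * g z x + dz g z x * z powi m)"
      unfolding th_def using dz_eqI[where f = "\<lambda>z x. z powi m * g z x"] by simp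
    also have "\<dots> = z powi m * (of_int m * g z x + th g z x)"
    proof -
      have "z * z powi (m - 1) = z powi m" using zx power_int_add_1'[of z "m - 1"] by simp
      then show ?thesis unfolding th_def by (simp add: algebra_simps)
    qed
    finally show "th f z x = z powi m * (of_int m * g z x + th g z x)" .
  qed
qed

text \<open>The operator \<open>th\<close> kills the constant term, so one order is gained at 0.
  Because of this gain the bracket of two nonnegative parts has no residue.\<close>

lemma pol_th_0: assumes "sm (ball 0 r) J f" shows "pol 1 (th f)"
  by (rule polI[OF sm_dz(1)[OF open_ball J assms]]) (simp add: th_def)

lemma pol_bracket: "pol m f \<Longrightarrow> pol n g \<Longrightarrow> pol (m + n) (bracket f g)"
  unfolding bracket_th[abs_def]
  using pol_mult[OF pol_th pol_dx, of m f n g] pol_mult[OF pol_th pol_dx, of n g m f]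
  by (intro pol_diff) (simp_all add: add.commute)

text \<open>The derivative in log z is odd under inversion; this transfers order statements at 0 to
  infinity.\<close>

lemma mil_eq_th: assumes "sm (exterior r) J f" "z \<in> pball r" "x \<in> J"
  shows "th (\<lambda>z x. f (inverse z) x) z x = - th f (inverse z) x"
proof -
  have i: "inverse z \<in> exterior r" "z \<noteq> 0" using inverse_exterior_iff[of r z] assms r by auto
  have "((\<lambda>z. f (inverse z) x) has_field_derivative
      dz f (inverse z) x * - (inverse z ^ Suc (Suc 0))) (at z)"
    by (rule DERIV_chain2[OF sm_has_dz[OF assms(1) open_exterior i(1) assms(3)] DERIV_inverse[OF i(2)]])
  from dz_eqI[where f = "\<lambda>z x. f (inverse z) x", OF this] show ?thesis
    unfolding th_def using i(2) by (simp add: field_simps)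
qed

lemma mil_sm: assumes "mil m f" shows "sm (exterior r) J f"
proof -
  have "inverse holomorphic_on exterior r"
    using r by (auto intro!: holomorphic_intros simp: exterior_def)
  moreover have "inverse ` exterior r \<subseteq> pball r"
  proof (rule image_subsetI)
    show "inverse z \<in> pball r" if "z \<in> exterior r" for z :: complex
      using that r inverse_pball_iff[of r z] by linarith
  qed
  ultimately have "sm (exterior r) J (\<lambda>z x. (\<lambda>z x. f (inverse z) x) (inverse z) x)"
    by (rule sm_compose_z[OF J pol_sm[OF assms[unfolded mil_def]]])
  then show ?thesis by simp
qed

lemma mil_cong: "mil m f \<Longrightarrow> (\<And>z x. z \<in> exterior r \<Longrightarrow> x \<in> J \<Longrightarrow> f z x = g z x) \<Longrightarrow> mil m g"
  unfolding mil_def using r inverse_exterior_iff[of r]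
  by (elim pol_cong) auto

lemma mil_mult: "mil m f \<Longrightarrow> mil n g \<Longrightarrow> mil (m + n) (\<lambda>z x. f z x * g z x)"
  unfolding mil_def
  using pol_mult[of "- m" "\<lambda>z x. f (inverse z) x" "- n" "\<lambda>z x. g (inverse z) x"] by simp

lemma mil_add: "mil m f \<Longrightarrow> mil m g \<Longrightarrow> mil m (\<lambda>z x. f z x + g z x)"
  unfolding mil_def by (rule pol_add)

lemma mil_diff: "mil m f \<Longrightarrow> mil m g \<Longrightarrow> mil m (\<lambda>z x. f z x - g z x)"
  unfolding mil_def by (rule pol_diff)

lemma mil_uminus: "mil m f \<Longrightarrow> mil m (\<lambda>z x. - f z x)"
  unfolding mil_def by (rule pol_uminus)

lemma mil_mono: "mil m f \<Longrightarrow> m \<le> n \<Longrightarrow> mil n f"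
  unfolding mil_def by (erule pol_mono) simp

lemma mil_dx: "mil m f \<Longrightarrow> mil m (dx f)"
  unfolding mil_def using pol_dx by (simp add: dx_def)

lemma mil_th: assumes "mil m f" shows "mil m (th f)"
  unfolding mil_def
  by (rule pol_cong[OF pol_uminus[OF pol_th[OF assms[unfolded mil_def]]]])
    (simp add: mil_eq_th[OF mil_sm[OF assms]])

lemma mil_bracket: "mil m f \<Longrightarrow> mil n g \<Longrightarrow> mil (m + n) (bracket f g)"
  unfolding bracket_th[abs_def]
  using mil_mult[OF mil_th mil_dx, of m f n g] mil_mult[OF mil_th mil_dx, of n g m f]
  by (intro mil_diff) (simp_all add: add.commute)

lemma pol_coeff: assumes "pol m f" "x \<in> J" "k < m" shows "coeff (\<lambda>z. f z x) k = 0"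
proof -
  from assms(1) obtain g where g: "sm (ball 0 r) J g"
    "\<And>z x. z \<in> pball r \<Longrightarrow> x \<in> J \<Longrightarrow> f z x = z powi m * g z x"
    unfolding pol_def by blast
  have "coeff (\<lambda>z. f z x) k = coeff (\<lambda>z. z powi m * g z x) k"
  proof (rule coeff_cong)
    fix z assume "z \<in> circ"
    then have "z \<in> pball r" using r by auto
    then show "f z x = z powi m * g z x" using g(2) assms(2) by blast
  qed
  then show ?thesis
    using coeff_holomorphic[OF sm_hol[OF g(1) assms(2)] r] assms(3) by (simp add: coeff_shift)
qed

lemma mil_coeff: "mil m f \<Longrightarrow> x \<in> J \<Longrightarrow> m < k \<Longrightarrow> coeff (\<lambda>z. f z x) k = 0"
  using pol_coeff[of "- m" "\<lambda>z x. f (inverse z) x" x "- k"] coeff_inverse[of "\<lambda>z. f z x" "- k"]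
  unfolding mil_def by simp

lemma pol_proj_0: "pol m f \<Longrightarrow> x \<in> J \<Longrightarrow> A \<subseteq> {..<m} \<Longrightarrow> proj A f z x = 0"
  unfolding proj_def by (rule infsum_0) (use pol_coeff in auto)

lemma mil_proj_0: "mil m f \<Longrightarrow> x \<in> J \<Longrightarrow> A \<subseteq> {m<..} \<Longrightarrow> proj A f z x = 0"
  unfolding proj_def by (rule infsum_0) (use mil_coeff in auto)

lemma ball_proj_id:
  assumes f: "sm (ball 0 r) J f" and zx: "z \<in> ball 0 r" "x \<in> J" shows "proj {0..} f z x = f z x"
  by (rule proj_eqI) (rule has_sum_holomorphic[OF sm_hol[OF f zx(2)] r zx(1)])

lemma pol_proj_id: assumes "pol m f" and zx: "z \<in> pball r" "x \<in> J" shows "proj {m..} f z x = f z x"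
proof -
  from assms(1) obtain g where g: "sm (ball 0 r) J g"
    "\<And>z x. z \<in> pball r \<Longrightarrow> x \<in> J \<Longrightarrow> f z x = z powi m * g z x"
    unfolding pol_def by blast
  have "proj {0..} (\<lambda>z x. z powi (- m) * f z x) z x = proj {0..} g z x"
  proof (rule proj_cong)
    fix w assume "w \<in> circ"
    then have "w \<in> pball r" using r by auto
    then show "w powi (- m) * f w x = g w x" using g(2) zx by (simp add: power_int_minus)
  qed
  also have "\<dots> = g z x" using zx by (intro ball_proj_id g) auto
  finally show ?thesis using proj_shift_ge[of z m f x] g(2) zx by simp
qed

lemma mil_proj_id: assumes "mil m f" and zx: "z \<in> exterior r" "x \<in> J" shows "proj {..m} f z x = f z x"
  unfolding proj_reflect
  using pol_proj_id[OF assms(1)[unfolded mil_def], of "inverse z" x] zx r inverse_pball_iff[of r z] by simp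

section \<open>Projections as operators on smooth families\<close>

lemma sm_shift: "sm (annulus r) J f \<Longrightarrow> sm (annulus r) J (\<lambda>z x. z powi m * f z x)"
  using annulus_nz[of r] r by (intro sm_mult J sm_powi sm_z) auto

lemma sm_reflect: assumes "sm (annulus r) J f" shows "sm (annulus r) J (\<lambda>z x. f (inverse z) x)"
proof (rule sm_compose_z[OF J assms])
  show "inverse holomorphic_on annulus r"
    using annulus_nz[of r] r by (auto intro!: holomorphic_intros)
  show "inverse ` annulus r \<subseteq> annulus r" using inverse_annulus[of r] r by auto
qed

lemma pol_proj: assumes "sm (annulus r) J f" shows "pol m (proj {m..} f)"
  by (rule polI[where g = "proj {0..} (\<lambda>z x. z powi (- m) * f z x)"])
    (rule proj_nonneg(1)[OF sm_shift[OF assms]], rule proj_shift_ge, simp)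

lemma mil_proj: assumes "sm (annulus r) J f" shows "mil m (proj {..m} f)"
  unfolding mil_def proj_reflect[abs_def] using pol_proj[OF sm_reflect[OF assms], of "- m"] by simp

text \<open>Couples a half line of exponents with the domain on which its projection lives: upwards
  with the punctured disc, downwards with the exterior. Facts about \<open>proj\<close> then need
  only one statement for both parts of a function.\<close>

definition half :: "int set \<Rightarrow> complex set \<Rightarrow> bool" where
  "half A D \<longleftrightarrow> (\<exists>m. A = {m..} \<and> D = pball r) \<or> (\<exists>m. A = {..m} \<and> D = exterior r)"

lemma half_open: "half A D \<Longrightarrow> open D"
  unfolding half_def using open_pball open_exterior by auto

lemma annulus_half: "half A D \<Longrightarrow> annulus r \<subseteq> D"
  unfolding half_def using annulus_eq r by auto

lemma proj_sm: "half A D \<Longrightarrow> sm (annulus r) J f \<Longrightarrow> sm D J (proj A f)"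
  unfolding half_def using pol_sm[OF pol_proj] mil_sm[OF mil_proj] by blast

lemma proj_dx:
  assumes A: "half A D" and f: "sm (annulus r) J f" and zx: "z \<in> D" "x \<in> J"
  shows "dx (proj A f) z x = proj A (dx f) z x"
proof -
  have pos: "dx (proj {m..} f) z x = proj {m..} (dx f) z x"
    if f: "sm (annulus r) J f" and z: "z \<in> pball r" for m f z
  proof -
    note h = proj_nonneg[OF sm_shift[OF f, of "- m"]]
    have "dx (proj {m..} f) z x = dx (\<lambda>z x. z powi m * proj {0..} (\<lambda>z x. z powi (- m) * f z x) z x) z x"
      by (rule dx_cong[OF J zx(2)], rule proj_shift_ge) (use z in simp)
    also have "\<dots> = z powi m * dx (proj {0..} (\<lambda>z x. z powi (- m) * f z x)) z x"
      by (rule dx_eqI[where f = "\<lambda>z x. z powi m * proj {0..} (\<lambda>z x. z powi (- m) * f z x) z x"])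
        (rule has_vector_derivative_mult_right, rule sm_has_dx[OF h(1)], use z zx in auto)
    also have "dx (proj {0..} (\<lambda>z x. z powi (- m) * f z x)) z x = proj {0..} (dx (\<lambda>z x. z powi (- m) * f z x)) z x"
      by (rule h(2)) (use z zx in auto)
    also have "\<dots> = proj {0..} (\<lambda>z x. z powi (- m) * dx f z x) z x"
    proof (rule proj_cong)
      fix w assume "w \<in> circ"
      then have "w \<in> annulus r" using circ_subset_annulus[OF r] by blast
      then show "dx (\<lambda>z x. z powi (- m) * f z x) w x = w powi (- m) * dx f w x"
        by (intro dx_eqI[where f = "\<lambda>z x. z powi (- m) * f z x"] has_vector_derivative_mult_right sm_has_dx[OF f] zx)
    qed
    also have "z powi m * \<dots> = proj {m..} (dx f) z x"
      using proj_shift_ge[of z m "dx f" x] z by simp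
    finally show ?thesis .
  qed
  from A show ?thesis unfolding half_def
  proof (elim disjE exE conjE)
    fix m assume A: "A = {m..}" and D: "D = pball r"
    show ?thesis unfolding A using zx D by (intro pos[OF f]) auto
  next
    fix m assume A: "A = {..m}" and D: "D = exterior r"
    have "dx (proj {..m} f) z x = dx (proj {- m..} (\<lambda>z x. f (inverse z) x)) (inverse z) x"
      unfolding proj_reflect[abs_def] by (simp add: dx_def)
    also have "\<dots> = proj {- m..} (dx (\<lambda>z x. f (inverse z) x)) (inverse z) x"
      by (rule pos[OF sm_reflect[OF f]]) (use zx D r inverse_pball_iff[of r z] in auto)
    also have "\<dots> = proj {..m} (dx f) z x"
      unfolding proj_reflect by (simp add: dx_def)
    finally show ?thesis unfolding A .
  qed
qed

lemma proj_add_ball: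
  assumes f: "sm (annulus r) J f" and g: "sm (annulus r) J g" and zx: "z \<in> ball 0 r" "x \<in> J"
  shows "proj {0..} (\<lambda>z x. f z x + g z x) z x = proj {0..} f z x + proj {0..} g z x"
proof (rule proj_eqI)
  have "continuous_on circ (\<lambda>z. h z x)" if "sm (annulus r) J h" for h
    by (rule continuous_on_subset[OF holomorphic_on_imp_continuous_on[OF sm_hol[OF that zx(2)]]])
      (rule circ_subset_annulus[OF r])
  then have "coeff (\<lambda>z. f z x + g z x) k = coeff (\<lambda>z. f z x) k + coeff (\<lambda>z. g z x) k" for k
    using coeff_add f g by blast
  then show "((\<lambda>k. coeff (\<lambda>z. f z x + g z x) k * z powi k) has_sum proj {0..} f z x + proj {0..} g z x) {0..}"
    using has_sum_add[OF proj_nonneg(3)[OF f zx] proj_nonneg(3)[OF g zx]] by (simp add: distrib_right)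
qed

lemma proj_add:
  assumes A: "half A D" and f: "sm (annulus r) J f" and g: "sm (annulus r) J g" and zx: "z \<in> D" "x \<in> J"
  shows "proj A (\<lambda>z x. f z x + g z x) z x = proj A f z x + proj A g z x"
proof -
  have pos: "proj {m..} (\<lambda>z x. f z x + g z x) z x = proj {m..} f z x + proj {m..} g z x"
    if f: "sm (annulus r) J f" and g: "sm (annulus r) J g" and z: "z \<in> pball r" for m f g z
    using proj_add_ball[OF sm_shift[OF f, of "- m"] sm_shift[OF g, of "- m"], of z x] z zx
    by (simp add: proj_shift_ge[of z m] distrib_left)
  from A show ?thesis unfolding half_def
  proof (elim disjE exE conjE)
    fix m assume A: "A = {m..}" and D: "D = pball r"
    show ?thesis unfolding A using zx D by (intro pos f g) auto
  next
    fix m assume A: "A = {..m}" and D: "D = exterior r"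
    show ?thesis unfolding A proj_reflect
      by (rule pos[OF sm_reflect[OF f] sm_reflect[OF g]]) (use zx D r inverse_pball_iff[of r z] in auto)
  qed
qed

lemma proj_cmult: "proj A (\<lambda>z x. c * f z x) z x = c * proj A f z x"
  unfolding proj_def by (simp add: coeff_cmult infsum_cmult_right' mult.assoc)

lemma proj_uminus: "proj A (\<lambda>z x. - f z x) z x = - proj A f z x"
  using proj_cmult[of A "-1" f] by simp

lemma proj_diff:
  assumes A: "half A D" and f: "sm (annulus r) J f" and g: "sm (annulus r) J g" and zx: "z \<in> D" "x \<in> J"
  shows "proj A (\<lambda>z x. f z x - g z x) z x = proj A f z x - proj A g z x"
  using proj_add[OF A f sm_uminus[OF J g] zx] by (simp add: proj_uminus)

text \<open>The residue is the value at 0 of the nonnegative projection, and that projection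
  commutes with \<open>dx\<close>.\<close>

lemma coeff_dx:
  assumes f: "sm (annulus r) J f" and x: "x \<in> J"
  shows "((\<lambda>x. coeff (\<lambda>z. f z x) 0) has_vector_derivative coeff (\<lambda>z. dx f z x) 0) (at x)"
proof -
  have "(proj {0..} f 0 has_vector_derivative dx (proj {0..} f) 0 x) (at x)"
    by (rule sm_has_dx[OF proj_nonneg(1)[OF f]]) (use r x in auto)
  moreover have "dx (proj {0..} f) 0 x = proj {0..} (dx f) 0 x"
    by (rule proj_nonneg(2)[OF f]) (use r x in auto)
  ultimately show ?thesis by (simp add: proj_at_0 proj_at_0[abs_def])
qed

end

lemma res0_coeff: "res0 f x = coeff (\<lambda>z. f z x) 0"
proof -
  have "f z x / z = f z x * z powi (- 0 - 1)" for z
    by (simp add: divide_inverse power_int_minus)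
  then show ?thesis unfolding res0_def coeff_def by presburger
qed

section \<open>Germs and branches of the logarithms\<close>

lemma annulus_near_circ:
  assumes "e > 0" "z \<in> annulus (1 + e)"
  shows "sgn z \<in> circ" "dist (sgn z) z < e" "z \<noteq> 0"
proof -
  show z: "z \<noteq> 0" using annulus_nz[OF _ assms(2)] assms(1) by simp
  then show "sgn z \<in> circ" by (simp add: norm_sgn)
  have "1 - e < inverse (1 + e)"
    using assms(1) by (simp add: field_simps)
  then have n: "\<bar>1 - norm z\<bar> < e" using assms(2) unfolding annulus_def by auto
  have "of_real (norm z) * sgn z = z"
    using z by (simp add: sgn_eq)
  then have "sgn z - z = of_real (1 - norm z) * sgn z"
    by (simp add: left_diff_distrib)
  then show "dist (sgn z) z < e"
    using n z unfolding dist_norm by (simp add: norm_mult norm_sgn del: of_real_diff)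
qed

text \<open>Compactness of the circle gives a uniform distance, measured along radii. The ball, the
  punctured ball and the exterior differ from \<open>D0\<close>, \<open>D0p\<close> and
  \<open>Dinf\<close> only inside such an annulus, so the sets that are not compact cause no
  difficulty.\<close>

lemma eventually_annulus:
  assumes "open U" "circ \<subseteq> U"
  shows "\<forall>\<^sub>F r in at_right 1. annulus r \<subseteq> U"
proof -
  obtain e where e: "e > 0" "(\<Union>x\<in>circ. ball x e) \<subseteq> U"
    by (rule compact_subset_open_imp_ball_epsilon_subset[OF compact_sphere assms])
  have "annulus (1 + e) \<subseteq> U"
    using annulus_near_circ[OF e(1)] e(2) by (force simp: dist_commute)
  then have "annulus r \<subseteq> U" if "1 < r" "r < 1 + e" for r
    using annulus_mono[of r "1 + e"] that by auto
  then show ?thesis unfolding eventually_at_right_field using e(1) by (intro exI[of _ "1 + e"]) auto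
qed

lemma ball_annulus: "r > 1 \<Longrightarrow> z \<in> ball 0 r \<Longrightarrow> z \<in> cball 0 1 \<or> z \<in> annulus r"
  unfolding annulus_def using inverse_less_1_iff[of r] by (auto intro: less_trans)

lemma exterior_annulus: "r > 1 \<Longrightarrow> z \<in> exterior r \<Longrightarrow> z \<in> Dinf \<or> z \<in> annulus r"
  unfolding annulus_def exterior_def by auto

lemma eventually_ball:
  assumes "open U" "D0 \<subseteq> U" shows "\<forall>\<^sub>F r in at_right 1. ball 0 r \<subseteq> U"
proof -
  have "\<forall>\<^sub>F r in at_right 1. annulus r \<subseteq> U" by (rule eventually_annulus) (use assms in auto)
  moreover have "\<forall>\<^sub>F r in at_right (1::real). r > 1" by (rule eventually_at_right_less)
  ultimately show ?thesis by eventually_elim (use assms ball_annulus in blast)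
qed

lemma eventually_pball:
  assumes "open U" "D0p \<subseteq> U" shows "\<forall>\<^sub>F r in at_right 1. pball r \<subseteq> U"
proof -
  have "\<forall>\<^sub>F r in at_right 1. annulus r \<subseteq> U" by (rule eventually_annulus) (use assms in auto)
  moreover have "\<forall>\<^sub>F r in at_right (1::real). r > 1" by (rule eventually_at_right_less)
  ultimately show ?thesis by eventually_elim (use assms ball_annulus in blast)
qed

lemma eventually_exterior:
  assumes "open U" "Dinf \<subseteq> U" shows "\<forall>\<^sub>F r in at_right 1. exterior r \<subseteq> U"
proof -
  have "\<forall>\<^sub>F r in at_right 1. annulus r \<subseteq> U" by (rule eventually_annulus) (use assms in auto)
  moreover have "\<forall>\<^sub>F r in at_right (1::real). r > 1" by (rule eventually_at_right_less)
  ultimately show ?thesis by eventually_elim (use assms exterior_annulus in blast)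
qed

lemma domain_subsets:
  assumes "r > 1" shows "circ \<subseteq> annulus r" "D0 \<subseteq> ball 0 r" "D0p \<subseteq> pball r" "Dinf \<subseteq> exterior r"
  using assms circ_subset_annulus[OF assms] inverse_less_1_iff[of r] unfolding exterior_def by auto

lemma obtain_radius:
  assumes "\<forall>\<^sub>F r in at_right (1::real). P r" obtains r where "r > 1" "P r"
proof -
  have "\<forall>\<^sub>F r in at_right 1. r > 1 \<and> P r"
    by (rule eventually_conj[OF eventually_at_right_less assms])
  then show ?thesis
    using eventually_happens'[OF trivial_limit_at_right_real] that by blast
qed

text \<open>The domains \<open>D r\<close> form a neighbourhood basis as \<open>r\<close> decreases
  to 1. Existence of some neighbourhood becomes an eventual statement, and finitely many conditions
  on germs can be met at a single radius.\<close>

lemma near_iff: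
  assumes "\<And>U. open U \<Longrightarrow> K \<subseteq> U \<Longrightarrow> \<forall>\<^sub>F r in at_right 1. D r \<subseteq> U"
    and "\<And>r. r > 1 \<Longrightarrow> K \<subseteq> D r" "\<And>r. open (D r)" "\<And>U V. P U \<Longrightarrow> V \<subseteq> U \<Longrightarrow> P V"
  shows "(\<exists>U. open U \<and> K \<subseteq> U \<and> P U) \<longleftrightarrow> (\<forall>\<^sub>F r in at_right (1::real). P (D r))"
proof
  assume "\<exists>U. open U \<and> K \<subseteq> U \<and> P U"
  then obtain U where U: "open U" "K \<subseteq> U" "P U" by blast
  from assms(1)[OF U(1,2)] show "\<forall>\<^sub>F r in at_right 1. P (D r)"
    by eventually_elim (rule assms(4)[OF U(3)])
next
  assume "\<forall>\<^sub>F r in at_right 1. P (D r)"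
  then obtain r where "r > 1" "P (D r)" by (rule obtain_radius)
  then show "\<exists>U. open U \<and> K \<subseteq> U \<and> P U" using assms(2,3) by blast
qed

lemma eq_near_iff:
  fixes f g :: "complex \<Rightarrow> 'b"
  shows eq_near_annulus: "eq_near circ f g \<longleftrightarrow> (\<forall>\<^sub>F r in at_right 1. \<forall>z\<in>annulus r. f z = g z)"
    and eq_near_ball: "eq_near D0 f g \<longleftrightarrow> (\<forall>\<^sub>F r in at_right 1. \<forall>z\<in>ball 0 r. f z = g z)"
    and eq_near_pball: "eq_near D0p f g \<longleftrightarrow> (\<forall>\<^sub>F r in at_right 1. \<forall>z\<in>pball r. f z = g z)"
    and eq_near_exterior: "eq_near Dinf f g \<longleftrightarrow> (\<forall>\<^sub>F r in at_right 1. \<forall>z\<in>exterior r. f z = g z)"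
  unfolding eq_near_def
  by (rule near_iff[where P = "\<lambda>U. \<forall>z\<in>U. f z = g z"];
      (rule eventually_annulus eventually_ball eventually_pball eventually_exterior domain_subsets
        open_annulus open_ball open_pball open_exterior | blast); assumption)+

lemma smooth_fam_circ_iff: "smooth_fam circ g \<longleftrightarrow> (\<forall>\<^sub>F r in at_right 1. sm (annulus r) UNIV g)"
  unfolding smooth_fam_iff
  by (rule near_iff[where P = "\<lambda>U. sm U UNIV g", OF eventually_annulus domain_subsets(1) open_annulus])
    (auto intro: sm_subset)

lemma smooth_fam_D0_iff: "smooth_fam D0 g \<longleftrightarrow> (\<forall>\<^sub>F r in at_right 1. sm (ball 0 r) UNIV g)"
  unfolding smooth_fam_iff
  by (rule near_iff[where P = "\<lambda>U. sm U UNIV g", OF eventually_ball domain_subsets(2) open_ball])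
    (auto intro: sm_subset)

lemma eventually_pol_iff:
  "(\<exists>g. smooth_fam D0 g \<and> eq_near D0p f (\<lambda>z x. z powi m * g z x)) \<longleftrightarrow> (\<forall>\<^sub>F r in at_right 1. pol r UNIV m f)"
proof
  assume "\<exists>g. smooth_fam D0 g \<and> eq_near D0p f (\<lambda>z x. z powi m * g z x)"
  then obtain g where "\<forall>\<^sub>F r in at_right 1. sm (ball 0 r) UNIV g"
    "\<forall>\<^sub>F r in at_right 1. \<forall>z\<in>pball r. f z = (\<lambda>x. z powi m * g z x)"
    unfolding smooth_fam_D0_iff eq_near_pball by blast
  moreover have "\<forall>\<^sub>F r in at_right (1::real). r > 1" by (rule eventually_at_right_less)
  ultimately show "\<forall>\<^sub>F r in at_right 1. pol r UNIV m f"
    by eventually_elim (rule polI, auto)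
next
  assume "\<forall>\<^sub>F r in at_right 1. pol r UNIV m f"
  then obtain r where r: "r > 1" "pol r UNIV m f" by (rule obtain_radius)
  then obtain g where g: "sm (ball 0 r) UNIV g" "\<forall>z\<in>pball r. \<forall>x. f z x = z powi m * g z x"
    unfolding pol_def[OF r(1) open_UNIV] by auto
  have "smooth_fam D0 g" unfolding smooth_fam_iff using domain_subsets[OF r(1)] g(1) by blast
  moreover have "eq_near D0p f (\<lambda>z x. z powi m * g z x)"
    unfolding eq_near_def using domain_subsets[OF r(1)] g(2) open_pball[of r] by (intro exI[of _ "pball r"]) auto
  ultimately show "\<exists>g. smooth_fam D0 g \<and> eq_near D0p f (\<lambda>z x. z powi m * g z x)" by blast
qed

lemma eventually_mil_iff:
  fixes f :: fld
  shows "(\<exists>g. smooth_fam D0 g \<and> eq_near Dinf f (\<lambda>z x. z powi m * g (inverse z) x)) \<longleftrightarrow> (\<forall>\<^sub>F r in at_right 1. mil r UNIV m f)"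
proof -
  have "eq_near Dinf f (\<lambda>z x. z powi m * g (inverse z) x) \<longleftrightarrow>
      eq_near D0p (\<lambda>z x. f (inverse z) x) (\<lambda>z x. z powi (- m) * g z x)" for g :: fld
  proof -
    have "(\<forall>z\<in>exterior r. f z = (\<lambda>x. z powi m * g (inverse z) x)) \<longleftrightarrow>
        (\<forall>z\<in>pball r. (\<lambda>x. f (inverse z) x) = (\<lambda>x. z powi (- m) * g z x))" if "r > 1" for r
    proof (intro iffI ballI)
      fix z assume h: "\<forall>z\<in>exterior r. f z = (\<lambda>x. z powi m * g (inverse z) x)" and z: "z \<in> pball r"
      then have "inverse z \<in> exterior r" using inverse_exterior_iff[of r z] that by linarith
      with h have "f (inverse z) = (\<lambda>x. inverse z powi m * g (inverse (inverse z)) x)" by blast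
      then show "(\<lambda>x. f (inverse z) x) = (\<lambda>x. z powi (- m) * g z x)"
        by (simp add: power_int_inverse power_int_minus)
    next
      fix z assume h: "\<forall>z\<in>pball r. (\<lambda>x. f (inverse z) x) = (\<lambda>x. z powi (- m) * g z x)" and z: "z \<in> exterior r"
      then have "inverse z \<in> pball r" using inverse_pball_iff[of r z] that by linarith
      with h have "f (inverse (inverse z)) = (\<lambda>x. inverse z powi (- m) * g (inverse z) x)" by blast
      then show "f z = (\<lambda>x. z powi m * g (inverse z) x)"
        by (simp add: power_int_inverse power_int_minus)
    qed
    then have "\<forall>\<^sub>F r in at_right 1. (\<forall>z\<in>exterior r. f z = (\<lambda>x. z powi m * g (inverse z) x)) \<longleftrightarrow>
        (\<forall>z\<in>pball r. (\<lambda>x. f (inverse z) x) = (\<lambda>x. z powi (- m) * g z x))"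
      by (rule eventually_mono[OF eventually_at_right_less])
    then show ?thesis
      unfolding eq_near_exterior eq_near_pball by (rule eventually_subst)
  qed
  moreover have "(\<forall>\<^sub>F r in at_right 1. mil r UNIV m f) \<longleftrightarrow>
      (\<forall>\<^sub>F r in at_right 1. pol r UNIV (- m) (\<lambda>z x. f (inverse z) x))"
    by (rule eventually_subst, rule eventually_mono[OF eventually_at_right_less])
      (simp add: mil_def)
  ultimately show ?thesis by (simp add: eventually_pol_iff)
qed

lemma smooth_Dinf_iff: "smooth_Dinf f \<longleftrightarrow> (\<forall>\<^sub>F r in at_right 1. mil r UNIV 0 f)"
  unfolding smooth_Dinf_def using eventually_mil_iff[of f 0] by simp

lemma smooth_zDinf_iff: "smooth_zDinf f \<longleftrightarrow> (\<forall>\<^sub>F r in at_right 1. mil r UNIV 1 f)"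
  unfolding smooth_zDinf_def using eventually_mil_iff[of f 1] by simp

lemma smooth_zinvDinf_iff: "smooth_zinvDinf f \<longleftrightarrow> (\<forall>\<^sub>F r in at_right 1. mil r UNIV (-1) f)"
  unfolding smooth_zinvDinf_def using eventually_mil_iff[of f "-1"]
  by (simp add: power_int_minus field_class.field_divide_inverse mult.commute)

lemma smooth_zinvD0_iff: "smooth_zinvD0 f \<longleftrightarrow> (\<forall>\<^sub>F r in at_right 1. pol r UNIV (-1) f)"
  unfolding smooth_zinvD0_def using eventually_pol_iff[of f "-1"]
  by (simp add: power_int_minus field_class.field_divide_inverse mult.commute)

text \<open>By the winding condition \<open>F\<close> itself does not wind along the circle at
  \<open>x = 0\<close>, so it has a closed continuous logarithm there and is homotopic to a constant
  in the punctured plane. Annulus times line retracts to that circle, hence \<open>F\<close> is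
  inessential on the whole domain and has a continuous logarithm.\<close>

lemma continuous_logarithm_annulus:
  fixes F :: "complex \<times> real \<Rightarrow> complex" and n :: int
  assumes r: "r > 1" and F: "continuous_on (annulus r \<times> UNIV) F"
    and nz: "\<And>p. p \<in> annulus r \<times> UNIV \<Longrightarrow> F p \<noteq> 0"
    and w: "winding_number (\<lambda>t. F (circlepath 0 1 t, 0) * circlepath 0 1 t powi n) 0 = of_int n"
  obtains g where "continuous_on (annulus r \<times> UNIV) g" "\<And>p. p \<in> annulus r \<times> UNIV \<Longrightarrow> F p = exp (g p)"
proof -
  let ?S = "annulus r \<times> (UNIV :: real set)"
  have ca: "circ \<subseteq> annulus r" by (rule circ_subset_annulus[OF r])
  define \<gamma> where "\<gamma> = circlepath 0 1"
  have \<gamma>: "\<gamma> t = cis (2 * pi * t)" for t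
    unfolding \<gamma>_def circlepath by (simp add: cis_conv_exp mult_ac)
  have c\<gamma>: "continuous_on A \<gamma>" for A unfolding \<gamma> by (intro continuous_intros)
  have \<gamma>circ: "\<gamma> t \<in> circ" for t unfolding \<gamma> by simp
  define p where "p t = F (\<gamma> t, 0) * \<gamma> t powi n" for t
  have cF: "continuous_on A (\<lambda>s. F (a s, b s))"
    if "continuous_on A a" "continuous_on A b" "\<And>s. s \<in> A \<Longrightarrow> a s \<in> annulus r"
    for A :: "'x :: topological_space set" and a b
    by (rule continuous_on_compose2[OF F continuous_on_Pair[OF that(1,2)]]) (use that in auto)
  have p: "path p"
    unfolding path_def p_def using \<gamma>circ ca
    by (intro continuous_intros cF c\<gamma>) (auto simp: \<gamma>)
  have "p t \<noteq> 0" for t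
  proof -
    have "(\<gamma> t, 0) \<in> ?S" using \<gamma>circ[of t] ca by auto
    then show ?thesis unfolding p_def using nz by (auto simp: \<gamma>)
  qed
  then have "0 \<notin> path_image p" unfolding path_image_def by auto
  with p obtain q where q: "path q" "pathfinish q - pathstart q = 2 * of_real pi * \<i> * winding_number p 0"
    "\<And>t. t \<in> {0..1} \<Longrightarrow> p t = 0 + exp (q t)"
    by (rule winding_number_as_continuous_log) auto
  \<comment> \<open>The logarithm \<open>q\<close> of the product gains 2 pi i n along the circle by
    the winding hypothesis; subtracting a logarithm of \<open>\<gamma> t powi n\<close> leaves a
    logarithm of \<open>F\<close> that closes up.\<close>
  define h where "h t = q t - 2 * of_real pi * \<i> * n * t" for t :: real
  have h: "path h" "pathfinish h = pathstart h"
    using q(1,2) w unfolding path_def h_def pathfinish_def pathstart_def p_def \<gamma>_def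
    by (auto intro!: continuous_intros simp: algebra_simps)
  have Fh: "F (\<gamma> t, 0) = exp (h t)" if "t \<in> {0..1}" for t
  proof -
    have "exp (2 * of_real pi * \<i> * n * t) = \<gamma> t powi n"
      unfolding \<gamma> cis_conv_exp exp_power_int by (simp add: mult_ac)
    then have "exp (h t) * \<gamma> t powi n = F (\<gamma> t, 0) * \<gamma> t powi n"
      using q(3)[OF that] unfolding h_def exp_diff p_def by (simp add: \<gamma>)
    then show ?thesis by (simp add: \<gamma>)
  qed
  have "homotopic_loops UNIV h (\<lambda>t. 0)"
    using h by (intro homotopic_loops_linear) (auto simp: path_def pathfinish_def pathstart_def)
  then have "homotopic_loops (- {0}) (exp \<circ> h) (exp \<circ> (\<lambda>t. 0))"
    by (rule homotopic_loops_continuous_image) (auto intro!: continuous_intros)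
  from homotopic_loops_imp_homotopic_circlemaps[OF this]
  have hc: "homotopic_with_canon (\<lambda>h. True) circ (- {0}) (\<lambda>z. F (z, 0)) (\<lambda>z. 1)"
  proof (rule homotopic_with_eq)
    fix z assume "z \<in> topspace (top_of_set circ)"
    then have z: "norm z = 1" by simp
    have "\<gamma> (Arg2pi z / (2 * pi)) = z"
      unfolding \<gamma> using Arg2pi_eq[of z] z by (simp add: cis_conv_exp mult_ac)
    moreover have "Arg2pi z / (2 * pi) \<in> {0..1}" using Arg2pi_ge_0[of z] Arg2pi_lt_2pi[of z] by auto
    ultimately show "F (z, 0) = (exp \<circ> h \<circ> (\<lambda>z. Arg2pi z / (2 * pi))) z"
      using Fh[of "Arg2pi z / (2 * pi)"] by simp
  qed auto
  \<comment> \<open>Radial retraction onto the circle; combined with contracting the line to 0 it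
    deforms the domain inside itself.\<close>
  define \<pi> where "\<pi> = (\<lambda>p :: complex \<times> real. sgn (fst p))"
  have c\<pi>: "continuous_on ?S \<pi>"
    unfolding \<pi>_def sgn_div_norm using annulus_nz[of r] r by (intro continuous_intros) auto
  have \<pi>c: "\<pi> p \<in> circ" if "p \<in> ?S" for p
    unfolding \<pi>_def using that annulus_nz[of r "fst p"] r by (auto simp: norm_sgn)
  have "homotopic_with_canon (\<lambda>h. True) ?S (- {0}) ((\<lambda>z. F (z, 0)) \<circ> \<pi>) ((\<lambda>z. 1) \<circ> \<pi>)"
    by (rule homotopic_with_compose_continuous_right[OF hc c\<pi>]) (use \<pi>c in auto)
  moreover have "homotopic_with_canon (\<lambda>h. True) ?S (- {0}) (F \<circ> (\<lambda>p. p)) (F \<circ> (\<lambda>p. (\<pi> p, 0)))"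
  proof (rule homotopic_with_compose_continuous_left[OF _ F])
    show "homotopic_with_canon (\<lambda>f. True) ?S ?S (\<lambda>p. p) (\<lambda>p. (\<pi> p, 0))"
    proof (rule homotopic_with_linear)
      fix p assume p: "p \<in> ?S"
      show "closed_segment p (\<pi> p, 0) \<subseteq> ?S"
      proof
        fix y assume "y \<in> closed_segment p (\<pi> p, 0)"
        then obtain u where u: "0 \<le> u" "u \<le> 1" "y = (1 - u) *\<^sub>R p + u *\<^sub>R (\<pi> p, 0)"
          unfolding closed_segment_def by blast
        have z0: "fst p \<noteq> 0" using annulus_nz[of r "fst p"] p r by auto
        have "fst y = (1 - u) *\<^sub>R fst p + u *\<^sub>R sgn (fst p)" unfolding u \<pi>_def by simp
        also have "\<dots> = of_real ((1 - u) * norm (fst p) + u) * sgn (fst p)"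
          using z0 by (simp add: sgn_eq scaleR_conv_of_real field_simps)
        finally have "norm (fst y) = (1 - u) * norm (fst p) + u"
          using u z0 by (simp add: norm_mult norm_sgn del: of_real_add of_real_mult of_real_diff)
        moreover have "(1 - u) * norm (fst p) + u * 1 < r"
          using p r u unfolding annulus_def by (intro convex_bound_lt) auto
        moreover have "(1 - u) * (- norm (fst p)) + u * (- 1) < - inverse r"
          using p r u inverse_less_1_iff[of r] unfolding annulus_def by (intro convex_bound_lt) auto
        ultimately have "fst y \<in> annulus r" unfolding annulus_def by simp
        then show "y \<in> ?S" by (cases y) auto
      qed
    qed (intro continuous_intros c\<pi>)+
  qed (use nz in auto)
  ultimately have "homotopic_with_canon (\<lambda>h. True) ?S (- {0}) F (\<lambda>p. 1)"
    using homotopic_with_trans by (fastforce simp: o_def)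
  then have "\<exists>g. continuous_on ?S g \<and> (\<forall>p\<in>?S. F p = exp (g p))"
    using inessential_eq_continuous_logarithm[of ?S F] by blast
  then show ?thesis using that by blast
qed

lemma periodic_int:
  fixes f :: "real \<Rightarrow> 'a"
  assumes "\<And>x. f (x + 2 * pi) = f x"
  obtains y where "0 \<le> y" "y \<le> 2 * pi" "f y = f x"
proof -
  have n: "f (x + 2 * pi * real n) = f x" for n x
  proof (induction n)
    case (Suc n)
    have "f (x + 2 * pi * real (Suc n)) = f (x + 2 * pi * real n + 2 * pi)" by (simp add: algebra_simps)
    then show ?case using Suc assms by metis
  qed simp
  have z: "f (x - 2 * pi * of_int k) = f x" for k
  proof (cases "k \<ge> 0")
    case True
    then show ?thesis using n[of "x - 2 * pi * of_int k" "nat k"] by simp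
  next
    case False
    then show ?thesis using n[of x "nat (- k)"] by simp
  qed
  define k where "k = \<lfloor>x / (2 * pi)\<rfloor>"
  have "of_int k \<le> x / (2 * pi)" "x / (2 * pi) < of_int k + 1" unfolding k_def by linarith+
  then have "0 \<le> x - 2 * pi * of_int k" "x - 2 * pi * of_int k \<le> 2 * pi"
    by (simp_all add: field_simps)
  then show ?thesis using that z by blast
qed

text \<open>The line is not compact, but periodicity reduces \<open>x\<close> to one period;
  compactness of circle times period then yields one annulus for all \<open>x\<close>.\<close>

lemma eventually_nonzero:
  assumes r: "r > 1" and F: "sm (annulus r) UNIV F"
    and per: "\<And>z x. z \<in> annulus r \<Longrightarrow> F z (x + 2 * pi) = F z x"
    and nz: "\<And>z x. z \<in> circ \<Longrightarrow> F z x \<noteq> 0"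
  shows "\<forall>\<^sub>F s in at_right 1. \<forall>z\<in>annulus s. \<forall>x. F z x \<noteq> 0"
proof -
  define W where "W = {p \<in> annulus r \<times> UNIV. F (fst p) (snd p) \<noteq> 0}"
  have W: "open W"
    using continuous_open_preimage[OF sm_cont[OF F] open_Times[OF open_annulus open_UNIV], of "- {0}"]
    unfolding W_def vimage_def Int_def by auto
  have "compact (circ \<times> {0..2 * pi})" "circ \<times> {0..2 * pi} \<subseteq> W"
    using nz circ_subset_annulus[OF r] unfolding W_def by (auto intro: compact_Times)
  then obtain e where e: "e > 0" "(\<Union>x\<in>circ \<times> {0..2 * pi}. ball x e) \<subseteq> W"
    using compact_subset_open_imp_ball_epsilon_subset[OF _ W] by blast
  have "F z x \<noteq> 0" if s: "1 < s" "s < min r (1 + e)" and z: "z \<in> annulus s" for s z x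
  proof -
    have zr: "z \<in> annulus r" "z \<in> annulus (1 + e)" using annulus_mono[of s r] annulus_mono[of s "1 + e"] s z by auto
    obtain y where y: "0 \<le> y" "y \<le> 2 * pi" "F z y = F z x"
      using periodic_int[of "F z" x] per[OF zr(1)] by blast
    have "(z, y) \<in> ball (sgn z, y) e"
      using annulus_near_circ(2)[OF e(1) zr(2)] by (simp add: dist_Pair_Pair)
    then have "(z, y) \<in> W"
      using e(2) annulus_near_circ(1)[OF e(1) zr(2)] y by force
    then show ?thesis using y unfolding W_def by simp
  qed
  then show ?thesis unfolding eventually_at_right_field using e(1) r
    by (intro exI[of _ "min r (1 + e)"]) auto
qed

text \<open>Liouville's theorem on the sphere in terms of coefficients: the expansion at 0 forbids
  negative exponents and the one at infinity forbids positive ones, so only the constant term is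
  left.\<close>

lemma ball_liouville:
  assumes r: "r > 1" and v: "v holomorphic_on ball 0 r" and w: "w holomorphic_on ball 0 r"
    and eq: "\<And>z. z \<in> circ \<Longrightarrow> v z = w (inverse z)" and z: "z \<in> ball 0 r"
  shows "v z = w 0"
proof -
  have c: "coeff v k = coeff w (- k)" for k
    using coeff_cong[of v "\<lambda>z. w (inverse z)" k] eq coeff_inverse[of w k] by simp
  have "coeff v k = 0" if "k \<noteq> 0" for k
  proof (cases "k < 0")
    case True then show ?thesis by (simp add: coeff_holomorphic[OF v r])
  next
    case False then show ?thesis using that c by (simp add: coeff_holomorphic[OF w r])
  qed
  note c0 = this
  have "((\<lambda>k. coeff v k * z powi k) has_sum coeff v 0) {0}"
    using has_sum_finite[of "{0 :: int}" "\<lambda>k. coeff v k * z powi k"] by simp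
  then have "((\<lambda>k. coeff v k * z powi k) has_sum coeff v 0) {0..}"
    by (rule has_sum_cong_neutral[THEN iffD1, rotated -1]) (use c0 in auto)
  then have "v z = coeff v 0"
    using has_sum_holomorphic[OF v r z] has_sum_unique by blast
  then show ?thesis using c[of 0] by (simp add: coeff_holomorphic[OF w r])
qed

lemma proj_split_0:
  assumes r: "r > 1" and J: "open J" and f: "sm (annulus r) J f" and zx: "z \<in> ball 0 r" "x \<in> J"
  shows "proj {0..} f z x = proj {0..} f 0 x + proj {1..} f z x"
proof -
  have "((\<lambda>k. coeff (\<lambda>z. f z x) k * z powi k) has_sum coeff (\<lambda>z. f z x) 0) {0}"
    using has_sum_finite[of "{0 :: int}" "\<lambda>k. coeff (\<lambda>z. f z x) k * z powi k"] by simp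
  from has_sum_Diff[OF proj_nonneg(3)[OF r J f zx] this]
  have "((\<lambda>k. coeff (\<lambda>z. f z x) k * z powi k) has_sum proj {0..} f z x - coeff (\<lambda>z. f z x) 0) ({0..} - {0})"
    by simp
  moreover have "{0..} - {0} = {1 :: int..}" by auto
  ultimately have "proj {1..} f z x = proj {0..} f z x - coeff (\<lambda>z. f z x) 0"
    using proj_eqI[where f = f and A = "{1..}"] by metis
  then show ?thesis by (simp add: proj_at_0[OF r J])
qed

lemma LM1_D:
  assumes "(l, lb) \<in> LM1"
  shows "\<forall>\<^sub>F r in at_right 1. mil r UNIV 0 (\<lambda>z x. l z x - z)"
    and "\<forall>\<^sub>F r in at_right 1. pol r UNIV (-1) lb"
    and "\<forall>\<^sub>F r in at_right 1. \<forall>z\<in>exterior r. \<forall>x. l z (x + 2 * pi) = l z x"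
    and "\<forall>\<^sub>F r in at_right 1. \<forall>z\<in>pball r. \<forall>x. lb z (x + 2 * pi) = lb z x"
    and "winds (\<lambda>z. l z x + lb z x) 1" "winds (\<lambda>z. l z x) 1" "winds (\<lambda>z. lb z x) (-1)"
proof -
  have T: "smooth_Dinf (\<lambda>z x. l z x - z)" "smooth_zinvD0 lb"
    "periodic_near Dinf (\<lambda>z x. l z x - z)" "periodic_near D0p lb"
    using assms unfolding LM1_def TLM_def smooth_vectors_def periodic_vectors_def by auto
  show "\<forall>\<^sub>F r in at_right 1. mil r UNIV 0 (\<lambda>z x. l z x - z)" using T smooth_Dinf_iff by blast
  show "\<forall>\<^sub>F r in at_right 1. pol r UNIV (-1) lb" using T smooth_zinvD0_iff by blast
  show "\<forall>\<^sub>F r in at_right 1. \<forall>z\<in>exterior r. \<forall>x. l z (x + 2 * pi) = l z x"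
    using T(3) unfolding periodic_near_def eq_near_exterior by (simp add: fun_eq_iff)
  show "\<forall>\<^sub>F r in at_right 1. \<forall>z\<in>pball r. \<forall>x. lb z (x + 2 * pi) = lb z x"
    using T(4) unfolding periodic_near_def eq_near_pball by (simp add: fun_eq_iff)
  show "winds (\<lambda>z. l z x + lb z x) 1" "winds (\<lambda>z. l z x) 1" "winds (\<lambda>z. lb z x) (-1)"
    using assms unfolding LM1_def M1_def by auto
qed

text \<open>As \<open>th\<close> fixes the leading term \<open>z\<close> of \<lambda>, the
  difference \<open>th l - l\<close> stays bounded at infinity, and so does \<open>dx l\<close>.
  Both are used to compute the residue that enters the second Poisson structure.\<close>

lemma l_mil:
  assumes "r > 1" "mil r UNIV 0 (\<lambda>z x. l z x - z)"
  shows "mil r UNIV 1 l" and "mil r UNIV 0 (dx l)" and "mil r UNIV 0 (\<lambda>z x. th l z x - l z x)"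
    and "sm (exterior r) UNIV l"
proof -
  note r = assms(1) open_UNIV[where 'a = real]
  interpret D: domain_pair "exterior r" UNIV by unfold_locales (auto simp: open_exterior)
  have "mil r UNIV 1 (\<lambda>z x. z)"
    unfolding mil_def[OF r] by (rule polI[OF r sm_const[of _ _ 1]]) (auto simp: power_int_minus)
  from mil_add[OF r mil_mono[OF r assms(2)] this] show m: "mil r UNIV 1 l" by simp
  show l: "sm (exterior r) UNIV l" by (rule mil_sm[OF r m])
  note z = sm_z[of UNIV "exterior r"] 
  show "mil r UNIV 0 (dx l)"
  proof (rule mil_cong[OF r mil_dx[OF r assms(2)]])
    show "dx (\<lambda>z x. l z x - z) z x = dx l z x" if "z \<in> exterior r" for z x
      using D.dx_diff[OF that _ l z] dx_eqI[where f = "\<lambda>z x. z" and D = 0 and z = z and x = x] by simp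
  qed
  show "mil r UNIV 0 (\<lambda>z x. th l z x - l z x)"
  proof (rule mil_cong[OF r mil_diff[OF r mil_th[OF r assms(2)] assms(2)]])
    show "th (\<lambda>z x. l z x - z) z x - (l z x - z) = th l z x - l z x" if "z \<in> exterior r" for z x
    proof -
      have "th (\<lambda>z x. z) z x = z"
        unfolding th_def by (subst dz_eqI[where f = "\<lambda>z x. z" and D = 1]) auto
      then show ?thesis using D.th_diff[OF that _ l z, of x] by simp
    qed
  qed
qed

text \<open>\<open>F\<close> is one of \<lambda>/z, (\<lambda> + \<lambda>b)/z and z \<lambda>b.
  Multiplication by the power of \<open>z\<close> with exponent 1, 1 or -1 restores the function
  whose winding number is prescribed in \<open>M1\<close>.\<close>

lemma log_annulus:
  assumes F: "\<forall>\<^sub>F r in at_right 1. sm (annulus r) UNIV F"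
    and per: "\<forall>\<^sub>F r in at_right 1. \<forall>z\<in>annulus r. \<forall>x. F z (x + 2 * pi) = F z x"
    and w: "\<And>x. winds (\<lambda>z. F z x * z powi n) n"
  obtains h where "\<forall>\<^sub>F r in at_right 1. sm (annulus r) UNIV h \<and> (\<forall>z\<in>annulus r. \<forall>x. exp (h z x) = F z x)"
proof -
  from eventually_conj[OF F per] obtain r where r: "r > 1" "sm (annulus r) UNIV F"
    "\<forall>z\<in>annulus r. \<forall>x. F z (x + 2 * pi) = F z x"
    by (rule obtain_radius) blast
  have nz: "F z x \<noteq> 0" if "z \<in> circ" for z x
    using w[of x] that unfolding winds_def by auto
  have "\<forall>\<^sub>F s in at_right 1. \<forall>z\<in>annulus s. \<forall>x. F z x \<noteq> 0"
    by (rule eventually_nonzero[OF r(1,2) _ nz]) (use r(3) in auto)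
  from eventually_conj[OF this F] obtain s where s: "s > 1" "sm (annulus s) UNIV F"
    "\<forall>z\<in>annulus s. \<forall>x. F z x \<noteq> 0"
    by (rule obtain_radius) blast
  obtain g where g: "continuous_on (annulus s \<times> UNIV) g"
    "\<And>p. p \<in> annulus s \<times> UNIV \<Longrightarrow> F (fst p) (snd p) = exp (g p)"
  proof (rule continuous_logarithm_annulus[OF s(1) sm_cont[OF s(2)]])
    show "winding_number (\<lambda>t. F (fst (circlepath 0 1 t, 0)) (snd (circlepath 0 1 t, 0)) * circlepath 0 1 t powi n) 0 = of_int n"
      using w[of 0] unfolding winds_def by (simp add: o_def)
  qed (use s in auto)
  define h where "h z x = g (z, x)" for z x
  have e: "exp (h z x) = F z x" if "z \<in> annulus s" for z x
    using g(2)[of "(z, x)"] that unfolding h_def by simp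
  have h: "sm (annulus s) UNIV h"
    by (rule sm_log[OF open_annulus open_UNIV s(2)]) (use g(1) e in \<open>auto simp: h_def\<close>)
  have "sm (annulus q) UNIV h \<and> (\<forall>z\<in>annulus q. \<forall>x. exp (h z x) = F z x)" if "1 < q" "q < s" for q
    using annulus_mono[of q s] that e sm_subset[OF h] by auto
  then show ?thesis using s(1) by (intro that[of h]) (auto simp: eventually_at_right_field)
qed

text \<open>The branches on the circle come directly from \<open>log_annulus\<close>. The branch
  \<open>l0\<close> must extend to the whole exterior and vanish at infinity: it is cut out of a
  logarithm on the annulus by a projection, and Liouville's argument shows that the projection still
  exponentiates to \<lambda>/z.\<close>

lemma exists_log_branch:
  assumes "L \<in> LM1"
  shows "\<exists>B. log_branch L B"
proof -
  obtain l lb where L: "L = (l, lb)" by (cases L)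
  note D = LM1_D[OF assms[unfolded L]]
  have gt: "\<forall>\<^sub>F r in at_right (1::real). r > 1" by (rule eventually_at_right_less)
  have l: "\<forall>\<^sub>F r in at_right 1. sm (annulus r) UNIV l"
    using D(1) gt by eventually_elim (rule sm_subset[OF l_mil(4)], auto simp: annulus_eq)
  have lb: "\<forall>\<^sub>F r in at_right 1. sm (annulus r) UNIV lb"
    using D(2) gt by eventually_elim (rule sm_subset[OF pol_sm[OF _ open_UNIV]], auto simp: annulus_eq)
  have zz: "\<forall>\<^sub>F r in at_right 1. sm (annulus r) UNIV (\<lambda>z x. inverse z)"
    using gt
  proof eventually_elim
    case (elim r)
    then have "z \<noteq> 0" if "z \<in> annulus r" for z using annulus_nz[of r z] that by linarith
    then show ?case by (intro sm_inverse[OF open_UNIV sm_z[OF open_UNIV]])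
  qed
  have lp: "\<forall>\<^sub>F r in at_right 1. \<forall>z\<in>annulus r. \<forall>x. l z (x + 2 * pi) = l z x"
    using D(3) gt by eventually_elim (use annulus_eq in auto)
  have lbp: "\<forall>\<^sub>F r in at_right 1. \<forall>z\<in>annulus r. \<forall>x. lb z (x + 2 * pi) = lb z x"
    using D(4) gt by eventually_elim (use annulus_eq in auto)
  have wcong: "winds f n \<Longrightarrow> (\<And>z. z \<in> circ \<Longrightarrow> f z = g z) \<Longrightarrow> winds g n" for f g n
  proof -
    assume w: "winds f n" and e: "\<And>z. z \<in> circ \<Longrightarrow> f z = g z"
    have "f \<circ> circlepath 0 1 = g \<circ> circlepath 0 1"
      by (rule ext) (simp add: e circlepath norm_exp)
    then show "winds g n" using w e unfolding winds_def by simp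
  qed
  have z0: "z \<noteq> 0" if "z \<in> circ" for z :: complex using that by auto
  obtain h where h: "\<forall>\<^sub>F r in at_right 1. sm (annulus r) UNIV h \<and> (\<forall>z\<in>annulus r. \<forall>x. exp (h z x) = l z x * inverse z)"
  proof (rule log_annulus[where F = "\<lambda>z x. l z x * inverse z" and n = 1])
    show "\<forall>\<^sub>F r in at_right 1. sm (annulus r) UNIV (\<lambda>z x. l z x * inverse z)"
      using l zz by eventually_elim (rule sm_mult[OF open_UNIV])
    show "\<forall>\<^sub>F r in at_right 1. \<forall>z\<in>annulus r. \<forall>x. l z (x + 2 * pi) * inverse z = l z x * inverse z"
      using lp by eventually_elim auto
    show "winds (\<lambda>z. l z x * inverse z * z powi 1) 1" for x
      by (rule wcong[OF D(6)[of x]]) (use z0 in auto)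
  qed
  obtain l1 where l1: "\<forall>\<^sub>F r in at_right 1. sm (annulus r) UNIV l1 \<and>
      (\<forall>z\<in>annulus r. \<forall>x. exp (l1 z x) = (l z x + lb z x) * inverse z)"
  proof (rule log_annulus[where F = "\<lambda>z x. (l z x + lb z x) * inverse z" and n = 1])
    show "\<forall>\<^sub>F r in at_right 1. sm (annulus r) UNIV (\<lambda>z x. (l z x + lb z x) * inverse z)"
      using l lb zz by eventually_elim (intro sm_mult[OF open_UNIV] sm_add[OF open_UNIV])
    show "\<forall>\<^sub>F r in at_right 1. \<forall>z\<in>annulus r. \<forall>x.
        (l z (x + 2 * pi) + lb z (x + 2 * pi)) * inverse z = (l z x + lb z x) * inverse z"
      using lp lbp by eventually_elim auto
    show "winds (\<lambda>z. (l z x + lb z x) * inverse z * z powi 1) 1" for x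
      by (rule wcong[OF D(5)[of x]]) (use z0 in auto)
  qed
  obtain l2 where l2: "\<forall>\<^sub>F r in at_right 1. sm (annulus r) UNIV l2 \<and> (\<forall>z\<in>annulus r. \<forall>x. exp (l2 z x) = z * lb z x)"
  proof (rule log_annulus[where F = "\<lambda>z x. z * lb z x" and n = "-1"])
    show "\<forall>\<^sub>F r in at_right 1. sm (annulus r) UNIV (\<lambda>z x. z * lb z x)"
      using lb by eventually_elim (intro sm_mult[OF open_UNIV] sm_z[OF open_UNIV])
    show "\<forall>\<^sub>F r in at_right 1. \<forall>z\<in>annulus r. \<forall>x. z * lb z (x + 2 * pi) = z * lb z x"
      using lbp by eventually_elim auto
    show "winds (\<lambda>z. z * lb z x * z powi (-1)) (-1)" for x
      by (rule wcong[OF D(7)[of x]]) (use z0 in \<open>auto simp: power_int_minus\<close>)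
  qed
  from eventually_conj[OF h D(1)] obtain r where r: "r > 1" and "(sm (annulus r) UNIV h \<and>
      (\<forall>z\<in>annulus r. \<forall>x. exp (h z x) = l z x * inverse z)) \<and> mil r UNIV 0 (\<lambda>z x. l z x - z)"
    by (rule obtain_radius)
  then have rh: "sm (annulus r) UNIV h" "\<And>z x. z \<in> annulus r \<Longrightarrow> exp (h z x) = l z x * inverse z"
    and rl: "mil r UNIV 0 (\<lambda>z x. l z x - z)" by auto
  note rJ = r open_UNIV[where 'a = real]
  from rl obtain g where g: "sm (ball 0 r) UNIV g"
    "\<And>z x. z \<in> pball r \<Longrightarrow> l (inverse z) x - inverse z = g z x"
    unfolding mil_def[OF rJ] pol_def[OF rJ] by auto
  define hI where "hI = (\<lambda>z x. h (inverse z) x)"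
  have hI: "sm (annulus r) UNIV hI" unfolding hI_def by (rule sm_reflect[OF rJ rh(1)])
  note hp = proj_nonneg(1)[OF rJ hI]
  have hIe: "exp (hI z x) = 1 + z * g z x" if "z \<in> annulus r" for z x
  proof -
    have i: "inverse z \<in> annulus r" "z \<in> pball r" "z \<noteq> 0"
      using inverse_annulus[of r z] annulus_eq[of r] that r by auto
    show ?thesis
      unfolding hI_def rh(2)[OF i(1)] using g(2)[OF i(2), of x] i(3) by (simp add: field_simps eq_diff_eq)
  qed
  \<comment> \<open>In the coordinate 1/z, dividing \<lambda>/z by the exponential of the
    nonnegative part leaves the exponential of the negative part. The former is holomorphic inside,
    the latter outside with value 1 at infinity, so both equal 1.\<close>
  have u: "1 + z * g z x = exp (proj {0..} hI z x)" if z: "z \<in> ball 0 r" for z x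
  proof -
    have m: "pol r UNIV 1 (\<lambda>z x. proj {..-1} hI (inverse z) x)"
      using mil_proj[OF rJ hI, of "-1"] unfolding mil_def[OF rJ] by simp
    then obtain k where k: "sm (ball 0 r) UNIV k" "\<And>z x. z \<in> pball r \<Longrightarrow> proj {..-1} hI (inverse z) x = z * k z x"
      unfolding pol_def[OF rJ] by auto
    have "(1 + z * g z x) * exp (- proj {0..} hI z x) = exp (0 * k 0 x)"
    proof (rule ball_liouville[OF r, where v = "\<lambda>z. (1 + z * g z x) * exp (- proj {0..} hI z x)" and w = "\<lambda>z. exp (z * k z x)"])
      show "(\<lambda>z. (1 + z * g z x) * exp (- proj {0..} hI z x)) holomorphic_on ball 0 r"
        by (intro holomorphic_intros sm_hol[OF g(1)] sm_hol[OF hp] UNIV_I)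
      show "(\<lambda>z. exp (z * k z x)) holomorphic_on ball 0 r"
        by (intro holomorphic_intros sm_hol[OF k(1)] UNIV_I)
      fix z :: complex assume z: "z \<in> circ"
      then have za: "z \<in> annulus r" "inverse z \<in> pball r"
        using circ_subset_annulus[OF r] r by (auto simp: norm_inverse)
      have "{..<0} = {..-1 :: int}" by auto
      with laurent[OF rJ hI za(1), of x 0] have "hI z x = proj {0..} hI z x + proj {..-1} hI z x" by simp
      moreover have "proj {..-1} hI z x = inverse z * k (inverse z) x" using k(2)[OF za(2)] by simp
      ultimately show "(1 + z * g z x) * exp (- proj {0..} hI z x) = exp (inverse z * k (inverse z) x)"
        unfolding hIe[OF za(1), symmetric] by (simp add: exp_add exp_minus)
    qed (rule z)
    then show ?thesis by (simp add: exp_minus field_simps)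
  qed
  \<comment> \<open>The constant term of the logarithm is a multiple of 2 pi i because \<lambda>/z
    tends to 1 at infinity; dropping it normalises the branch.\<close>
  define l0 where "l0 z x = proj {1..} hI (inverse z) x" for z x
  have l0m: "mil r UNIV (-1) l0"
    unfolding mil_def[OF rJ] l0_def using pol_proj[OF rJ hI, of 1] by simp
  have l0e: "exp (l0 z x) = l z x / z" if "z \<in> exterior r" for z x
  proof -
    have z: "inverse z \<in> pball r" "z \<noteq> 0" using inverse_pball_iff[of r z] r that by (auto simp: exterior_def)
    have "exp (proj {0..} hI 0 x) = 1" using u[of 0 x] r by simp
    then have "exp (l0 z x) = exp (proj {0..} hI (inverse z) x)"
      using proj_split_0[OF rJ hI, of "inverse z" x] z unfolding l0_def by (simp add: exp_add)
    also have "\<dots> = 1 + inverse z * g (inverse z) x" using u[of "inverse z" x] z by simp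
    also have "\<dots> = l z x / z" using g(2)[OF z(1), of x] z(2) by (simp add: field_simps)
    finally show ?thesis .
  qed
  have "smooth_zinvDinf l0"
    unfolding smooth_zinvDinf_def
  proof -
    from l0m obtain g where g: "sm (ball 0 r) UNIV g" "\<And>z x. z \<in> pball r \<Longrightarrow> l0 (inverse z) x = z * g z x"
      unfolding mil_def[OF rJ] pol_def[OF rJ] by auto
    have "l0 z = (\<lambda>x. g (inverse z) x / z)" if "z \<in> exterior r" for z
      using g(2)[of "inverse z"] inverse_pball_iff[of r z] r that by (auto simp: divide_inverse fun_eq_iff)
    then have "eq_near Dinf l0 (\<lambda>z x. g (inverse z) x / z)"
      unfolding eq_near_def using open_exterior domain_subsets[OF r] by blast
    moreover have "smooth_fam D0 g" unfolding smooth_fam_iff using g(1) domain_subsets[OF r] by blast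
    ultimately show "\<exists>g. smooth_fam D0 g \<and> eq_near Dinf l0 (\<lambda>z x. g (inverse z) x / z)" by blast
  qed
  moreover have "eq_near Dinf (\<lambda>z x. exp (l0 z x)) (\<lambda>z x. l z x / z)"
    unfolding eq_near_def using open_exterior domain_subsets(4)[OF r] l0e by (intro exI[of _ "exterior r"]) auto
  moreover have "smooth_fam circ l1" "eq_near circ (\<lambda>z x. exp (l1 z x)) (\<lambda>z x. (l z x + lb z x) / z)"
    using l1 unfolding smooth_fam_circ_iff eq_near_annulus by (auto elim!: eventually_mono simp: divide_inverse)
  moreover have "smooth_fam circ l2" "eq_near circ (\<lambda>z x. exp (l2 z x)) (\<lambda>z x. z * lb z x)"
    using l2 unfolding smooth_fam_circ_iff eq_near_annulus by (auto elim!: eventually_mono)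
  ultimately show ?thesis unfolding L by (intro exI[of _ "(l0, l1, l2)"]) simp
qed

section \<open>Expressions in the Lax functions\<close>

text \<open>A syntax closed under \<open>\<partial>/\<partial>\<lambda>\<close> and \<open>\<partial>/\<partial>\<lambda>b\<close> and containing all \<open>Q\<^bsub>a,p\<^esub>\<close>. \<open>G1\<close> and \<open>G2\<close> stand
  for \<open>log (1 + \<lambda>b/\<lambda>)\<close> and \<open>log (\<lambda>b (\<lambda> + \<lambda>b))\<close>.\<close>

datatype qx = Cn complex | VL | VB | IL | IB | WP int | G1 | G2 | Ad qx qx | Mu qx qx | Pw qx nat

primrec qev :: "qx \<Rightarrow> complex \<Rightarrow> complex \<Rightarrow> complex \<Rightarrow> complex \<Rightarrow> complex" where
  "qev (Cn c) l b g h = c"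
| "qev VL l b g h = l"
| "qev VB l b g h = b"
| "qev IL l b g h = inverse l"
| "qev IB l b g h = inverse b"
| "qev (WP k) l b g h = (l + b) powi k"
| "qev G1 l b g h = g"
| "qev G2 l b g h = h"
| "qev (Ad e f) l b g h = qev e l b g h + qev f l b g h"
| "qev (Mu e f) l b g h = qev e l b g h * qev f l b g h"
| "qev (Pw e n) l b g h = qev e l b g h ^ n"

text \<open>At exponent 0 the truncated \<open>n - 1\<close> in the case \<open>Pw\<close> is
  harmless, since the coefficient is 0. The case \<open>G1\<close> reads log (1 +
  \<lambda>b/\<lambda>) as log (\<lambda> + \<lambda>b) - log \<lambda>.\<close>

primrec dl :: "qx \<Rightarrow> qx" where
  "dl (Cn c) = Cn 0"
| "dl VL = Cn 1"
| "dl VB = Cn 0"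
| "dl IL = Mu (Cn (-1)) (Mu IL IL)"
| "dl IB = Cn 0"
| "dl (WP k) = Mu (Cn (of_int k)) (WP (k - 1))"
| "dl G1 = Ad (WP (-1)) (Mu (Cn (-1)) IL)"
| "dl G2 = WP (-1)"
| "dl (Ad e f) = Ad (dl e) (dl f)"
| "dl (Mu e f) = Ad (Mu (dl e) f) (Mu e (dl f))"
| "dl (Pw e n) = Mu (Mu (Cn (of_nat n)) (Pw e (n - 1))) (dl e)"

primrec db :: "qx \<Rightarrow> qx" where
  "db (Cn c) = Cn 0"
| "db VL = Cn 0"
| "db VB = Cn 1"
| "db IL = Cn 0"
| "db IB = Mu (Cn (-1)) (Mu IB IB)"
| "db (WP k) = Mu (Cn (of_int k)) (WP (k - 1))"
| "db G1 = WP (-1)"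
| "db G2 = Ad (WP (-1)) IB"
| "db (Ad e f) = Ad (db e) (db f)"
| "db (Mu e f) = Ad (Mu (db e) f) (Mu e (db f))"
| "db (Pw e n) = Mu (Mu (Cn (of_nat n)) (Pw e (n - 1))) (db e)"

text \<open>Equality of mixed partial derivatives is needed twice: the brackets with the gradient
  cancel by it, and it lets \<open>dx\<close> commute with differentiation along a line.\<close>

lemma qev_schwarz: "qev (dl (db e)) l b g h = qev (db (dl e)) l b g h"
  by (induction e) (simp_all add: algebra_simps)

text \<open>Stated with Frechet derivatives over a normed space, so that one induction covers both
  the real variable \<open>x\<close> and the complex variable \<open>z\<close>. The assumptions on
  \<open>g\<close> and \<open>h\<close> are the derivatives of the two logarithms.\<close>

lemma qev_has_derivative:
  fixes l b g h :: "'a :: real_normed_vector \<Rightarrow> complex"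
  assumes l: "(l has_derivative l') (at x)" and b: "(b has_derivative b') (at x)"
    and g: "(g has_derivative (\<lambda>t. (l' t + b' t) / (l x + b x) - l' t / l x)) (at x)"
    and h: "(h has_derivative (\<lambda>t. b' t / b x + (l' t + b' t) / (l x + b x))) (at x)"
    and nz: "l x \<noteq> 0" "b x \<noteq> 0" "l x + b x \<noteq> 0"
  shows "((\<lambda>x. qev e (l x) (b x) (g x) (h x)) has_derivative
    (\<lambda>t. qev (dl e) (l x) (b x) (g x) (h x) * l' t + qev (db e) (l x) (b x) (g x) (h x) * b' t)) (at x)"
proof (induction e)
  case IL
  show ?case using Deriv.has_derivative_inverse[OF nz(1) l] by (simp add: mult_ac)
next
  case IB
  show ?case using Deriv.has_derivative_inverse[OF nz(2) b] by (simp add: mult_ac)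
next
  case (WP k)
  show ?case using has_derivative_power_int[OF nz(3) has_derivative_add[OF l b], of k]
    by (simp add: algebra_simps)
next
  case (Mu e f)
  show ?case using has_derivative_mult[OF Mu] by (simp add: algebra_simps)
next
  case (Pw e n)
  show ?case using has_derivative_power[OF Pw, of n] by (simp add: algebra_simps)
next
  case (Ad e f)
  show ?case using has_derivative_add[OF Ad] by (simp add: algebra_simps)
qed (use l b g h in \<open>simp_all add: power_int_minus divide_inverse algebra_simps\<close>)

section \<open>Expressions evaluated at states\<close>

fun ev :: "qx \<Rightarrow> state \<Rightarrow> fld" where
  "ev e ((l, lb), (l0, l1, l2)) = (\<lambda>z x. qev e (l z x) (lb z x) (l1 z x - l0 z x) (l2 z x + l1 z x))"

text \<open>Only the annulus is involved and the parameter set is arbitrary, so that slices of a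
  line of states, with the line parameter in place of \<open>x\<close>, are covered as well.\<close>

fun good :: "real \<Rightarrow> real set \<Rightarrow> state \<Rightarrow> bool" where
  "good r J ((l, lb), (l0, l1, l2)) \<longleftrightarrow>
     sm (annulus r) J l \<and> sm (annulus r) J lb \<and> sm (annulus r) J l0 \<and> sm (annulus r) J l1 \<and> sm (annulus r) J l2 \<and>
     (\<forall>z\<in>annulus r. \<forall>x\<in>J. exp (l0 z x) = l z x / z \<and> exp (l1 z x) = (l z x + lb z x) / z \<and> exp (l2 z x) = z * lb z x)"

lemma good_subset: "good r J St \<Longrightarrow> 0 < s \<Longrightarrow> s \<le> r \<Longrightarrow> I \<subseteq> J \<Longrightarrow> good s I St"
  using annulus_mono[of s r] by (cases "(s, I, St)" rule: good.cases) (auto intro: sm_subset)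

lemma log_rules:
  assumes U: "open U" and J: "open J" and f: "sm U J f" and g: "sm U J g"
    and e: "\<forall>z\<in>U. \<forall>x\<in>J. exp (g z x) = f z x" and z: "z \<in> U" and x: "x \<in> J"
  shows "dx g z x = dx f z x / f z x" "th g z x = th f z x / f z x"
proof -
  have e': "exp (g z x) = f z x" if "z \<in> U" "x \<in> J" for z x using e that by blast
  have nz: "f z x \<noteq> 0" using e'[OF z x] by (metis exp_not_eq_zero)
  show "dx g z x = dx f z x / f z x"
    by (rule dx_eqI, rule sm_log(2)[OF U J f sm_cont[OF g] e' z x])
  have "((\<lambda>w. exp (g w x)) has_field_derivative exp (g z x) * dz g z x) (at z)"
    by (rule DERIV_chain2[OF DERIV_exp sm_has_dz[OF g U z x]])
  moreover have "((\<lambda>w. exp (g w x)) has_field_derivative dz f z x) (at z)"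
    by (rule has_field_derivative_transform_within_open[OF sm_has_dz[OF f U z x] U z]) (simp add: e' x)
  ultimately have "f z x * dz g z x = dz f z x" using DERIV_unique e'[OF z x] by metis
  then show "th g z x = th f z x / f z x" using nz unfolding th_def by (simp add: field_simps)
qed

locale good_state =
  fixes r :: real and J :: "real set" and l lb l0 l1 l2 :: fld
  assumes r: "r > 1" and J: "open J" and good: "good r J ((l, lb), (l0, l1, l2))"
begin

sublocale domain_pair "annulus r" J by unfold_locales (use J open_annulus in auto)

abbreviation "St \<equiv> ((l, lb), (l0, l1, l2))"

lemma sms: "sm (annulus r) J l" "sm (annulus r) J lb" "sm (annulus r) J l0" "sm (annulus r) J l1" "sm (annulus r) J l2"
  using good by auto

lemma exps:
  assumes "z \<in> annulus r" "x \<in> J"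
  shows "exp (l0 z x) = l z x / z" "exp (l1 z x) = (l z x + lb z x) / z" "exp (l2 z x) = z * lb z x"
  using good assms by auto

lemma z_nz: "z \<in> annulus r \<Longrightarrow> z \<noteq> 0"
  using annulus_nz[of r z] r by linarith

lemma nz:
  assumes "z \<in> annulus r" "x \<in> J"
  shows "l z x \<noteq> 0" "lb z x \<noteq> 0" "l z x + lb z x \<noteq> 0"
  using exps[OF assms] exp_not_eq_zero by force+

lemma sm_inv_z: "sm (annulus r) J (\<lambda>z x. inverse z)"
  by (intro sm_inverse J sm_z z_nz)

text \<open>The summands -1, -1 and 1 come from the factors 1/z, 1/z and z under the logarithms;
  they cancel in the combinations \<open>l1 - l0\<close> and \<open>l2 + l1\<close>, the only ones
  that \<open>ev\<close> uses.\<close>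

lemma log_derivs:
  assumes z: "z \<in> annulus r" and x: "x \<in> J"
  shows "dx l0 z x = dx l z x / l z x" "th l0 z x = th l z x / l z x - 1"
    "dx l1 z x = (dx l z x + dx lb z x) / (l z x + lb z x)"
    "th l1 z x = (th l z x + th lb z x) / (l z x + lb z x) - 1"
    "dx l2 z x = dx lb z x / lb z x" "th l2 z x = th lb z x / lb z x + 1"
proof -
  note U = open_annulus[of r]
  have di: "dx (\<lambda>z x. inverse z) z x = 0" "dx (\<lambda>z x. z) z x = 0"
    by (rule dx_eqI, rule has_vector_derivative_const)+
  have ti: "th (\<lambda>z x. inverse z) z x = - inverse z"
    unfolding th_def using dz_eqI[where f = "\<lambda>z x. inverse z", OF DERIV_inverse[OF z_nz[OF z]]] z_nz[OF z]
    by (simp add: field_simps)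
  have tz: "th (\<lambda>z x. z) z x = z"
    unfolding th_def using dz_eqI[where f = "\<lambda>z x. z", OF DERIV_ident] by simp
  have s0: "sm (annulus r) J (\<lambda>z x. l z x * inverse z)" by (intro sm_mult J sms sm_inv_z)
  have s1: "sm (annulus r) J (\<lambda>z x. (l z x + lb z x) * inverse z)" by (intro sm_mult J sms sm_inv_z sm_add)
  have s2: "sm (annulus r) J (\<lambda>z x. z * lb z x)" by (intro sm_mult J sms sm_z)
  have e0: "\<forall>z\<in>annulus r. \<forall>x\<in>J. exp (l0 z x) = l z x * inverse z"
    "\<forall>z\<in>annulus r. \<forall>x\<in>J. exp (l1 z x) = (l z x + lb z x) * inverse z"
    "\<forall>z\<in>annulus r. \<forall>x\<in>J. exp (l2 z x) = z * lb z x"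
    using exps by (simp_all add: divide_inverse)
  note L0 = log_rules[OF U J s0 sms(3) e0(1) z x] and L1 = log_rules[OF U J s1 sms(4) e0(2) z x]
    and L2 = log_rules[OF U J s2 sms(5) e0(3) z x]
  note nz' = nz[OF z x] z_nz[OF z]
  have q: "(A * inverse z + F * 0) / (F * inverse z) = A / F"
      "(A * inverse z + F * - inverse z) / (F * inverse z) = A / F - 1"
      "(0 * F + z * A) / (z * F) = A / F" "(z * F + z * A) / (z * F) = A / F + 1" if "F \<noteq> 0" for A F
    using that z_nz[OF z] by (simp_all add: divide_simps) (simp_all add: algebra_simps)?
  show "dx l0 z x = dx l z x / l z x" "th l0 z x = th l z x / l z x - 1"
    using L0 unfolding dx_mult[OF z x sms(1) sm_inv_z] th_mult[OF z x sms(1) sm_inv_z] di ti q[OF nz'(1)] .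
  show "dx l1 z x = (dx l z x + dx lb z x) / (l z x + lb z x)"
    "th l1 z x = (th l z x + th lb z x) / (l z x + lb z x) - 1"
    using L1 unfolding dx_mult[OF z x sm_add[OF J sms(1,2)] sm_inv_z] th_mult[OF z x sm_add[OF J sms(1,2)] sm_inv_z]
      dx_add[OF z x sms(1,2)] th_add[OF z x sms(1,2)] di ti q[OF nz'(3)] .
  show "dx l2 z x = dx lb z x / lb z x" "th l2 z x = th lb z x / lb z x + 1"
    using L2 unfolding dx_mult[OF z x sm_z[OF J] sms(2)] th_mult[OF z x sm_z[OF J] sms(2)] di tz q[OF nz'(2)] .
qed

lemma sm_ev: "sm (annulus r) J (ev e St)"
proof (induction e)
  case (WP k)
  show ?case unfolding ev.simps qev.simps by (intro sm_powi sm_add J sms nz)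
qed (unfold ev.simps qev.simps, (intro sm_const sm_add sm_mult sm_inverse sm_diff sm_power J sms nz; simp)+)

lemma dx_ev:
  assumes z: "z \<in> annulus r" and x: "x \<in> J"
  shows "dx (ev e St) z x = ev (dl e) St z x * dx l z x + ev (db e) St z x * dx lb z x"
proof -
  have d: "(f z has_derivative (\<lambda>t. t *\<^sub>R dx f z x)) (at x)" if "sm (annulus r) J f" for f
    using sm_has_dx[OF that z x] unfolding has_vector_derivative_def .
  have "((\<lambda>x. qev e (l z x) (lb z x) (l1 z x - l0 z x) (l2 z x + l1 z x)) has_derivative
    (\<lambda>t. ev (dl e) St z x * (t *\<^sub>R dx l z x) + ev (db e) St z x * (t *\<^sub>R dx lb z x))) (at x)"
    unfolding ev.simps
  proof (rule qev_has_derivative[where l = "l z" and b = "lb z" and g = "\<lambda>x. l1 z x - l0 z x"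
        and h = "\<lambda>x. l2 z x + l1 z x" and l' = "\<lambda>t. t *\<^sub>R dx l z x" and b' = "\<lambda>t. t *\<^sub>R dx lb z x"])
    show "(l z has_derivative (\<lambda>t. t *\<^sub>R dx l z x)) (at x)" "(lb z has_derivative (\<lambda>t. t *\<^sub>R dx lb z x)) (at x)"
      by (rule d[OF sms(1)] d[OF sms(2)])+
    show "((\<lambda>x. l1 z x - l0 z x) has_derivative
       (\<lambda>t. (t *\<^sub>R dx l z x + t *\<^sub>R dx lb z x) / (l z x + lb z x) - t *\<^sub>R dx l z x / l z x)) (at x)"
      using has_derivative_diff[OF d[OF sms(4)] d[OF sms(3)]] unfolding log_derivs[OF z x]
      by (simp add: scaleR_right_distrib scaleR_conv_of_real add_divide_distrib distrib_left)
    show "((\<lambda>x. l2 z x + l1 z x) has_derivative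
       (\<lambda>t. t *\<^sub>R dx lb z x / lb z x + (t *\<^sub>R dx l z x + t *\<^sub>R dx lb z x) / (l z x + lb z x))) (at x)"
      using has_derivative_add[OF d[OF sms(5)] d[OF sms(4)]] unfolding log_derivs[OF z x]
      by (simp add: scaleR_right_distrib scaleR_conv_of_real add_divide_distrib distrib_left)
  qed (rule nz[OF z x])+
  then have "((\<lambda>x. qev e (l z x) (lb z x) (l1 z x - l0 z x) (l2 z x + l1 z x)) has_vector_derivative
      ev (dl e) St z x * dx l z x + ev (db e) St z x * dx lb z x) (at x)"
    unfolding has_vector_derivative_def by (simp add: scaleR_right_distrib)
  then show ?thesis by (intro dx_eqI) simp
qed

lemma th_ev:
  assumes z: "z \<in> annulus r" and x: "x \<in> J"
  shows "th (ev e St) z x = ev (dl e) St z x * th l z x + ev (db e) St z x * th lb z x"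
proof -
  have d: "((\<lambda>z. f z x) has_derivative (\<lambda>t. th f z x / z * t)) (at z)" if "sm (annulus r) J f" for f
    using sm_has_dz[OF that open_annulus z x] z_nz[OF z] unfolding has_field_derivative_def th_def by simp
  have "((\<lambda>z. qev e (l z x) (lb z x) (l1 z x - l0 z x) (l2 z x + l1 z x)) has_derivative
    (\<lambda>t. ev (dl e) St z x * (th l z x / z * t) + ev (db e) St z x * (th lb z x / z * t))) (at z)"
    unfolding ev.simps
  proof (rule qev_has_derivative[where l = "\<lambda>z. l z x" and b = "\<lambda>z. lb z x" and g = "\<lambda>z. l1 z x - l0 z x"
        and h = "\<lambda>z. l2 z x + l1 z x" and l' = "\<lambda>t. th l z x / z * t" and b' = "\<lambda>t. th lb z x / z * t"])
    show "((\<lambda>z. l z x) has_derivative (\<lambda>t. th l z x / z * t)) (at z)"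
      "((\<lambda>z. lb z x) has_derivative (\<lambda>t. th lb z x / z * t)) (at z)"
      by (rule d[OF sms(1)] d[OF sms(2)])+
    show "((\<lambda>z. l1 z x - l0 z x) has_derivative
       (\<lambda>t. (th l z x / z * t + th lb z x / z * t) / (l z x + lb z x) - th l z x / z * t / l z x)) (at z)"
      using has_derivative_diff[OF d[OF sms(4)] d[OF sms(3)]] unfolding log_derivs[OF z x]
      by (rule has_derivative_eq_rhs) (auto simp: fun_eq_iff divide_inverse algebra_simps)
    show "((\<lambda>z. l2 z x + l1 z x) has_derivative
       (\<lambda>t. th lb z x / z * t / lb z x + (th l z x / z * t + th lb z x / z * t) / (l z x + lb z x))) (at z)"
      using has_derivative_add[OF d[OF sms(5)] d[OF sms(4)]] unfolding log_derivs[OF z x]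
      by (rule has_derivative_eq_rhs) (auto simp: fun_eq_iff divide_inverse algebra_simps)
  qed (rule nz[OF z x])+
  then have "((\<lambda>z. qev e (l z x) (lb z x) (l1 z x - l0 z x) (l2 z x + l1 z x)) has_field_derivative
      (ev (dl e) St z x * th l z x + ev (db e) St z x * th lb z x) / z) (at z)"
    unfolding has_field_derivative_def
    by (rule has_derivative_eq_rhs) (auto simp: fun_eq_iff divide_inverse algebra_simps)
  then have "dz (ev e St) z x = (ev (dl e) St z x * th l z x + ev (db e) St z x * th lb z x) / z"
    by (intro dz_eqI) simp
  then show ?thesis unfolding th_def[of "ev e St"] using z_nz[OF z] by simp
qed

text \<open>Each of the three functions is multiplied by a factor 1 + F with F smaller than 1. The
  factor stays in the right half plane, where the principal logarithm is continuous, so adding it to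
  the old branch gives a branch for the new function.\<close>

lemma good_perturb:
  assumes P: "sm (annulus r) J P" and R: "sm (annulus r) J R"
    and small: "\<And>z x. z \<in> annulus r \<Longrightarrow> x \<in> J \<Longrightarrow> norm (P z x / l z x) < 1 \<and>
      norm ((P z x + R z x) / (l z x + lb z x)) < 1 \<and> norm (R z x / lb z x) < 1"
  shows "good r J ((\<lambda>z x. l z x + P z x, \<lambda>z x. lb z x + R z x),
    (\<lambda>z x. l0 z x + Ln (1 + P z x / l z x),
     \<lambda>z x. l1 z x + Ln (1 + (P z x + R z x) / (l z x + lb z x)),
     \<lambda>z x. l2 z x + Ln (1 + R z x / lb z x)))"
proof -
  have Ln: "sm (annulus r) J (\<lambda>z x. Ln (1 + F z x))" and n0: "\<And>z x. z \<in> annulus r \<Longrightarrow> x \<in> J \<Longrightarrow> 1 + F z x \<noteq> 0"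
    if F: "sm (annulus r) J F" and s: "\<And>z x. z \<in> annulus r \<Longrightarrow> x \<in> J \<Longrightarrow> norm (F z x) < 1" for F
  proof -
    have re: "Re (1 + F z x) > 0" if "z \<in> annulus r" "x \<in> J" for z x
      using s[OF that] abs_Re_le_cmod[of "F z x"] by auto
    show n: "1 + F z x \<noteq> 0" if "z \<in> annulus r" "x \<in> J" for z x
      using re[OF that] by force
    have F1: "sm (annulus r) J (\<lambda>z x. 1 + F z x)" by (intro sm_add J sm_const F)
    show "sm (annulus r) J (\<lambda>z x. Ln (1 + F z x))"
    proof (rule sm_log(1)[OF open_annulus J F1])
      show "continuous_on (annulus r \<times> J) (\<lambda>p. Ln (1 + F (fst p) (snd p)))"
        using re sm_cont[OF F1] by (intro continuous_on_Ln') (force simp: complex_nonpos_Reals_iff)+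
      show "exp (Ln (1 + F z x)) = 1 + F z x" if "z \<in> annulus r" "x \<in> J" for z x
        using n[OF that] by simp
    qed
  qed
  have F: "sm (annulus r) J (\<lambda>z x. P z x / l z x)" "sm (annulus r) J (\<lambda>z x. (P z x + R z x) / (l z x + lb z x))"
    "sm (annulus r) J (\<lambda>z x. R z x / lb z x)"
    by (intro sm_divide sm_add J P R sms nz; assumption)+
  have e: "exp (a + Ln (1 + F)) = exp a * (1 + F)" if "1 + F \<noteq> 0" for a F
    using that by (simp add: exp_add)
  show ?thesis
    unfolding good.simps
  proof (intro conjI ballI)
    fix z x assume zx: "z \<in> annulus r" "x \<in> J"
    have n: "1 + P z x / l z x \<noteq> 0" "1 + (P z x + R z x) / (l z x + lb z x) \<noteq> 0" "1 + R z x / lb z x \<noteq> 0"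
      by (rule n0[OF F(1) _ zx] n0[OF F(2) _ zx] n0[OF F(3) _ zx], use small in blast)+
    have q: "A / z * (1 + p / A) = (A + p) / z" "z * A * (1 + p / A) = z * (A + p)" if "A \<noteq> 0" for A p
      using that z_nz[OF zx(1)] by (simp_all add: field_simps)
    show "exp (l0 z x + Ln (1 + P z x / l z x)) = (l z x + P z x) / z"
      unfolding e[OF n(1)] exps[OF zx] q[OF nz(1)[OF zx]] ..
    show "exp (l1 z x + Ln (1 + (P z x + R z x) / (l z x + lb z x))) = (l z x + P z x + (lb z x + R z x)) / z"
      unfolding e[OF n(2)] exps[OF zx] q[OF nz(3)[OF zx]] by (simp add: add_ac)
    show "exp (l2 z x + Ln (1 + R z x / lb z x)) = z * (lb z x + R z x)"
      unfolding e[OF n(3)] exps[OF zx] q[OF nz(2)[OF zx]] ..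
  qed (use small in \<open>(intro sm_add J sms P R Ln F; blast)+\<close>)
qed

end

text \<open>For fixed \<open>x\<close>, the line \<open>s \<mapsto> shift s X St\<close> is itself a family with parameter \<open>s\<close> in the place
  of \<open>x\<close>, so that derivatives along the line are given by \<open>dx\<close>.\<close>

fun shifted_slice :: "real \<Rightarrow> fpair \<Rightarrow> state \<Rightarrow> state" where
  "shifted_slice x (X, Y) ((l, lb), (l0, l1, l2)) =
     ((\<lambda>z s. l z x + complex_of_real s * X z x, \<lambda>z s. lb z x + complex_of_real s * Y z x),
      (\<lambda>z s. l0 z x + Ln (1 + complex_of_real s * X z x / l z x),
       \<lambda>z s. l1 z x + Ln (1 + complex_of_real s * (X z x + Y z x) / (l z x + lb z x)),
       \<lambda>z s. l2 z x + Ln (1 + complex_of_real s * Y z x / lb z x)))"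

lemma ev_shift: "ev e (shift s (X, Y) ((l, lb), (l0, l1, l2))) z x = ev e (shifted_slice x (X, Y) ((l, lb), (l0, l1, l2))) z s"
  by simp

lemma shift_0: "shift 0 X St = St"
  by (cases "(0 :: real, X, St)" rule: shift.cases) simp

context good_state
begin

text \<open>Compactness bounds the three relative changes over a slightly smaller annulus and a
  bounded interval, so a single \<delta> serves every point there; this costs the passage from
  radius \<open>r\<close> to \<open>s\<close>.\<close>

lemma good_shift:
  assumes X: "sm (annulus r) J X" "sm (annulus r) J Y" and s: "1 < s" "s < r" and ab: "{a..b} \<subseteq> J"
  obtains \<delta> where "\<delta> > 0"
    "\<And>t. \<bar>t\<bar> < \<delta> \<Longrightarrow> good s {a<..<b} (shift t (X, Y) St)"
    "\<And>x. x \<in> {a..b} \<Longrightarrow> good s {-\<delta><..<\<delta>} (shifted_slice x (X, Y) St)"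
    "\<And>t z x. \<bar>t\<bar> < \<delta> \<Longrightarrow> z \<in> annulus s \<Longrightarrow> x \<in> {a..b} \<Longrightarrow>
      norm (complex_of_real t * X z x / l z x) < 1 \<and>
      norm (complex_of_real t * (X z x + Y z x) / (l z x + lb z x)) < 1 \<and>
      norm (complex_of_real t * Y z x / lb z x) < 1"
proof -
  \<comment> \<open>The closed annulus is compact and lies between the open annuli of radii
    \<open>s\<close> and \<open>r\<close>.\<close>
  define K where "K = {z :: complex. inverse s \<le> norm z \<and> norm z \<le> s}"
  have K: "compact (K \<times> {a..b})"
  proof (rule compact_Times)
    have "K = cball 0 s - ball 0 (inverse s)" unfolding K_def by auto
    then show "compact K" using compact_diff[OF compact_cball open_ball] by metis
  qed simp
  have sK: "annulus s \<subseteq> K" "K \<subseteq> annulus r"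
    unfolding annulus_def K_def using s less_le_trans[OF less_imp_inverse_less[of s r]] by auto
  have bd: "\<exists>B>0. \<forall>z\<in>K. \<forall>x\<in>{a..b}. norm (F z x) < B" if "sm (annulus r) J F" for F
  proof -
    have "continuous_on (K \<times> {a..b}) (\<lambda>p. F (fst p) (snd p))"
      by (rule continuous_on_subset[OF sm_cont[OF that]]) (use sK ab in auto)
    then have "bounded ((\<lambda>p. F (fst p) (snd p)) ` (K \<times> {a..b}))"
      using K compact_continuous_image compact_imp_bounded by blast
    then obtain B where B: "B > 0" "\<forall>y\<in>(\<lambda>p. F (fst p) (snd p)) ` (K \<times> {a..b}). norm y < B"
      unfolding bounded_pos_less by blast
    then have "norm (F z x) < B" if "z \<in> K" "x \<in> {a..b}" for z x
    proof -
      have "F z x \<in> (\<lambda>p. F (fst p) (snd p)) ` (K \<times> {a..b})"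
        using that by (intro image_eqI[of _ _ "(z, x)"]) auto
      then show ?thesis using B(2) by blast
    qed
    then show ?thesis using B(1) by blast
  qed
  have F: "sm (annulus r) J (\<lambda>z x. X z x / l z x)" "sm (annulus r) J (\<lambda>z x. (X z x + Y z x) / (l z x + lb z x))"
    "sm (annulus r) J (\<lambda>z x. Y z x / lb z x)"
    by (intro sm_divide sm_add J X sms nz; assumption)+
  from bd[OF F(1)] obtain B1 where B1: "B1 > 0" "\<forall>z\<in>K. \<forall>x\<in>{a..b}. norm (X z x / l z x) < B1" by blast
  from bd[OF F(2)] obtain B2 where B2: "B2 > 0"
    "\<forall>z\<in>K. \<forall>x\<in>{a..b}. norm ((X z x + Y z x) / (l z x + lb z x)) < B2" by blast
  from bd[OF F(3)] obtain B3 where B3: "B3 > 0" "\<forall>z\<in>K. \<forall>x\<in>{a..b}. norm (Y z x / lb z x) < B3" by blast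
  note B = B1(1) B2(1) B3(1)
  define \<delta> where "\<delta> = inverse (max B1 (max B2 B3))"
  have \<delta>: "\<delta> > 0" unfolding \<delta>_def using B by simp
  have lt: "norm (complex_of_real t * c) < 1" if "\<bar>t\<bar> < \<delta>" "norm c < C" "C = B1 \<or> C = B2 \<or> C = B3" for t c C
  proof -
    have C: "0 < C" "C \<le> inverse \<delta>" using that(3) B unfolding \<delta>_def by auto
    have "\<bar>t\<bar> * norm c \<le> \<bar>t\<bar> * C" using that by (intro mult_left_mono) auto
    also have "\<dots> \<le> \<bar>t\<bar> * inverse \<delta>" using C by (intro mult_left_mono) auto
    also have "\<dots> < 1" using that(1) \<delta> by (simp add: field_simps)
    finally show ?thesis by (simp add: norm_mult)
  qed
  have small: "norm (complex_of_real t * X z x / l z x) < 1 \<and>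
      norm ((complex_of_real t * X z x + complex_of_real t * Y z x) / (l z x + lb z x)) < 1 \<and>
      norm (complex_of_real t * Y z x / lb z x) < 1" if "\<bar>t\<bar> < \<delta>" "z \<in> annulus s" "x \<in> {a..b}" for t z x
  proof -
    have z: "z \<in> K" using that(2) sK by blast
    have "norm (complex_of_real t * (X z x / l z x)) < 1"
      by (rule lt[OF that(1), of _ B1]) (use B1(2) z that(3) in auto)
    moreover have "norm (complex_of_real t * ((X z x + Y z x) / (l z x + lb z x))) < 1"
      by (rule lt[OF that(1), of _ B2]) (use B2(2) z that(3) in auto)
    moreover have "norm (complex_of_real t * (Y z x / lb z x)) < 1"
      by (rule lt[OF that(1), of _ B3]) (use B3(2) z that(3) in auto)
    ultimately show ?thesis by (simp only: distrib_left[symmetric] times_divide_eq_right)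
  qed
  show ?thesis
  proof (rule that[OF \<delta>])
    show "norm (complex_of_real t * X z x / l z x) < 1 \<and>
      norm (complex_of_real t * (X z x + Y z x) / (l z x + lb z x)) < 1 \<and>
      norm (complex_of_real t * Y z x / lb z x) < 1" if "\<bar>t\<bar> < \<delta>" "z \<in> annulus s" "x \<in> {a..b}" for t z x
      using small[OF that] by (simp only: distrib_left)
    show "good s {a<..<b} (shift t (X, Y) St)" if t: "\<bar>t\<bar> < \<delta>" for t
    proof -
      have "{a<..<b} \<subseteq> J" using ab by auto
      then have g: "good s {a<..<b} St" using s by (intro good_subset[OF good]) auto
      interpret S: good_state s "{a<..<b}" l lb l0 l1 l2
        by unfold_locales (use s(1) g in simp_all)
      have sub: "annulus s \<subseteq> annulus r" "{a<..<b} \<subseteq> J" using sK ab by auto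
      have "good s {a<..<b} ((\<lambda>z x. l z x + complex_of_real t * X z x, \<lambda>z x. lb z x + complex_of_real t * Y z x),
        (\<lambda>z x. l0 z x + Ln (1 + complex_of_real t * X z x / l z x),
         \<lambda>z x. l1 z x + Ln (1 + (complex_of_real t * X z x + complex_of_real t * Y z x) / (l z x + lb z x)),
         \<lambda>z x. l2 z x + Ln (1 + complex_of_real t * Y z x / lb z x)))"
        by (rule S.good_perturb) (use small[OF t] in \<open>auto intro!: sm_mult sm_const sm_subset[OF X(1) sub] sm_subset[OF X(2) sub]\<close>)
      then show ?thesis by (simp only: shift.simps distrib_left)
    qed
    show "good s {-\<delta><..<\<delta>} (shifted_slice x (X, Y) St)" if x: "x \<in> {a..b}" for x
    proof -
      have xJ: "x \<in> J" using x ab by auto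
      have c: "sm (annulus s) {-\<delta><..<\<delta>} (\<lambda>z t. F z x)" if "sm (annulus r) J F" for F
        by (rule sm_hol_const[OF open_greaterThanLessThan holomorphic_on_subset[OF sm_hol[OF that xJ]]]) (use sK in auto)
      have e: "z \<in> annulus r" if "z \<in> annulus s" for z using that sK by auto
      interpret S: good_state s "{-\<delta><..<\<delta>}" "\<lambda>z t. l z x" "\<lambda>z t. lb z x" "\<lambda>z t. l0 z x" "\<lambda>z t. l1 z x" "\<lambda>z t. l2 z x"
        by unfold_locales (use s c[OF sms(1)] c[OF sms(2)] c[OF sms(3)] c[OF sms(4)] c[OF sms(5)] exps[OF e xJ] in auto)
      have "good s {-\<delta><..<\<delta>} ((\<lambda>z t. l z x + complex_of_real t * X z x, \<lambda>z t. lb z x + complex_of_real t * Y z x),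
        (\<lambda>z t. l0 z x + Ln (1 + complex_of_real t * X z x / l z x),
         \<lambda>z t. l1 z x + Ln (1 + (complex_of_real t * X z x + complex_of_real t * Y z x) / (l z x + lb z x)),
         \<lambda>z t. l2 z x + Ln (1 + complex_of_real t * Y z x / lb z x)))"
        by (rule S.good_perturb) (use small x in \<open>auto intro!: sm_mult sm_param c X\<close>)
      then show ?thesis by (simp only: shifted_slice.simps distrib_left)
    qed
  qed
qed

end

section \<open>Derivatives along lines\<close>

lemma has_vector_derivative_affine: "((\<lambda>t. a + complex_of_real t * b) has_vector_derivative b) (at t)"
proof -
  have "(complex_of_real has_vector_derivative 1) (at t)"
    using has_vector_derivative_of_real[OF DERIV_ident] by simp
  then have "((\<lambda>t. a + complex_of_real t * b) has_vector_derivative 0 + 1 * b) (at t)"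
    by (intro has_vector_derivative_add has_vector_derivative_const has_vector_derivative_mult_left)
  then show ?thesis by simp
qed

lemma dx_affine: "dx (\<lambda>z t. f z x + complex_of_real t * F z x) w t = F w x"
  by (rule dx_eqI, rule has_vector_derivative_affine)

lemma proj_slice: "(\<And>w. f w x = g w t) \<Longrightarrow> proj A f z x = proj A g z t"
  unfolding proj_def by simp

lemma th_slice: "(\<And>w. f w x = g w t) \<Longrightarrow> th f z x = th g z t"
  unfolding th_def dz_def by simp

lemma sm_hol_slice: "open J \<Longrightarrow> sm U UNIV f \<Longrightarrow> V \<subseteq> U \<Longrightarrow> sm V J (\<lambda>z t. f z x)"
  by (rule sm_hol_const) (auto intro: holomorphic_on_subset[OF sm_hol])

definition ev_along :: "qx \<Rightarrow> state \<Rightarrow> fpair \<Rightarrow> fld" where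
  "ev_along e St X = (\<lambda>z x. ev (dl e) St z x * fst X z x + ev (db e) St z x * snd X z x)"

locale good_state_line = good_state r UNIV l lb l0 l1 l2 for r l lb l0 l1 l2
begin

lemma sm_ev_along:
  "sm (annulus r) UNIV X \<Longrightarrow> sm (annulus r) UNIV Y \<Longrightarrow> sm (annulus r) UNIV (ev_along e St (X, Y))"
  unfolding ev_along_def fst_conv snd_conv by (intro sm_add sm_mult sm_ev open_UNIV)

lemma dx_ev_along:
  assumes z: "z \<in> annulus r" and X: "sm (annulus r) UNIV X" and Y: "sm (annulus r) UNIV Y"
  shows "dx (ev_along e St (X, Y)) z x =
    (ev (dl (dl e)) St z x * dx l z x + ev (db (dl e)) St z x * dx lb z x) * X z x + ev (dl e) St z x * dx X z x +
    ((ev (dl (db e)) St z x * dx l z x + ev (db (db e)) St z x * dx lb z x) * Y z x + ev (db e) St z x * dx Y z x)"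
proof -
  note m = sm_mult[OF open_UNIV sm_ev[of "dl e"] X] sm_mult[OF open_UNIV sm_ev[of "db e"] Y]
  show ?thesis
    unfolding ev_along_def fst_conv snd_conv
      dx_add[OF z UNIV_I m] dx_mult[OF z UNIV_I sm_ev X] dx_mult[OF z UNIV_I sm_ev Y] dx_ev[OF z UNIV_I]
    ..
qed

text \<open>The same two-parameter family is seen in two ways: at fixed \<open>t\<close> as a state
  in \<open>x\<close>, at fixed \<open>x\<close> as a state in \<open>t\<close>. The formula for
  \<open>dx\<close> of the shifted expression is written through the slice, so that it can
  afterwards be differentiated in \<open>t\<close>.\<close>

lemma good_slice:
  assumes X: "sm (annulus r) UNIV X" "sm (annulus r) UNIV Y" and s: "1 < s" "s < r"
  obtains \<delta> where "\<delta> > 0"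
    "\<And>t. \<bar>t\<bar> < \<delta> \<Longrightarrow> good s {x-1<..<x+1} (shift t (X, Y) St)"
    "good s {-\<delta><..<\<delta>} (shifted_slice x (X, Y) St)"
    "\<And>e w t. w \<in> annulus s \<Longrightarrow> \<bar>t\<bar> < \<delta> \<Longrightarrow> dx (ev e (shift t (X, Y) St)) w x =
       ev (dl e) (shifted_slice x (X, Y) St) w t * (dx l w x + complex_of_real t * dx X w x) +
       ev (db e) (shifted_slice x (X, Y) St) w t * (dx lb w x + complex_of_real t * dx Y w x)"
    "\<And>e. sm (annulus s) {-\<delta><..<\<delta>} (ev e (shifted_slice x (X, Y) St))"
    "\<And>e w. w \<in> annulus s \<Longrightarrow> dx (ev e (shifted_slice x (X, Y) St)) w 0 = ev_along e St (X, Y) w x"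
    "\<And>e w. ev e (shifted_slice x (X, Y) St) w 0 = ev e St w x"
proof -
  from good_shift[OF X s, of "x - 1" "x + 1"] obtain \<delta> where \<delta>: "\<delta> > 0"
    "\<And>t. \<bar>t\<bar> < \<delta> \<Longrightarrow> good s {x-1<..<x+1} (shift t (X, Y) St)"
    "\<And>y. y \<in> {x-1..x+1} \<Longrightarrow> good s {-\<delta><..<\<delta>} (shifted_slice y (X, Y) St)"
    "\<And>t z y. \<bar>t\<bar> < \<delta> \<Longrightarrow> z \<in> annulus s \<Longrightarrow> y \<in> {x-1..x+1} \<Longrightarrow>
      norm (complex_of_real t * X z y / l z y) < 1 \<and>
      norm (complex_of_real t * (X z y + Y z y) / (l z y + lb z y)) < 1 \<and>
      norm (complex_of_real t * Y z y / lb z y) < 1"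
    by blast
  have sr: "annulus s \<subseteq> annulus r" using annulus_mono[of s r] s by auto
  have g: "good s {-\<delta><..<\<delta>} (shifted_slice x (X, Y) St)" by (rule \<delta>(3)) auto
  interpret S: good_state s "{-\<delta><..<\<delta>}" "\<lambda>z s. l z x + complex_of_real s * X z x" "\<lambda>z s. lb z x + complex_of_real s * Y z x"
    "\<lambda>z s. l0 z x + Ln (1 + complex_of_real s * X z x / l z x)"
    "\<lambda>z s. l1 z x + Ln (1 + complex_of_real s * (X z x + Y z x) / (l z x + lb z x))"
    "\<lambda>z s. l2 z x + Ln (1 + complex_of_real s * Y z x / lb z x)"
    by unfold_locales (use s(1) g in \<open>simp_all only: shifted_slice.simps open_greaterThanLessThan\<close>)
  have e0: "ev e (shifted_slice x (X, Y) St) w 0 = ev e St w x" for e w by simp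
  show ?thesis
  proof (rule that[OF \<delta>(1,2) g])
    fix e w and t :: real assume w: "w \<in> annulus s" and t: "\<bar>t\<bar> < \<delta>"
    interpret T: good_state s "{x-1<..<x+1}" "\<lambda>z x. l z x + complex_of_real t * X z x" "\<lambda>z x. lb z x + complex_of_real t * Y z x"
      "\<lambda>z x. l0 z x + Ln (1 + complex_of_real t * X z x / l z x)"
      "\<lambda>z x. l1 z x + Ln (1 + complex_of_real t * (X z x + Y z x) / (l z x + lb z x))"
      "\<lambda>z x. l2 z x + Ln (1 + complex_of_real t * Y z x / lb z x)"
      by unfold_locales (use s(1) \<delta>(2)[OF t] in \<open>simp_all only: shift.simps open_greaterThanLessThan\<close>)
    have wr: "w \<in> annulus r" using w sr by blast
    have "dx (\<lambda>z x. f z x + complex_of_real t * F z x) w x = dx f w x + complex_of_real t * dx F w x"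
      if "sm (annulus r) UNIV f" "sm (annulus r) UNIV F" for f F
      using dx_add[OF wr UNIV_I that(1) sm_mult[OF open_UNIV sm_const[OF open_UNIV, of _ "complex_of_real t"] that(2)]]
        dx_cmult[OF wr UNIV_I that(2) that(2)] by simp
    with T.dx_ev[OF w, where x = x and e = e] X sms show "dx (ev e (shift t (X, Y) St)) w x =
       ev (dl e) (shifted_slice x (X, Y) St) w t * (dx l w x + complex_of_real t * dx X w x) +
       ev (db e) (shifted_slice x (X, Y) St) w t * (dx lb w x + complex_of_real t * dx Y w x)"
      by (simp only: shift.simps ev_shift[symmetric]) simp
  next
    show "sm (annulus s) {-\<delta><..<\<delta>} (ev e (shifted_slice x (X, Y) St))" for e
      using S.sm_ev[of e] by (simp only: shifted_slice.simps)
  next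
    fix e w assume w: "w \<in> annulus s"
    have "0 \<in> {-\<delta><..<\<delta>}" using \<delta>(1) by simp
    from S.dx_ev[OF w this, of e] show "dx (ev e (shifted_slice x (X, Y) St)) w 0 = ev_along e St (X, Y) w x"
      unfolding dx_affine shifted_slice.simps[symmetric] e0 ev_along_def by simp
  qed (assumption | rule e0)+
qed

text \<open>The bracket contains \<open>dx\<close> of a projection of the shifted expression, so a
  derivative in \<open>t\<close> of a derivative in \<open>x\<close> is wanted. Instead of
  smoothness in both variables, the \<open>x\<close>-derivative is written as an explicit family in
  \<open>t\<close> on the slice and differentiated there; the projections commute with both
  derivatives.\<close>

lemma shift_bracket_deriv:
  assumes X: "sm (annulus r) UNIV X" "sm (annulus r) UNIV Y" and s: "1 < s" "s < r"
    and A: "half s A D" and m: "sm D UNIV m" "sm D UNIV N" and z: "z \<in> D"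
  shows "((\<lambda>t. bracket (proj A (ev e (shift t (X, Y) St))) (\<lambda>z x. m z x + complex_of_real t * N z x) z x)
    has_vector_derivative bracket (proj A (ev_along e St (X, Y))) m z x + bracket (proj A (ev e St)) N z x) (at 0)"
proof -
  from good_slice[OF X s] obtain \<delta> where \<delta>: "\<delta> > 0"
    and gs: "\<And>t. \<bar>t\<bar> < \<delta> \<Longrightarrow> good s {x-1<..<x+1} (shift t (X, Y) St)"
    and dxe: "\<And>e w t. w \<in> annulus s \<Longrightarrow> \<bar>t\<bar> < \<delta> \<Longrightarrow> dx (ev e (shift t (X, Y) St)) w x =
       ev (dl e) (shifted_slice x (X, Y) St) w t * (dx l w x + complex_of_real t * dx X w x) +
       ev (db e) (shifted_slice x (X, Y) St) w t * (dx lb w x + complex_of_real t * dx Y w x)"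
    and sme: "\<And>e. sm (annulus s) {-\<delta><..<\<delta>} (ev e (shifted_slice x (X, Y) St))"
    and dxs: "\<And>e w. w \<in> annulus s \<Longrightarrow> dx (ev e (shifted_slice x (X, Y) St)) w 0 = ev_along e St (X, Y) w x"
    and e0: "\<And>e w. ev e (shifted_slice x (X, Y) St) w 0 = ev e St w x"
    by metis
  define T where "T = {-\<delta><..<\<delta>}"
  have T: "open T" "0 \<in> T" unfolding T_def using \<delta> by auto
  have Tt: "\<bar>t\<bar> < \<delta>" if "t \<in> T" for t using that unfolding T_def by auto
  have D: "open D" using half_open[OF s(1) T(1) A] .
  note sA = annulus_half[OF s(1) T(1) A]
  have sr: "annulus s \<subseteq> annulus r" using annulus_mono[of s r] s by auto
  have cs: "w \<in> annulus s" if "w \<in> circ" for w using that domain_subsets(1)[OF s(1)] by blast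
  interpret DT: domain_pair D T by unfold_locales (rule D T)+
  interpret DU: domain_pair D UNIV by unfold_locales (rule D open_UNIV)+
  interpret AT: domain_pair "annulus s" T by unfold_locales (rule open_annulus T)+
  define Sl where "Sl = shifted_slice x (X, Y) St"
  define E where "E = ev e Sl"
  \<comment> \<open>The derivative in \<open>x\<close> at the shifted state, by the chain rule, with
    \<open>x\<close> fixed and the line parameter as variable.\<close>
  define F where "F w t = ev (dl e) Sl w t * (dx l w x + complex_of_real t * dx X w x) +
       ev (db e) Sl w t * (dx lb w x + complex_of_real t * dx Y w x)" for w t
  have smS: "sm (annulus s) T (ev e Sl)" for e using sme unfolding T_def Sl_def .
  have E: "sm (annulus s) T E" unfolding E_def by (rule smS)
  have h: "sm (annulus s) T (\<lambda>w t. f w x + complex_of_real t * g w x)"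
    if "sm (annulus r) UNIV f" "sm (annulus r) UNIV g" for f g
    by (intro sm_add sm_mult T sm_param sm_hol_slice[OF _ that(1) sr] sm_hol_slice[OF _ that(2) sr])
  have F: "sm (annulus s) T F"
    unfolding F_def[abs_def] by (intro sm_add sm_mult T smS h sm_dx sms X)
  define V where "V = ev_along e St (X, Y)"
  have V: "sm (annulus s) UNIV V"
    unfolding V_def by (rule sm_subset[OF sm_ev_along[OF X] sr]) simp
  have E': "sm (annulus s) {x-1<..<x+1} (ev e (shift t (X, Y) St))" if "t \<in> T" for t
  proof -
    interpret T: good_state s "{x-1<..<x+1}" "\<lambda>z x. l z x + complex_of_real t * X z x" "\<lambda>z x. lb z x + complex_of_real t * Y z x"
      "\<lambda>z x. l0 z x + Ln (1 + complex_of_real t * X z x / l z x)"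
      "\<lambda>z x. l1 z x + Ln (1 + complex_of_real t * (X z x + Y z x) / (l z x + lb z x))"
      "\<lambda>z x. l2 z x + Ln (1 + complex_of_real t * Y z x / lb z x)"
      by unfold_locales (use s(1) gs[OF Tt[OF that]] in \<open>simp_all only: shift.simps open_greaterThanLessThan\<close>)
    show ?thesis using T.sm_ev[of e] by (simp only: shift.simps)
  qed
  have pF: "proj A (dx (ev e (shift t (X, Y) St))) z x = proj A F z t" if t: "t \<in> T" for t z
  proof -
    have "proj A (dx (ev e (shift t (X, Y) St))) z x = proj A (\<lambda>w x. F w t) z x"
      by (rule proj_cong) (simp add: dxe[OF cs Tt[OF t]] F_def Sl_def del: ev.simps shifted_slice.simps shift.simps)
    then show ?thesis by (simp add: proj_def)
  qed
  have P: "bracket (proj A (ev e (shift t (X, Y) St))) (\<lambda>z x. m z x + complex_of_real t * N z x) z x =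
      th (proj A E) z t * (dx m z x + complex_of_real t * dx N z x) -
      (th m z x + complex_of_real t * th N z x) * proj A F z t" if t: "t \<in> T" for t
  proof -
    note c = sm_mult[OF open_UNIV sm_const[OF open_UNIV, of D "complex_of_real t"] m(2)]
    have "dx (\<lambda>z x. m z x + complex_of_real t * N z x) z x = dx m z x + complex_of_real t * dx N z x"
      unfolding DU.dx_add[OF z UNIV_I m(1) c] DU.dx_cmult[OF z UNIV_I m(2) m(2)] ..
    moreover have "th (\<lambda>z x. m z x + complex_of_real t * N z x) z x = th m z x + complex_of_real t * th N z x"
      unfolding DU.th_add[OF z UNIV_I m(1) c] DU.th_cmult[OF z UNIV_I m(2) m(2)] ..
    moreover have "th (proj A (ev e (shift t (X, Y) St))) z x = th (proj A E) z t"
      unfolding E_def Sl_def by (intro th_slice proj_slice ev_shift)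
    moreover have "dx (proj A (ev e (shift t (X, Y) St))) z x = proj A F z t"
      using proj_dx[OF s(1) _ A E'[OF t] z, of x] pF[OF t] by simp
    ultimately show ?thesis unfolding bracket_th by simp
  qed
  have d1: "(th (proj A E) z has_vector_derivative th (proj A V) z x) (at 0)"
  proof -
    note pE = proj_sm[OF s(1) T(1) A E]
    have "dx (th (proj A E)) z 0 = th (dx (proj A E)) z 0" by (rule DT.dx_th[OF z T(2) pE])
    also have "\<dots> = th (proj A (dx E)) z 0"
      by (rule th_cong[OF D z]) (rule proj_dx[OF s(1) T(1) A E _ T(2)])
    also have "\<dots> = th (proj A V) z x"
    proof (rule th_slice)
      fix w
      have "proj A (dx E) w 0 = proj A (\<lambda>w t. V w x) w 0"
        by (rule proj_cong) (simp only: E_def Sl_def V_def dxs[OF cs])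
      then show "proj A (dx E) w 0 = proj A V w x" by (simp add: proj_def)
    qed
    finally show ?thesis using sm_has_dx[OF DT.sm_th[OF pE] z T(2)] by simp
  qed
  have d2: "(proj A F z has_vector_derivative dx (proj A V) z x) (at 0)"
  proof -
    \<comment> \<open>After expansion the two sides differ only in the order of second partial
      derivatives, which \<open>qev_schwarz\<close> identifies.\<close>
    have dF: "dx F w 0 = dx V w x" if w: "w \<in> annulus s" for w
    proof -
      have wr: "w \<in> annulus r" using w sr by blast
      have hX: "sm (annulus s) T (\<lambda>w t. dx l w x + complex_of_real t * dx X w x)"
        "sm (annulus s) T (\<lambda>w t. dx lb w x + complex_of_real t * dx Y w x)"
        by (intro h sm_dx sms X)+
      have "dx F w 0 = dx (ev (dl e) Sl) w 0 * (dx l w x + complex_of_real 0 * dx X w x) + ev (dl e) Sl w 0 * dx X w x +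
        (dx (ev (db e) Sl) w 0 * (dx lb w x + complex_of_real 0 * dx Y w x) + ev (db e) Sl w 0 * dx Y w x)"
        unfolding F_def[abs_def] AT.dx_add[OF w T(2) sm_mult[OF T(1) smS hX(1)] sm_mult[OF T(1) smS hX(2)]]
          AT.dx_mult[OF w T(2) smS hX(1)] AT.dx_mult[OF w T(2) smS hX(2)] dx_affine ..
      also have "\<dots> = dx V w x"
        unfolding V_def dx_ev_along[OF wr X] Sl_def dxs[OF w] e0
        using qev_schwarz[where e = e] by (simp add: ev_along_def algebra_simps)
      finally show ?thesis .
    qed
    have "dx (proj A F) z 0 = proj A (dx F) z 0" by (rule proj_dx[OF s(1) T(1) A F z T(2)])
    also have "\<dots> = proj A (\<lambda>w t. dx V w x) z 0" by (rule proj_cong) (rule dF[OF cs])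
    also have "\<dots> = proj A (dx V) z x" by (simp add: proj_def)
    also have "\<dots> = dx (proj A V) z x" by (rule proj_dx[OF s(1) open_UNIV A V z UNIV_I, symmetric])
    finally show ?thesis using sm_has_dx[OF proj_sm[OF s(1) T(1) A F] z T(2)] by simp
  qed
  have "((\<lambda>t. th (proj A E) z t * (dx m z x + complex_of_real t * dx N z x) -
      (th m z x + complex_of_real t * th N z x) * proj A F z t) has_vector_derivative
      (th (proj A E) z 0 * dx N z x + th (proj A V) z x * (dx m z x + complex_of_real 0 * dx N z x)) -
      ((th m z x + complex_of_real 0 * th N z x) * dx (proj A V) z x + th N z x * proj A F z 0)) (at 0)"
    by (intro has_vector_derivative_diff has_vector_derivative_mult d1 d2 has_vector_derivative_affine)
  moreover have "th (proj A E) z 0 = th (proj A (ev e St)) z x"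
    unfolding E_def Sl_def by (intro th_slice proj_slice e0)
  moreover have "proj A F z 0 = dx (proj A (ev e St)) z x"
    using pF[OF T(2), of z] proj_dx[where x = x, OF s(1) open_UNIV A sm_subset[OF sm_ev[of e] sr subset_UNIV] z UNIV_I]
    unfolding shift_0 by simp
  ultimately have "((\<lambda>t. th (proj A E) z t * (dx m z x + complex_of_real t * dx N z x) -
      (th m z x + complex_of_real t * th N z x) * proj A F z t) has_vector_derivative
      bracket (proj A V) m z x + bracket (proj A (ev e St)) N z x) (at 0)"
    unfolding bracket_th by (simp add: algebra_simps)
  then show ?thesis
    unfolding V_def by (rule has_vector_derivative_transform_within_open[OF _ T]) (rule P[symmetric])
qed

lemma shift_coeff_deriv:
  assumes X: "sm (annulus r) UNIV X" "sm (annulus r) UNIV Y"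
  shows "((\<lambda>t. coeff (\<lambda>z. ev e (shift t (X, Y) St) z x) 0) has_vector_derivative
    coeff (\<lambda>z. ev_along e St (X, Y) z x) 0) (at 0)"
proof -
  obtain s where s: "1 < s" "s < r" using dense[OF r] by blast
  from good_slice[OF X s] obtain \<delta> where \<delta>: "\<delta> > 0"
    and sme: "\<And>e. sm (annulus s) {-\<delta><..<\<delta>} (ev e (shifted_slice x (X, Y) St))"
    and dxs: "\<And>e w. w \<in> annulus s \<Longrightarrow> dx (ev e (shifted_slice x (X, Y) St)) w 0 = ev_along e St (X, Y) w x"
    by metis
  have "((\<lambda>t. coeff (\<lambda>z. ev e (shifted_slice x (X, Y) St) z t) 0) has_vector_derivative
      coeff (\<lambda>z. dx (ev e (shifted_slice x (X, Y) St)) z 0) 0) (at 0)"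
    by (rule coeff_dx[OF s(1) open_greaterThanLessThan sme]) (use \<delta> in simp)
  moreover have "coeff (\<lambda>z. dx (ev e (shifted_slice x (X, Y) St)) z 0) 0 = coeff (\<lambda>z. ev_along e St (X, Y) z x) 0"
    by (rule coeff_cong, rule dxs) (use domain_subsets(1)[OF s(1)] in blast)
  ultimately show ?thesis by (simp only: ev_shift)
qed

end

section \<open>Commuting flows\<close>

text \<open>Gathers the germ conditions on a state at one radius. The exponential of
  \<open>l0\<close> is controlled on the whole exterior because periodicity of \<open>l0\<close> is
  obtained by comparison with infinity.\<close>

fun regular :: "real \<Rightarrow> state \<Rightarrow> bool" where
  "regular r ((l, lb), (l0, l1, l2)) \<longleftrightarrow> good r UNIV ((l, lb), (l0, l1, l2)) \<and>
     mil r UNIV 0 (\<lambda>z x. l z x - z) \<and> pol r UNIV (-1) lb \<and> mil r UNIV (-1) l0 \<and>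
     (\<forall>z\<in>exterior r. \<forall>x. l z (x + 2 * pi) = l z x \<and> exp (l0 z x) = l z x / z) \<and>
     (\<forall>z\<in>pball r. \<forall>x. lb z (x + 2 * pi) = lb z x)"

lemma state_exhaust:
  obtains l lb l0 l1 l2 where "(St :: state) = ((l, lb), (l0, l1, l2))"
  by (metis prod.exhaust)

lemma states_regular:
  assumes "St \<in> states"
  shows "\<forall>\<^sub>F r in at_right 1. regular r St"
proof -
  obtain l lb l0 l1 l2 where St: "St = ((l, lb), (l0, l1, l2))"
    by (rule state_exhaust)
  have L: "(l, lb) \<in> LM1" and B: "log_branch (l, lb) (l0, l1, l2)"
    using assms unfolding St states_def by auto
  note D = LM1_D[OF L]
  have B': "smooth_zinvDinf l0" "eq_near Dinf (\<lambda>z x. exp (l0 z x)) (\<lambda>z x. l z x / z)"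
     "smooth_fam circ l1" "eq_near circ (\<lambda>z x. exp (l1 z x)) (\<lambda>z x. (l z x + lb z x) / z)"
     "smooth_fam circ l2" "eq_near circ (\<lambda>z x. exp (l2 z x)) (\<lambda>z x. z * lb z x)"
    using B by simp_all
  have gt: "\<forall>\<^sub>F r in at_right (1::real). r > 1" by (rule eventually_at_right_less)
  show ?thesis
    using D(1-4) B'(1)[unfolded smooth_zinvDinf_iff] B'(2)[unfolded eq_near_exterior]
      B'(3)[unfolded smooth_fam_circ_iff] B'(4)[unfolded eq_near_annulus]
      B'(5)[unfolded smooth_fam_circ_iff] B'(6)[unfolded eq_near_annulus] gt
  proof eventually_elim
    case (elim r)
    have a: "annulus r \<subseteq> exterior r" "annulus r \<subseteq> pball r" using annulus_eq[of r] elim by auto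
    have "sm (annulus r) UNIV l" "sm (annulus r) UNIV lb" "sm (annulus r) UNIV l0"
      using sm_subset[OF l_mil(4)[OF elim(11) elim(1)] a(1)] sm_subset[OF pol_sm[OF elim(11) open_UNIV elim(2)] a(2)]
        sm_subset[OF mil_sm[OF elim(11) open_UNIV elim(5)] a(1)] by auto
    then show ?case using elim a unfolding St by (auto simp: fun_eq_iff)
  qed
qed

definition neg :: "qx \<Rightarrow> qx" where
  "neg e = Mu (Cn (-1)) e"

lemma ev_neg: "ev (neg e) St z x = - ev e St z x"
  by (cases "(e, St)" rule: ev.cases) (simp add: neg_def)

lemma proj_ev_neg: "proj A (ev (neg e) St) z x = - proj A (ev e St) z x"
proof -
  have "ev (neg e) St = (\<lambda>z x. - ev e St z x)" by (intro ext) (rule ev_neg)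
  then show ?thesis by (simp add: proj_uminus[of 2 UNIV])
qed

lemma ev_along_neg: "ev_along (neg e) St X z x = - ev_along e St X z x"
  by (cases "(e, St)" rule: ev.cases) (simp add: ev_along_def neg_def algebra_simps)

text \<open>The sign sits inside the expression and the exponents are written \<open>{..-1}\<close>,
  so that both components have exactly the form treated in \<open>shift_bracket_deriv\<close>, with
  exponent sets of the kind allowed by \<open>half\<close>.\<close>

definition flow :: "qx \<Rightarrow> state \<Rightarrow> fpair" where
  "flow e St = (bracket (proj {..-1} (ev (neg e) St)) (fst (fst St)), bracket (proj {0..} (ev e St)) (snd (fst St)))"

text \<open>\<open>al\<close>, \<open>ab\<close>, \<open>bl\<close>, \<open>bb\<close> are the partial derivatives of two functions of \<open>(l, k) = (\<lambda>, \<lambda>b)\<close>, \<open>p\<close> and \<open>q\<close> their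
  nonnegative parts; the suffixes \<open>t\<close> and \<open>x\<close> stand for \<open>th\<close> and \<open>dx\<close>.\<close>

lemma flow_difference_identity:
  fixes al ab bl bb lx lt kx kt px pt qx qt :: complex
  shows "bl * - ((al * lt + ab * kt - pt) * lx - lt * (al * lx + ab * kx - px)) + bb * (pt * kx - kt * px) -
    (al * - ((bl * lt + bb * kt - qt) * lx - lt * (bl * lx + bb * kx - qx)) + ab * (qt * kx - kt * qx)) =
    (pt * qx - qt * px) - ((al * lt + ab * kt - pt) * (bl * lx + bb * kx - qx) - (bl * lt + bb * kt - qt) * (al * lx + ab * kx - px))"
  by (simp add: algebra_simps)

section \<open>Flows at a regular state\<close>

locale regular_state =
  fixes r :: real and l lb l0 l1 l2 :: fld
  assumes r1: "r > 1" and reg: "regular r ((l, lb), (l0, l1, l2))"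
begin

sublocale good_state_line r l lb l0 l1 l2
  by unfold_locales (use r1 reg in auto)

sublocale X: domain_pair "exterior r" UNIV by unfold_locales (auto simp: open_exterior)
sublocale P: domain_pair "pball r" UNIV by unfold_locales (auto simp: open_pball)

lemmas rJ = r1 open_UNIV[where 'a = real]

lemma mil_l0: "mil r UNIV 0 (\<lambda>z x. l z x - z)" and pol_lb: "pol r UNIV (-1) lb" using reg by auto

lemmas l_mils = l_mil[OF r1 mil_l0]

lemma lb_sm: "sm (pball r) UNIV lb" by (rule pol_sm[OF rJ pol_lb])

lemma ann_sub: "annulus r \<subseteq> exterior r" "annulus r \<subseteq> pball r"
  using annulus_eq[of r] r1 by auto

lemma halves: "half r {..m} (exterior r)" "half r {m..} (pball r)"
  unfolding half_def[OF rJ] by auto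

abbreviation neg_part :: "qx \<Rightarrow> fld" where "neg_part e \<equiv> proj {..-1} (ev e St)"
abbreviation pos_part :: "qx \<Rightarrow> fld" where "pos_part e \<equiv> proj {0..} (ev e St)"

lemma neg_part_mil: "mil r UNIV (-1) (neg_part e)" by (rule mil_proj[OF rJ sm_ev])
lemma pos_part_ball: "sm (ball 0 r) UNIV (pos_part e)" by (rule proj_nonneg(1)[OF rJ sm_ev])
lemma pos_part_pol: "pol r UNIV 0 (pos_part e)" by (rule pol_ball[OF rJ pos_part_ball])
lemma neg_part_sm: "sm (exterior r) UNIV (neg_part e)" by (rule mil_sm[OF rJ neg_part_mil])
lemma pos_part_sm: "sm (pball r) UNIV (pos_part e)" by (rule pol_sm[OF rJ pos_part_pol])
lemma neg_part_ann: "sm (annulus r) UNIV (neg_part e)" by (rule sm_subset[OF neg_part_sm ann_sub(1)]) simp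
lemma pos_part_ann: "sm (annulus r) UNIV (pos_part e)" by (rule sm_subset[OF pos_part_sm ann_sub(2)]) simp

lemma neg_part_eq: "z \<in> annulus r \<Longrightarrow> neg_part e z x = ev e St z x - pos_part e z x"
proof -
  assume z: "z \<in> annulus r"
  have "{..<0} = {..-1 :: int}" by auto
  with laurent[OF rJ sm_ev[of e] z UNIV_I, of 0 x] show ?thesis by (simp add: algebra_simps)
qed

lemma neg_part_derivs:
  assumes z: "z \<in> annulus r"
  shows "th (neg_part e) z x = th (ev e St) z x - th (pos_part e) z x"
    "dx (neg_part e) z x = dx (ev e St) z x - dx (pos_part e) z x"
proof -
  have "th (neg_part e) z x = th (\<lambda>z x. ev e St z x - pos_part e z x) z x"
    by (rule th_cong[OF open_annulus z]) (rule neg_part_eq)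
  then show "th (neg_part e) z x = th (ev e St) z x - th (pos_part e) z x"
    unfolding th_diff[OF z UNIV_I sm_ev pos_part_ann] .
  have "dx (neg_part e) z x = dx (\<lambda>z x. ev e St z x - pos_part e z x) z x"
    by (rule dx_cong[OF open_UNIV UNIV_I]) (rule neg_part_eq[OF z])
  then show "dx (neg_part e) z x = dx (ev e St) z x - dx (pos_part e) z x"
    unfolding dx_diff[OF z UNIV_I sm_ev pos_part_ann] .
qed

lemma flow_eq:
  "z \<in> exterior r \<Longrightarrow> fst (flow e St) z x = - bracket (neg_part e) l z x"
  "snd (flow e St) = bracket (pos_part e) lb"
proof -
  have "proj {..-1} (ev (neg e) St) = (\<lambda>z x. - neg_part e z x)"
    by (intro ext) (rule proj_ev_neg)
  then show "z \<in> exterior r \<Longrightarrow> fst (flow e St) z x = - bracket (neg_part e) l z x"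
    unfolding flow_def using X.bracket_uminus[OF _ UNIV_I neg_part_sm neg_part_sm l_mils(4)] by simp
qed (simp add: flow_def)

lemma flow_mil: "mil r UNIV 0 (fst (flow e St))"
  unfolding flow_def using mil_bracket[OF rJ mil_proj[OF rJ sm_ev] l_mils(1), of "-1"] by simp

lemma flow_pol: "pol r UNIV (-1) (snd (flow e St))"
  unfolding flow_def using pol_bracket[OF rJ pos_part_pol pol_lb] by simp

lemma flow_sm: "sm (annulus r) UNIV (fst (flow e St))" "sm (annulus r) UNIV (snd (flow e St))"
  using sm_subset[OF mil_sm[OF rJ flow_mil] ann_sub(1)] sm_subset[OF pol_sm[OF rJ flow_pol] ann_sub(2)] by auto

lemma flow_X_sm: "sm (exterior r) UNIV (fst (flow e St))" by (rule mil_sm[OF rJ flow_mil])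
lemma flow_P_sm: "sm (pball r) UNIV (snd (flow e St))" by (rule pol_sm[OF rJ flow_pol])

lemma sm_along: "sm (annulus r) UNIV (ev_along e St (flow f St))"
  using sm_ev_along[OF flow_sm(1)[of f] flow_sm(2)[of f]] by simp

text \<open>Negative parts are eliminated as total minus nonnegative part, and the totals are
  expanded by the chain rule. No projection then has to be evaluated, and what remains is
  \<open>flow_difference_identity\<close>.\<close>

lemma along_diff:
  assumes z: "z \<in> annulus r"
  shows "ev_along f St (flow e St) z x - ev_along e St (flow f St) z x =
    bracket (pos_part e) (pos_part f) z x - bracket (neg_part e) (neg_part f) z x"
proof -
  have zx: "z \<in> exterior r" using z ann_sub by blast
  show ?thesis
    unfolding ev_along_def flow_eq(1)[OF zx] flow_eq(2) bracket_th neg_part_derivs[OF z] dx_ev[OF z UNIV_I] th_ev[OF z UNIV_I]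
    by (rule flow_difference_identity)
qed

lemma pp_pol: "pol r UNIV 0 (bracket (pos_part e) (pos_part f))"
  using pol_bracket[OF rJ pos_part_pol pos_part_pol] by simp

lemma nn_mil: "mil r UNIV (-1) (bracket (neg_part e) (neg_part f))"
  by (rule mil_mono[OF rJ mil_bracket[OF rJ neg_part_mil neg_part_mil]]) simp

lemma pp_ann: "sm (annulus r) UNIV (bracket (pos_part e) (pos_part f))"
  and nn_ann: "sm (annulus r) UNIV (bracket (neg_part e) (neg_part f))"
  using sm_bracket pos_part_ann neg_part_ann by blast+

lemma circ_ann: "z \<in> circ \<Longrightarrow> z \<in> annulus r"
  using domain_subsets(1)[OF r1] by blast

text \<open>The two brackets on the right of \<open>along_diff\<close> have exponents at least 0 and
  at most -1 respectively, so a projection selects one of them unchanged. This is one half of the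
  zero-curvature equation.\<close>

lemma neg_along_diff:
  assumes z: "z \<in> exterior r"
  shows "proj {..-1} (ev_along f St (flow e St)) z x - proj {..-1} (ev_along e St (flow f St)) z x =
    - bracket (neg_part e) (neg_part f) z x"
proof -
  have "proj {..-1} (ev_along f St (flow e St)) z x - proj {..-1} (ev_along e St (flow f St)) z x =
      proj {..-1} (\<lambda>z x. ev_along f St (flow e St) z x - ev_along e St (flow f St) z x) z x"
    by (rule proj_diff[OF rJ halves(1) sm_along sm_along z UNIV_I, symmetric])
  also have "\<dots> = proj {..-1} (\<lambda>z x. bracket (pos_part e) (pos_part f) z x - bracket (neg_part e) (neg_part f) z x) z x"
    by (rule proj_cong) (rule along_diff[OF circ_ann])
  also have "\<dots> = proj {..-1} (bracket (pos_part e) (pos_part f)) z x - proj {..-1} (bracket (neg_part e) (neg_part f)) z x"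
    by (rule proj_diff[OF rJ halves(1) pp_ann nn_ann z UNIV_I])
  also have "proj {..-1} (bracket (pos_part e) (pos_part f)) z x = 0"
    by (rule pol_proj_0[OF rJ pp_pol]) auto
  also have "proj {..-1} (bracket (neg_part e) (neg_part f)) z x = bracket (neg_part e) (neg_part f) z x"
    by (rule mil_proj_id[OF rJ nn_mil z UNIV_I])
  finally show ?thesis by simp
qed

lemma pos_along_diff:
  assumes z: "z \<in> pball r"
  shows "proj {0..} (ev_along f St (flow e St)) z x - proj {0..} (ev_along e St (flow f St)) z x =
    bracket (pos_part e) (pos_part f) z x"
proof -
  have "proj {0..} (ev_along f St (flow e St)) z x - proj {0..} (ev_along e St (flow f St)) z x =
      proj {0..} (\<lambda>z x. ev_along f St (flow e St) z x - ev_along e St (flow f St) z x) z x"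
    by (rule proj_diff[OF rJ halves(2) sm_along sm_along z UNIV_I, symmetric])
  also have "\<dots> = proj {0..} (\<lambda>z x. bracket (pos_part e) (pos_part f) z x - bracket (neg_part e) (neg_part f) z x) z x"
    by (rule proj_cong) (rule along_diff[OF circ_ann])
  also have "\<dots> = proj {0..} (bracket (pos_part e) (pos_part f)) z x - proj {0..} (bracket (neg_part e) (neg_part f)) z x"
    by (rule proj_diff[OF rJ halves(2) pp_ann nn_ann z UNIV_I])
  also have "proj {0..} (bracket (neg_part e) (neg_part f)) z x = 0"
    by (rule mil_proj_0[OF rJ nn_mil]) auto
  also have "proj {0..} (bracket (pos_part e) (pos_part f)) z x = bracket (pos_part e) (pos_part f) z x"
    by (rule pol_proj_id[OF rJ pp_pol z UNIV_I])
  finally show ?thesis by simp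
qed

text \<open>The bracket of nonnegative parts starts at exponent 1, since \<open>th\<close> kills
  constants, and the bracket of negative parts ends below exponent 0. Neither contributes a residue,
  which is the symmetry of the densities.\<close>

lemma coeff_along_eq: "coeff (\<lambda>z. ev_along f St (flow e St) z x) 0 = coeff (\<lambda>z. ev_along e St (flow f St) z x) 0"
proof -
  have c: "continuous_on circ (\<lambda>z. g z x)" if "sm (annulus r) UNIV g" for g
    by (rule continuous_on_subset[OF holomorphic_on_imp_continuous_on[OF sm_hol[OF that UNIV_I]]]) (use circ_ann in blast)
  have m: "sm (annulus r) UNIV (\<lambda>z x. - bracket (neg_part e) (neg_part f) z x)"
    by (rule sm_uminus[OF open_UNIV nn_ann])
  have "pol r UNIV 1 (bracket (pos_part e) (pos_part f))"
    unfolding bracket_th[abs_def]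
    using pol_mult[OF rJ pol_th_0[OF rJ pos_part_ball[of e]] pol_dx[OF rJ pos_part_pol[of f]]]
      pol_mult[OF rJ pol_th_0[OF rJ pos_part_ball[of f]] pol_dx[OF rJ pos_part_pol[of e]]]
    by (intro pol_diff[OF rJ]) simp_all
  then have 1: "coeff (\<lambda>z. bracket (pos_part e) (pos_part f) z x) 0 = 0"
    by (rule pol_coeff[OF rJ]) auto
  have 2: "coeff (\<lambda>z. - bracket (neg_part e) (neg_part f) z x) 0 = 0"
    using mil_coeff[OF rJ nn_mil UNIV_I, of 0 e f x] coeff_cmult[of "-1" "\<lambda>z. bracket (neg_part e) (neg_part f) z x" 0] by simp
  have "coeff (\<lambda>z. ev_along f St (flow e St) z x) 0 =
      coeff (\<lambda>z. ev_along e St (flow f St) z x + (bracket (pos_part e) (pos_part f) z x + - bracket (neg_part e) (neg_part f) z x)) 0"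
  proof (rule coeff_cong)
    fix z assume "z \<in> circ"
    from along_diff[OF circ_ann[OF this], of f e x] show "ev_along f St (flow e St) z x =
       ev_along e St (flow f St) z x + (bracket (pos_part e) (pos_part f) z x + - bracket (neg_part e) (neg_part f) z x)"
      by (simp add: algebra_simps)
  qed
  also have "\<dots> = coeff (\<lambda>z. ev_along e St (flow f St) z x) 0 +
      (coeff (\<lambda>z. bracket (pos_part e) (pos_part f) z x) 0 + coeff (\<lambda>z. - bracket (neg_part e) (neg_part f) z x) 0)"
    by (subst coeff_add, (intro continuous_on_add c sm_along pp_ann m)+, subst coeff_add, (intro c pp_ann m)+) simp
  finally show ?thesis using 1 2 by simp
qed

text \<open>The Leibniz derivative of the first component of \<open>flow e\<close> in the direction
  \<open>flow f\<close>: the expression varies in one term, the factor \<lambda> in the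
  other.\<close>

definition commutator_fst :: "qx \<Rightarrow> qx \<Rightarrow> fld" where
  "commutator_fst e f z x = bracket (proj {..-1} (ev_along (neg e) St (flow f St))) l z x + bracket (proj {..-1} (ev (neg e) St)) (fst (flow f St)) z x"

text \<open>In the second term both the outer expression and the flow of \<lambda> carry a sign, and
  the two signs cancel.\<close>

lemma second_derivative_fst:
  assumes z: "z \<in> exterior r"
  shows "commutator_fst e f z x =
    - bracket (proj {..-1} (ev_along e St (flow f St))) l z x + bracket (neg_part e) (bracket (neg_part f) l) z x"
proof -
  have "ev_along (neg e) St (flow f St) = (\<lambda>z x. - ev_along e St (flow f St) z x)"
    by (intro ext) (rule ev_along_neg)
  then have 1: "proj {..-1} (ev_along (neg e) St (flow f St)) = (\<lambda>z x. - proj {..-1} (ev_along e St (flow f St)) z x)"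
    by (intro ext) (simp add: proj_uminus[OF rJ])
  have 2: "proj {..-1} (ev (neg e) St) = (\<lambda>z x. - neg_part e z x)"
    by (intro ext) (rule proj_ev_neg)
  note s = proj_sm[OF rJ halves(1)[of "-1"] sm_along[of e f]]
  have b: "sm (exterior r) UNIV (bracket (neg_part f) l)" by (intro X.sm_bracket neg_part_sm l_mils)
  have "bracket (\<lambda>z x. - neg_part e z x) (fst (flow f St)) z x =
      bracket (\<lambda>z x. - neg_part e z x) (\<lambda>z x. - bracket (neg_part f) l z x) z x"
    by (rule bracket_cong[OF open_exterior open_UNIV z UNIV_I]) (auto simp: flow_eq)
  also have "\<dots> = - bracket (neg_part e) (\<lambda>z x. - bracket (neg_part f) l z x) z x"
    by (rule X.bracket_uminus[OF z UNIV_I neg_part_sm neg_part_sm sm_uminus[OF open_UNIV b]])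
  also have "\<dots> = bracket (\<lambda>z x. - bracket (neg_part f) l z x) (neg_part e) z x"
    using X.bracket_commute[of "neg_part e" "\<lambda>z x. - bracket (neg_part f) l z x" z x] by simp
  also have "\<dots> = - bracket (bracket (neg_part f) l) (neg_part e) z x"
    by (rule X.bracket_uminus[OF z UNIV_I b b neg_part_sm])
  also have "\<dots> = bracket (neg_part e) (bracket (neg_part f) l) z x"
    using X.bracket_commute[of "neg_part e" "bracket (neg_part f) l" z x] by simp
  finally show ?thesis
    unfolding commutator_fst_def 1 2 X.bracket_uminus[OF z UNIV_I s s l_mils(4)] by simp
qed

text \<open>By the zero-curvature equation the terms in which the expressions vary differ by the
  bracket of a bracket; the Jacobi identity cancels it against the difference of the nested
  brackets.\<close>

lemma commutator_fst_sym:
  assumes z: "z \<in> exterior r"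
  shows "commutator_fst e f z x = commutator_fst f e z x"
proof -
  note s = proj_sm[OF rJ halves(1)[of "-1"] sm_along]
  note b = X.sm_bracket[OF neg_part_sm[of e] neg_part_sm[of f]]
  have "bracket (proj {..-1} (ev_along f St (flow e St))) l z x - bracket (proj {..-1} (ev_along e St (flow f St))) l z x =
    bracket (\<lambda>z x. proj {..-1} (ev_along f St (flow e St)) z x - proj {..-1} (ev_along e St (flow f St)) z x) l z x"
    by (rule X.bracket_diff[OF z UNIV_I s s l_mils(4), symmetric])
  also have "\<dots> = bracket (\<lambda>z x. - bracket (neg_part e) (neg_part f) z x) l z x"
    by (rule bracket_cong[OF open_exterior open_UNIV z UNIV_I]) (auto simp: neg_along_diff)
  also have "\<dots> = - bracket (bracket (neg_part e) (neg_part f)) l z x"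
    by (rule X.bracket_uminus[OF z UNIV_I b b l_mils(4)])
  finally show ?thesis
    using X.jacobi[OF z UNIV_I neg_part_sm neg_part_sm l_mils(4), of e f x] unfolding second_derivative_fst[OF z]
    by (simp add: algebra_simps)
qed

lemma commutator_snd_sym:
  assumes z: "z \<in> pball r"
  shows "bracket (proj {0..} (ev_along e St (flow f St))) lb z x + bracket (pos_part e) (snd (flow f St)) z x =
    bracket (proj {0..} (ev_along f St (flow e St))) lb z x + bracket (pos_part f) (snd (flow e St)) z x"
proof -
  note s = proj_sm[OF rJ halves(2)[of 0] sm_along]
  have "bracket (proj {0..} (ev_along f St (flow e St))) lb z x - bracket (proj {0..} (ev_along e St (flow f St))) lb z x =
    bracket (\<lambda>z x. proj {0..} (ev_along f St (flow e St)) z x - proj {0..} (ev_along e St (flow f St)) z x) lb z x"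
    by (rule P.bracket_diff[OF z UNIV_I s s lb_sm, symmetric])
  also have "\<dots> = bracket (bracket (pos_part e) (pos_part f)) lb z x"
    by (rule bracket_cong[OF open_pball open_UNIV z UNIV_I]) (auto simp: pos_along_diff)
  finally show ?thesis
    using P.jacobi[OF z UNIV_I pos_part_sm pos_part_sm lb_sm, of e f x] unfolding flow_eq(2)
    by (simp add: algebra_simps)
qed

text \<open>The radius drops from \<open>r\<close> to \<open>s\<close> because shifted states are
  controlled only on a strictly smaller annulus.\<close>

lemma flow_deriv_fst:
  assumes s: "1 < s" "s < r" and z: "z \<in> exterior s"
  shows "has_deriv_along (\<lambda>T. fst (flow e T) z x) St (flow f St) (commutator_fst e f z x)"
proof -
  have sub: "exterior s \<subseteq> exterior r" using exterior_mono[of s r] s by auto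
  have "half s {..-1} (exterior s)" unfolding half_def[OF s(1) open_UNIV] by auto
  from shift_bracket_deriv[OF flow_sm(1)[of f] flow_sm(2)[of f] s this sm_subset[OF l_mils(4) sub] sm_subset[OF flow_X_sm[of f] sub] z, of "neg e" x]
  have "((\<lambda>t. bracket (proj {..-1} (ev (neg e) (shift t (flow f St) St))) (\<lambda>z x. l z x + complex_of_real t * fst (flow f St) z x) z x)
     has_vector_derivative commutator_fst e f z x) (at 0)"
    unfolding commutator_fst_def by simp
  moreover have "fst (fst (shift t (flow f St) St)) = (\<lambda>z x. l z x + complex_of_real t * fst (flow f St) z x)" for t
    by (cases "flow f St") simp
  ultimately show ?thesis unfolding has_deriv_along_def flow_def[of e] fst_conv by simp
qed

lemma flow_deriv_snd:
  assumes s: "1 < s" "s < r" and z: "z \<in> pball s"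
  shows "has_deriv_along (\<lambda>T. snd (flow e T) z x) St (flow f St)
    (bracket (proj {0..} (ev_along e St (flow f St))) lb z x + bracket (pos_part e) (snd (flow f St)) z x)"
proof -
  have sub: "pball s \<subseteq> pball r" using s by auto
  have "half s {0..} (pball s)" unfolding half_def[OF s(1) open_UNIV] by auto
  from shift_bracket_deriv[OF flow_sm(1)[of f] flow_sm(2)[of f] s this sm_subset[OF lb_sm sub] sm_subset[OF flow_P_sm[of f] sub] z, of e x]
  have "((\<lambda>t. bracket (proj {0..} (ev e (shift t (flow f St) St))) (\<lambda>z x. lb z x + complex_of_real t * snd (flow f St) z x) z x)
     has_vector_derivative bracket (proj {0..} (ev_along e St (flow f St))) lb z x + bracket (pos_part e) (snd (flow f St)) z x) (at 0)"
    by simp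
  moreover have "snd (fst (shift t (flow f St) St)) = (\<lambda>z x. lb z x + complex_of_real t * snd (flow f St) z x)" for t
    by (cases "flow f St") simp
  ultimately show ?thesis unfolding has_deriv_along_def flow_def[of e] snd_conv by simp
qed

lemma density_deriv:
  "has_deriv_along (\<lambda>T. res0 (ev e T) x) St (flow f St) (coeff (\<lambda>z. ev_along e St (flow f St) z x) 0)"
  using shift_coeff_deriv[OF flow_sm(1)[of f] flow_sm(2)[of f], where e = e and x = x] unfolding has_deriv_along_def res0_coeff prod.collapse .

end

lemma regular_cases:
  assumes "St \<in> states"
  obtains r l lb l0 l1 l2 where "St = ((l, lb), (l0, l1, l2))" "regular_state r l lb l0 l1 l2"
proof -
  obtain l lb l0 l1 l2 where St: "St = ((l, lb), (l0, l1, l2))"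
    by (rule state_exhaust)
  obtain r where "r > 1" "regular r St" using states_regular[OF assms] by (rule obtain_radius)
  then show ?thesis using that[OF St, of r] unfolding regular_state_def St by blast
qed

lemma flow_smooth_vectors:
  assumes "St \<in> states" shows "flow e St \<in> smooth_vectors"
proof -
  have gt: "\<forall>\<^sub>F r in at_right (1::real). r > 1" by (rule eventually_at_right_less)
  have "\<forall>\<^sub>F r in at_right 1. mil r UNIV 0 (fst (flow e St)) \<and> pol r UNIV (-1) (snd (flow e St))"
    using states_regular[OF assms] gt
  proof eventually_elim
    case (elim r)
    obtain l lb l0 l1 l2 where St: "St = ((l, lb), (l0, l1, l2))"
      by (rule state_exhaust)
    interpret regular_state r l lb l0 l1 l2 by unfold_locales (use elim St in auto)
    show ?case using flow_mil flow_pol unfolding St by blast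
  qed
  then show ?thesis unfolding smooth_vectors_def
    by (cases "flow e St") (simp add: smooth_Dinf_iff smooth_zinvD0_iff eventually_conj_iff)
qed

lemma flows_commute: "commuting (flow e) (flow f)"
  unfolding commuting_def
proof (intro ballI)
  fix St assume "St \<in> states"
  then obtain r l lb l0 l1 l2 where St: "St = ((l, lb), (l0, l1, l2))" and reg: "regular_state r l lb l0 l1 l2"
    by (rule regular_cases)
  interpret regular_state r l lb l0 l1 l2 by (rule reg)
  obtain s where s: "1 < s" "s < r" using dense[OF r1] by blast
  have 1: "\<exists>D. has_deriv_along (\<lambda>T. fst (flow e T) z x) St (flow f St) D \<and>
      has_deriv_along (\<lambda>T. fst (flow f T) z x) St (flow e St) D" if z: "z \<in> exterior s" for z x
  proof -
    have zr: "z \<in> exterior r" using exterior_mono[of s r] s z by auto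
    show ?thesis
      using flow_deriv_fst[OF s z, of e x f] flow_deriv_fst[OF s z, of f x e] commutator_fst_sym[OF zr, of e f x]
      unfolding St by auto
  qed
  have 2: "\<exists>D. has_deriv_along (\<lambda>T. snd (flow e T) z x) St (flow f St) D \<and>
      has_deriv_along (\<lambda>T. snd (flow f T) z x) St (flow e St) D" if z: "z \<in> pball s" for z x
  proof -
    have zr: "z \<in> pball r" using s z by auto
    show ?thesis
      using flow_deriv_snd[OF s z, of e x f] flow_deriv_snd[OF s z, of f x e] commutator_snd_sym[OF zr, of e f x]
      unfolding St by auto
  qed
  show "(\<exists>U. open U \<and> Dinf \<subseteq> U \<and> (\<forall>z\<in>U. \<forall>x. \<exists>D.
        has_deriv_along (\<lambda>T. fst (flow e T) z x) St (flow f St) D \<and>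
        has_deriv_along (\<lambda>T. fst (flow f T) z x) St (flow e St) D)) \<and>
     (\<exists>U. open U \<and> D0p \<subseteq> U \<and> (\<forall>z\<in>U. \<forall>x. \<exists>D.
        has_deriv_along (\<lambda>T. snd (flow e T) z x) St (flow f St) D \<and>
        has_deriv_along (\<lambda>T. snd (flow f T) z x) St (flow e St) D))"
    by (rule conjI; rule exI[of _ "exterior s"] exI[of _ "pball s"],
        intro conjI ballI allI open_exterior open_pball domain_subsets(3,4)[OF s(1)] 1 2)
qed

lemma densities_symmetric:
  assumes "St \<in> states"
  shows "\<exists>D. has_deriv_along (\<lambda>T. res0 (ev e T) x) St (flow f St) D \<and>
     has_deriv_along (\<lambda>T. res0 (ev f T) x) St (flow e St) D"
proof -
  obtain r l lb l0 l1 l2 where St: "St = ((l, lb), (l0, l1, l2))" and reg: "regular_state r l lb l0 l1 l2"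
    using assms by (rule regular_cases)
  interpret regular_state r l lb l0 l1 l2 by (rule reg)
  show ?thesis
    using density_deriv[of e x f] density_deriv[of f x e] coeff_along_eq[of f e x] unfolding St by auto
qed

section \<open>Differentials of functionals\<close>

lemma qev_continuous_on:
  assumes "continuous_on S l" "continuous_on S b" "continuous_on S g" "continuous_on S h"
    and nz: "\<And>y. y \<in> S \<Longrightarrow> l y \<noteq> 0 \<and> b y \<noteq> 0 \<and> l y + b y \<noteq> 0"
  shows "continuous_on S (\<lambda>y. qev e (l y) (b y) (g y) (h y))"
proof (induction e)
  case (WP k)
  show ?case unfolding qev.simps using assms by (intro continuous_on_power_int continuous_on_add) auto
qed (use assms in \<open>auto intro!: continuous_intros\<close>)

lemma pol_antimono: "r > 1 \<Longrightarrow> pol r UNIV m f \<Longrightarrow> 1 < s \<Longrightarrow> s \<le> r \<Longrightarrow> pol s UNIV m f"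
  unfolding pol_def[OF _ open_UNIV] by (fastforce intro: sm_subset)

lemma mil_antimono: "r > 1 \<Longrightarrow> mil r UNIV m f \<Longrightarrow> 1 < s \<Longrightarrow> s \<le> r \<Longrightarrow> mil s UNIV m f"
  unfolding mil_def[OF _ open_UNIV] by (rule pol_antimono)

lemma eventually_pol: "r > 1 \<Longrightarrow> pol r UNIV m f \<Longrightarrow> \<forall>\<^sub>F s in at_right 1. pol s UNIV m f"
  unfolding eventually_at_right_field using pol_antimono by (intro exI[of _ r]) auto

lemma eventually_mil: "r > 1 \<Longrightarrow> mil r UNIV m f \<Longrightarrow> \<forall>\<^sub>F s in at_right 1. mil s UNIV m f"
  unfolding eventually_at_right_field using mil_antimono by (intro exI[of _ r]) auto

lemma proj_periodic:
  "(\<And>z x. z \<in> circ \<Longrightarrow> f z (x + 2 * pi) = f z x) \<Longrightarrow> proj A f z (x + 2 * pi) = proj A f z x"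
  unfolding proj_def using coeff_cong[of "\<lambda>z. f z (x + 2 * pi)" "\<lambda>z. f z x"] by simp

lemma dx_periodic:
  assumes f: "sm U UNIV f" and z: "z \<in> U" and p: "\<And>x. f z (x + 2 * pi) = f z x"
  shows "dx f z (x + 2 * pi) = dx f z x"
proof -
  have "((\<lambda>y. y + 2 * pi) has_vector_derivative 1) (at x)"
    unfolding has_real_derivative_iff_has_vector_derivative[symmetric] by (auto intro!: derivative_eq_intros)
  from vector_diff_chain_at[OF this sm_has_dx[OF f z UNIV_I]]
  have "(f z has_vector_derivative dx f z (x + 2 * pi)) (at x)"
    by (simp add: o_def p)
  then show ?thesis by (rule dx_eqI[symmetric])
qed

context good_state_line
begin

text \<open>Joint continuity in the line parameter, \<open>z\<close> and \<open>x\<close>, which the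
  slices do not give, is required for differentiating under the integral over \<open>x\<close>.
  Composition with arbitrary continuous maps states it once for all arrangements of the
  variables.\<close>

lemma coeff_integrand_continuous:
  assumes X: "sm (annulus r) UNIV X" "sm (annulus r) UNIV Y" and s: "1 < s" "s < r"
    and g: "\<And>t. t \<in> T \<Longrightarrow> good s {a<..<b} (shift t (X, Y) St)"
    and small: "\<And>t z x. t \<in> T \<Longrightarrow> z \<in> annulus s \<Longrightarrow> x \<in> {a..b} \<Longrightarrow>
      norm (complex_of_real t * X z x / l z x) < 1 \<and>
      norm (complex_of_real t * (X z x + Y z x) / (l z x + lb z x)) < 1 \<and>
      norm (complex_of_real t * Y z x / lb z x) < 1"
    and A: "continuous_on A \<tau>" "continuous_on A w" "continuous_on A \<xi>"
    "\<And>y. y \<in> A \<Longrightarrow> \<tau> y \<in> T \<and> w y \<in> annulus s \<and> \<xi> y \<in> {a<..<b}"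
  shows "continuous_on A (\<lambda>y. ev e (shift (\<tau> y) (X, Y) St) (w y) (\<xi> y))"
proof -
  have sr: "annulus s \<subseteq> annulus r" using annulus_mono[of s r] s by auto
  have c: "continuous_on A (\<lambda>y. f (w y) (\<xi> y))" if "sm (annulus r) UNIV f" for f
    by (rule continuous_on_pair[OF sm_cont[OF that] A(2,3)]) (use A(4) sr in blast)
  have n: "l (w y) (\<xi> y) \<noteq> 0" "lb (w y) (\<xi> y) \<noteq> 0" "l (w y) (\<xi> y) + lb (w y) (\<xi> y) \<noteq> 0" if "y \<in> A" for y
    using nz[of "w y" "\<xi> y"] A(4)[OF that] sr by auto
  have ln: "continuous_on A (\<lambda>y. Ln (1 + F y))" if "continuous_on A F" "\<And>y. y \<in> A \<Longrightarrow> norm (F y) < 1" for F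
  proof (rule continuous_on_Ln')
    fix y assume "y \<in> A"
    then have "Re (1 + F y) > 0" using that(2) abs_Re_le_cmod[of "F y"] by force
    then show "1 + F y \<notin> \<real>\<^sub>\<le>\<^sub>0" by (auto simp: complex_nonpos_Reals_iff)
  qed (intro continuous_intros that)
  have sm': "norm (complex_of_real (\<tau> y) * X (w y) (\<xi> y) / l (w y) (\<xi> y)) < 1"
      "norm (complex_of_real (\<tau> y) * (X (w y) (\<xi> y) + Y (w y) (\<xi> y)) / (l (w y) (\<xi> y) + lb (w y) (\<xi> y))) < 1"
      "norm (complex_of_real (\<tau> y) * Y (w y) (\<xi> y) / lb (w y) (\<xi> y)) < 1" if "y \<in> A" for y
    using small[of "\<tau> y" "w y" "\<xi> y"] A(4)[OF that] by auto
  have n': "l (w y) (\<xi> y) + complex_of_real (\<tau> y) * X (w y) (\<xi> y) \<noteq> 0 \<and>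
      lb (w y) (\<xi> y) + complex_of_real (\<tau> y) * Y (w y) (\<xi> y) \<noteq> 0 \<and>
      l (w y) (\<xi> y) + complex_of_real (\<tau> y) * X (w y) (\<xi> y) + (lb (w y) (\<xi> y) + complex_of_real (\<tau> y) * Y (w y) (\<xi> y)) \<noteq> 0"
    if "y \<in> A" for y
  proof -
    note g' = g[of "\<tau> y"]
    interpret S: good_state s "{a<..<b}" "\<lambda>z x. l z x + complex_of_real (\<tau> y) * X z x" "\<lambda>z x. lb z x + complex_of_real (\<tau> y) * Y z x"
      "\<lambda>z x. l0 z x + Ln (1 + complex_of_real (\<tau> y) * X z x / l z x)"
      "\<lambda>z x. l1 z x + Ln (1 + complex_of_real (\<tau> y) * (X z x + Y z x) / (l z x + lb z x))"
      "\<lambda>z x. l2 z x + Ln (1 + complex_of_real (\<tau> y) * Y z x / lb z x)"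
      by unfold_locales (use s(1) g' A(4)[OF that] in \<open>simp_all only: shift.simps open_greaterThanLessThan\<close>)
    show ?thesis using S.nz[of "w y" "\<xi> y"] A(4)[OF that] by blast
  qed
  note ct = continuous_on_of_real[OF A(1)]
  have cF: "continuous_on A (\<lambda>y. complex_of_real (\<tau> y) * X (w y) (\<xi> y) / l (w y) (\<xi> y))"
    "continuous_on A (\<lambda>y. complex_of_real (\<tau> y) * (X (w y) (\<xi> y) + Y (w y) (\<xi> y)) / (l (w y) (\<xi> y) + lb (w y) (\<xi> y)))"
    "continuous_on A (\<lambda>y. complex_of_real (\<tau> y) * Y (w y) (\<xi> y) / lb (w y) (\<xi> y))"
    by (rule continuous_on_divide[OF continuous_on_mult[OF ct c[OF X(1)]] c[OF sms(1)]]
          continuous_on_divide[OF continuous_on_mult[OF ct continuous_on_add[OF c[OF X(1)] c[OF X(2)]]]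
            continuous_on_add[OF c[OF sms(1)] c[OF sms(2)]]]
          continuous_on_divide[OF continuous_on_mult[OF ct c[OF X(2)]] c[OF sms(2)]]; use n in blast)+
  show ?thesis
    unfolding shift.simps ev.simps
  proof (rule qev_continuous_on)
    show "continuous_on A (\<lambda>y. l1 (w y) (\<xi> y) + Ln (1 + complex_of_real (\<tau> y) * (X (w y) (\<xi> y) + Y (w y) (\<xi> y)) / (l (w y) (\<xi> y) + lb (w y) (\<xi> y))) -
        (l0 (w y) (\<xi> y) + Ln (1 + complex_of_real (\<tau> y) * X (w y) (\<xi> y) / l (w y) (\<xi> y))))"
      by (intro continuous_on_diff continuous_on_add c[OF sms(3)] c[OF sms(4)] ln[OF cF(1) sm'(1)] ln[OF cF(2) sm'(2)])
    show "continuous_on A (\<lambda>y. l2 (w y) (\<xi> y) + Ln (1 + complex_of_real (\<tau> y) * Y (w y) (\<xi> y) / lb (w y) (\<xi> y)) +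
        (l1 (w y) (\<xi> y) + Ln (1 + complex_of_real (\<tau> y) * (X (w y) (\<xi> y) + Y (w y) (\<xi> y)) / (l (w y) (\<xi> y) + lb (w y) (\<xi> y)))))"
      by (intro continuous_on_add c[OF sms(5)] c[OF sms(4)] ln[OF cF(3) sm'(3)] ln[OF cF(2) sm'(2)])
    show "continuous_on A (\<lambda>y. l (w y) (\<xi> y) + complex_of_real (\<tau> y) * X (w y) (\<xi> y))"
      "continuous_on A (\<lambda>y. lb (w y) (\<xi> y) + complex_of_real (\<tau> y) * Y (w y) (\<xi> y))"
      by (rule continuous_on_add[OF c[OF sms(1)] continuous_on_mult[OF ct c[OF X(1)]]]
          continuous_on_add[OF c[OF sms(2)] continuous_on_mult[OF ct c[OF X(2)]]])+
  qed (rule n')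
qed

lemma coeff_continuous:
  assumes "\<And>A (\<xi> :: 'b \<times> real \<Rightarrow> 'b) w. continuous_on A \<xi> \<Longrightarrow> continuous_on A w \<Longrightarrow>
    (\<And>y. y \<in> A \<Longrightarrow> \<xi> y \<in> B \<and> w y \<in> circ) \<Longrightarrow> continuous_on A (\<lambda>y. h (w y) (\<xi> y))"
  shows "continuous_on (B :: 'b :: topological_space set) (\<lambda>y. coeff (\<lambda>z. h z y) k)"
proof -
  have "continuous_on B (\<lambda>y. integral (cbox 0 1) (\<lambda>t. h (cis (2 * pi * t)) y * cis (2 * pi * t) powi (- k)))"
  proof (rule integral_continuous_on_param, unfold case_prod_beta')
    show "continuous_on (B \<times> cbox 0 1) (\<lambda>p. h (cis (2 * pi * snd p)) (fst p) * cis (2 * pi * snd p) powi (- k))"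
      by (intro continuous_on_mult assms continuous_on_power_int) (auto intro!: continuous_intros)
  qed
  then show ?thesis unfolding coeff_integral by simp
qed

text \<open>For each \<open>x\<close> the residue is differentiated along the slice, at every small
  \<open>t\<close>; joint continuity of the result then permits differentiation under the integral
  over the period.\<close>

lemma functional_deriv:
  assumes X: "sm (annulus r) UNIV X" "sm (annulus r) UNIV Y"
  shows "has_deriv_along (\<lambda>T. integral {0..2 * pi} (res0 (ev e T))) St (X, Y)
    (integral {0..2 * pi} (\<lambda>x. coeff (\<lambda>z. ev_along e St (X, Y) z x) 0))"
proof -
  obtain s where s: "1 < s" "s < r" using dense[OF r] by blast
  have sr: "annulus s \<subseteq> annulus r" using annulus_mono[of s r] s by auto
  have cs: "w \<in> annulus s" if "w \<in> circ" for w using that domain_subsets(1)[OF s(1)] by blast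
  \<comment> \<open>The margin of 1 places the closed period inside an open interval on which the
    shifted states are good.\<close>
  define a b :: real where "a = -1" and "b = 2 * pi + 1"
  obtain \<delta> where \<delta>: "\<delta> > 0"
    "\<And>t. \<bar>t\<bar> < \<delta> \<Longrightarrow> good s {a<..<b} (shift t (X, Y) St)"
    "\<And>x. x \<in> {a..b} \<Longrightarrow> good s {-\<delta><..<\<delta>} (shifted_slice x (X, Y) St)"
    "\<And>t z x. \<bar>t\<bar> < \<delta> \<Longrightarrow> z \<in> annulus s \<Longrightarrow> x \<in> {a..b} \<Longrightarrow>
      norm (complex_of_real t * X z x / l z x) < 1 \<and>
      norm (complex_of_real t * (X z x + Y z x) / (l z x + lb z x)) < 1 \<and>
      norm (complex_of_real t * Y z x / lb z x) < 1"
    using good_shift[OF X s subset_UNIV, of a b] by blast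
  define T where "T = {-\<delta><..<\<delta>}"
  have T: "open T" "0 \<in> T" "convex T" unfolding T_def using \<delta> by auto
  have Tt: "\<bar>t\<bar> < \<delta>" if "t \<in> T" for t using that unfolding T_def by auto
  have ci: "continuous_on A (\<lambda>y. ev e (shift (\<tau> y) (X, Y) St) (w y) (\<xi> y))"
    if "continuous_on A \<tau>" "continuous_on A w" "continuous_on A \<xi>"
      "\<And>y. y \<in> A \<Longrightarrow> \<tau> y \<in> T \<and> w y \<in> annulus s \<and> \<xi> y \<in> {a<..<b}"
    for e and A :: "'q :: topological_space set" and \<tau> w \<xi>
    by (rule coeff_integrand_continuous[where T = T and a = a and b = b, OF X s _ _ that])
      (use \<delta>(2,4) Tt in blast)+
  have ab: "x \<in> {a<..<b}" if "x \<in> {0..2 * pi}" for x using that unfolding a_def b_def by auto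
  define V where "V t z x = ev (dl e) (shift t (X, Y) St) z x * X z x + ev (db e) (shift t (X, Y) St) z x * Y z x" for t z x
  have slice: "((\<lambda>t. coeff (\<lambda>z. ev e (shift t (X, Y) St) z x) 0) has_vector_derivative coeff (\<lambda>z. V t z x) 0) (at t)"
    if t: "t \<in> T" and x: "x \<in> {0..2 * pi}" for t x
  proof -
    have g: "good s T (shifted_slice x (X, Y) St)" unfolding T_def by (rule \<delta>(3)) (use ab[OF x] in auto)
    interpret S: good_state s T "\<lambda>z s. l z x + complex_of_real s * X z x" "\<lambda>z s. lb z x + complex_of_real s * Y z x"
      "\<lambda>z s. l0 z x + Ln (1 + complex_of_real s * X z x / l z x)"
      "\<lambda>z s. l1 z x + Ln (1 + complex_of_real s * (X z x + Y z x) / (l z x + lb z x))"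
      "\<lambda>z s. l2 z x + Ln (1 + complex_of_real s * Y z x / lb z x)"
      by unfold_locales (use s(1) g T(1) in \<open>simp_all only: shifted_slice.simps\<close>)
    have "((\<lambda>t. coeff (\<lambda>z. ev e (shifted_slice x (X, Y) St) z t) 0) has_vector_derivative
        coeff (\<lambda>z. dx (ev e (shifted_slice x (X, Y) St)) z t) 0) (at t)"
      unfolding shifted_slice.simps by (rule coeff_dx[OF s(1) T(1) S.sm_ev t])
    moreover have "coeff (\<lambda>z. dx (ev e (shifted_slice x (X, Y) St)) z t) 0 = coeff (\<lambda>z. V t z x) 0"
    proof (rule coeff_cong)
      fix w assume "w \<in> circ"
      from S.dx_ev[OF cs[OF this] t, of e] show "dx (ev e (shifted_slice x (X, Y) St)) w t = V t w x"
        unfolding dx_affine shifted_slice.simps[symmetric] ev_shift[symmetric] V_def .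
    qed
    ultimately show ?thesis by (simp only: ev_shift)
  qed
  have "((\<lambda>t. integral (cbox 0 (2 * pi)) (\<lambda>x. coeff (\<lambda>z. ev e (shift t (X, Y) St) z x) 0)) has_vector_derivative
      integral (cbox 0 (2 * pi)) (\<lambda>x. coeff (\<lambda>z. V 0 z x) 0)) (at 0 within T)"
  proof (rule leibniz_rule_vector_derivative)
    show "((\<lambda>t. coeff (\<lambda>z. ev e (shift t (X, Y) St) z x) 0) has_vector_derivative coeff (\<lambda>z. V t z x) 0) (at t within T)"
      if "t \<in> T" "x \<in> cbox 0 (2 * pi)" for t x
      by (rule has_vector_derivative_at_within[OF slice]) (use that in auto)
    show "(\<lambda>x. coeff (\<lambda>z. ev e (shift t (X, Y) St) z x) 0) integrable_on cbox 0 (2 * pi)" if t: "t \<in> T" for t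
      unfolding cbox_interval
    proof (rule integrable_continuous_interval, rule coeff_continuous)
      fix A :: "(real \<times> real) set" and \<xi> w
      assume h: "continuous_on A \<xi>" "continuous_on A w" "\<And>y. y \<in> A \<Longrightarrow> \<xi> y \<in> {0..2 * pi} \<and> w y \<in> circ"
      show "continuous_on A (\<lambda>y. ev e (shift t (X, Y) St) (w y) (\<xi> y))"
        by (rule ci[OF continuous_on_const h(2,1)]) (use h(3) t ab cs in blast)
    qed
    have "continuous_on (T \<times> cbox 0 (2 * pi)) (\<lambda>p. coeff (\<lambda>z. V (fst p) z (snd p)) 0)"
    proof (rule coeff_continuous)
      fix A :: "((real \<times> real) \<times> real) set" and \<xi> w
      assume h: "continuous_on A \<xi>" "continuous_on A w" "\<And>y. y \<in> A \<Longrightarrow> \<xi> y \<in> T \<times> cbox 0 (2 * pi) \<and> w y \<in> circ"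
      have h': "fst (\<xi> y) \<in> T \<and> w y \<in> annulus s \<and> snd (\<xi> y) \<in> {a<..<b}" if "y \<in> A" for y
        using h(3)[OF that] ab cs by (cases "\<xi> y") auto
      have "continuous_on A (\<lambda>y. f (w y) (snd (\<xi> y)))" if "sm (annulus r) UNIV f" for f
        by (rule continuous_on_pair[OF sm_cont[OF that] h(2) continuous_on_snd[OF h(1)]]) (use h' sr in blast)
      note cX = this[OF X(1)] this[OF X(2)]
      note cE = ci[OF continuous_on_fst[OF h(1)] h(2) continuous_on_snd[OF h(1)] h']
      show "continuous_on A (\<lambda>y. V (fst (\<xi> y)) (w y) (snd (\<xi> y)))"
        unfolding V_def by (rule continuous_on_add[OF continuous_on_mult[OF cE cX(1)] continuous_on_mult[OF cE cX(2)]])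
    qed
    then show "continuous_on (T \<times> cbox 0 (2 * pi)) (\<lambda>(t, x). coeff (\<lambda>z. V t z x) 0)"
      unfolding case_prod_beta' .
  qed (use T in auto)
  moreover have "V 0 = ev_along e St (X, Y)"
    unfolding V_def ev_along_def shift_0 fst_conv snd_conv ..
  ultimately show ?thesis
    unfolding has_deriv_along_def res0_coeff[abs_def] at_within_open[OF T(2,1)] cbox_interval by (simp only:)
qed

end

text \<open>Testing with the conjugate of the difference of two coefficients.\<close>

lemma pairing_zero_imp:
  fixes c1 c2 :: "real \<Rightarrow> complex"
  assumes c: "continuous_on UNIV c1" "continuous_on UNIV c2"
    and per: "\<And>x. c1 (x + 2 * pi) = c1 x" "\<And>x. c2 (x + 2 * pi) = c2 x"
    and eq: "integral {0..2 * pi} (\<lambda>x. c1 x * cnj (c1 x - c2 x)) = integral {0..2 * pi} (\<lambda>x. c2 x * cnj (c1 x - c2 x))"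
  shows "c1 x = c2 x"
proof -
  define d where "d x = c1 x - c2 x" for x
  have cd: "continuous_on A c1" "continuous_on A c2" "continuous_on A d" for A
    unfolding d_def using c continuous_on_subset by (auto intro!: continuous_on_diff)
  have "integral {0..2 * pi} (\<lambda>x. c1 x * cnj (d x)) - integral {0..2 * pi} (\<lambda>x. c2 x * cnj (d x)) =
      integral {0..2 * pi} (\<lambda>x. c1 x * cnj (d x) - c2 x * cnj (d x))"
    by (rule integral_diff[symmetric]; rule integrable_continuous_interval; intro continuous_on_mult continuous_on_cnj cd)
  also have "\<dots> = integral {0..2 * pi} (\<lambda>x. complex_of_real ((norm (d x))\<^sup>2))"
    by (rule integral_cong) (simp only: d_def left_diff_distrib complex_norm_square)
  finally have 0: "integral {0..2 * pi} (\<lambda>x. complex_of_real ((norm (d x))\<^sup>2)) = 0"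
    using eq unfolding d_def by simp
  have "(\<lambda>x. complex_of_real ((norm (d x))\<^sup>2)) integrable_on {0..2 * pi}"
    by (rule integrable_continuous_interval) (intro continuous_intros cd)
  from integral_linear[OF this bounded_linear_Re] 0
  have "integral {0..2 * pi} (\<lambda>x. (norm (d x))\<^sup>2) = 0" by (simp add: o_def)
  moreover have "continuous_on {0..2 * pi} (\<lambda>x. (norm (d x))\<^sup>2)" by (intro continuous_intros cd)
  ultimately have d0: "d x = 0" if "x \<in> {0..2 * pi}" for x
    using integral_eq_0_iff[of 0 "2 * pi" "\<lambda>x. (norm (d x))\<^sup>2"] that by auto
  have "d (x + 2 * pi) = d x" for x unfolding d_def using per by simp
  then obtain y where "0 \<le> y" "y \<le> 2 * pi" "d y = d x" by (rule periodic_int[of d x])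
  then show ?thesis using d0[of y] unfolding d_def by simp
qed

lemma coeff_as_proj:
  assumes r: "r > 1" and f: "sm (annulus r) UNIV f"
  shows "sm (ball 0 r) UNIV (proj {0..} (\<lambda>z x. z powi (- k) * f z x))"
    and "coeff (\<lambda>z. f z x) k = proj {0..} (\<lambda>z x. z powi (- k) * f z x) 0 x"
    and "continuous_on UNIV (\<lambda>x. coeff (\<lambda>z. f z x) k)"
proof -
  note s = proj_nonneg(1)[OF r open_UNIV sm_shift[OF r open_UNIV f, of "- k"]]
  then show "sm (ball 0 r) UNIV (proj {0..} (\<lambda>z x. z powi (- k) * f z x))" .
  show e: "coeff (\<lambda>z. f z x) k = proj {0..} (\<lambda>z x. z powi (- k) * f z x) 0 x" for x
    by (simp add: proj_at_0[OF r open_UNIV] coeff_shift)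
  have "continuous_on UNIV (\<lambda>x. proj {0..} (\<lambda>z x. z powi (- k) * f z x) 0 x)"
    by (rule continuous_on_pair[OF sm_cont[OF s]]) (use r in \<open>auto intro: continuous_intros\<close>)
  then show "continuous_on UNIV (\<lambda>x. coeff (\<lambda>z. f z x) k)" unfolding e .
qed

lemma sm_cnj_coeff: "r > 1 \<Longrightarrow> sm (annulus r) UNIV f \<Longrightarrow> sm U UNIV (\<lambda>z x. cnj (coeff (\<lambda>z. f z x) k))"
  unfolding coeff_as_proj(2) by (rule sm_cnj[OF open_UNIV coeff_as_proj(1)]) auto

section \<open>Uniqueness of the differential\<close>

lemma TLM_I:
  assumes r: "r > 1" and X: "mil r UNIV 0 X" and Y: "pol r UNIV (-1) Y"
    and p: "\<And>z x. z \<in> exterior r \<Longrightarrow> X z (x + 2 * pi) = X z x" "\<And>z x. z \<in> pball r \<Longrightarrow> Y z (x + 2 * pi) = Y z x"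
  shows "(X, Y) \<in> TLM"
proof -
  have "periodic_near Dinf X"
    unfolding periodic_near_def eq_near_def
    using p(1) open_exterior[of r] domain_subsets(4)[OF r] by (intro exI[of _ "exterior r"]) auto
  moreover have "periodic_near D0p Y"
    unfolding periodic_near_def eq_near_def
    using p(2) open_pball[of r] domain_subsets(3)[OF r] by (intro exI[of _ "pball r"]) auto
  ultimately show ?thesis
    using eventually_mil[OF r X] eventually_pol[OF r Y]
    unfolding TLM_def smooth_vectors_def periodic_vectors_def by (simp add: smooth_Dinf_iff smooth_zinvD0_iff)
qed

lemma one_forms_radius:
  assumes "W \<in> one_forms"
  shows "\<forall>\<^sub>F r in at_right 1. sm (ball 0 r) UNIV (fst W) \<and> mil r UNIV 1 (snd W) \<and>
    (\<forall>z\<in>ball 0 r. \<forall>x. fst W z (x + 2 * pi) = fst W z x) \<and> (\<forall>z\<in>exterior r. \<forall>x. snd W z (x + 2 * pi) = snd W z x)"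
proof -
  obtain v w where W: "W = (v, w)" by (cases W)
  have h: "smooth_fam D0 v" "smooth_zDinf w" "periodic_near D0 v" "periodic_near Dinf w"
    using assms unfolding W one_forms_def by auto
  show ?thesis
    using h(1)[unfolded smooth_fam_D0_iff] h(2)[unfolded smooth_zDinf_iff]
      h(3)[unfolded periodic_near_def eq_near_ball] h(4)[unfolded periodic_near_def eq_near_exterior]
    by eventually_elim (simp add: W fun_eq_iff)
qed

text \<open>Two differentials pair equally with every tangent vector. Monomial test vectors isolate
  single coefficients, and the exponents they reach, at least 0 in the first and at most 1 in the
  second component, are precisely those that occur in \<open>one_forms\<close>.\<close>

lemma differential_unique:
  assumes "differential F St W" "differential F St V"
  shows "\<forall>\<^sub>F r in at_right 1. (\<forall>z\<in>ball 0 r. fst W z = fst V z) \<and> (\<forall>z\<in>exterior r. snd W z = snd V z)"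
proof -
  have of: "W \<in> one_forms" "V \<in> one_forms" using assms unfolding differential_def by auto
  have pair: "pairing W X = pairing V X" if "X \<in> TLM" for X
    using assms that unfolding differential_def has_deriv_along_def by (blast intro: vector_derivative_unique_at)
  have gt: "\<forall>\<^sub>F r in at_right (1::real). r > 1" by (rule eventually_at_right_less)
  show ?thesis
    using one_forms_radius[OF of(1)] one_forms_radius[OF of(2)] gt
  proof eventually_elim
    case (elim r)
    note r = elim(3) and rJ = elim(3) open_UNIV[where 'a = real]
    have a: "annulus r \<subseteq> exterior r" "annulus r \<subseteq> pball r" "annulus r \<subseteq> ball 0 r"
      using annulus_eq[of r] r by auto
    have ca: "circ \<subseteq> annulus r" using domain_subsets(1)[OF r] .
    have per0: "coeff (\<lambda>z. f z (x + 2 * pi)) k = coeff (\<lambda>z. f z x) k"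
      if "\<And>z. z \<in> annulus r \<Longrightarrow> f z (x + 2 * pi) = f z x" for f :: fld and x k
      by (rule coeff_cong) (use that ca in blast)
    have pers: "coeff (\<lambda>z. fst W z (x + 2 * pi)) k = coeff (\<lambda>z. fst W z x) k"
      "coeff (\<lambda>z. fst V z (x + 2 * pi)) k = coeff (\<lambda>z. fst V z x) k"
      "coeff (\<lambda>z. snd W z (x + 2 * pi)) k = coeff (\<lambda>z. snd W z x) k"
      "coeff (\<lambda>z. snd V z (x + 2 * pi)) k = coeff (\<lambda>z. snd V z x) k" for x k
      by (rule per0; use elim(1,2) a in blast)+
    have w: "coeff (\<lambda>z. fst W z x) k = coeff (\<lambda>z. fst V z x) k" if k: "k \<ge> 0" for x k
    proof -
      have s: "sm (annulus r) UNIV (fst W)" "sm (annulus r) UNIV (fst V)"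
        using elim(1,2) sm_subset[OF _ a(3)] by auto
      define c where "c x = coeff (\<lambda>z. fst W z x - fst V z x) k" for x
      have c: "c x = coeff (\<lambda>z. fst W z x) k - coeff (\<lambda>z. fst V z x) k" for x
      proof -
        have ch: "continuous_on circ (\<lambda>z. g z x)" if "sm (annulus r) UNIV g" for g
          by (rule continuous_on_subset[OF holomorphic_on_imp_continuous_on[OF sm_hol[OF that UNIV_I]] ca])
        have "c x = coeff (\<lambda>z. fst W z x) k + coeff (\<lambda>z. - fst V z x) k"
          unfolding c_def using coeff_add[OF ch[OF s(1)] ch[OF sm_uminus[OF open_UNIV s(2)]], of k] by simp
        then show ?thesis using coeff_cmult[of "-1" "\<lambda>z. fst V z x" k] by simp
      qed
      \<comment> \<open>The power \<open>- k\<close> moves the k-th coefficient to the residue; the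
        vector is regular at infinity because \<open>k\<close> is nonnegative. The conjugate makes
        the difference of the pairings an integral of a squared modulus.\<close>
      define X where "X = (\<lambda>z x. z powi (- k) * cnj (c x))"
      have "mil r UNIV (- k) X"
        unfolding mil_def[OF rJ]
      proof (rule polI[OF rJ])
        show "sm (ball 0 r) UNIV (\<lambda>z x. cnj (c x))"
          unfolding c_def by (rule sm_cnj_coeff[OF r sm_diff[OF open_UNIV s]])
      qed (simp add: X_def power_int_inverse power_int_minus)
      then have X: "mil r UNIV 0 X" by (rule mil_mono[OF rJ]) (use k in simp)
      have Y: "pol r UNIV (-1) (\<lambda>z x. 0)" by (rule polI[OF rJ sm_const[OF open_UNIV, of _ 0]]) simp
      have cp: "c (x + 2 * pi) = c x" for x
        unfolding c pers ..
      have T: "(X, \<lambda>z x. 0) \<in> TLM"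
        by (rule TLM_I[OF r X Y]) (auto simp: X_def cp)
      have res: "res0 (\<lambda>z x. fst Z z x * fst (X, \<lambda>z x. 0) z x + snd Z z x * snd (X, \<lambda>z x. 0) z x) x =
          coeff (\<lambda>z. fst Z z x) k * cnj (c x)" for Z :: fpair and x
      proof -
        have "(\<lambda>z. fst Z z x * fst (X, \<lambda>z x. 0) z x + snd Z z x * snd (X, \<lambda>z x. 0) z x) =
            (\<lambda>z. cnj (c x) * (z powi (- k) * fst Z z x))"
          by (auto simp: X_def fun_eq_iff mult_ac)
        then show ?thesis unfolding res0_coeff by (simp add: coeff_cmult coeff_shift mult.commute)
      qed
      show ?thesis
      proof (rule pairing_zero_imp[where x = x])
        show "integral {0..2 * pi} (\<lambda>x. coeff (\<lambda>z. fst W z x) k * cnj (coeff (\<lambda>z. fst W z x) k - coeff (\<lambda>z. fst V z x) k)) =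
            integral {0..2 * pi} (\<lambda>x. coeff (\<lambda>z. fst V z x) k * cnj (coeff (\<lambda>z. fst W z x) k - coeff (\<lambda>z. fst V z x) k))"
          using pair[OF T] unfolding pairing_def res[abs_def] c .
      qed (rule pers coeff_as_proj(3)[OF r s(1)] coeff_as_proj(3)[OF r s(2)])+
    qed
    have w': "coeff (\<lambda>z. snd W z x) k = coeff (\<lambda>z. snd V z x) k" if k: "k \<le> 1" for x k
    proof -
      have s: "sm (annulus r) UNIV (snd W)" "sm (annulus r) UNIV (snd V)"
        using elim(1,2) sm_subset[OF mil_sm[OF rJ] a(1)] by auto
      define c where "c x = coeff (\<lambda>z. snd W z x - snd V z x) k" for x
      have c: "c x = coeff (\<lambda>z. snd W z x) k - coeff (\<lambda>z. snd V z x) k" for x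
      proof -
        have ch: "continuous_on circ (\<lambda>z. g z x)" if "sm (annulus r) UNIV g" for g
          by (rule continuous_on_subset[OF holomorphic_on_imp_continuous_on[OF sm_hol[OF that UNIV_I]] ca])
        have "c x = coeff (\<lambda>z. snd W z x) k + coeff (\<lambda>z. - snd V z x) k"
          unfolding c_def using coeff_add[OF ch[OF s(1)] ch[OF sm_uminus[OF open_UNIV s(2)]], of k] by simp
        then show ?thesis using coeff_cmult[of "-1" "\<lambda>z. snd V z x" k] by simp
      qed
      \<comment> \<open>A simple pole at 0 is allowed in the second component, so exponents up to 1
        can be tested.\<close>
      define Y where "Y = (\<lambda>z x. z powi (- k) * cnj (c x))"
      have "pol r UNIV (- k) Y"
      proof (rule polI[OF rJ])
        show "sm (ball 0 r) UNIV (\<lambda>z x. cnj (c x))"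
          unfolding c_def by (rule sm_cnj_coeff[OF r sm_diff[OF open_UNIV s]])
      qed (simp add: Y_def)
      then have Y: "pol r UNIV (-1) Y" by (rule pol_mono[OF rJ]) (use k in simp)
      have X: "mil r UNIV 0 (\<lambda>z x. 0)" unfolding mil_def[OF rJ] by (rule polI[OF rJ sm_const[OF open_UNIV, of _ 0]]) simp
      have cp: "c (x + 2 * pi) = c x" for x
        unfolding c pers ..
      have T: "(\<lambda>z x. 0, Y) \<in> TLM"
        by (rule TLM_I[OF r X Y]) (auto simp: Y_def cp)
      have res: "res0 (\<lambda>z x. fst Z z x * fst (\<lambda>z x. 0, Y) z x + snd Z z x * snd (\<lambda>z x. 0, Y) z x) x =
          coeff (\<lambda>z. snd Z z x) k * cnj (c x)" for Z :: fpair and x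
      proof -
        have "(\<lambda>z. fst Z z x * fst (\<lambda>z x. 0, Y) z x + snd Z z x * snd (\<lambda>z x. 0, Y) z x) =
            (\<lambda>z. cnj (c x) * (z powi (- k) * snd Z z x))"
          by (auto simp: Y_def fun_eq_iff mult_ac)
        then show ?thesis unfolding res0_coeff by (simp add: coeff_cmult coeff_shift mult.commute)
      qed
      show ?thesis
      proof (rule pairing_zero_imp[where x = x])
        show "integral {0..2 * pi} (\<lambda>x. coeff (\<lambda>z. snd W z x) k * cnj (coeff (\<lambda>z. snd W z x) k - coeff (\<lambda>z. snd V z x) k)) =
            integral {0..2 * pi} (\<lambda>x. coeff (\<lambda>z. snd V z x) k * cnj (coeff (\<lambda>z. snd W z x) k - coeff (\<lambda>z. snd V z x) k))"
          using pair[OF T] unfolding pairing_def res[abs_def] c .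
      qed (rule pers coeff_as_proj(3)[OF r s(1)] coeff_as_proj(3)[OF r s(2)])+
    qed
    have "fst W z x = fst V z x" if z: "z \<in> ball 0 r" for z x
    proof -
      have "proj {0..} (fst W) z x = proj {0..} (fst V) z x"
        unfolding proj_def by (rule infsum_cong) (simp add: w)
      then show ?thesis
        using ball_proj_id[OF rJ, of "fst W" z x] ball_proj_id[OF rJ, of "fst V" z x] elim(1,2) z by simp
    qed
    moreover have "snd W z x = snd V z x" if z: "z \<in> exterior r" for z x
    proof -
      have "proj {..1} (snd W) z x = proj {..1} (snd V) z x"
        unfolding proj_def by (rule infsum_cong) (simp add: w')
      then show ?thesis
        using mil_proj_id[OF rJ, of 1 "snd W" z x] mil_proj_id[OF rJ, of 1 "snd V" z x] elim(1,2) z by simp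
    qed
    ultimately show ?case by (auto simp: fun_eq_iff)
  qed
qed

section \<open>Hamiltonian vector fields\<close>

declare ev.simps [simp del]

context domain_pair
begin

lemma bracket_right:
  assumes z: "z \<in> U" and x: "x \<in> J" and h: "sm U J h" and f: "sm U J f" and g: "sm U J g"
  shows bracket_right_add: "bracket h (\<lambda>z x. f z x + g z x) z x = bracket h f z x + bracket h g z x"
    and bracket_right_diff: "bracket h (\<lambda>z x. f z x - g z x) z x = bracket h f z x - bracket h g z x"
    and bracket_right_uminus: "bracket h (\<lambda>z x. - f z x) z x = - bracket h f z x"
    and bracket_right_mult: "bracket h (\<lambda>z x. f z x * g z x) z x = bracket h f z x * g z x + f z x * bracket h g z x"
  unfolding bracket_th dx_rules[OF z x f g] th_rules[OF z x f g] by (simp_all add: algebra_simps)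

end

lemma bracket_self: "bracket f f z x = 0"
  unfolding bracket_th by simp

context
  fixes r :: real
  assumes r: "r > 1"
begin

lemma mil_split_0:
  assumes f: "mil r UNIV 0 f" and z: "z \<in> exterior r"
  shows "f z x = proj {..-1} f z x + coeff (\<lambda>z. f z x) 0"
proof -
  note rJ = r open_UNIV[where 'a = real]
  have i: "inverse z \<in> pball r" using z inverse_pball_iff[of r z] r by linarith
  have s: "sm (annulus r) UNIV (\<lambda>z x. f (inverse z) x)"
    by (rule sm_reflect[OF rJ sm_subset[OF mil_sm[OF rJ f]]]) (use annulus_eq[of r] r in auto)
  have "f z x = proj {..0} f z x" by (rule mil_proj_id[OF rJ f z UNIV_I, symmetric])
  also have "\<dots> = proj {0..} (\<lambda>z x. f (inverse z) x) (inverse z) x"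
    using proj_reflect[OF rJ, of 0 f z x] by simp
  also have "\<dots> = proj {0..} (\<lambda>z x. f (inverse z) x) 0 x + proj {1..} (\<lambda>z x. f (inverse z) x) (inverse z) x"
    by (rule proj_split_0[OF rJ s]) (use i in auto)
  also have "proj {0..} (\<lambda>z x. f (inverse z) x) 0 x = coeff (\<lambda>z. f z x) 0"
    using coeff_inverse[of "\<lambda>z. f z x" 0] by (simp add: proj_at_0[OF rJ])
  also have "proj {1..} (\<lambda>z x. f (inverse z) x) (inverse z) x = proj {..-1} f z x"
    using proj_reflect[OF rJ, of "-1" f z x] by simp
  finally show ?thesis by simp
qed

text \<open>A decomposition on the circle into exponents at most \<open>m\<close> and at least
  \<open>m + 1\<close> must be the one given by the projections. With it the projections in the
  Poisson tensors are found by exhibiting a decomposition.\<close>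

lemma split_proj:
  assumes f: "mil r UNIV m f" and g: "pol r UNIV (m + 1) g"
    and F: "\<And>z. z \<in> circ \<Longrightarrow> F z x = f z x + g z x"
  shows "z \<in> exterior r \<Longrightarrow> proj {..m} F z x = f z x"
    and "z \<in> pball r \<Longrightarrow> proj {m + 1..} F z x = g z x"
    and "coeff (\<lambda>z. F z x) k = coeff (\<lambda>z. f z x) k + coeff (\<lambda>z. g z x) k"
proof -
  note rJ = r open_UNIV[where 'a = real]
  have s: "sm (annulus r) UNIV f" "sm (annulus r) UNIV g"
    using sm_subset[OF mil_sm[OF rJ f], of "annulus r" UNIV] sm_subset[OF pol_sm[OF rJ g], of "annulus r" UNIV]
      annulus_eq[of r] r by auto
  have p: "proj A F z x = proj A (\<lambda>z x. f z x + g z x) z x" for A z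
    by (rule proj_cong) (rule F)
  have h: "half r {..m} (exterior r)" "half r {m + 1..} (pball r)" unfolding half_def[OF rJ] by auto
  have i: "{..m} \<subseteq> {..<m + 1}" "{m + 1..} \<subseteq> {m<..}" by auto
  show "z \<in> exterior r \<Longrightarrow> proj {..m} F z x = f z x"
    unfolding p using proj_add[OF rJ h(1) s, of z x] mil_proj_id[OF rJ f, of z x] pol_proj_0[OF rJ g, of x "{..m}" z] i(1)
    by auto
  show "z \<in> pball r \<Longrightarrow> proj {m + 1..} F z x = g z x"
    unfolding p using proj_add[OF rJ h(2) s, of z x] pol_proj_id[OF rJ g, of z x] mil_proj_0[OF rJ f, of x "{m + 1..}" z] i(2)
    by auto
  have ca: "circ \<subseteq> annulus r" using domain_subsets(1)[OF r] .
  have ch: "continuous_on circ (\<lambda>z. g z x)" if "sm (annulus r) UNIV g" for g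
    by (rule continuous_on_subset[OF holomorphic_on_imp_continuous_on[OF sm_hol[OF that UNIV_I]] ca])
  show "coeff (\<lambda>z. F z x) k = coeff (\<lambda>z. f z x) k + coeff (\<lambda>z. g z x) k"
    using coeff_add[OF ch[OF s(1)] ch[OF s(2)]] coeff_cong[of "\<lambda>z. F z x" "\<lambda>z. f z x + g z x" k] F by simp
qed

end

text \<open>The pairing with \<open>TLM\<close> sees only the projections of the gradient to the spaces of \<open>one_forms\<close>.\<close>

definition dform :: "qx \<Rightarrow> state \<Rightarrow> fpair" where
  "dform e St = (proj {0..} (ev (dl e) St), proj {..1} (ev (db e) St))"

definition diff_op :: "qx \<Rightarrow> qx" where
  "diff_op e = Ad (db e) (neg (dl e))"

definition euler_op :: "qx \<Rightarrow> qx" where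
  "euler_op e = Ad (Mu VL (dl e)) (Mu VB (db e))"

context regular_state
begin

section \<open>Truncated gradients and the two Poisson structures\<close>

abbreviation "high e \<equiv> proj {2..} (ev e St)"
abbreviation "low e \<equiv> proj {..1} (ev e St)"

lemma high_pol: "pol r UNIV 2 (high e)" by (rule pol_proj[OF rJ sm_ev])
lemma low_mil: "mil r UNIV 1 (low e)" by (rule mil_proj[OF rJ sm_ev])
lemma high_sm: "sm (pball r) UNIV (high e)" by (rule pol_sm[OF rJ high_pol])
lemma low_sm: "sm (exterior r) UNIV (low e)" by (rule mil_sm[OF rJ low_mil])
lemma high_ann: "sm (annulus r) UNIV (high e)" by (rule sm_subset[OF high_sm ann_sub(2)]) simp
lemma low_ann: "sm (annulus r) UNIV (low e)" by (rule sm_subset[OF low_sm ann_sub(1)]) simp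

lemma low_eq: "z \<in> annulus r \<Longrightarrow> low e z x = ev e St z x - high e z x"
proof -
  assume z: "z \<in> annulus r"
  have "{..<2} = {..1 :: int}" by auto
  with laurent[OF rJ sm_ev[of e] z UNIV_I, of 2 x] show ?thesis by (simp add: algebra_simps)
qed

lemma pos_part_eq: "z \<in> annulus r \<Longrightarrow> pos_part e z x = ev e St z x - neg_part e z x"
  by (simp add: neg_part_eq)

text \<open>The discarded tails pair to zero: exponents at most -1 against a vector regular at
  infinity stay below 0, and exponents at least 2 against a simple pole stay above 0.\<close>

lemma dform_pairing:
  assumes X: "mil r UNIV 0 X" and Y: "pol r UNIV (-1) Y"
  shows "pairing (dform e St) (X, Y) = integral {0..2 * pi} (\<lambda>x. coeff (\<lambda>z. ev_along e St (X, Y) z x) 0)"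
  unfolding pairing_def res0_coeff
proof (rule integral_cong)
  fix x
  have s: "sm (annulus r) UNIV X" "sm (annulus r) UNIV Y"
    using sm_subset[OF mil_sm[OF rJ X] ann_sub(1)] sm_subset[OF pol_sm[OF rJ Y] ann_sub(2)] by auto
  have ch: "continuous_on circ (\<lambda>z. g z x)" if "sm (annulus r) UNIV g" for g
    by (rule continuous_on_subset[OF holomorphic_on_imp_continuous_on[OF sm_hol[OF that UNIV_I]]]) (use circ_ann in blast)
  have f: "mil r UNIV (-1) (\<lambda>z x. neg_part (dl e) z x * X z x)"
    using mil_mult[OF rJ neg_part_mil X] by simp
  have g: "pol r UNIV (-1 + 1 + 1) (\<lambda>z x. high (db e) z x * Y z x)"
    using pol_mult[OF rJ high_pol Y] by simp
  have "coeff (\<lambda>z. ev_along e St (X, Y) z x) 0 = coeff (\<lambda>z. (pos_part (dl e) z x * X z x + low (db e) z x * Y z x) +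
      (neg_part (dl e) z x * X z x + high (db e) z x * Y z x)) 0"
    by (rule coeff_cong) (simp add: ev_along_def pos_part_eq[OF circ_ann] low_eq[OF circ_ann] algebra_simps)
  also have "\<dots> = coeff (\<lambda>z. pos_part (dl e) z x * X z x + low (db e) z x * Y z x) 0 +
      (coeff (\<lambda>z. neg_part (dl e) z x * X z x) 0 + coeff (\<lambda>z. high (db e) z x * Y z x) 0)"
  proof -
    note m = sm_mult[OF open_UNIV pos_part_ann s(1), of "dl e"] sm_mult[OF open_UNIV low_ann s(2), of "db e"]
      sm_mult[OF open_UNIV neg_part_ann s(1), of "dl e"] sm_mult[OF open_UNIV high_ann s(2), of "db e"]
    show ?thesis
      using coeff_add[OF continuous_on_add[OF ch[OF m(1)] ch[OF m(2)]] continuous_on_add[OF ch[OF m(3)] ch[OF m(4)]], of 0]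
        coeff_add[OF ch[OF m(3)] ch[OF m(4)], of 0] by simp
  qed
  also have "coeff (\<lambda>z. neg_part (dl e) z x * X z x) 0 = 0" by (rule mil_coeff[OF rJ f]) auto
  also have "coeff (\<lambda>z. high (db e) z x * Y z x) 0 = 0" by (rule pol_coeff[OF rJ g]) auto
  finally show "coeff (\<lambda>z. fst (dform e St) z x * fst (X, Y) z x + snd (dform e St) z x * snd (X, Y) z x) 0 =
      coeff (\<lambda>z. ev_along e St (X, Y) z x) 0"
    unfolding dform_def by simp
qed

lemma dform_deriv:
  assumes X: "mil r UNIV 0 X" and Y: "pol r UNIV (-1) Y"
  shows "has_deriv_along (\<lambda>T. integral {0..2 * pi} (res0 (ev e T))) St (X, Y) (pairing (dform e St) (X, Y))"
  unfolding dform_pairing[OF X Y]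
  by (rule functional_deriv; rule sm_subset[OF mil_sm[OF rJ X] ann_sub(1)] sm_subset[OF pol_sm[OF rJ Y] ann_sub(2)]; simp)

lemma dform_one_forms:
  assumes "\<And>z x. z \<in> circ \<Longrightarrow> ev (dl e) St z (x + 2 * pi) = ev (dl e) St z x"
    "\<And>z x. z \<in> circ \<Longrightarrow> ev (db e) St z (x + 2 * pi) = ev (db e) St z x"
  shows "dform e St \<in> one_forms"
proof -
  have "smooth_fam D0 (pos_part (dl e))"
    unfolding smooth_fam_iff using pos_part_ball domain_subsets(2)[OF r1] by blast
  moreover have "smooth_zDinf (low (db e))"
    unfolding smooth_zDinf_iff by (rule eventually_mil[OF r1 low_mil])
  moreover have "periodic_near D0 (pos_part (dl e))" "periodic_near Dinf (low (db e))"
    unfolding periodic_near_def eq_near_def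
    using proj_periodic[of "ev (dl e) St", OF assms(1)] proj_periodic[of "ev (db e) St", OF assms(2)]
    by (auto intro!: exI[of _ UNIV])
  ultimately show ?thesis unfolding dform_def one_forms_def by simp
qed

abbreviation "S e \<equiv> Ssum (l, lb) (dform e St)"

lemma l_ann: "sm (annulus r) UNIV l" and lb_ann: "sm (annulus r) UNIV lb" by (rule sms)+

text \<open>By the chain rule the two brackets are mixed second partials times {\<lambda>,
  \<lambda>b} and {\<lambda>b, \<lambda>}, which cancel by symmetry.\<close>

lemma bracket_gradient: "z \<in> annulus r \<Longrightarrow> bracket l (ev (dl e) St) z x + bracket lb (ev (db e) St) z x = 0"
proof -
  assume z: "z \<in> annulus r"
  have "ev (dl (db e)) St z x = ev (db (dl e)) St z x" by (simp add: ev.simps qev_schwarz)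
  then show ?thesis unfolding bracket_th dx_ev[OF z UNIV_I] th_ev[OF z UNIV_I] by (simp add: algebra_simps)
qed

text \<open>The brackets with the full gradient cancel, so those with the truncated one equal minus
  the brackets with its tails. The two summands have exponents at most 0 and at least 1, exactly the
  cut made in \<open>P1\<close> and \<open>P2\<close>, which explains the truncation at 1 instead of
  0 in the second component.\<close>

lemma S_eq:
  assumes z: "z \<in> annulus r"
  shows "S e z x = - bracket l (neg_part (dl e)) z x + - bracket lb (high (db e)) z x"
proof -
  have "bracket l (pos_part (dl e)) z x = bracket l (\<lambda>z x. ev (dl e) St z x - neg_part (dl e) z x) z x"
    by (rule bracket_cong[OF open_annulus open_UNIV z UNIV_I]) (auto simp: pos_part_eq)
  also have "\<dots> = bracket l (ev (dl e) St) z x - bracket l (neg_part (dl e)) z x"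
    by (rule bracket_right_diff[OF z UNIV_I l_ann sm_ev neg_part_ann])
  finally have 1: "bracket l (pos_part (dl e)) z x = bracket l (ev (dl e) St) z x - bracket l (neg_part (dl e)) z x" .
  have "bracket lb (low (db e)) z x = bracket lb (\<lambda>z x. ev (db e) St z x - high (db e) z x) z x"
    by (rule bracket_cong[OF open_annulus open_UNIV z UNIV_I]) (auto simp: low_eq)
  also have "\<dots> = bracket lb (ev (db e) St) z x - bracket lb (high (db e)) z x"
    by (rule bracket_right_diff[OF z UNIV_I lb_ann sm_ev high_ann])
  finally have 2: "bracket lb (low (db e)) z x = bracket lb (ev (db e) St) z x - bracket lb (high (db e)) z x" .
  have "S e z x = bracket l (pos_part (dl e)) z x + bracket lb (low (db e)) z x" by (simp add: dform_def)
  then show ?thesis using bracket_gradient[OF z, of e x] unfolding 1 2 by (simp add: algebra_simps add_eq_0_iff)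
qed

lemma S_mil: "mil r UNIV 0 (\<lambda>z x. - bracket l (neg_part (dl e)) z x)"
  using mil_uminus[OF rJ mil_bracket[OF rJ l_mils(1) neg_part_mil]] by simp

lemma S_pol: "pol r UNIV (0 + 1) (\<lambda>z x. - bracket lb (high (db e)) z x)"
  using pol_uminus[OF rJ pol_bracket[OF rJ pol_lb high_pol]] by simp

lemma S_projs:
  "z \<in> exterior r \<Longrightarrow> proj {..0} (S e) z x = - bracket l (neg_part (dl e)) z x"
  "z \<in> pball r \<Longrightarrow> proj {1..} (S e) z x = - bracket lb (high (db e)) z x"
  "coeff (\<lambda>z. S e z x) 0 = - coeff (\<lambda>z. bracket l (neg_part (dl e)) z x) 0"
proof -
  note h = split_proj[OF r1 S_mil[of e] S_pol[of e], where F = "S e" and x = x, OF S_eq[OF circ_ann]]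
  show "z \<in> exterior r \<Longrightarrow> proj {..0} (S e) z x = - bracket l (neg_part (dl e)) z x" by (rule h(1))
  show "z \<in> pball r \<Longrightarrow> proj {1..} (S e) z x = - bracket lb (high (db e)) z x" using h(2) by simp
  have "coeff (\<lambda>z. - bracket lb (high (db e)) z x) 0 = 0"
    by (rule pol_coeff[OF rJ S_pol]) auto
  then show "coeff (\<lambda>z. S e z x) 0 = - coeff (\<lambda>z. bracket l (neg_part (dl e)) z x) 0"
    using h(3)[of 0] coeff_cmult[of "-1" "\<lambda>z. bracket l (neg_part (dl e)) z x" 0] by simp
qed

lemma sets_eq: "{..<0} = {..-1 :: int}" "{0<..} = {1 :: int..}"
  by auto

lemma diff_op_parts:
  "z \<in> exterior r \<Longrightarrow> neg_part (diff_op e) z x = neg_part (db e) z x - neg_part (dl e) z x"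
  "z \<in> pball r \<Longrightarrow> pos_part (diff_op e) z x = pos_part (db e) z x - pos_part (dl e) z x"
proof -
  have "ev (diff_op e) St z x = ev (db e) St z x - ev (dl e) St z x" for z x
    by (simp add: diff_op_def neg_def ev.simps)
  then have e: "ev (diff_op e) St = (\<lambda>z x. ev (db e) St z x - ev (dl e) St z x)" by blast
  show "z \<in> exterior r \<Longrightarrow> neg_part (diff_op e) z x = neg_part (db e) z x - neg_part (dl e) z x"
    unfolding e by (rule proj_diff[OF rJ halves(1) sm_ev sm_ev _ UNIV_I])
  show "z \<in> pball r \<Longrightarrow> pos_part (diff_op e) z x = pos_part (db e) z x - pos_part (dl e) z x"
    unfolding e by (rule proj_diff[OF rJ halves(2) sm_ev sm_ev _ UNIV_I])
qed

lemma eq_vecI: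
  assumes "\<And>z x. z \<in> exterior r \<Longrightarrow> fst X z x = fst Y z x" "\<And>z x. z \<in> pball r \<Longrightarrow> snd X z x = snd Y z x"
  shows "eq_vec X Y"
  unfolding eq_vec_def eq_near_def
  using assms open_exterior[of r] open_pball[of r] domain_subsets(3,4)[OF r1]
  by (intro conjI exI[of _ "exterior r"] exI[of _ "pball r"]) auto

text \<open>On the circle the difference of the truncated gradients is rewritten with tails. The
  tail \<open>high\<close> then occurs in the second component once through this difference and once
  through S, with opposite signs; in the first component the tails combine to the negative part of
  the difference of the partial derivatives.\<close>

lemma P1_dform: "eq_vec (P1 (l, lb) (dform e St)) (flow (diff_op e) St)"
proof -
  define d where "d = (\<lambda>z x. pos_part (dl e) z x - low (db e) z x)"
  have g: "pol r UNIV (-1 + 1) (\<lambda>z x. pos_part (dl e) z x - pos_part (db e) z x + high (db e) z x)"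
    using pol_add[OF rJ pol_diff[OF rJ pos_part_pol[of "dl e"] pos_part_pol[of "db e"]] pol_mono[OF rJ high_pol[of "db e"], of 0]] by simp
  have "d z x = - neg_part (db e) z x + (pos_part (dl e) z x - pos_part (db e) z x + high (db e) z x)" if "z \<in> circ" for z x
    unfolding d_def low_eq[OF circ_ann[OF that]] pos_part_eq[OF circ_ann[OF that]] by simp
  note h = split_proj[OF r1 mil_uminus[OF rJ neg_part_mil] g, where F = d, OF this]
  have "fst (P1 (l, lb) (dform e St)) z x = fst (flow (diff_op e) St) z x" if z: "z \<in> exterior r" for z x
  proof -
    have "fst (P1 (l, lb) (dform e St)) z x = - bracket l (proj {..-1} d) z x + proj {..0} (S e) z x"
      unfolding dform_def d_def by (simp add: Let_def sets_eq)
    also have "bracket l (proj {..-1} d) z x = bracket l (\<lambda>z x. - neg_part (db e) z x) z x"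
      by (rule bracket_cong[OF open_exterior open_UNIV z UNIV_I]) (use h(1) in auto)
    also have "\<dots> = - bracket l (neg_part (db e)) z x"
      by (rule X.bracket_right_uminus[OF z UNIV_I l_mils(4) neg_part_sm neg_part_sm])
    also have "proj {..0} (S e) z x = - bracket l (neg_part (dl e)) z x" by (rule S_projs(1)[OF z])
    finally have 1: "fst (P1 (l, lb) (dform e St)) z x = bracket l (neg_part (db e)) z x - bracket l (neg_part (dl e)) z x"
      by simp
    have "fst (flow (diff_op e) St) z x = bracket l (neg_part (diff_op e)) z x"
      unfolding flow_eq(1)[OF z] using X.bracket_commute[of l "neg_part (diff_op e)" z x] by simp
    also have "\<dots> = bracket l (\<lambda>z x. neg_part (db e) z x - neg_part (dl e) z x) z x"
      by (rule bracket_cong[OF open_exterior open_UNIV z UNIV_I]) (auto simp: diff_op_parts)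
    also have "\<dots> = bracket l (neg_part (db e)) z x - bracket l (neg_part (dl e)) z x"
      by (rule X.bracket_right_diff[OF z UNIV_I l_mils(4) neg_part_sm neg_part_sm])
    finally show ?thesis using 1 by simp
  qed
  moreover have "snd (P1 (l, lb) (dform e St)) z x = snd (flow (diff_op e) St) z x" if z: "z \<in> pball r" for z x
  proof -
    note s = sm_diff[OF open_UNIV pos_part_sm[of "dl e"] pos_part_sm[of "db e"]]
    have "snd (P1 (l, lb) (dform e St)) z x = bracket lb (proj {0..} d) z x + proj {1..} (S e) z x"
      unfolding dform_def d_def by (simp add: Let_def sets_eq)
    also have "bracket lb (proj {0..} d) z x = bracket lb (\<lambda>z x. pos_part (dl e) z x - pos_part (db e) z x + high (db e) z x) z x"
      by (rule bracket_cong[OF open_pball open_UNIV z UNIV_I]) (use h(2) in auto)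
    also have "\<dots> = bracket lb (\<lambda>z x. pos_part (dl e) z x - pos_part (db e) z x) z x + bracket lb (high (db e)) z x"
      by (rule P.bracket_right_add[OF z UNIV_I lb_sm s high_sm])
    also have "bracket lb (\<lambda>z x. pos_part (dl e) z x - pos_part (db e) z x) z x = bracket lb (pos_part (dl e)) z x - bracket lb (pos_part (db e)) z x"
      by (rule P.bracket_right_diff[OF z UNIV_I lb_sm pos_part_sm pos_part_sm])
    also have "proj {1..} (S e) z x = - bracket lb (high (db e)) z x" by (rule S_projs(2)[OF z])
    finally have 1: "snd (P1 (l, lb) (dform e St)) z x = bracket lb (pos_part (dl e)) z x - bracket lb (pos_part (db e)) z x" by simp
    have "snd (flow (diff_op e) St) z x = - bracket lb (pos_part (diff_op e)) z x"
      unfolding flow_eq(2) by (rule P.bracket_commute)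
    also have "bracket lb (pos_part (diff_op e)) z x = bracket lb (\<lambda>z x. pos_part (db e) z x - pos_part (dl e) z x) z x"
      by (rule bracket_cong[OF open_pball open_UNIV z UNIV_I]) (auto simp: diff_op_parts)
    also have "\<dots> = bracket lb (pos_part (db e)) z x - bracket lb (pos_part (dl e)) z x"
      by (rule P.bracket_right_diff[OF z UNIV_I lb_sm pos_part_sm pos_part_sm])
    finally show ?thesis using 1 by simp
  qed
  ultimately show ?thesis by (rule eq_vecI)
qed

text \<open>\<open>- phi_potential e\<close> is a primitive in \<open>x\<close> of the function \<open>\<phi>\<^sub>x\<close> in \<open>P2\<close>.\<close>

definition phi_potential :: "qx \<Rightarrow> fld" where
  "phi_potential e z x = coeff (\<lambda>w. l w x * neg_part (dl e) w x) 0"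

lemma lN_mil: "mil r UNIV 0 (\<lambda>z x. l z x * neg_part e z x)"
  using mil_mult[OF rJ l_mils(1) neg_part_mil] by simp

lemma lN_ann: "sm (annulus r) UNIV (\<lambda>z x. l z x * neg_part e z x)"
  by (intro sm_mult open_UNIV l_ann neg_part_ann)

lemma phi_potential_sm: "sm U UNIV (phi_potential e)"
proof -
  have "phi_potential e = (\<lambda>z x. proj {0..} (\<lambda>z x. l z x * neg_part (dl e) z x) 0 x)"
    by (simp add: proj_at_0[OF rJ] phi_potential_def fun_eq_iff)
  moreover have "sm U UNIV (\<lambda>z x. proj {0..} (\<lambda>z x. l z x * neg_part (dl e) z x) 0 x)"
    by (rule sm_slice[OF open_UNIV proj_nonneg(1)[OF rJ lN_ann]]) (use r1 in auto)
  ultimately show ?thesis by simp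
qed

lemma th_phi_potential: "th (phi_potential e) z x = 0"
  unfolding th_def dz_def phi_potential_def[abs_def] by simp

text \<open>With N the negative part of the first partial derivative, {\<lambda>, N} differs from
  the \<open>x\<close>-derivative of \<lambda> N by terms containing \<open>th l - l\<close> or
  \<open>dx l\<close>. These factors are regular at infinity while N vanishes there, so the
  difference has no residue.\<close>

lemma dx_phi_potential: "dx (phi_potential e) z x = coeff (\<lambda>z. bracket l (neg_part (dl e)) z x) 0"
proof -
  have d1: "mil r UNIV (-1) (\<lambda>z x. (th l z x - l z x) * dx (neg_part (dl e)) z x)"
    using mil_mult[OF rJ l_mils(3) mil_dx[OF rJ neg_part_mil[of "dl e"]]] by simp
  have d2: "mil r UNIV (-1) (\<lambda>z x. (th (neg_part (dl e)) z x + neg_part (dl e) z x) * dx l z x)"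
    using mil_mult[OF rJ mil_add[OF rJ mil_th[OF rJ neg_part_mil[of "dl e"]] neg_part_mil] l_mils(2)] by simp
  note D = mil_diff[OF rJ d1 d2]
  have D0: "pol r UNIV (-1 + 1) (\<lambda>z x. 0)"
    by (rule polI[OF rJ sm_const[OF open_UNIV, of _ 0]]) simp
  have s: "sm (annulus r) UNIV (dx (\<lambda>z x. l z x * neg_part (dl e) z x))" by (rule sm_dx[OF lN_ann])
  have "coeff (\<lambda>z. bracket l (neg_part (dl e)) z x) 0 =
      coeff (\<lambda>z. dx (\<lambda>z x. l z x * neg_part (dl e) z x) z x +
        ((th l z x - l z x) * dx (neg_part (dl e)) z x - (th (neg_part (dl e)) z x + neg_part (dl e) z x) * dx l z x)) 0"
  proof (rule coeff_cong)
    fix z assume "z \<in> circ"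
    note dm = dx_mult[OF circ_ann[OF this] UNIV_I l_ann neg_part_ann]
    show "bracket l (neg_part (dl e)) z x = dx (\<lambda>z x. l z x * neg_part (dl e) z x) z x +
        ((th l z x - l z x) * dx (neg_part (dl e)) z x - (th (neg_part (dl e)) z x + neg_part (dl e) z x) * dx l z x)"
      unfolding dm bracket_th by (simp add: algebra_simps)
  qed
  also have "\<dots> = coeff (\<lambda>z. dx (\<lambda>z x. l z x * neg_part (dl e) z x) z x) 0 +
      coeff (\<lambda>z. (th l z x - l z x) * dx (neg_part (dl e)) z x - (th (neg_part (dl e)) z x + neg_part (dl e) z x) * dx l z x) 0"
  proof (rule coeff_add)
    have ch: "continuous_on circ (\<lambda>z. g z x)" if "sm (annulus r) UNIV g" for g
      by (rule continuous_on_subset[OF holomorphic_on_imp_continuous_on[OF sm_hol[OF that UNIV_I]]]) (use circ_ann in blast)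
    show "continuous_on circ (\<lambda>z. dx (\<lambda>z x. l z x * neg_part (dl e) z x) z x)" by (rule ch[OF s])
    show "continuous_on circ (\<lambda>z. (th l z x - l z x) * dx (neg_part (dl e)) z x - (th (neg_part (dl e)) z x + neg_part (dl e) z x) * dx l z x)"
      by (rule ch[OF sm_subset[OF mil_sm[OF rJ D] ann_sub(1)]]) simp
  qed
  also have "coeff (\<lambda>z. (th l z x - l z x) * dx (neg_part (dl e)) z x - (th (neg_part (dl e)) z x + neg_part (dl e) z x) * dx l z x) 0 = 0"
    by (rule mil_coeff[OF rJ D]) auto
  also have "coeff (\<lambda>z. dx (\<lambda>z x. l z x * neg_part (dl e) z x) z x) 0 = dx (phi_potential e) z x"
    using coeff_dx[OF rJ lN_ann[of "dl e"] UNIV_I, of x] by (intro dx_eqI[symmetric]) (simp add: phi_potential_def[abs_def])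
  finally show ?thesis by simp
qed

lemma ev_euler_op: "ev (euler_op e) St z x = l z x * ev (dl e) St z x + lb z x * ev (db e) St z x"
  by (simp add: euler_op_def ev.simps)

text \<open>Replacing truncated partials by full ones leaves the tails \<lambda> N and \<lambda>b
  \<open>high\<close>. The product \<lambda> N has exponents up to 0, so its constant term,
  \<open>phi_potential\<close>, crosses to the nonnegative part; the terms with \<phi> in
  \<open>P2\<close> compensate exactly for this. As \<lambda> commutes with itself, the rest of
  \<lambda> N cancels against \<lambda> times the projection of S, and likewise for
  \<lambda>b.\<close>

lemma P2_dform: "eq_vec (P2 (l, lb) (dform e St)) (flow (euler_op e) St)"
proof -
  define q where "q = (\<lambda>z x. l z x * pos_part (dl e) z x + lb z x * low (db e) z x)"
  define k where "k = proj {..-1} (\<lambda>z x. l z x * neg_part (dl e) z x)"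
  have k: "mil r UNIV (-1) k" unfolding k_def by (rule mil_proj[OF rJ lN_ann])
  have kr: "l z x * neg_part (dl e) z x = k z x + phi_potential e z x" if "z \<in> exterior r" for z x
    using mil_split_0[OF r1 lN_mil[of "dl e"] that, of x] unfolding k_def phi_potential_def .
  have g: "pol r UNIV (-1 + 1) (\<lambda>z x. pos_part (euler_op e) z x - phi_potential e z x - lb z x * high (db e) z x)"
  proof -
    have "pol r UNIV 0 (\<lambda>z x. lb z x * high (db e) z x)"
      by (rule pol_mono[OF rJ pol_mult[OF rJ pol_lb high_pol]]) simp
    from pol_diff[OF rJ pol_diff[OF rJ pos_part_pol[of "euler_op e"] pol_ball[OF rJ phi_potential_sm[of _ e]]] this] show ?thesis by simp
  qed
  have "q z x = (neg_part (euler_op e) z x - k z x) + (pos_part (euler_op e) z x - phi_potential e z x - lb z x * high (db e) z x)" if "z \<in> circ" for z x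
  proof -
    have za: "z \<in> annulus r" "z \<in> exterior r" using circ_ann[OF that] ann_sub by auto
    have "q z x = ev (euler_op e) St z x - l z x * neg_part (dl e) z x - lb z x * high (db e) z x"
      unfolding q_def low_eq[OF za(1)] pos_part_eq[OF za(1)] ev_euler_op by (simp add: algebra_simps)
    then show ?thesis unfolding kr[OF za(2)] using neg_part_eq[OF za(1), of "euler_op e" x] by simp
  qed
  note h = split_proj[OF r1 mil_diff[OF rJ neg_part_mil k] g, where F = q, OF this]
  have phi: "res0 (S e) x = - dx (phi_potential e) z x" for x z
    unfolding res0_coeff S_projs(3) dx_phi_potential ..
  have "fst (P2 (l, lb) (dform e St)) z x = fst (flow (euler_op e) St) z x" if z: "z \<in> exterior r" for z x
  proof -
    note s = sm_mult[OF open_UNIV l_mils(4) neg_part_sm[of "dl e"]]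
    have "fst (P2 (l, lb) (dform e St)) z x =
        bracket l (proj {..-1} q) z x - l z x * proj {..0} (S e) z x + th l z x * res0 (S e) x"
      unfolding dform_def q_def th_def by (simp add: Let_def sets_eq)
    also have "bracket l (proj {..-1} q) z x =
        bracket l (\<lambda>z x. neg_part (euler_op e) z x - l z x * neg_part (dl e) z x + phi_potential e z x) z x"
      by (rule bracket_cong[OF open_exterior open_UNIV z UNIV_I]) (use h(1) kr in auto)
    also have "\<dots> = bracket l (\<lambda>z x. neg_part (euler_op e) z x - l z x * neg_part (dl e) z x) z x + bracket l (phi_potential e) z x"
      by (rule X.bracket_right_add[OF z UNIV_I l_mils(4) sm_diff[OF open_UNIV neg_part_sm s] phi_potential_sm])
    also have "bracket l (\<lambda>z x. neg_part (euler_op e) z x - l z x * neg_part (dl e) z x) z x =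
        bracket l (neg_part (euler_op e)) z x - bracket l (\<lambda>z x. l z x * neg_part (dl e) z x) z x"
      by (rule X.bracket_right_diff[OF z UNIV_I l_mils(4) neg_part_sm s])
    also have "bracket l (\<lambda>z x. l z x * neg_part (dl e) z x) z x = l z x * bracket l (neg_part (dl e)) z x"
      using X.bracket_right_mult[OF z UNIV_I l_mils(4) l_mils(4) neg_part_sm] bracket_self by simp
    also have "bracket l (phi_potential e) z x = th l z x * dx (phi_potential e) z x" unfolding bracket_th th_phi_potential by simp
    also have "proj {..0} (S e) z x = - bracket l (neg_part (dl e)) z x" by (rule S_projs(1)[OF z])
    also have "res0 (S e) x = - dx (phi_potential e) z x" by (rule phi)
    finally have "fst (P2 (l, lb) (dform e St)) z x = bracket l (neg_part (euler_op e)) z x" by simp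
    then show ?thesis
      unfolding flow_eq(1)[OF z] using X.bracket_commute[of l "neg_part (euler_op e)" z x] by simp
  qed
  moreover have "snd (P2 (l, lb) (dform e St)) z x = snd (flow (euler_op e) St) z x" if z: "z \<in> pball r" for z x
  proof -
    note s = sm_mult[OF open_UNIV lb_sm high_sm[of "db e"]]
    have "snd (P2 (l, lb) (dform e St)) z x =
        - bracket lb (proj {0..} q) z x + lb z x * proj {1..} (S e) z x + th lb z x * res0 (S e) x"
      unfolding dform_def q_def th_def by (simp add: Let_def sets_eq)
    also have "bracket lb (proj {0..} q) z x =
        bracket lb (\<lambda>z x. pos_part (euler_op e) z x - phi_potential e z x - lb z x * high (db e) z x) z x"
      by (rule bracket_cong[OF open_pball open_UNIV z UNIV_I]) (use h(2) in auto)
    also have "\<dots> = bracket lb (\<lambda>z x. pos_part (euler_op e) z x - phi_potential e z x) z x - bracket lb (\<lambda>z x. lb z x * high (db e) z x) z x"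
      by (rule P.bracket_right_diff[OF z UNIV_I lb_sm sm_diff[OF open_UNIV pos_part_sm phi_potential_sm] s])
    also have "bracket lb (\<lambda>z x. pos_part (euler_op e) z x - phi_potential e z x) z x = bracket lb (pos_part (euler_op e)) z x - bracket lb (phi_potential e) z x"
      by (rule P.bracket_right_diff[OF z UNIV_I lb_sm pos_part_sm phi_potential_sm])
    also have "bracket lb (\<lambda>z x. lb z x * high (db e) z x) z x = lb z x * bracket lb (high (db e)) z x"
      using P.bracket_right_mult[OF z UNIV_I lb_sm lb_sm high_sm] bracket_self by simp
    also have "bracket lb (phi_potential e) z x = th lb z x * dx (phi_potential e) z x" unfolding bracket_th th_phi_potential by simp
    also have "proj {1..} (S e) z x = - bracket lb (high (db e)) z x" by (rule S_projs(2)[OF z])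
    also have "res0 (S e) x = - dx (phi_potential e) z x" by (rule phi)
    finally have "snd (P2 (l, lb) (dform e St)) z x = - bracket lb (pos_part (euler_op e)) z x" by (simp add: algebra_simps)
    then show ?thesis
      unfolding flow_eq(2) using P.bracket_commute[of "pos_part (euler_op e)" lb z x] by simp
  qed
  ultimately show ?thesis by (rule eq_vecI)
qed

end

lemma Ssum_cong:
  assumes "\<And>z. z \<in> annulus s \<Longrightarrow> fst W z = fst V z" "\<And>z. z \<in> annulus s \<Longrightarrow> snd W z = snd V z" "z \<in> annulus s"
  shows "Ssum L W z x = Ssum L V z x"
proof -
  obtain l lb where L: "L = (l, lb)" by (cases L)
  have "bracket l (fst W) z x = bracket l (fst V) z x" "bracket lb (snd W) z x = bracket lb (snd V) z x"
    by (rule bracket_cong[OF open_annulus open_UNIV assms(3) UNIV_I]; simp add: assms)+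
  then show ?thesis unfolding L by (cases W; cases V) simp
qed

text \<open>Both tensors read a form only through projections and residues, hence through its values
  near the circle. Differentials that agree there give equal vector fields, not merely equal
  germs.\<close>

lemma P_cong:
  assumes s: "s > 1" and e: "\<And>z. z \<in> annulus s \<Longrightarrow> fst W z = fst V z" "\<And>z. z \<in> annulus s \<Longrightarrow> snd W z = snd V z"
  shows "P1 L W = P1 L V" and "P2 L W = P2 L V"
proof -
  have ca: "z \<in> annulus s" if "z \<in> circ" for z using that domain_subsets(1)[OF s] by blast
  obtain l lb where L: "L = (l, lb)" by (cases L)
  obtain w w' v v' where W: "W = (w, w')" "V = (v, v')" by (cases W; cases V)
  have S: "proj A (Ssum L W) = proj A (Ssum L V)" "res0 (Ssum L W) = res0 (Ssum L V)" for A
    by (intro ext proj_cong Ssum_cong[OF e ca]; assumption)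
      (simp add: res0_coeff fun_eq_iff; intro allI coeff_cong Ssum_cong[OF e ca]; assumption)
  have d: "proj A (\<lambda>z x. w z x - w' z x) = proj A (\<lambda>z x. v z x - v' z x)"
    "proj A (\<lambda>z x. l z x * w z x + lb z x * w' z x) = proj A (\<lambda>z x. l z x * v z x + lb z x * v' z x)" for A
    using e[OF ca] unfolding W by (auto intro!: ext proj_cong)
  show "P1 L W = P1 L V" using S(1) d(1) unfolding L W by (simp add: Let_def)
  show "P2 L W = P2 L V" using S d(2) unfolding L W by (simp add: Let_def)
qed

lemma dform_differential:
  assumes "St \<in> states"
    and per: "\<And>z x. z \<in> circ \<Longrightarrow> ev (dl e) St z (x + 2 * pi) = ev (dl e) St z x"
    "\<And>z x. z \<in> circ \<Longrightarrow> ev (db e) St z (x + 2 * pi) = ev (db e) St z x"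
  shows "differential (\<lambda>T. integral {0..2 * pi} (res0 (ev e T))) St (dform e St)"
  unfolding differential_def
proof (intro conjI ballI)
  obtain r l lb l0 l1 l2 where St: "St = ((l, lb), (l0, l1, l2))" and reg: "regular_state r l lb l0 l1 l2"
    using assms(1) by (rule regular_cases)
  show "dform e St \<in> one_forms"
    using regular_state.dform_one_forms[OF reg, of e] per unfolding St by blast
  fix X assume X: "X \<in> TLM"
  obtain v w where vw: "X = (v, w)" by (cases X)
  have "\<forall>\<^sub>F r in at_right 1. mil r UNIV 0 v" "\<forall>\<^sub>F r in at_right 1. pol r UNIV (-1) w"
    using X unfolding vw TLM_def smooth_vectors_def by (auto simp: smooth_Dinf_iff smooth_zinvD0_iff)
  \<comment> \<open>The radius is chosen anew for each tangent vector, because the domain of the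
    vector may be smaller than that of the state.\<close>
  from eventually_conj[OF states_regular[OF assms(1)] eventually_conj[OF this]]
  obtain s where s: "s > 1" "regular s St \<and> mil s UNIV 0 v \<and> pol s UNIV (-1) w" by (rule obtain_radius)
  have "regular_state s l lb l0 l1 l2" unfolding regular_state_def using s St by auto
  from regular_state.dform_deriv[OF this, of v w e] s
  show "has_deriv_along (\<lambda>T. integral {0..2 * pi} (res0 (ev e T))) St X (pairing (dform e St) X)"
    unfolding St vw by blast
qed

lemma ham_field_flow:
  assumes "St \<in> states"
    and per: "\<And>z x. z \<in> circ \<Longrightarrow> ev (dl e) St z (x + 2 * pi) = ev (dl e) St z x"
    "\<And>z x. z \<in> circ \<Longrightarrow> ev (db e) St z (x + 2 * pi) = ev (db e) St z x"
  shows "ham_field P1 (\<lambda>T. integral {0..2 * pi} (res0 (ev e T))) St (flow (diff_op e) St)"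
    and "ham_field P2 (\<lambda>T. integral {0..2 * pi} (res0 (ev e T))) St (flow (euler_op e) St)"
proof -
  obtain r l lb l0 l1 l2 where St: "St = ((l, lb), (l0, l1, l2))" and reg: "regular_state r l lb l0 l1 l2"
    using assms(1) by (rule regular_cases)
  have D: "differential (\<lambda>T. integral {0..2 * pi} (res0 (ev e T))) St (dform e St)"
    by (rule dform_differential[OF assms(1)]) (rule per; assumption)+
  have c: "P1 (fst St) W = P1 (fst St) (dform e St)" "P2 (fst St) W = P2 (fst St) (dform e St)"
    if W: "differential (\<lambda>T. integral {0..2 * pi} (res0 (ev e T))) St W" for W
  proof -
    obtain s where s: "s > 1" "(\<forall>z\<in>ball 0 s. fst W z = fst (dform e St) z) \<and> (\<forall>z\<in>exterior s. snd W z = snd (dform e St) z)"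
      using differential_unique[OF W D] by (rule obtain_radius)
    have "annulus s \<subseteq> ball 0 s" "annulus s \<subseteq> exterior s" using annulus_eq[of s] s by auto
    then show "P1 (fst St) W = P1 (fst St) (dform e St)" "P2 (fst St) W = P2 (fst St) (dform e St)"
      using s by (auto intro!: P_cong[OF s(1)])
  qed
  have E: "eq_vec (P1 (fst St) (dform e St)) (flow (diff_op e) St)" "eq_vec (P2 (fst St) (dform e St)) (flow (euler_op e) St)"
    using regular_state.P1_dform[OF reg, of e] regular_state.P2_dform[OF reg, of e] unfolding St fst_conv by auto
  show "ham_field P1 (\<lambda>T. integral {0..2 * pi} (res0 (ev e T))) St (flow (diff_op e) St)"
    unfolding ham_field_def
  proof (intro conjI exI[of _ "dform e St"] D allI impI)
    fix W assume W: "differential (\<lambda>T. integral {0..2 * pi} (res0 (ev e T))) St W"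
    show "eq_vec (P1 (fst St) W) (flow (diff_op e) St)" unfolding c(1)[OF W] by (rule E)
  qed
  show "ham_field P2 (\<lambda>T. integral {0..2 * pi} (res0 (ev e T))) St (flow (euler_op e) St)"
    unfolding ham_field_def
  proof (intro conjI exI[of _ "dform e St"] D allI impI)
    fix W assume W: "differential (\<lambda>T. integral {0..2 * pi} (res0 (ev e T))) St W"
    show "eq_vec (P2 (fst St) W) (flow (euler_op e) St)" unfolding c(2)[OF W] by (rule E)
  qed
qed

section \<open>Linear combinations and periodicity\<close>

lemma ev_simps:
  "ev (Cn c) St z x = c" "ev VL St = fst (fst St)" "ev VB St = snd (fst St)"
  "ev (Ad e f) St z x = ev e St z x + ev f St z x" "ev (Mu e f) St z x = ev e St z x * ev f St z x"
  "ev (Pw e n) St z x = ev e St z x ^ n"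
  by (cases "(e, St)" rule: ev.cases; simp add: ev.simps)+

lemma flow_cong:
  assumes "\<And>z x. z \<in> circ \<Longrightarrow> ev e St z x = ev f St z x"
  shows "flow e St = flow f St"
proof -
  have "proj A (ev e St) = proj A (ev f St)" "proj A (ev (neg e) St) = proj A (ev (neg f) St)" for A
    by (intro ext proj_cong; simp add: assms ev_neg)+
  then show ?thesis unfolding flow_def by simp
qed

lemma eq_near_trans: "eq_near K f g \<Longrightarrow> eq_near K g h \<Longrightarrow> eq_near K f h"
proof -
  assume "eq_near K f g" "eq_near K g h"
  then obtain U V where "open U" "K \<subseteq> U" "\<forall>z\<in>U. f z = g z" "open V" "K \<subseteq> V" "\<forall>z\<in>V. g z = h z"
    unfolding eq_near_def by blast
  then show ?thesis unfolding eq_near_def by (intro exI[of _ "U \<inter> V"]) auto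
qed

lemma eq_vec_trans: "eq_vec X Y \<Longrightarrow> eq_vec Y Z \<Longrightarrow> eq_vec X Z"
  unfolding eq_vec_def using eq_near_trans by blast

lemma ham_field_cong: "ham_field P F St X \<Longrightarrow> eq_vec X Y \<Longrightarrow> ham_field P F St Y"
  unfolding ham_field_def using eq_vec_trans by blast

lemma bracket_const_left: "bracket (\<lambda>z x. c) g z x = 0"
  unfolding bracket_def dx_def dz_def by simp

lemma bracket_periodic:
  assumes U: "open U" and z: "z \<in> U" and f: "sm U UNIV f" and g: "sm U UNIV g"
    and p: "\<And>z x. z \<in> U \<Longrightarrow> f z (x + 2 * pi) = f z x" "\<And>z x. z \<in> U \<Longrightarrow> g z (x + 2 * pi) = g z x"
  shows "bracket f g z (x + 2 * pi) = bracket f g z x"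
proof -
  have t: "th h z (x + 2 * pi) = th h z x" if "\<And>z x. z \<in> U \<Longrightarrow> h z (x + 2 * pi) = h z x" for h
  proof -
    have "th h z (x + 2 * pi) = th (\<lambda>z y. h z (y + 2 * pi)) z x" unfolding th_def dz_def ..
    also have "\<dots> = th h z x" by (rule th_cong[OF U z]) (rule that)
    finally show ?thesis .
  qed
  have "th f z (x + 2 * pi) = th f z x" "th g z (x + 2 * pi) = th g z x"
    by (rule t, rule p, assumption)+
  then show ?thesis unfolding bracket_th dx_periodic[OF f z p(1)[OF z]] dx_periodic[OF g z p(2)[OF z]] by simp
qed

text \<open>\<open>laurent\<close> holds on the annulus only. For a family with a pole the lower
  part is a finite sum, so the splitting persists on the whole punctured disc.\<close>

lemma pol_split:
  assumes r: "r > 1" and f: "pol r UNIV m f" and z: "z \<in> pball r" and k: "0 \<le> k" "m \<le> k"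
  shows "f z x = proj {..<k} f z x + proj {k..} f z x"
proof -
  note rJ = r open_UNIV[where 'a = real]
  define c where "c j = coeff (\<lambda>z. f z x) j * z powi j" for j
  have c0: "c j = 0" if "j < m" for j
    unfolding c_def using pol_coeff[OF rJ f UNIV_I that] by simp
  have s: "sm (annulus r) UNIV f"
    by (rule sm_subset[OF pol_sm[OF rJ f]]) (use annulus_eq[of r] r in auto)
  have "c summable_on {0..}"
    using proj_nonneg(3)[OF rJ s, of z x] z unfolding c_def[abs_def] summable_on_def by blast
  then have sk: "c summable_on {k..}" by (rule summable_on_subset_banach) (use k in auto)
  have "{m..} = {m..<k} \<union> {k..}" "{m..<k} \<inter> {k..} = {}" using k by auto
  then have "infsum c {m..} = infsum c {m..<k} + infsum c {k..}"
    using infsum_Un_disjoint[OF summable_on_finite sk, of "{m..<k}"] by auto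
  moreover have "infsum c {m..<k} = infsum c {..<k}"
    by (rule infsum_cong_neutral) (auto simp: c0)
  moreover have "infsum c {m..} = f z x"
    using pol_proj_id[OF rJ f z UNIV_I, of x] unfolding proj_def c_def .
  ultimately show ?thesis unfolding proj_def c_def by simp
qed

lemma mil_split:
  assumes r: "r > 1" and f: "mil r UNIV m f" and z: "z \<in> exterior r" and m: "0 \<le> m"
  shows "f z x = proj {..-1} f z x + proj {0..} f z x"
proof -
  note rJ = r open_UNIV[where 'a = real]
  have i: "inverse z \<in> pball r" using z inverse_pball_iff[of r z] r by linarith
  have e: "{..<1} = {..0 :: int}" by auto
  have "f z x = proj {..<1} (\<lambda>z x. f (inverse z) x) (inverse z) x + proj {1..} (\<lambda>z x. f (inverse z) x) (inverse z) x"
    using pol_split[OF r f[unfolded mil_def[OF rJ]] i, of 1 x] m by simp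
  then show ?thesis
    unfolding e using proj_reflect[OF rJ, of 0 "\<lambda>z x. f (inverse z) x" "inverse z" x] proj_reflect[OF rJ, of "-1" f z x] by simp
qed

section \<open>Linearity, periodicity and the Toda flows\<close>

context regular_state
begin

lemma flow_lin:
  "eq_vec (flow (Ad (Mu (Cn c) e) f) St) (\<lambda>z x. c * fst (flow e St) z x + fst (flow f St) z x,
    \<lambda>z x. c * snd (flow e St) z x + snd (flow f St) z x)"
proof (rule eq_vecI)
  have e: "ev (Ad (Mu (Cn c) e) f) St = (\<lambda>z x. c * ev e St z x + ev f St z x)"
    by (simp add: fun_eq_iff ev_simps)
  have s: "sm (annulus r) UNIV (\<lambda>z x. c * ev e St z x)"
    by (intro sm_mult sm_const open_UNIV sm_ev)
  have n: "neg_part (Ad (Mu (Cn c) e) f) z x = c * neg_part e z x + neg_part f z x" if "z \<in> exterior r" for z x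
    unfolding e using proj_add[OF rJ halves(1) s sm_ev that UNIV_I] by (simp add: proj_cmult[OF rJ])
  have p: "pos_part (Ad (Mu (Cn c) e) f) z x = c * pos_part e z x + pos_part f z x" if "z \<in> pball r" for z x
    unfolding e using proj_add[OF rJ halves(2) s sm_ev that UNIV_I] by (simp add: proj_cmult[OF rJ])
  fix z x
  show "fst (flow (Ad (Mu (Cn c) e) f) St) z x = fst (\<lambda>z x. c * fst (flow e St) z x + fst (flow f St) z x,
    \<lambda>z x. c * snd (flow e St) z x + snd (flow f St) z x) z x" if z: "z \<in> exterior r"
  proof -
    have "bracket (neg_part (Ad (Mu (Cn c) e) f)) l z x = bracket (\<lambda>z x. c * neg_part e z x + neg_part f z x) l z x"
      by (rule bracket_cong[OF open_exterior open_UNIV z UNIV_I]) (auto simp: n)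
    also have "\<dots> = bracket (\<lambda>z x. c * neg_part e z x) l z x + bracket (neg_part f) l z x"
      by (rule X.bracket_add[OF z UNIV_I sm_mult[OF open_UNIV sm_const[OF open_UNIV] neg_part_sm] neg_part_sm l_mils(4)])
    also have "bracket (\<lambda>z x. c * neg_part e z x) l z x = c * bracket (neg_part e) l z x"
      by (rule X.bracket_cmult[OF z UNIV_I neg_part_sm neg_part_sm l_mils(4)])
    finally show ?thesis using z by (simp add: flow_eq)
  qed
  show "snd (flow (Ad (Mu (Cn c) e) f) St) z x = snd (\<lambda>z x. c * fst (flow e St) z x + fst (flow f St) z x,
    \<lambda>z x. c * snd (flow e St) z x + snd (flow f St) z x) z x" if z: "z \<in> pball r"
  proof -
    have "bracket (pos_part (Ad (Mu (Cn c) e) f)) lb z x = bracket (\<lambda>z x. c * pos_part e z x + pos_part f z x) lb z x"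
      by (rule bracket_cong[OF open_pball open_UNIV z UNIV_I]) (auto simp: p)
    also have "\<dots> = bracket (\<lambda>z x. c * pos_part e z x) lb z x + bracket (pos_part f) lb z x"
      by (rule P.bracket_add[OF z UNIV_I sm_mult[OF open_UNIV sm_const[OF open_UNIV] pos_part_sm] pos_part_sm lb_sm])
    also have "bracket (\<lambda>z x. c * pos_part e z x) lb z x = c * bracket (pos_part e) lb z x"
      by (rule P.bracket_cmult[OF z UNIV_I pos_part_sm pos_part_sm lb_sm])
    finally show ?thesis by (simp add: flow_eq)
  qed
qed

text \<open>Constants are central for the bracket, so expressions matter only up to constants; the
  Toda flows with \<open>n = 0\<close> are of this trivial kind.\<close>

lemma flow_Cn: "eq_vec (flow (Cn c) St) (\<lambda>z x. 0, \<lambda>z x. 0)"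
proof (rule eq_vecI)
  have e: "ev (Cn c) St = (\<lambda>z x. c)" by (simp add: fun_eq_iff ev_simps)
  have s: "sm (ball 0 r) UNIV (\<lambda>z x. c)" by (rule sm_const[OF open_UNIV])
  have "{..-1} \<subseteq> {..<0 :: int}" by auto
  from pol_proj_0[OF rJ pol_ball[OF rJ s] UNIV_I this]
  have n: "neg_part (Cn c) = (\<lambda>z x. 0)" unfolding e by (simp add: fun_eq_iff)
  have p: "pos_part (Cn c) z x = c" if "z \<in> pball r" for z x
    unfolding e using ball_proj_id[OF rJ s, of z x] that by simp
  fix z x
  show "fst (flow (Cn c) St) z x = fst (\<lambda>z x. 0, \<lambda>z x. 0) z x" if "z \<in> exterior r"
    unfolding flow_eq(1)[OF that] n by (simp add: bracket_const_left)
  show "snd (flow (Cn c) St) z x = snd (\<lambda>z x. 0, \<lambda>z x. 0) z x" if z: "z \<in> pball r"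
  proof -
    have "bracket (pos_part (Cn c)) lb z x = bracket (\<lambda>z x. c) lb z x"
      by (rule bracket_cong[OF open_pball open_UNIV z UNIV_I]) (auto simp: p)
    then show ?thesis by (simp add: flow_eq bracket_const_left)
  qed
qed

text \<open>The increment of \<open>l0\<close> over a period is a logarithm of 1, hence constant,
  and it vanishes at infinity. So the normalisation at infinity forces periodicity of this
  branch.\<close>

lemma l0_periodic:
  assumes z: "z \<in> exterior r"
  shows "l0 z (x + 2 * pi) = l0 z x"
proof -
  obtain g where g: "sm (ball 0 r) UNIV g" "\<And>u x. u \<in> pball r \<Longrightarrow> l0 (inverse u) x = u * g u x"
    using reg unfolding regular.simps mil_def[OF rJ] pol_def[OF rJ] by auto
  define d where "d u = u * (g u (x + 2 * pi) - g u x)" for u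
  have hd: "d holomorphic_on ball 0 r"
    unfolding d_def by (intro holomorphic_intros sm_hol[OF g(1)] UNIV_I)
  have e: "exp (d u) = 1" if "u \<in> ball 0 r" for u
  proof (cases "u = 0")
    case False
    then have i: "inverse u \<in> exterior r" "u \<in> pball r" using that inverse_pball_iff[of r "inverse u"] r1 by auto
    have "d u = l0 (inverse u) (x + 2 * pi) - l0 (inverse u) x"
      unfolding d_def g(2)[OF i(2)] by (simp add: algebra_simps)
    moreover have "exp (l0 (inverse u) (x + 2 * pi)) = exp (l0 (inverse u) x)" using reg i(1) by simp
    ultimately show ?thesis by (simp add: exp_diff)
  qed (simp add: d_def)
  have "(d has_field_derivative 0) (at u within ball 0 r)" if u: "u \<in> ball 0 r" for u
  proof -
    have D: "(d has_field_derivative deriv d u) (at u)" by (rule holomorphic_derivI[OF hd open_ball u])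
    have "((\<lambda>u. exp (d u)) has_field_derivative exp (d u) * deriv d u) (at u)"
      by (rule DERIV_chain2[OF DERIV_exp D])
    moreover have "((\<lambda>u. exp (d u)) has_field_derivative 0) (at u)"
      by (rule has_field_derivative_transform_within_open[OF DERIV_const[of 1] open_ball u]) (simp add: e)
    ultimately have "exp (d u) * deriv d u = 0" by (rule DERIV_unique)
    then show ?thesis using D by (auto intro: has_field_derivative_at_within)
  qed
  then obtain c where c: "\<And>u. u \<in> ball 0 r \<Longrightarrow> d u = c"
    using has_field_derivative_zero_constant[OF convex_ball, of 0 r d] by blast
  have "inverse z \<in> ball 0 r" "0 \<in> ball 0 r" using z inverse_pball_iff[of r z] r1 by auto
  then have "d (inverse z) = d 0" using c by metis
  moreover have "inverse z \<in> pball r" using z inverse_pball_iff[of r z] r1 by linarith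
  ultimately show ?thesis using g(2)[of "inverse z"] unfolding d_def by (auto simp: algebra_simps)
qed

lemma flow_TLM:
  assumes p: "\<And>z x. z \<in> circ \<Longrightarrow> ev e St z (x + 2 * pi) = ev e St z x"
  shows "flow e St \<in> TLM"
proof -
  have n: "neg_part e z (x + 2 * pi) = neg_part e z x" "pos_part e z (x + 2 * pi) = pos_part e z x" for z x
    by (rule proj_periodic[of "ev e St", OF p]; simp)+
  have lp: "\<And>z x. z \<in> exterior r \<Longrightarrow> l z (x + 2 * pi) = l z x" "\<And>z x. z \<in> pball r \<Longrightarrow> lb z (x + 2 * pi) = lb z x"
    using reg by auto
  have "(fst (flow e St), snd (flow e St)) \<in> TLM"
  proof (rule TLM_I[OF r1 flow_mil flow_pol])
    fix z x
    show "fst (flow e St) z (x + 2 * pi) = fst (flow e St) z x" if z: "z \<in> exterior r"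
      unfolding flow_eq(1)[OF z] neg_equal_iff_equal
      by (rule bracket_periodic[OF open_exterior z neg_part_sm l_mils(4) n(1) lp(1)])
    show "snd (flow e St) z (x + 2 * pi) = snd (flow e St) z x" if z: "z \<in> pball r"
      unfolding flow_eq(2) by (rule bracket_periodic[OF open_pball z pos_part_sm lb_sm n(2) lp(2)])
  qed
  then show ?thesis by simp
qed

text \<open>Since \<lambda>^n commutes with \<lambda>, its nonnegative part and minus its negative
  part act equally on \<lambda>. Hence one expression describes both components in the form of the
  Lax equations.\<close>

lemma toda_flow: "eq_vec (toda n (l, lb)) (flow (Pw VL n) St)"
proof -
  have e: "(\<lambda>z x. l z x ^ n) = ev (Pw VL n) St" by (simp add: fun_eq_iff ev_simps)
  have m: "mil r UNIV (int n) (ev (Pw VL n) St)"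
    unfolding e[symmetric]
  proof (induction n)
    case 0
    show ?case unfolding mil_def[OF rJ] using pol_ball[OF rJ sm_const[OF open_UNIV, of _ 1]] by simp
  next
    case (Suc n)
    from mil_mult[OF rJ l_mils(1) Suc] show ?case by (simp add: add.commute)
  qed
  have s: "sm (exterior r) UNIV (ev (Pw VL n) St)" by (rule mil_sm[OF rJ m])
  show ?thesis
  proof (rule eq_vecI)
    fix z x
    show "fst (toda n (l, lb)) z x = fst (flow (Pw VL n) St) z x" if z: "z \<in> exterior r"
    proof -
      have "fst (toda n (l, lb)) z x = bracket (proj {0..} (ev (Pw VL n) St)) l z x"
        unfolding toda.simps e by (simp add: Let_def)
      also have "\<dots> = bracket (\<lambda>z x. ev (Pw VL n) St z x - neg_part (Pw VL n) z x) l z x"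
        by (rule bracket_cong[OF open_exterior open_UNIV z UNIV_I]) (use mil_split[OF r1 m] in \<open>auto simp: algebra_simps\<close>)
      also have "\<dots> = bracket (ev (Pw VL n) St) l z x - bracket (neg_part (Pw VL n)) l z x"
        by (rule X.bracket_diff[OF z UNIV_I s neg_part_sm l_mils(4)])
      also have "bracket (ev (Pw VL n) St) l z x = 0"
      proof -
        have "\<forall>n. bracket (\<lambda>z x. l z x ^ n) l z x = 0"
        proof
          fix n show "bracket (\<lambda>z x. l z x ^ n) l z x = 0"
          proof (induction n)
            case (Suc n)
            then show ?case
              using X.bracket_mult[OF z UNIV_I l_mils(4) sm_power[OF open_UNIV l_mils(4)] l_mils(4), of n]
              by (simp add: bracket_self)
          qed (simp add: bracket_const_left)
        qed
        then show ?thesis unfolding e[symmetric] by blast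
      qed
      finally show ?thesis unfolding flow_eq(1)[OF z] by simp
    qed
    show "snd (toda n (l, lb)) z x = snd (flow (Pw VL n) St) z x"
      unfolding toda.simps e flow_eq(2) by (simp add: Let_def)
  qed
qed

text \<open>Here \<lambda>b^n commutes with \<lambda>b, so in the second component its negative part
  acts as minus its nonnegative part, which is the sign in the expression.\<close>

lemma toda_bar_flow: "eq_vec (toda_bar n (l, lb)) (flow (neg (Pw VB n)) St)"
proof -
  have e: "(\<lambda>z x. lb z x ^ n) = ev (Pw VB n) St" by (simp add: fun_eq_iff ev_simps)
  have m: "pol r UNIV (- int n) (ev (Pw VB n) St)"
    unfolding e[symmetric]
  proof (induction n)
    case 0
    show ?case using pol_ball[OF rJ sm_const[OF open_UNIV, of _ 1]] by simp
  next
    case (Suc n)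
    from pol_mult[OF rJ pol_lb Suc] show ?case by (simp add: add.commute)
  qed
  have s: "sm (pball r) UNIV (ev (Pw VB n) St)" by (rule pol_sm[OF rJ m])
  have i: "{..<0} = {..-1 :: int}" by auto
  have nn: "proj A (ev (neg (Pw VB n)) St) = (\<lambda>z x. - proj A (ev (Pw VB n) St) z x)" for A
    by (intro ext) (rule proj_ev_neg)
  show ?thesis
  proof (rule eq_vecI)
    fix z x
    show "fst (toda_bar n (l, lb)) z x = fst (flow (neg (Pw VB n)) St) z x" if z: "z \<in> exterior r"
      unfolding toda_bar.simps e flow_eq(1)[OF z] nn
      using X.bracket_uminus[OF z UNIV_I neg_part_sm neg_part_sm l_mils(4)] by (simp add: Let_def i)
    show "snd (toda_bar n (l, lb)) z x = snd (flow (neg (Pw VB n)) St) z x" if z: "z \<in> pball r"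
    proof -
      have "snd (toda_bar n (l, lb)) z x = bracket (neg_part (Pw VB n)) lb z x"
        unfolding toda_bar.simps e by (simp add: Let_def i)
      also have "\<dots> = bracket (\<lambda>z x. ev (Pw VB n) St z x - pos_part (Pw VB n) z x) lb z x"
        by (rule bracket_cong[OF open_pball open_UNIV z UNIV_I]) (use pol_split[OF r1 m, of _ 0] i in \<open>auto simp: algebra_simps\<close>)
      also have "\<dots> = bracket (ev (Pw VB n) St) lb z x - bracket (pos_part (Pw VB n)) lb z x"
        by (rule P.bracket_diff[OF z UNIV_I s pos_part_sm lb_sm])
      also have "bracket (ev (Pw VB n) St) lb z x = 0"
      proof -
        have "\<forall>n. bracket (\<lambda>z x. lb z x ^ n) lb z x = 0"
        proof
          fix n show "bracket (\<lambda>z x. lb z x ^ n) lb z x = 0"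
          proof (induction n)
            case (Suc n)
            then show ?case
              using P.bracket_mult[OF z UNIV_I lb_sm sm_power[OF open_UNIV lb_sm] lb_sm, of n]
              by (simp add: bracket_self)
          qed (simp add: bracket_const_left)
        qed
        then show ?thesis unfolding e[symmetric] by blast
      qed
      finally show ?thesis
        unfolding flow_eq(2) nn using P.bracket_uminus[OF z UNIV_I pos_part_sm pos_part_sm lb_sm] by simp
    qed
  qed
qed

end

text \<open>Flows see an expression only on the circle and modulo constants; the additive constant
  \<open>k\<close> absorbs the zeroth power in the Toda flows with \<open>n = 0\<close>.\<close>

lemma flow_lincomb:
  assumes "finite I" "St \<in> states"
    and e: "\<And>z x. z \<in> circ \<Longrightarrow> ev e St z x = k + (\<Sum>i\<in>I. c i * ev (F i) St z x)"
  shows "eq_vec (flow e St) (lincomb I c (\<lambda>i. flow (F i) St))"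
proof -
  obtain r l lb l0 l1 l2 where St: "St = ((l, lb), (l0, l1, l2))" and reg: "regular_state r l lb l0 l1 l2"
    using assms(2) by (rule regular_cases)
  \<comment> \<open>The sum is assembled as an actual expression \<open>g\<close>, one index at a
    time, so that linearity of flows applies at each step.\<close>
  have "\<exists>g. (\<forall>z x. ev g St z x = k + (\<Sum>i\<in>I. c i * ev (F i) St z x)) \<and>
      eq_vec (flow g St) (lincomb I c (\<lambda>i. flow (F i) St))"
    using assms(1)
  proof induction
    case empty
    show ?case
      using regular_state.flow_Cn[OF reg, of k] unfolding St lincomb_def by (intro exI[of _ "Cn k"]) (simp add: ev_simps)
  next
    case (insert i I)
    then obtain g where g: "\<And>z x. ev g St z x = k + (\<Sum>i\<in>I. c i * ev (F i) St z x)"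
      "eq_vec (flow g St) (lincomb I c (\<lambda>i. flow (F i) St))" by blast
    let ?g = "Ad (Mu (Cn (c i)) (F i)) g"
    have "ev ?g St z x = k + (\<Sum>i\<in>insert i I. c i * ev (F i) St z x)" for z x
      using insert by (simp add: ev_simps g)
    moreover have "eq_vec (\<lambda>z x. c i * fst (flow (F i) St) z x + fst (flow g St) z x,
        \<lambda>z x. c i * snd (flow (F i) St) z x + snd (flow g St) z x) (lincomb (insert i I) c (\<lambda>i. flow (F i) St))"
      using g(2) insert unfolding eq_vec_def eq_near_def lincomb_def by (simp add: fun_eq_iff)
    ultimately show ?case
      using eq_vec_trans[OF regular_state.flow_lin[OF reg, of "c i" "F i" g]] unfolding St by blast
  qed
  then obtain g where g: "\<And>z x. ev g St z x = k + (\<Sum>i\<in>I. c i * ev (F i) St z x)"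
    "eq_vec (flow g St) (lincomb I c (\<lambda>i. flow (F i) St))" by blast
  have "flow e St = flow g St" by (rule flow_cong) (simp add: e g)
  then show ?thesis using g(2) by simp
qed

lemma flow_scale:
  assumes "St \<in> states" "\<And>z x. z \<in> circ \<Longrightarrow> ev e St z x = c * ev f St z x"
  shows "eq_vec (flow e St) (vscale c (flow f St))"
  using flow_lincomb[where I = "{()}" and c = "\<lambda>_. c" and F = "\<lambda>_. f" and k = 0 and e = e, OF _ assms(1)] assms(2)
  by (simp add: lincomb_def vscale_def)

lemma flow_add:
  assumes "St \<in> states" "\<And>z x. z \<in> circ \<Longrightarrow> ev e St z x = c * ev f St z x + d * ev g St z x"
  shows "eq_vec (flow e St) (vadd (vscale c (flow f St)) (vscale d (flow g St)))"
  using flow_lincomb[where I = "{True, False}" and c = "\<lambda>b. if b then c else d" and F = "\<lambda>b. if b then f else g"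
      and k = 0 and e = e, OF _ assms(1)] assms(2)
  by (simp add: lincomb_def vscale_def vadd_def)

text \<open>\<open>1\<close> and \<open>2\<close> record a dependence on \<open>l1\<close> and \<open>l2\<close>; the branch \<open>l0\<close> is always periodic.\<close>

primrec logs :: "qx \<Rightarrow> nat set" where
  "logs (Cn c) = {}"
| "logs VL = {}"
| "logs VB = {}"
| "logs IL = {}"
| "logs IB = {}"
| "logs (WP k) = {}"
| "logs G1 = {1}"
| "logs G2 = {1, 2}"
| "logs (Ad e f) = logs e \<union> logs f"
| "logs (Mu e f) = logs e \<union> logs f"
| "logs (Pw e n) = logs e"

lemma logs_derivs: "logs (dl e) \<subseteq> logs e" "logs (db e) \<subseteq> logs e"
  by (induction e) auto

lemma ev_periodic:
  assumes St: "((l, lb), (l0, l1, l2)) \<in> states"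
    and p1: "1 \<in> logs e \<Longrightarrow> periodic_near circ l1" and p2: "2 \<in> logs e \<Longrightarrow> periodic_near circ l2"
    and z: "z \<in> circ"
  shows "ev e ((l, lb), (l0, l1, l2)) z (x + 2 * pi) = ev e ((l, lb), (l0, l1, l2)) z x"
proof -
  obtain r where r: "regular_state r l lb l0 l1 l2" using St by (rule regular_cases) auto
  interpret regular_state r l lb l0 l1 l2 by (rule r)
  have zz: "z \<in> exterior r" "z \<in> pball r" using circ_ann[OF z] ann_sub by auto
  have p: "l z (x + 2 * pi) = l z x" "lb z (x + 2 * pi) = lb z x" "l0 z (x + 2 * pi) = l0 z x"
    using reg zz l0_periodic by auto
  have q: "f z (x + 2 * pi) = f z x" if "periodic_near circ f" for f :: fld
  proof -
    have "(\<lambda>x. f z (x + 2 * pi)) = f z" using that z unfolding periodic_near_def eq_near_def by blast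
    then show ?thesis by metis
  qed
  have "qev e (l z (x + 2 * pi)) (lb z (x + 2 * pi)) (l1 z (x + 2 * pi) - l0 z (x + 2 * pi)) (l2 z (x + 2 * pi) + l1 z (x + 2 * pi)) =
      qev e (l z x) (lb z x) (l1 z x - l0 z x) (l2 z x + l1 z x)"
    using p1 p2 by (induction e) (auto simp: p q)
  then show ?thesis by (simp add: ev.simps)
qed

section \<open>The hierarchy\<close>

definition qlog_l :: "nat \<Rightarrow> qx" where
  "qlog_l p = Mu (Mu (Cn (-1 / fact p)) (Pw (Mu (Cn (-1)) VL) p)) (Ad G1 (Cn (harm p - 1)))"

definition qlog_b :: "nat \<Rightarrow> qx" where
  "qlog_b p = Mu (Mu (Cn (1 / fact p)) (Pw VB p)) (Ad G2 (Cn (- harm p - 1)))"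

text \<open>The factor 1/(\<alpha> + 1) is kept out so that \<open>k = 0\<close> is meaningful: that
  case is the term without logarithm in Q for \<alpha> = -1.\<close>

definition qpow :: "int \<Rightarrow> nat \<Rightarrow> qx" where
  "qpow k p = Mu (Mu (Cn (-1 / (2 ^ p * fact p))) (WP k)) (Pw (Ad VB (Mu (Cn (-1)) VL)) p)"

fun qq :: "hidx \<Rightarrow> nat \<Rightarrow> qx" where
  "qq (Zidx \<alpha>) p = (if \<alpha> = -1 then Ad (qlog_l p) (qpow 0 p) else Mu (Cn (1 / of_int (\<alpha> + 1))) (qpow (\<alpha> + 1) p))"
| "qq Vidx p = Ad (qlog_l p) (qlog_b p)"
| "qq Uidx p = Mu (Cn (1 / fact (p + 1))) (Pw VB (p + 1))"

lemma qev_qq: "qev (qq a p) l b g h = Q a p l b g h"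
  by (cases a) (simp_all add: qlog_l_def qlog_b_def qpow_def add_diff_eq)

lemma Qfld_eq: "Qfld a p St = ev (qq a p) St"
  by (cases "(a, p, St)" rule: Qfld.cases) (simp add: ev.simps qev_qq)

lemma lax_eq: "lax a p = flow (qq a p)"
proof
  fix St
  have "{..<0} = {..-1 :: int}" by auto
  then have "(\<lambda>z x. - proj {..<0} (Qfld a p St) z x) = proj {..-1} (ev (neg (qq a p)) St)"
    by (simp add: fun_eq_iff Qfld_eq proj_ev_neg)
  then show "lax a p St = flow (qq a p) St" unfolding lax_def flow_def Qfld_eq by simp
qed

lemma hdens_eq: "hdens a p = (\<lambda>St. res0 (ev (qq a (nat (p + 1))) St))"
  by (simp add: fun_eq_iff hdens_def Qfld_eq)

lemma H_eq: "H a p = (\<lambda>St. integral {0..2 * pi} (res0 (ev (qq a (nat (p + 1))) St)))"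
  by (simp add: fun_eq_iff H_def hdens_eq)

lemma harm_Suc_complex: "harm (Suc p) = harm p + inverse (of_nat (Suc p) :: complex)"
  by (simp add: harm_Suc)

lemma of_nat_Suc_inverse: "of_nat (Suc p) * inverse (of_nat (Suc p) :: complex) = 1"
  using of_nat_neq_0[of p, where 'a = complex] by (rule right_inverse)

lemma of_nat_times_power: "of_nat p * (y :: complex) ^ (p - 1) * y = of_nat p * y ^ p"
  by (cases p) simp_all

section \<open>Recursion and homogeneity of the functions Q\<close>

lemma qlog_l_parts:
  "qev (qlog_l p) l b g h = - inverse (fact p) * (- l) ^ p * (g + harm p - 1)"
  "qev (dl (qlog_l p)) l b g h = - inverse (fact p) *
     (- (of_nat p * (- l) ^ (p - 1)) * (g + harm p - 1) + (- l) ^ p * (inverse (l + b) - inverse l))"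
  "qev (db (qlog_l p)) l b g h = - inverse (fact p) * (- l) ^ p * inverse (l + b)"
  by (simp_all add: qlog_l_def power_int_minus divide_inverse algebra_simps)

lemma qlog_b_parts:
  "qev (qlog_b p) l b g h = inverse (fact p) * b ^ p * (h - harm p - 1)"
  "qev (dl (qlog_b p)) l b g h = inverse (fact p) * b ^ p * inverse (l + b)"
  "qev (db (qlog_b p)) l b g h = inverse (fact p) *
     (of_nat p * b ^ (p - 1) * (h - harm p - 1) + b ^ p * (inverse (l + b) + inverse b))"
  by (simp_all add: qlog_b_def power_int_minus divide_inverse algebra_simps)

lemma qpow_parts:
  "qev (qpow k p) l b g h = - inverse (2 ^ p * fact p) * ((l + b) powi k * (b - l) ^ p)"
  "qev (dl (qpow k p)) l b g h = - inverse (2 ^ p * fact p) *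
     (of_int k * (l + b) powi (k - 1) * (b - l) ^ p - (l + b) powi k * (of_nat p * (b - l) ^ (p - 1)))"
  "qev (db (qpow k p)) l b g h = - inverse (2 ^ p * fact p) *
     (of_int k * (l + b) powi (k - 1) * (b - l) ^ p + (l + b) powi k * (of_nat p * (b - l) ^ (p - 1)))"
  by (simp_all add: qpow_def divide_inverse algebra_simps)

text \<open>\<open>N\<close> is p + 1 with inverse \<open>M\<close>, \<open>P\<close> a p-th power,
  and \<open>G\<close> in the first two identities the logarithmic factor at level p, with
  \<open>w\<close> the inverse of l + b. The shift of \<open>G\<close> by \<open>M\<close> is the
  increment of the harmonic numbers; it cancels the term from differentiating log l or log b, which
  is why these numbers appear in Q. In the third identity \<open>k\<close> is 1/2 and
  \<open>w\<close> the power of l + b.\<close>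

lemma diff_identities:
  fixes N M F P l b k w G :: complex
  assumes "N * M = 1"
  shows "l * k = 1 \<Longrightarrow> - (M * F) * (- l * P) * w - - (M * F) * (- (N * P) * (G + M) + - l * P * (w - k)) = - F * P * G"
    and "b * k = 1 \<Longrightarrow> M * F * (N * P * (G - M) + b * P * (w + k)) - M * F * (b * P) * w = F * P * G"
    and "2 * k = 1 \<Longrightarrow> - (k * M * F) * (G + w * (N * P)) - - (k * M * F) * (G - w * (N * P)) = - F * (w * P)"
  using assms by algebra+

text \<open>\<open>R\<close> and \<open>P\<close> are powers with exponents p - 1 and p, and
  \<open>n\<close> is p. The relations between them carry the factor \<open>n\<close> so that they
  remain true at p = 0, where p - 1 truncates.\<close>

lemma euler_identities:
  fixes n F P R l b k w G j :: complex
  assumes "(l + b) * w = 1"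
  shows "n * R * - l = n * P \<Longrightarrow> l * k = 1 \<Longrightarrow>
      l * (- F * (- (n * R) * G + P * (w - k))) + b * (- F * P * w) = n * (- F * P * G)"
    and "n * R * b = n * P \<Longrightarrow> b * k = 1 \<Longrightarrow>
      l * (F * P * w) + b * (F * (n * R * G + P * (w + k))) = n * (F * P * G) + 2 * (P * F)"
    and "n * R * (b - l) = n * P \<Longrightarrow>
      l * (- F * (j * (G * w) * P - G * (n * R))) + b * (- F * (j * (G * w) * P + G * (n * R))) = (j + n) * (- F * (G * P))"
  using assms by algebra+

context
  fixes l b g h :: complex
  assumes nz: "l \<noteq> 0" "b \<noteq> 0" "l + b \<noteq> 0"
begin

abbreviation "diff_val e \<equiv> qev (db e) l b g h - qev (dl e) l b g h"
abbreviation "euler_val e \<equiv> l * qev (dl e) l b g h + b * qev (db e) l b g h"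

lemma invs: "l * inverse l = 1" "b * inverse b = 1" "(l + b) * inverse (l + b) = 1"
  using nz by simp_all

lemma diff_qlog_l: "diff_val (qlog_l (Suc p)) = qev (qlog_l p) l b g h"
  using diff_identities(1)[OF of_nat_Suc_inverse[of p] invs(1), of "inverse (fact p)" "(- l) ^ p" "inverse (l + b)" "g + harm p - 1"]
  unfolding qlog_l_parts fact_Suc inverse_mult_distrib power_Suc diff_Suc_1 harm_Suc_complex by (simp only: add_ac diff_conv_add_uminus)

lemma diff_qlog_b: "diff_val (qlog_b (Suc p)) = qev (qlog_b p) l b g h"
  using diff_identities(2)[OF of_nat_Suc_inverse[of p] invs(2), of "inverse (fact p)" "b ^ p" "h - harm p - 1" "inverse (l + b)"]
  unfolding qlog_b_parts fact_Suc inverse_mult_distrib power_Suc diff_Suc_1 harm_Suc_complex by (simp only: add_ac diff_conv_add_uminus minus_add_distrib)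

lemma diff_qpow: "diff_val (qpow k (Suc p)) = qev (qpow k p) l b g h"
proof -
  have "inverse (2 ^ Suc p * fact (Suc p)) = inverse 2 * inverse (of_nat (Suc p)) * inverse (2 ^ p * fact p :: complex)"
    unfolding fact_Suc inverse_mult_distrib power_Suc by simp
  moreover have "2 * inverse 2 = (1 :: complex)" by simp
  ultimately show ?thesis
    using diff_identities(3)[OF of_nat_Suc_inverse[of p], of "inverse 2" "inverse (2 ^ p * fact p)"
        "of_int k * (l + b) powi (k - 1) * (b - l) ^ Suc p" "(l + b) powi k" "(b - l) ^ p"]
    unfolding qpow_parts diff_Suc_1 by (simp only: )
qed

lemma euler_qlog_l: "euler_val (qlog_l p) = of_nat p * qev (qlog_l p) l b g h"
  unfolding qlog_l_parts by (rule euler_identities(1)[OF invs(3) of_nat_times_power invs(1)])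

text \<open>The logarithm of b (l + b) is that of a function of degree 2, which breaks homogeneity
  by twice b^p/p!. This is the origin of the term with H_u in the recursion for H_v; the logarithm
  in \<open>qlog_l\<close> has an argument of degree 0 and causes no such term.\<close>

lemma euler_qlog_b: "euler_val (qlog_b p) = of_nat p * qev (qlog_b p) l b g h + 2 * (b ^ p / fact p)"
  unfolding qlog_b_parts divide_inverse by (rule euler_identities(2)[OF invs(3) of_nat_times_power invs(2)])

lemma euler_qpow: "euler_val (qpow k p) = (of_int k + of_nat p) * qev (qpow k p) l b g h"
proof -
  have "(l + b) powi (k - 1) = (l + b) powi k * inverse (l + b)"
    using nz(3) by (simp add: power_int_diff divide_inverse)
  then show ?thesis
    unfolding qpow_parts by (simp only:) (rule euler_identities(3)[OF invs(3) of_nat_times_power])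
qed

text \<open>For p = 0 the value is 1, a constant without a corresponding Q; the first bracket with
  H_{u,-1} therefore gives the zero flow.\<close>

lemma diff_qq_U: "diff_val (qq Uidx p) = b ^ p / fact p"
  using of_nat_neq_0[of p, where 'a = complex] by (simp add: field_simps del: of_nat_Suc)

lemma diff_qq: "diff_val (qq a (Suc p)) = qev (qq a p) l b g h"
proof (cases a)
  case (Zidx \<alpha>)
  then show ?thesis using diff_qlog_l[of p] diff_qpow[of 0 p] diff_qpow[of "\<alpha> + 1" p] by (simp add: algebra_simps flip: right_diff_distrib)
next
  case Vidx
  then show ?thesis using diff_qlog_l[of p] diff_qlog_b[of p] by (simp add: algebra_simps)
next
  case Uidx
  then show ?thesis unfolding Uidx diff_qq_U by simp
qed

lemma euler_qq_Z: "euler_val (qq (Zidx \<alpha>) p) = (of_int \<alpha> + 1 + of_nat p) * qev (qq (Zidx \<alpha>) p) l b g h"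
proof (cases "\<alpha> = -1")
  case True
  then show ?thesis using euler_qlog_l[of p] euler_qpow[of 0 p] by (simp add: algebra_simps)
next
  case False
  let ?c = "1 / of_int (\<alpha> + 1) :: complex" and ?q = "qpow (\<alpha> + 1) p"
  have "euler_val (qq (Zidx \<alpha>) p) = ?c * euler_val ?q" using False by (simp add: distrib_left mult_ac)
  also have "\<dots> = (of_int \<alpha> + 1 + of_nat p) * (?c * qev ?q l b g h)"
    unfolding euler_qpow by (simp add: mult_ac)
  finally show ?thesis using False by simp
qed

lemma euler_qq_V: "euler_val (qq Vidx p) = of_nat p * qev (qq Vidx p) l b g h + 2 * diff_val (qq Uidx p)"
  using euler_qlog_l[of p] euler_qlog_b[of p] unfolding diff_qq_U by (simp add: algebra_simps)

lemma euler_qq_U: "euler_val (qq Uidx p) = of_nat (p + 1) * qev (qq Uidx p) l b g h"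
  by (simp add: field_simps)

end

text \<open>One choice of values serves all expressions at once, so identities between different
  expressions transfer from numbers to states.\<close>

lemma ev_qev:
  assumes "St \<in> states" "z \<in> circ"
  shows "\<exists>l b g h. l \<noteq> 0 \<and> b \<noteq> 0 \<and> l + b \<noteq> 0 \<and> (\<forall>e. ev e St z x = qev e l b g h)"
proof -
  obtain r l lb l0 l1 l2 where St: "St = ((l, lb), (l0, l1, l2))" and reg: "regular_state r l lb l0 l1 l2"
    using assms(1) by (rule regular_cases)
  interpret regular_state r l lb l0 l1 l2 by (rule reg)
  show ?thesis unfolding St ev.simps using nz[OF circ_ann[OF assms(2)] UNIV_I] by blast
qed

lemma ev_diff_op_qq: "St \<in> states \<Longrightarrow> z \<in> circ \<Longrightarrow> ev (diff_op (qq a (Suc p))) St z x = ev (qq a p) St z x"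
proof -
  assume "St \<in> states" "z \<in> circ"
  then obtain l b g h where n: "l \<noteq> 0" "b \<noteq> 0" "l + b \<noteq> 0" and e: "\<And>e. ev e St z x = qev e l b g h"
    using ev_qev by blast
  show ?thesis using diff_qq[OF n] unfolding e diff_op_def neg_def by (simp del: qq.simps)
qed

lemma ev_euler_op_qq:
  assumes "St \<in> states" "z \<in> circ"
  shows "ev (euler_op (qq (Zidx \<alpha>) p)) St z x = (of_int \<alpha> + 1 + of_nat p) * ev (qq (Zidx \<alpha>) p) St z x"
    and "ev (euler_op (qq Vidx p)) St z x = of_nat p * ev (qq Vidx p) St z x + 2 * ev (diff_op (qq Uidx p)) St z x"
    and "ev (euler_op (qq Uidx p)) St z x = of_nat (p + 1) * ev (qq Uidx p) St z x"
proof -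
  obtain l b g h where n: "l \<noteq> 0" "b \<noteq> 0" "l + b \<noteq> 0" and e: "\<And>e. ev e St z x = qev e l b g h"
    using ev_qev[OF assms] by blast
  note E = euler_qq_Z[OF n, where g = g and h = h and \<alpha> = \<alpha> and p = p]
    euler_qq_V[OF n, where g = g and h = h and p = p] euler_qq_U[OF n, where g = g and h = h and p = p]
  show "ev (euler_op (qq (Zidx \<alpha>) p)) St z x = (of_int \<alpha> + 1 + of_nat p) * ev (qq (Zidx \<alpha>) p) St z x"
    using E(1) unfolding e euler_op_def qev.simps .
  show "ev (euler_op (qq Vidx p)) St z x = of_nat p * ev (qq Vidx p) St z x + 2 * ev (diff_op (qq Uidx p)) St z x"
    using E(2) unfolding e euler_op_def diff_op_def neg_def qev.simps by simp
  show "ev (euler_op (qq Uidx p)) St z x = of_nat (p + 1) * ev (qq Uidx p) St z x"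
    using E(3) unfolding e euler_op_def qev.simps .
qed

text \<open>Differentiating introduces no new logarithms, so the lemma applies to the partial
  derivatives of Q as well as to Q itself.\<close>

lemma single_valued_periodic:
  assumes St: "St \<in> states" and s: "single_valued_at a St" and e: "logs e \<subseteq> logs (qq a p)" and z: "z \<in> circ"
  shows "ev e St z (x + 2 * pi) = ev e St z x"
proof -
  obtain l lb l0 l1 l2 where S: "St = ((l, lb), (l0, l1, l2))" by (rule state_exhaust)
  have "(1 \<in> logs (qq a p) \<longrightarrow> periodic_near circ l1) \<and> (2 \<in> logs (qq a p) \<longrightarrow> periodic_near circ l2)"
    using s unfolding S by (cases a) (auto simp: qlog_l_def qlog_b_def qpow_def split: if_splits)
  then show ?thesis using ev_periodic[of l lb l0 l1 l2 e z x] St e z unfolding S by blast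
qed

lemma lax_TLM: "St \<in> states \<Longrightarrow> single_valued_at a St \<Longrightarrow> lax a p St \<in> TLM"
proof -
  assume St: "St \<in> states" and s: "single_valued_at a St"
  obtain r l lb l0 l1 l2 where S: "St = ((l, lb), (l0, l1, l2))" and reg: "regular_state r l lb l0 l1 l2"
    using St by (rule regular_cases)
  have "ev (qq a p) St z (x + 2 * pi) = ev (qq a p) St z x" if "z \<in> circ" for z x
    by (rule single_valued_periodic[OF St s subset_refl that])
  then show ?thesis unfolding lax_eq using regular_state.flow_TLM[OF reg, of "qq a p"] unfolding S by blast
qed

section \<open>Hamiltonian fields and the recursion relations\<close>

lemma ham_field_H:
  assumes St: "St \<in> states" and s: "single_valued_at a St"
  shows "ham_field P1 (H a p) St (flow (diff_op (qq a (nat (p + 1)))) St)"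
    and "ham_field P2 (H a p) St (flow (euler_op (qq a (nat (p + 1)))) St)"
proof -
  define q where "q = qq a (nat (p + 1))"
  have "ev (dl q) St z (x + 2 * pi) = ev (dl q) St z x" "ev (db q) St z (x + 2 * pi) = ev (db q) St z x"
    if "z \<in> circ" for z x
    by (rule single_valued_periodic[OF St s _ that, where p = "nat (p + 1)"]; simp add: logs_derivs q_def del: qq.simps)+
  note ham_field_flow[OF St this]
  then show "ham_field P1 (H a p) St (flow (diff_op (qq a (nat (p + 1)))) St)"
    "ham_field P2 (H a p) St (flow (euler_op (qq a (nat (p + 1)))) St)"
    unfolding H_eq q_def by auto
qed

lemma ham_field_lax:
  assumes "St \<in> states" "single_valued_at a St"
  shows "ham_field P1 (H a (int p)) St (lax a p St)"
proof -
  have "flow (diff_op (qq a (Suc p))) St = lax a p St"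
    unfolding lax_eq by (rule flow_cong) (rule ev_diff_op_qq[OF assms(1)])
  then show ?thesis using ham_field_H(1)[OF assms, of "int p"] by (simp add: nat_add_distrib del: qq.simps)
qed

text \<open>The natural number \<open>p\<close> is the level of Q inside the Hamiltonian, one more
  than its index. In the case of v the extra term is left as a flow of \<open>diff_op\<close>, since
  at level 0 there is no Lax flow with index u to name it.\<close>

lemma recursion:
  assumes St: "St \<in> states"
  shows "single_valued_at (Zidx \<alpha>) St \<Longrightarrow>
      ham_field P2 (H (Zidx \<alpha>) (int p - 1)) St (vscale (of_int (\<alpha> + int p + 1)) (lax (Zidx \<alpha>) p St))"
    and "single_valued_at Vidx St \<Longrightarrow>
      ham_field P2 (H Vidx (int p - 1)) St (vadd (vscale (of_nat p) (lax Vidx p St)) (vscale 2 (flow (diff_op (qq Uidx p)) St)))"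
    and "ham_field P2 (H Uidx (int p - 1)) St (vscale (of_nat (p + 1)) (lax Uidx p St))"
proof -
  note E = ev_euler_op_qq[OF St]
  show "ham_field P2 (H (Zidx \<alpha>) (int p - 1)) St (vscale (of_int (\<alpha> + int p + 1)) (lax (Zidx \<alpha>) p St))"
    if "single_valued_at (Zidx \<alpha>) St"
  proof (rule ham_field_cong[OF ham_field_H(2)[OF St that]])
    show "eq_vec (flow (euler_op (qq (Zidx \<alpha>) (nat (int p - 1 + 1)))) St) (vscale (of_int (\<alpha> + int p + 1)) (lax (Zidx \<alpha>) p St))"
      unfolding lax_eq by (rule flow_scale[OF St]) (simp add: E(1) add_ac del: qq.simps)
  qed
  show "ham_field P2 (H Vidx (int p - 1)) St (vadd (vscale (of_nat p) (lax Vidx p St)) (vscale 2 (flow (diff_op (qq Uidx p)) St)))"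
    if "single_valued_at Vidx St"
  proof (rule ham_field_cong[OF ham_field_H(2)[OF St that]])
    show "eq_vec (flow (euler_op (qq Vidx (nat (int p - 1 + 1)))) St) (vadd (vscale (of_nat p) (lax Vidx p St)) (vscale 2 (flow (diff_op (qq Uidx p)) St)))"
      unfolding lax_eq by (rule flow_add[OF St]) (simp add: E(2) del: qq.simps)
  qed
  have u: "single_valued_at Uidx St" by (cases St rule: state_exhaust) simp
  show "ham_field P2 (H Uidx (int p - 1)) St (vscale (of_nat (p + 1)) (lax Uidx p St))"
  proof (rule ham_field_cong[OF ham_field_H(2)[OF St u]])
    show "eq_vec (flow (euler_op (qq Uidx (nat (int p - 1 + 1)))) St) (vscale (of_nat (p + 1)) (lax Uidx p St))"
      unfolding lax_eq by (rule flow_scale[OF St]) (simp add: E(3) del: qq.simps)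
  qed
qed

lemma bi_hamiltonian:
  assumes St: "St \<in> states" and p: "p \<ge> -1"
  shows "(\<forall>\<alpha>. single_valued_at (Zidx \<alpha>) St \<longrightarrow>
             (\<exists>Y. ham_field P1 (H (Zidx \<alpha>) (p + 1)) St Y \<and>
                  ham_field P2 (H (Zidx \<alpha>) p) St (vscale (of_int (\<alpha> + p + 2)) Y))) \<and>
          (single_valued_at Vidx St \<longrightarrow>
             (\<exists>Y Z. ham_field P1 (H Vidx (p + 1)) St Y \<and> ham_field P1 (H Uidx p) St Z \<and>
                  ham_field P2 (H Vidx p) St (vadd (vscale (of_int (p + 1)) Y) (vscale 2 Z)))) \<and>
          (\<exists>Y. ham_field P1 (H Uidx (p + 1)) St Y \<and>
               ham_field P2 (H Uidx p) St (vscale (of_int (p + 2)) Y))"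
proof -
  \<comment> \<open>The range from -1 on is shifted to the natural numbers, where \<open>n\<close>
    is the level of Q in the Hamiltonian.\<close>
  define n where "n = nat (p + 1)"
  have n: "p = int n - 1" using p unfolding n_def by simp
  have u: "single_valued_at Uidx St" by (cases St rule: state_exhaust) simp
  have s: "p + 1 = int n" "of_int (p + 1) = (of_nat n :: complex)" "of_int (p + 2) = (of_nat (n + 1) :: complex)"
    "\<And>\<alpha>. \<alpha> + p + 2 = \<alpha> + int n + 1"
    unfolding n by simp_all
  show ?thesis
    unfolding s(2,3,4) unfolding s(1)
    using ham_field_lax[OF St] recursion[OF St, where p = n, folded n] ham_field_H(1)[OF St u, of p, folded n_def] u by blast
qed

text \<open>For k = \<alpha> + 1 and p = n - k this is the coefficient of
  \<open>power_diff_expansion\<close> divided by 2^n, times the inverse of the normalisation of Q,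
  including its sign. The entry for u turns b^n/n! into (-1)^n b^n. Only k at least 1 occurs in
  \<open>toda_indices\<close>, so the index \<alpha> = -1 with its logarithm is avoided.\<close>

definition toda_coeff :: "nat \<Rightarrow> hidx \<times> nat \<Rightarrow> complex" where
  "toda_coeff n = (\<lambda>(a, p). case a of
     Zidx \<alpha> \<Rightarrow> - (of_nat (n choose nat (\<alpha> + 1)) * ((-1) ^ p - (-1) ^ n) * of_int (\<alpha> + 1) * 2 ^ p * fact p) / 2 ^ n
   | Vidx \<Rightarrow> 0 | Uidx \<Rightarrow> (-1) ^ n * fact n)"

definition toda_indices :: "nat \<Rightarrow> (hidx \<times> nat) set" where
  "toda_indices n = insert (Uidx, n - 1) ((\<lambda>k. (Zidx (int k - 1), n - k)) ` {1..n})"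

text \<open>Binomial expansions of \<open>(2l)\<^sup>n\<close> and \<open>(2b)\<^sup>n\<close> in \<open>w = l + b\<close> and \<open>y = b - l\<close>, with the term \<open>y\<^sup>n\<close>,
  which is no multiple of a \<open>Q\<close>, eliminated.\<close>

lemma power_diff_expansion:
  fixes l b :: complex
  shows "2 ^ n * l ^ n = (-1) ^ n * (2 ^ n * b ^ n) +
    (\<Sum>k=1..n. of_nat (n choose k) * ((-1) ^ (n - k) - (-1) ^ n) * ((l + b) ^ k * (b - l) ^ (n - k)))"
proof -
  let ?w = "l + b" and ?y = "b - l"
  have m: "(- ?y) ^ j = (- 1) ^ j * ?y ^ j" for j
    unfolding power_mult_distrib[symmetric] by simp
  have s: "{..n} = insert 0 {1..n}" by auto
  have "2 ^ n * l ^ n = (?w + (- ?y)) ^ n" unfolding power_mult_distrib[symmetric] by simp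
  also have "\<dots> = (\<Sum>k\<le>n. of_nat (n choose k) * ?w ^ k * (- ?y) ^ (n - k))" by (rule binomial_ring)
  also have "\<dots> = (- ?y) ^ n + (\<Sum>k=1..n. of_nat (n choose k) * ?w ^ k * (- ?y) ^ (n - k))"
    unfolding s by simp
  finally have 1: "2 ^ n * l ^ n = (- ?y) ^ n + (\<Sum>k=1..n. of_nat (n choose k) * ?w ^ k * (- ?y) ^ (n - k))" .
  have "2 ^ n * b ^ n = (?w + ?y) ^ n" unfolding power_mult_distrib[symmetric] by simp
  also have "\<dots> = (\<Sum>k\<le>n. of_nat (n choose k) * ?w ^ k * ?y ^ (n - k))" by (rule binomial_ring)
  also have "\<dots> = ?y ^ n + (\<Sum>k=1..n. of_nat (n choose k) * ?w ^ k * ?y ^ (n - k))"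
    unfolding s by simp
  finally have 2: "2 ^ n * b ^ n = ?y ^ n + (\<Sum>k=1..n. of_nat (n choose k) * ?w ^ k * ?y ^ (n - k))" .
  show ?thesis
    unfolding 1 2 m by (simp add: algebra_simps sum_subtractf sum_distrib_left)
qed

lemma power_as_Q:
  assumes n: "n > 0"
  shows "l ^ n = (\<Sum>i\<in>toda_indices n. toda_coeff n i * Q (fst i) (snd i) l b g h)"
proof -
  have "inj_on (\<lambda>k. (Zidx (int k - 1), n - k)) {1..n}" by (auto simp: inj_on_def)
  moreover have "(Uidx, n - 1) \<notin> (\<lambda>k. (Zidx (int k - 1), n - k)) ` {1..n}" by auto
  ultimately have 1: "(\<Sum>i\<in>toda_indices n. toda_coeff n i * Q (fst i) (snd i) l b g h) =
      toda_coeff n (Uidx, n - 1) * Q Uidx (n - 1) l b g h +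
      (\<Sum>k=1..n. toda_coeff n (Zidx (int k - 1), n - k) * Q (Zidx (int k - 1)) (n - k) l b g h)"
    unfolding toda_indices_def by (simp add: sum.reindex del: Q.simps)
  have 2: "toda_coeff n (Uidx, n - 1) * Q Uidx (n - 1) l b g h = (-1) ^ n * b ^ n"
    using n unfolding toda_coeff_def by (cases n) (simp_all del: fact_Suc)
  have 3: "(\<Sum>k=1..n. toda_coeff n (Zidx (int k - 1), n - k) * Q (Zidx (int k - 1)) (n - k) l b g h) =
      (\<Sum>k=1..n. of_nat (n choose k) * ((-1) ^ (n - k) - (-1) ^ n) * ((l + b) ^ k * (b - l) ^ (n - k))) / 2 ^ n"
    unfolding sum_divide_distrib
  proof (rule sum.cong[OF refl])
    fix k assume "k \<in> {1..n}"
    then have "of_nat k \<noteq> (0 :: complex)" "k \<noteq> 0" by auto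
    then show "toda_coeff n (Zidx (int k - 1), n - k) * Q (Zidx (int k - 1)) (n - k) l b g h =
        of_nat (n choose k) * ((-1) ^ (n - k) - (-1) ^ n) * ((l + b) ^ k * (b - l) ^ (n - k)) / 2 ^ n"
      unfolding toda_coeff_def by (simp add: field_simps)
  qed
  have "(-1) ^ n * b ^ n + (2 ^ n * l ^ n - (-1) ^ n * (2 ^ n * b ^ n)) / 2 ^ n = l ^ n"
    by (simp add: diff_divide_distrib)
  then show ?thesis unfolding 1 2 3 power_diff_expansion[of n l b] by simp
qed

lemma toda_lincomb:
  "\<exists>I c. finite I \<and> (\<forall>St\<in>states. eq_vec (toda n (fst St)) (lincomb I c (\<lambda>(a, p). lax a p St)))"
proof -
  \<comment> \<open>At \<open>n = 0\<close> the generator is the constant 1, so the empty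
    combination represents the flow.\<close>
  define I where "I = (if n = 0 then {} else toda_indices n)"
  have "eq_vec (toda n (fst St)) (lincomb I (toda_coeff n) (\<lambda>(a, p). lax a p St))" if St: "St \<in> states" for St
  proof -
    obtain r l lb l0 l1 l2 where S: "St = ((l, lb), (l0, l1, l2))" and reg: "regular_state r l lb l0 l1 l2"
      using St by (rule regular_cases)
    have "eq_vec (flow (Pw VL n) St) (lincomb I (toda_coeff n) (\<lambda>i. flow (qq (fst i) (snd i)) St))"
    proof (rule flow_lincomb[OF _ St, where k = "if n = 0 then 1 else 0"])
      show "finite I" unfolding I_def toda_indices_def by simp
      show "ev (Pw VL n) St z x = (if n = 0 then 1 else 0) + (\<Sum>i\<in>I. toda_coeff n i * ev (qq (fst i) (snd i)) St z x)" for z x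
        using power_as_Q[of n "l z x" "lb z x"] unfolding S I_def by (simp add: ev.simps qev_qq del: qq.simps Q.simps)
    qed
    moreover have "eq_vec (toda n (fst St)) (flow (Pw VL n) St)"
      using regular_state.toda_flow[OF reg] unfolding S by simp
    ultimately show ?thesis unfolding lax_eq case_prod_beta' using eq_vec_trans by blast
  qed
  moreover have "finite I" unfolding I_def toda_indices_def by simp
  ultimately show ?thesis by blast
qed

lemma toda_bar_lincomb:
  "\<exists>I c. finite I \<and> (\<forall>St\<in>states. eq_vec (toda_bar n (fst St)) (lincomb I c (\<lambda>(a, p). lax a p St)))"
proof -
  \<comment> \<open>For positive \<open>n\<close> the only index needed is u at level
    \<open>n - 1\<close>, where Q is \<lambda>b^n/n!; hence the coefficient
    \<open>- fact n\<close>.\<close>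
  define I where "I = (if n = 0 then {} else {(Uidx, n - 1)})"
  have "eq_vec (toda_bar n (fst St)) (lincomb I (\<lambda>_. - fact n) (\<lambda>(a, p). lax a p St))" if St: "St \<in> states" for St
  proof -
    obtain r l lb l0 l1 l2 where S: "St = ((l, lb), (l0, l1, l2))" and reg: "regular_state r l lb l0 l1 l2"
      using St by (rule regular_cases)
    have "eq_vec (flow (neg (Pw VB n)) St) (lincomb I (\<lambda>_. - fact n) (\<lambda>i. flow (qq (fst i) (snd i)) St))"
    proof (rule flow_lincomb[OF _ St, where k = "if n = 0 then -1 else 0"])
      show "finite I" unfolding I_def by simp
      show "ev (neg (Pw VB n)) St z x = (if n = 0 then -1 else 0) + (\<Sum>i\<in>I. - fact n * ev (qq (fst i) (snd i)) St z x)" for z x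
        unfolding ev_neg S I_def by (cases n) (simp_all add: ev.simps del: fact_Suc)
    qed
    moreover have "eq_vec (toda_bar n (fst St)) (flow (neg (Pw VB n)) St)"
      using regular_state.toda_bar_flow[OF reg] unfolding S by simp
    ultimately show ?thesis unfolding lax_eq case_prod_beta' using eq_vec_trans by blast
  qed
  moreover have "finite I" unfolding I_def by simp
  ultimately show ?thesis by blast
qed

lemma tau_symmetry: tau_symmetric
  unfolding tau_symmetric_def hdens_eq lax_eq using densities_symmetric by simp

theorem mainTheorem1:
  shows
    "(\<forall>L\<in>LM1. \<exists>B. log_branch L B)
     \<and> (\<forall>a p. \<forall>St\<in>states. lax a p St \<in> smooth_vectors \<and>
          (single_valued_at a St \<longrightarrow> lax a p St \<in> TLM))
     \<and> (\<forall>a b p q. commuting (lax a p) (lax b q))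
     \<and> tau_symmetric
     \<and> (\<forall>a p. \<forall>St\<in>states. single_valued_at a St \<longrightarrow>
          ham_field P1 (H a (int p)) St (lax a p St))
     \<and> (\<forall>St\<in>states. \<forall>p\<ge>-1.
          (\<forall>\<alpha>. single_valued_at (Zidx \<alpha>) St \<longrightarrow>
             (\<exists>Y. ham_field P1 (H (Zidx \<alpha>) (p + 1)) St Y \<and>
                  ham_field P2 (H (Zidx \<alpha>) p) St (vscale (of_int (\<alpha> + p + 2)) Y))) \<and>
          (single_valued_at Vidx St \<longrightarrow>
             (\<exists>Y Z. ham_field P1 (H Vidx (p + 1)) St Y \<and> ham_field P1 (H Uidx p) St Z \<and>
                  ham_field P2 (H Vidx p) St (vadd (vscale (of_int (p + 1)) Y) (vscale 2 Z)))) \<and>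
          (\<exists>Y. ham_field P1 (H Uidx (p + 1)) St Y \<and>
               ham_field P2 (H Uidx p) St (vscale (of_int (p + 2)) Y)))
     \<and> (\<forall>n. \<exists>I c. finite I \<and> (\<forall>St\<in>states.
          eq_vec (toda n (fst St)) (lincomb I c (\<lambda>(a, p). lax a p St))))
     \<and> (\<forall>n. \<exists>I c. finite I \<and> (\<forall>St\<in>states.
          eq_vec (toda_bar n (fst St)) (lincomb I c (\<lambda>(a, p). lax a p St))))"
proof -
  have "\<forall>L\<in>LM1. \<exists>B. log_branch L B" using exists_log_branch by blast
  moreover have "\<forall>a p. \<forall>St\<in>states. lax a p St \<in> smooth_vectors \<and> (single_valued_at a St \<longrightarrow> lax a p St \<in> TLM)"
    using lax_TLM flow_smooth_vectors unfolding lax_eq by blast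
  moreover have "\<forall>a b p q. commuting (lax a p) (lax b q)"
    unfolding lax_eq by (intro allI) (rule flows_commute)
  moreover have "\<forall>a p. \<forall>St\<in>states. single_valued_at a St \<longrightarrow> ham_field P1 (H a (int p)) St (lax a p St)"
    using ham_field_lax by blast
  ultimately show ?thesis
    by (intro conjI) (assumption | rule tau_symmetry | intro ballI allI impI bi_hamiltonian toda_lincomb toda_bar_lincomb; assumption)+
qed

end
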